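(* Let $\Lambda$ be a finite-dimensional algebra over an algebraically closed field and let $d\geq2$. The truncation functor $$\tau_{\geq -d+2}:\mathrm{K}^{[-d+1,0]}(\operatorname{proj}\Lambda)\to\mathcal{D}^{[-d+2,0]}(\operatorname{mod}\Lambda)$$ induces an equivalence between the categories $\dfrac{\mathrm{K}^{[-d+1,0]}(\operatorname{proj}\Lambda)}{\operatorname{add}\Lambda[d-1]}$ and $\mathcal{D}^{[-d+2,0]}(\operatorname{mod}\Lambda)$.
   Context: $\operatorname{mod}\Lambda$ is the category of finitely generated $\Lambda$-modules, $\operatorname{proj}\Lambda$ its subcategory of projectives. $\mathcal{D}^{[-d+2,0]}(\operatorname{mod}\Lambda)$ is the full subcategory of $\mathcal{D}^b(\operatorname{mod}\Lambda)$ of objects with cohomology concentrated in degrees $-d+2,\dots,0$. $\mathrm{K}^{[-d+1,0]}(\operatorname{proj}\Lambda)$ is the full subcategory of $\mathrm{K}^b(\operatorname{proj}\Lambda)$ of objects isomorphic to complexes of finitely generated projectives concentrated in degrees $-d+1,\dots,0$. $\tau_{\geq -d+2}$ is the standard truncation functor for the natural $t$-structure on $\mathcal{D}^b(\operatorname{mod}\Lambda)$, sending a complex $A^\bullet$ with differentials $\delta^i$ to $\cdots\to0\to A^{-d+1}/\operatorname{Ker}\delta^{-d+1}\to A^{-d+2}\to A^{-d+3}\to\cdots$. $\operatorname{add}\Lambda[d-1]$ is the subcategory of finitely generated projectives placed in degree $-d+1$; the quotient category has the same objects and morphisms taken modulo those factoring through an object of $\operatorname{add}\Lambda[d-1]$.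 *)

theory Defs
  imports "HOL-Algebra.Algebra"
begin

text \<open>\<open>HOL-Algebra\<close> reserves the letter \<open>X\<close> for the polynomial variable.\<close>

no_notation var (\<open>X\<index>\<close>)

section \<open>Categories, functors, equivalences\<close>

text \<open>Hom-sets are indexed by source and target and need not be disjoint; accordingly composition
  and the action of a functor on morphisms take the objects as arguments:
  \<open>Comp C X Y Z g f\<close> is the composite of \<open>f : X \<rightarrow> Y\<close> followed by \<open>g : Y \<rightarrow> Z\<close>.\<close>

record ('o, 'm) cat =
  Obj :: "'o set"
  Hom :: "'o \<Rightarrow> 'o \<Rightarrow> 'm set"
  Comp :: "'o \<Rightarrow> 'o \<Rightarrow> 'o \<Rightarrow> 'm \<Rightarrow> 'm \<Rightarrow> 'm"
  Ident :: "'o \<Rightarrow> 'm"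

record ('o, 'm) add_cat = "('o, 'm) cat" +
  HAdd :: "'o \<Rightarrow> 'o \<Rightarrow> 'm \<Rightarrow> 'm \<Rightarrow> 'm"

record ('o, 'm, 'p, 'n) cat_functor =
  OMap :: "'o \<Rightarrow> 'p"
  AMap :: "'o \<Rightarrow> 'o \<Rightarrow> 'm \<Rightarrow> 'n"

definition category :: "('o, 'm, 'z) cat_scheme \<Rightarrow> bool" where
  "category C \<longleftrightarrow>
     (\<forall>X \<in> Obj C. Ident C X \<in> Hom C X X) \<and>
     (\<forall>X \<in> Obj C. \<forall>Y \<in> Obj C. \<forall>Z \<in> Obj C. \<forall>f \<in> Hom C X Y. \<forall>g \<in> Hom C Y Z.
        Comp C X Y Z g f \<in> Hom C X Z) \<and>
     (\<forall>X \<in> Obj C. \<forall>Y \<in> Obj C. \<forall>f \<in> Hom C X Y.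
        Comp C X X Y f (Ident C X) = f \<and> Comp C X Y Y (Ident C Y) f = f) \<and>
     (\<forall>W \<in> Obj C. \<forall>X \<in> Obj C. \<forall>Y \<in> Obj C. \<forall>Z \<in> Obj C.
        \<forall>f \<in> Hom C W X. \<forall>g \<in> Hom C X Y. \<forall>h \<in> Hom C Y Z.
        Comp C W Y Z h (Comp C W X Y g f) = Comp C W X Z (Comp C X Y Z h g) f)"

definition is_iso :: "('o, 'm, 'z) cat_scheme \<Rightarrow> 'o \<Rightarrow> 'o \<Rightarrow> 'm \<Rightarrow> bool" where
  "is_iso C X Y f \<longleftrightarrow> f \<in> Hom C X Y \<and>
     (\<exists>g \<in> Hom C Y X. Comp C X Y X g f = Ident C X \<and> Comp C Y X Y f g = Ident C Y)"

definition full_subcat :: "('o, 'm, 'z) cat_scheme \<Rightarrow> ('o \<Rightarrow> bool) \<Rightarrow> ('o, 'm, 'z) cat_scheme" where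
  "full_subcat C P = C\<lparr>Obj := {X \<in> Obj C. P X}\<rparr>"

definition is_functor ::
  "('o, 'm, 'y) cat_scheme \<Rightarrow> ('p, 'n, 'z) cat_scheme \<Rightarrow> ('o, 'm, 'p, 'n) cat_functor \<Rightarrow> bool" where
  "is_functor C D F \<longleftrightarrow>
     (\<forall>X \<in> Obj C. OMap F X \<in> Obj D) \<and>
     (\<forall>X \<in> Obj C. \<forall>Y \<in> Obj C. \<forall>f \<in> Hom C X Y. AMap F X Y f \<in> Hom D (OMap F X) (OMap F Y)) \<and>
     (\<forall>X \<in> Obj C. AMap F X X (Ident C X) = Ident D (OMap F X)) \<and>
     (\<forall>X \<in> Obj C. \<forall>Y \<in> Obj C. \<forall>Z \<in> Obj C. \<forall>f \<in> Hom C X Y. \<forall>g \<in> Hom C Y Z.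
        AMap F X Z (Comp C X Y Z g f) =
        Comp D (OMap F X) (OMap F Y) (OMap F Z) (AMap F Y Z g) (AMap F X Y f))"

definition id_functor :: "('o, 'm, 'o, 'm) cat_functor" where
  "id_functor = \<lparr>OMap = (\<lambda>X. X), AMap = (\<lambda>X Y f. f)\<rparr>"

definition functor_comp ::
  "('p, 'n, 'q, 'l) cat_functor \<Rightarrow> ('o, 'm, 'p, 'n) cat_functor \<Rightarrow> ('o, 'm, 'q, 'l) cat_functor" where
  "functor_comp G F = \<lparr>OMap = (\<lambda>X. OMap G (OMap F X)),
     AMap = (\<lambda>X Y f. AMap G (OMap F X) (OMap F Y) (AMap F X Y f))\<rparr>"

definition nat_isomorphic ::
  "('o, 'm, 'y) cat_scheme \<Rightarrow> ('p, 'n, 'z) cat_scheme \<Rightarrow>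
   ('o, 'm, 'p, 'n) cat_functor \<Rightarrow> ('o, 'm, 'p, 'n) cat_functor \<Rightarrow> bool" where
  "nat_isomorphic C D F G \<longleftrightarrow> (\<exists>\<eta>.
     (\<forall>X \<in> Obj C. is_iso D (OMap F X) (OMap G X) (\<eta> X)) \<and>
     (\<forall>X \<in> Obj C. \<forall>Y \<in> Obj C. \<forall>f \<in> Hom C X Y.
        Comp D (OMap F X) (OMap F Y) (OMap G Y) (\<eta> Y) (AMap F X Y f) =
        Comp D (OMap F X) (OMap G X) (OMap G Y) (AMap G X Y f) (\<eta> X)))"

definition equivalence ::
  "('o, 'm, 'y) cat_scheme \<Rightarrow> ('p, 'n, 'z) cat_scheme \<Rightarrow> ('o, 'm, 'p, 'n) cat_functor \<Rightarrow> bool" where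
  "equivalence C D F \<longleftrightarrow> category C \<and> category D \<and> is_functor C D F \<and>
     (\<exists>G. is_functor D C G \<and>
        nat_isomorphic C C id_functor (functor_comp G F) \<and>
        nat_isomorphic D D (functor_comp F G) id_functor)"


section \<open>Quotient by the morphisms factoring through a class of objects\<close>

definition factors_through ::
  "('o, 'm, 'z) cat_scheme \<Rightarrow> 'o set \<Rightarrow> 'o \<Rightarrow> 'o \<Rightarrow> 'm \<Rightarrow> bool" where
  "factors_through C U X Y h \<longleftrightarrow>
     (\<exists>A \<in> U. \<exists>p \<in> Hom C X A. \<exists>q \<in> Hom C A Y. h = Comp C X A Y q p)"

text \<open>Two morphisms are identified iff their difference \<open>h\<close> factors through an object of \<open>U\<close>.\<close>

definition quot_rel ::
  "('o, 'm, 'z) add_cat_scheme \<Rightarrow> 'o set \<Rightarrow> 'o \<Rightarrow> 'o \<Rightarrow> ('m \<times> 'm) set" where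
  "quot_rel C U X Y = {(f, g). f \<in> Hom C X Y \<and> g \<in> Hom C X Y \<and>
     (\<exists>h. factors_through C U X Y h \<and> f = HAdd C X Y g h)}"

definition quot_cat :: "('o, 'm, 'z) add_cat_scheme \<Rightarrow> 'o set \<Rightarrow> ('o, 'm set) cat" where
  "quot_cat C U = \<lparr>Obj = Obj C,
     Hom = (\<lambda>X Y. Hom C X Y // quot_rel C U X Y),
     Comp = (\<lambda>X Y Z b a. \<Union>f \<in> a. \<Union>g \<in> b. quot_rel C U X Z `` {Comp C X Y Z g f}),
     Ident = (\<lambda>X. quot_rel C U X X `` {Ident C X})\<rparr>"

definition quot_functor ::
  "('o, 'm, 'z) add_cat_scheme \<Rightarrow> 'o set \<Rightarrow> ('o, 'm, 'o, 'm set) cat_functor" where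
  "quot_functor C U = \<lparr>OMap = (\<lambda>X. X), AMap = (\<lambda>X Y f. quot_rel C U X Y `` {f})\<rparr>"


section \<open>Localization by roofs\<close>

text \<open>A roof \<open>(Z, s, f)\<close> from \<open>X\<close> to \<open>Y\<close> is \<open>X \<leftarrow> Z \<rightarrow> Y\<close> with \<open>s : Z \<rightarrow> X\<close> in \<open>S\<close> and
  \<open>f : Z \<rightarrow> Y\<close>; it represents the fraction \<open>f s\<^sup>-\<^sup>1\<close>. The construction is meant for an \<open>S\<close>
  admitting a calculus of fractions.\<close>

definition roofs ::
  "('o, 'm, 'z) cat_scheme \<Rightarrow> ('o \<Rightarrow> 'o \<Rightarrow> 'm set) \<Rightarrow> 'o \<Rightarrow> 'o \<Rightarrow> ('o \<times> 'm \<times> 'm) set" where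
  "roofs C S X Y = {(Z, s, f). Z \<in> Obj C \<and> s \<in> Hom C Z X \<and> s \<in> S Z X \<and> f \<in> Hom C Z Y}"

definition roof_rel ::
  "('o, 'm, 'z) cat_scheme \<Rightarrow> ('o \<Rightarrow> 'o \<Rightarrow> 'm set) \<Rightarrow> 'o \<Rightarrow> 'o \<Rightarrow>
   (('o \<times> 'm \<times> 'm) \<times> ('o \<times> 'm \<times> 'm)) set" where
  "roof_rel C S X Y = {((Z, s, f), (Z', s', f')).
     (Z, s, f) \<in> roofs C S X Y \<and> (Z', s', f') \<in> roofs C S X Y \<and>
     (\<exists>V \<in> Obj C. \<exists>u \<in> Hom C V Z. \<exists>v \<in> Hom C V Z'.
        Comp C V Z X s u \<in> S V X \<and>
        Comp C V Z X s u = Comp C V Z' X s' v \<and>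
        Comp C V Z Y f u = Comp C V Z' Y f' v)}"

text \<open>The composite of \<open>f s\<^sup>-\<^sup>1\<close> and \<open>g t\<^sup>-\<^sup>1\<close> is \<open>(g v) (s u)\<^sup>-\<^sup>1\<close> for any completion
  \<open>f u = t v\<close> with \<open>u\<close> in \<open>S\<close>.\<close>

definition localization ::
  "('o, 'm, 'z) cat_scheme \<Rightarrow> ('o \<Rightarrow> 'o \<Rightarrow> 'm set) \<Rightarrow> ('o, ('o \<times> 'm \<times> 'm) set) cat" where
  "localization C S = \<lparr>Obj = Obj C,
     Hom = (\<lambda>X Y. roofs C S X Y // roof_rel C S X Y),
     Comp = (\<lambda>X Y W b a. {r. \<exists>(Z, s, f) \<in> a. \<exists>(Z', t, g) \<in> b.
        \<exists>V \<in> Obj C. \<exists>u \<in> Hom C V Z \<inter> S V Z. \<exists>v \<in> Hom C V Z'.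
          Comp C V Z Y f u = Comp C V Z' Y t v \<and>
          ((V, Comp C V Z X s u, Comp C V Z' W g v), r) \<in> roof_rel C S X W}),
     Ident = (\<lambda>X. roof_rel C S X X `` {(X, Ident C X, Ident C X)})\<rparr>"

definition loc_functor ::
  "('o, 'm, 'z) cat_scheme \<Rightarrow> ('o \<Rightarrow> 'o \<Rightarrow> 'm set) \<Rightarrow>
   ('o, 'm, 'o, ('o \<times> 'm \<times> 'm) set) cat_functor" where
  "loc_functor C S = \<lparr>OMap = (\<lambda>X. X),
     AMap = (\<lambda>X Y f. roof_rel C S X Y `` {(X, Ident C X, f)})\<rparr>"

text \<open>The functor \<open>f s\<^sup>-\<^sup>1 \<mapsto> F(f) F(s)\<^sup>-\<^sup>1\<close> between localizations induced by an endofunctor \<open>F\<close>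
  that preserves \<open>S\<close>.\<close>

definition loc_extend ::
  "('o, 'm, 'z) cat_scheme \<Rightarrow> ('o \<Rightarrow> 'o \<Rightarrow> 'm set) \<Rightarrow> ('o, 'm, 'o, 'm) cat_functor \<Rightarrow>
   ('o, ('o \<times> 'm \<times> 'm) set, 'o, ('o \<times> 'm \<times> 'm) set) cat_functor" where
  "loc_extend C S F = \<lparr>OMap = OMap F,
     AMap = (\<lambda>X Y a. \<Union>(Z, s, f) \<in> a.
        roof_rel C S (OMap F X) (OMap F Y) `` {(OMap F Z, AMap F Z X s, AMap F Z Y f)})\<rparr>"


section \<open>Finite-dimensional algebras and finitely generated modules\<close>

text \<open>The locale \<open>algebra\<close> of \<open>HOL-Algebra\<close> is restricted to commutative algebras.\<close>

locale findim_algebra = module K A + A?: ring A for K (structure) and A (structure) +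
  assumes smult_mult_left:
      "\<lbrakk>c \<in> carrier K; x \<in> carrier A; y \<in> carrier A\<rbrakk> \<Longrightarrow>
       (c \<odot>\<^bsub>A\<^esub> x) \<otimes>\<^bsub>A\<^esub> y = c \<odot>\<^bsub>A\<^esub> (x \<otimes>\<^bsub>A\<^esub> y)"
    and smult_mult_right:
      "\<lbrakk>c \<in> carrier K; x \<in> carrier A; y \<in> carrier A\<rbrakk> \<Longrightarrow>
       x \<otimes>\<^bsub>A\<^esub> (c \<odot>\<^bsub>A\<^esub> y) = c \<odot>\<^bsub>A\<^esub> (x \<otimes>\<^bsub>A\<^esub> y)"
    and finite_dimensional:
      "\<exists>B. finite B \<and> B \<subseteq> carrier A \<and>
         (\<forall>x \<in> carrier A. \<exists>c \<in> B \<rightarrow> carrier K. x = (\<Oplus>\<^bsub>A\<^esub>b \<in> B. c b \<odot>\<^bsub>A\<^esub> b))"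

text \<open>Left modules over a not necessarily commutative ring, on the record type \<open>module\<close> of
  \<open>HOL-Algebra\<close>, whose fields \<open>mult\<close> and \<open>one\<close> play no role here.\<close>

locale left_module = R?: ring R + M?: abelian_group M
    for R :: "('a, 'r) ring_scheme" (structure) and M :: "('a, 'u, 'z) module_scheme" (structure) +
  assumes smult_closed:
      "\<lbrakk>a \<in> carrier R; x \<in> carrier M\<rbrakk> \<Longrightarrow> a \<odot>\<^bsub>M\<^esub> x \<in> carrier M"
    and smult_l_distr:
      "\<lbrakk>a \<in> carrier R; b \<in> carrier R; x \<in> carrier M\<rbrakk> \<Longrightarrow>
       (a \<oplus> b) \<odot>\<^bsub>M\<^esub> x = a \<odot>\<^bsub>M\<^esub> x \<oplus>\<^bsub>M\<^esub> b \<odot>\<^bsub>M\<^esub> x"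
    and smult_r_distr:
      "\<lbrakk>a \<in> carrier R; x \<in> carrier M; y \<in> carrier M\<rbrakk> \<Longrightarrow>
       a \<odot>\<^bsub>M\<^esub> (x \<oplus>\<^bsub>M\<^esub> y) = a \<odot>\<^bsub>M\<^esub> x \<oplus>\<^bsub>M\<^esub> a \<odot>\<^bsub>M\<^esub> y"
    and smult_assoc:
      "\<lbrakk>a \<in> carrier R; b \<in> carrier R; x \<in> carrier M\<rbrakk> \<Longrightarrow>
       (a \<otimes> b) \<odot>\<^bsub>M\<^esub> x = a \<odot>\<^bsub>M\<^esub> (b \<odot>\<^bsub>M\<^esub> x)"
    and smult_one: "x \<in> carrier M \<Longrightarrow> \<one> \<odot>\<^bsub>M\<^esub> x = x"

definition fg_module :: "('a, 'r) ring_scheme \<Rightarrow> ('a, 'u) module \<Rightarrow> bool" where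
  "fg_module R M \<longleftrightarrow> left_module R M \<and>
     (\<exists>G. finite G \<and> G \<subseteq> carrier M \<and>
        (\<forall>x \<in> carrier M. \<exists>c \<in> G \<rightarrow> carrier R. x = (\<Oplus>\<^bsub>M\<^esub>g \<in> G. c g \<odot>\<^bsub>M\<^esub> g)))"

definition mod_hom ::
  "('a, 'r) ring_scheme \<Rightarrow> ('a, 'u) module \<Rightarrow> ('a, 'u) module \<Rightarrow> ('u \<Rightarrow> 'u) set" where
  "mod_hom R M N = {f \<in> carrier M \<rightarrow> carrier N.
     (\<forall>x \<in> carrier M. \<forall>y \<in> carrier M. f (x \<oplus>\<^bsub>M\<^esub> y) = f x \<oplus>\<^bsub>N\<^esub> f y) \<and>
     (\<forall>a \<in> carrier R. \<forall>x \<in> carrier M. f (a \<odot>\<^bsub>M\<^esub> x) = a \<odot>\<^bsub>N\<^esub> f x)}"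

text \<open>Projective objects of the category of finitely generated modules.\<close>

definition fg_projective :: "('a, 'r) ring_scheme \<Rightarrow> ('a, 'u) module \<Rightarrow> bool" where
  "fg_projective R P \<longleftrightarrow> fg_module R P \<and>
     (\<forall>(M :: ('a, 'u) module) (N :: ('a, 'u) module) g f.
        fg_module R M \<and> fg_module R N \<and> g \<in> mod_hom R M N \<and> g ` carrier M = carrier N \<and>
        f \<in> mod_hom R P N \<longrightarrow>
        (\<exists>h \<in> mod_hom R P M. \<forall>x \<in> carrier P. g (h x) = f x))"

text \<open>The quotient \<open>M/N\<close>, realised on a set of representatives of the cosets instead of on the
  cosets themselves, so that its elements have the same type as those of \<open>M\<close>.\<close>

definition coset_rep :: "('a, 'u) module \<Rightarrow> 'u set \<Rightarrow> 'u \<Rightarrow> 'u" where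
  "coset_rep M N x = (SOME y. y \<in> N +>\<^bsub>M\<^esub> x)"

definition quot_module :: "('a, 'u) module \<Rightarrow> 'u set \<Rightarrow> ('a, 'u) module" where
  "quot_module M N = M\<lparr>carrier := coset_rep M N ` carrier M,
     zero := coset_rep M N \<zero>\<^bsub>M\<^esub>,
     add := (\<lambda>x y. coset_rep M N (x \<oplus>\<^bsub>M\<^esub> y)),
     smult := (\<lambda>a x. coset_rep M N (a \<odot>\<^bsub>M\<^esub> x))\<rparr>"


section \<open>Complexes and the homotopy category\<close>

text \<open>Cohomological grading: \<open>Diff X i\<close> maps \<open>Term X i\<close> to \<open>Term X (i + 1)\<close>.\<close>

record ('a, 'u) cplx =
  Term :: "int \<Rightarrow> ('a, 'u) module"
  Diff :: "int \<Rightarrow> 'u \<Rightarrow> 'u"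

definition concentrated :: "int \<Rightarrow> int \<Rightarrow> ('a, 'u) cplx \<Rightarrow> bool" where
  "concentrated a b X \<longleftrightarrow> (\<forall>i. i < a \<or> b < i \<longrightarrow> carrier (Term X i) = {\<zero>\<^bsub>Term X i\<^esub>})"

definition bounded_complex :: "('a, 'r) ring_scheme \<Rightarrow> ('a, 'u) cplx \<Rightarrow> bool" where
  "bounded_complex R X \<longleftrightarrow>
     (\<forall>i. fg_module R (Term X i) \<and> Diff X i \<in> mod_hom R (Term X i) (Term X (i + 1)) \<and>
        (\<forall>x \<in> carrier (Term X i). Diff X (i + 1) (Diff X i x) = \<zero>\<^bsub>Term X (i + 2)\<^esub>)) \<and>
     (\<exists>a b. concentrated a b X)"

definition chain_maps ::
  "('a, 'r) ring_scheme \<Rightarrow> ('a, 'u) cplx \<Rightarrow> ('a, 'u) cplx \<Rightarrow> (int \<Rightarrow> 'u \<Rightarrow> 'u) set" where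
  "chain_maps R X Y = {f. \<forall>i. f i \<in> mod_hom R (Term X i) (Term Y i) \<and>
     (\<forall>x \<in> carrier (Term X i). f (i + 1) (Diff X i x) = Diff Y i (f i x))}"

definition homotopy_rel ::
  "('a, 'r) ring_scheme \<Rightarrow> ('a, 'u) cplx \<Rightarrow> ('a, 'u) cplx \<Rightarrow>
   ((int \<Rightarrow> 'u \<Rightarrow> 'u) \<times> (int \<Rightarrow> 'u \<Rightarrow> 'u)) set" where
  "homotopy_rel R X Y = {(f, g). f \<in> chain_maps R X Y \<and> g \<in> chain_maps R X Y \<and>
     (\<exists>h. \<forall>i. h i \<in> mod_hom R (Term X i) (Term Y (i - 1)) \<and>
        (\<forall>x \<in> carrier (Term X i).
           f i x = g i x \<oplus>\<^bsub>Term Y i\<^esub>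
             (Diff Y (i - 1) (h i x) \<oplus>\<^bsub>Term Y i\<^esub> h (i + 1) (Diff X i x))))}"

text \<open>The bounded homotopy category of finitely generated modules. Morphisms are homotopy classes
  of chain maps; in particular, values of chain maps outside the carriers are irrelevant.\<close>

definition Kb_mod ::
  "('a, 'r) ring_scheme \<Rightarrow> (('a, 'u) cplx, (int \<Rightarrow> 'u \<Rightarrow> 'u) set) add_cat" where
  "Kb_mod R = \<lparr>Obj = {X. bounded_complex R X},
     Hom = (\<lambda>X Y. chain_maps R X Y // homotopy_rel R X Y),
     Comp = (\<lambda>X Y Z b a. \<Union>f \<in> a. \<Union>g \<in> b. homotopy_rel R X Z `` {\<lambda>i x. g i (f i x)}),
     Ident = (\<lambda>X. homotopy_rel R X X `` {\<lambda>i x. x}),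
     HAdd = (\<lambda>X Y a b. \<Union>f \<in> a. \<Union>g \<in> b.
        homotopy_rel R X Y `` {\<lambda>i x. f i x \<oplus>\<^bsub>Term Y i\<^esub> g i x})\<rparr>"

definition Kb_proj ::
  "('a, 'r) ring_scheme \<Rightarrow> (('a, 'u) cplx, (int \<Rightarrow> 'u \<Rightarrow> 'u) set) add_cat" where
  "Kb_proj R = full_subcat (Kb_mod R) (\<lambda>X. \<forall>i. fg_projective R (Term X i))"

definition K_proj_interval ::
  "('a, 'r) ring_scheme \<Rightarrow> int \<Rightarrow> int \<Rightarrow> (('a, 'u) cplx, (int \<Rightarrow> 'u \<Rightarrow> 'u) set) add_cat" where
  "K_proj_interval R a b = full_subcat (Kb_proj R)
     (\<lambda>X. \<exists>Y \<in> Obj (Kb_proj R). concentrated a b Y \<and> (\<exists>f. is_iso (Kb_proj R) X Y f))"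

text \<open>Finitely generated projectives placed in degree \<open>n\<close>, that is, \<open>add R[-n]\<close>.\<close>

definition proj_stalks :: "('a, 'r) ring_scheme \<Rightarrow> int \<Rightarrow> ('a, 'u) cplx set" where
  "proj_stalks R n = {X \<in> Obj (Kb_proj R). concentrated n n X}"


section \<open>Cohomology and the bounded derived category\<close>

definition cocycles :: "('a, 'u) cplx \<Rightarrow> int \<Rightarrow> 'u set" where
  "cocycles X i = {x \<in> carrier (Term X i). Diff X i x = \<zero>\<^bsub>Term X (i + 1)\<^esub>}"

definition coboundaries :: "('a, 'u) cplx \<Rightarrow> int \<Rightarrow> 'u set" where
  "coboundaries X i = Diff X (i - 1) ` carrier (Term X (i - 1))"

definition cohomology :: "('a, 'u) cplx \<Rightarrow> int \<Rightarrow> 'u set set" where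
  "cohomology X i = (\<lambda>x. coboundaries X i +>\<^bsub>Term X i\<^esub> x) ` cocycles X i"

text \<open>All members of the union below are the same coset.\<close>

definition cohomology_map ::
  "('a, 'u) cplx \<Rightarrow> (int \<Rightarrow> 'u \<Rightarrow> 'u) \<Rightarrow> int \<Rightarrow> 'u set \<Rightarrow> 'u set" where
  "cohomology_map Y f i c = (\<Union>x \<in> c. coboundaries Y i +>\<^bsub>Term Y i\<^esub> f i x)"

definition quasi_isos ::
  "('a, 'r) ring_scheme \<Rightarrow> ('a, 'u) cplx \<Rightarrow> ('a, 'u) cplx \<Rightarrow> (int \<Rightarrow> 'u \<Rightarrow> 'u) set set" where
  "quasi_isos R X Y = {a \<in> Hom (Kb_mod R) X Y.
     \<forall>f \<in> a. \<forall>i. bij_betw (cohomology_map Y f i) (cohomology X i) (cohomology Y i)}"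

type_synonym ('a, 'u) Db_mor =
  "(('a, 'u) cplx \<times> (int \<Rightarrow> 'u \<Rightarrow> 'u) set \<times> (int \<Rightarrow> 'u \<Rightarrow> 'u) set) set"

definition Db_mod :: "('a, 'r) ring_scheme \<Rightarrow> (('a, 'u) cplx, ('a, 'u) Db_mor) cat" where
  "Db_mod R = localization (Kb_mod R) (quasi_isos R)"

definition D_interval ::
  "('a, 'r) ring_scheme \<Rightarrow> int \<Rightarrow> int \<Rightarrow> (('a, 'u) cplx, ('a, 'u) Db_mor) cat" where
  "D_interval R a b = full_subcat (Db_mod R)
     (\<lambda>X. \<forall>i. i < a \<or> b < i \<longrightarrow> cohomology X i = {coboundaries X i})"


section \<open>The truncation functor\<close>

text \<open>\<open>trunc n X\<close> is the complex
  \<open>\<cdots> \<rightarrow> 0 \<rightarrow> X\<^sup>n\<^sup>-\<^sup>1 / Ker \<delta>\<^sup>n\<^sup>-\<^sup>1 \<rightarrow> X\<^sup>n \<rightarrow> X\<^sup>n\<^sup>+\<^sup>1 \<rightarrow> \<cdots>\<close>.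
  The differential induced on the quotient in degree \<open>n - 1\<close> is that of \<open>X\<close> applied to
  representatives.\<close>

definition trunc_term :: "int \<Rightarrow> ('a, 'u) cplx \<Rightarrow> int \<Rightarrow> ('a, 'u) module" where
  "trunc_term n X i =
     (if i < n - 1 then (Term X i)\<lparr>carrier := {\<zero>\<^bsub>Term X i\<^esub>}\<rparr>
      else if i = n - 1 then quot_module (Term X i) (cocycles X i)
      else Term X i)"

definition trunc :: "int \<Rightarrow> ('a, 'u) cplx \<Rightarrow> ('a, 'u) cplx" where
  "trunc n X = \<lparr>Term = trunc_term n X,
     Diff = (\<lambda>i x. if i < n - 1 then \<zero>\<^bsub>trunc_term n X (i + 1)\<^esub> else Diff X i x)\<rparr>"

definition trunc_map ::
  "int \<Rightarrow> ('a, 'u) cplx \<Rightarrow> (int \<Rightarrow> 'u \<Rightarrow> 'u) \<Rightarrow> int \<Rightarrow> 'u \<Rightarrow> 'u" where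
  "trunc_map n Y f i x =
     (if i < n - 1 then \<zero>\<^bsub>Term Y i\<^esub>
      else if i = n - 1 then coset_rep (Term Y i) (cocycles Y i) (f i x)
      else f i x)"

definition trunc_K ::
  "('a, 'r) ring_scheme \<Rightarrow> int \<Rightarrow>
   (('a, 'u) cplx, (int \<Rightarrow> 'u \<Rightarrow> 'u) set, ('a, 'u) cplx, (int \<Rightarrow> 'u \<Rightarrow> 'u) set) cat_functor" where
  "trunc_K R n = \<lparr>OMap = trunc n,
     AMap = (\<lambda>X Y a. \<Union>f \<in> a. homotopy_rel R (trunc n X) (trunc n Y) `` {trunc_map n Y f})\<rparr>"

definition trunc_D ::
  "('a, 'r) ring_scheme \<Rightarrow> int \<Rightarrow>
   (('a, 'u) cplx, ('a, 'u) Db_mor, ('a, 'u) cplx, ('a, 'u) Db_mor) cat_functor" where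
  "trunc_D R n = loc_extend (Kb_mod R) (quasi_isos R) (trunc_K R n)"

text \<open>The truncation functor restricted along the canonical functor from the homotopy category.\<close>

definition trunc_KD ::
  "('a, 'r) ring_scheme \<Rightarrow> int \<Rightarrow>
   (('a, 'u) cplx, (int \<Rightarrow> 'u \<Rightarrow> 'u) set, ('a, 'u) cplx, ('a, 'u) Db_mor) cat_functor" where
  "trunc_KD R n = functor_comp (trunc_D R n) (loc_functor (Kb_mod R) (quasi_isos R))"


section \<open>Induced functors and the universe of modules\<close>

definition induces_equivalence ::
  "('o, 'm, 'y) add_cat_scheme \<Rightarrow> 'o set \<Rightarrow> ('p, 'n, 'z) cat_scheme \<Rightarrow>
   ('o, 'm, 'p, 'n) cat_functor \<Rightarrow> bool" where
  "induces_equivalence C U D F \<longleftrightarrow> (\<exists>G.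
     (\<forall>X \<in> Obj C. OMap (functor_comp G (quot_functor C U)) X = OMap F X) \<and>
     (\<forall>X \<in> Obj C. \<forall>Y \<in> Obj C. \<forall>f \<in> Hom C X Y.
        AMap (functor_comp G (quot_functor C U)) X Y f = AMap F X Y f) \<and>
     equivalence (quot_cat C U) D G)"

text \<open>Modules are carried by subsets of the type \<open>'u\<close>. Since a finitely generated module is a
  quotient of a finite free module, its elements can be represented by finite lists over the ring;
  hence, if the lists over \<open>R\<close> embed into \<open>'u\<close>, every finitely generated module (on any type) is
  isomorphic to one carried by a subset of \<open>'u\<close>.\<close>

definition module_universe :: "('a, 'r) ring_scheme \<Rightarrow> 'u itself \<Rightarrow> bool" where
  "module_universe R _ \<longleftrightarrow> (\<exists>e :: 'a list \<Rightarrow> 'u. inj_on e (lists (carrier R)))"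

end

theory Submission
  imports Defs
begin

text \<open>Put \<open>n = - d + 2\<close> and call a complex \<open>n\<close>-truncated if it has no nonzero cocycles below degree
  \<open>n\<close>; this holds for every \<open>trunc n X\<close>, and \<open>X \<rightarrow> trunc n X\<close> is universal among maps to
  \<open>n\<close>-truncated complexes. Mapping cones of quasi-isomorphisms are acyclic, so a complex \<open>Q\<close> with
  \<open>Q\<^sup>i\<close> projective for \<open>i \<ge> n\<close> lifts, uniquely up to homotopy, through quasi-isomorphisms between
  \<open>n\<close>-truncated complexes; no projectivity is needed below degree \<open>n\<close> because there the lifts are
  forced. Every bounded complex is \<open>n\<close>-truncated for small \<open>n\<close>, and then it is quasi-isomorphic to
  \<open>trunc n X\<close> for a bounded complex \<open>X\<close> of projectives starting in degree \<open>n - 1\<close>. This yields the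
  Ore conditions without mapping cones inside the category, the essential surjectivity of the
  truncation functor, and \<open>Hom\<^sub>D (trunc n X) (trunc n Y) = Hom\<^sub>K (trunc n X) (trunc n Y)\<close>. Fullness and
  the kernel of the functor are then questions about chain maps, where only degree \<open>n - 1\<close> matters
  and is handled by projectivity.\<close>

section \<open>Categories and equivalences\<close>

text \<open>All modules are carried by subsets of one fixed type, and the only new ones placed there
  are subsets, sets of representatives, and free modules coded as lists. Products, pullbacks and
  mapping cones would need codes of their own. Submodules of a product are therefore kept as
  relations (\<open>rel2\<close>, \<open>rel3\<close>), and a contraction into a cone becomes a pair
  of families of maps, built one degree at a time downwards. For the same reason quotients consist
  of representatives: the terms of \<open>trunc n X\<close> are subsets of those of
  \<open>X\<close>, and a map on \<open>X\<close> that kills the right cocycles is, as a function,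
  already a map on \<open>trunc n X\<close>. An object of the source category is only isomorphic to
  a complex in degrees from \<open>n - 1\<close> to 0, whereas the arguments with chain maps need
  zero terms below \<open>n - 1\<close>. They are carried out for the concentrated complex and
  transported along a retraction. The bound on \<open>d\<close> enters as \<open>n \<le> 0\<close>,
  which puts all positive degrees in the range where truncation keeps cocycles and
  coboundaries.\<close>

locale cat =
  fixes C :: "('o, 'm, 'z) cat_scheme"
  assumes category: "category C"
begin

lemma id_hom [simp]: "X \<in> Obj C \<Longrightarrow> Ident C X \<in> Hom C X X"
  using category by (simp add: category_def)

lemma comp_hom [simp]:
  "\<lbrakk>X \<in> Obj C; Y \<in> Obj C; Z \<in> Obj C; f \<in> Hom C X Y; g \<in> Hom C Y Z\<rbrakk> \<Longrightarrow> Comp C X Y Z g f \<in> Hom C X Z"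
  using category by (simp add: category_def)

lemma id_right [simp]:
  "\<lbrakk>X \<in> Obj C; Y \<in> Obj C; f \<in> Hom C X Y\<rbrakk> \<Longrightarrow> Comp C X X Y f (Ident C X) = f"
  using category by (simp add: category_def)

lemma id_left [simp]:
  "\<lbrakk>X \<in> Obj C; Y \<in> Obj C; f \<in> Hom C X Y\<rbrakk> \<Longrightarrow> Comp C X Y Y (Ident C Y) f = f"
  using category by (simp add: category_def)

lemma assoc [simp]:
  "\<lbrakk>W \<in> Obj C; X \<in> Obj C; Y \<in> Obj C; Z \<in> Obj C; f \<in> Hom C W X; g \<in> Hom C X Y; h \<in> Hom C Y Z\<rbrakk> \<Longrightarrow>
   Comp C W X Z (Comp C X Y Z h g) f = Comp C W Y Z h (Comp C W X Y g f)"
  using category by (simp add: category_def)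

lemma is_isoE:
  assumes "is_iso C X Y f"
  obtains g where "f \<in> Hom C X Y" "g \<in> Hom C Y X"
    "Comp C X Y X g f = Ident C X" "Comp C Y X Y f g = Ident C Y"
  using assms by (auto simp: is_iso_def)

lemma iso_comp:
  assumes "X \<in> Obj C" "Y \<in> Obj C" "Z \<in> Obj C" "is_iso C X Y f" "is_iso C Y Z g"
  shows "is_iso C X Z (Comp C X Y Z g f)"
proof -
  obtain f' where f: "f \<in> Hom C X Y" "f' \<in> Hom C Y X"
    "Comp C X Y X f' f = Ident C X" "Comp C Y X Y f f' = Ident C Y"
    using assms(4) by (rule is_isoE)
  obtain g' where g: "g \<in> Hom C Y Z" "g' \<in> Hom C Z Y"
    "Comp C Y Z Y g' g = Ident C Y" "Comp C Z Y Z g g' = Ident C Z"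
    using assms(5) by (rule is_isoE)
  have "Comp C X Z X (Comp C Z Y X f' g') (Comp C X Y Z g f) =
      Comp C X Y X f' (Comp C X Y Y (Comp C Y Z Y g' g) f)"
    using assms(1-3) f(1,2) g(1,2) by simp
  moreover have "Comp C Z X Z (Comp C X Y Z g f) (Comp C Z Y X f' g') =
      Comp C Z Y Z g (Comp C Z Y Y (Comp C Y X Y f f') g')"
    using assms(1-3) f(1,2) g(1,2) by simp
  ultimately show ?thesis
    unfolding is_iso_def using assms(1-3) f g by (auto intro!: bexI[of _ "Comp C Z Y X f' g'"])
qed

end

lemma category_full_subcat: "category C \<Longrightarrow> category (full_subcat C P)"
  unfolding category_def full_subcat_def by simp

lemma full_subcat_simps [simp]:
  "Obj (full_subcat C P) = {X \<in> Obj C. P X}" "Hom (full_subcat C P) = Hom C"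
  "Comp (full_subcat C P) = Comp C" "Ident (full_subcat C P) = Ident C"
  by (simp_all add: full_subcat_def)

lemma HAdd_full_subcat [simp]: "HAdd (full_subcat C P) = HAdd C"
  by (simp add: full_subcat_def)

lemma is_iso_full_subcat [simp]: "is_iso (full_subcat C P) X Y f = is_iso C X Y f"
  by (simp add: is_iso_def)

locale fun_between = C: cat C + D: cat D
  for C :: "('o, 'm, 'y) cat_scheme" and D :: "('p, 'n, 'z) cat_scheme" +
  fixes F :: "('o, 'm, 'p, 'n) cat_functor"
  assumes is_fun: "is_functor C D F"
begin

lemma map_obj [simp]: "X \<in> Obj C \<Longrightarrow> OMap F X \<in> Obj D"
  using is_fun by (simp add: is_functor_def)

lemma map_hom [simp]:
  "\<lbrakk>X \<in> Obj C; Y \<in> Obj C; f \<in> Hom C X Y\<rbrakk> \<Longrightarrow> AMap F X Y f \<in> Hom D (OMap F X) (OMap F Y)"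
  using is_fun by (simp add: is_functor_def)

lemma map_id [simp]: "X \<in> Obj C \<Longrightarrow> AMap F X X (Ident C X) = Ident D (OMap F X)"
  using is_fun by (simp add: is_functor_def)

lemma map_comp:
  "\<lbrakk>X \<in> Obj C; Y \<in> Obj C; Z \<in> Obj C; f \<in> Hom C X Y; g \<in> Hom C Y Z\<rbrakk> \<Longrightarrow>
   AMap F X Z (Comp C X Y Z g f) =
   Comp D (OMap F X) (OMap F Y) (OMap F Z) (AMap F Y Z g) (AMap F X Y f)"
  using is_fun by (simp add: is_functor_def)

end

section \<open>Fully faithful, essentially surjective functors are equivalences\<close>

locale ff_es = fun_between +
  assumes full: "\<And>X Y g. \<lbrakk>X \<in> Obj C; Y \<in> Obj C; g \<in> Hom D (OMap F X) (OMap F Y)\<rbrakk> \<Longrightarrow>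
      \<exists>f \<in> Hom C X Y. AMap F X Y f = g"
    and faithful: "\<And>X Y f g. \<lbrakk>X \<in> Obj C; Y \<in> Obj C; f \<in> Hom C X Y; g \<in> Hom C X Y; AMap F X Y f = AMap F X Y g\<rbrakk> \<Longrightarrow> f = g"
    and ess_surj: "\<And>M. M \<in> Obj D \<Longrightarrow> \<exists>X \<in> Obj C. \<exists>e. is_iso D (OMap F X) M e"
begin

definition obj_inv where
  "obj_inv M = (SOME X. X \<in> Obj C \<and> (\<exists>e. is_iso D (OMap F X) M e))"

definition counit where
  "counit M = (SOME e. is_iso D (OMap F (obj_inv M)) M e)"

definition counit_inv where
  "counit_inv M = (SOME e. e \<in> Hom D M (OMap F (obj_inv M)) \<and>
     Comp D (OMap F (obj_inv M)) M (OMap F (obj_inv M)) e (counit M) = Ident D (OMap F (obj_inv M)) \<and>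
     Comp D M (OMap F (obj_inv M)) M (counit M) e = Ident D M)"

lemma obj_inv: "M \<in> Obj D \<Longrightarrow> obj_inv M \<in> Obj C \<and> (\<exists>e. is_iso D (OMap F (obj_inv M)) M e)"
  unfolding obj_inv_def by (rule someI_ex) (use ess_surj in blast)

lemma obj_inv_obj [simp]: "M \<in> Obj D \<Longrightarrow> obj_inv M \<in> Obj C"
  using obj_inv by blast

lemma counit: "M \<in> Obj D \<Longrightarrow> is_iso D (OMap F (obj_inv M)) M (counit M)"
  unfolding counit_def by (rule someI_ex) (use obj_inv in blast)

lemma counit_hom [simp]: "M \<in> Obj D \<Longrightarrow> counit M \<in> Hom D (OMap F (obj_inv M)) M"
  using counit unfolding is_iso_def by blast

lemma counit_inv:
  assumes "M \<in> Obj D"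
  shows "counit_inv M \<in> Hom D M (OMap F (obj_inv M))"
    "Comp D (OMap F (obj_inv M)) M (OMap F (obj_inv M)) (counit_inv M) (counit M) = Ident D (OMap F (obj_inv M))"
    "Comp D M (OMap F (obj_inv M)) M (counit M) (counit_inv M) = Ident D M"
proof -
  have "\<exists>e. e \<in> Hom D M (OMap F (obj_inv M)) \<and>
     Comp D (OMap F (obj_inv M)) M (OMap F (obj_inv M)) e (counit M) = Ident D (OMap F (obj_inv M)) \<and>
     Comp D M (OMap F (obj_inv M)) M (counit M) e = Ident D M"
    using counit[OF assms] unfolding is_iso_def by blast
  from someI_ex[OF this] show "counit_inv M \<in> Hom D M (OMap F (obj_inv M))"
    "Comp D (OMap F (obj_inv M)) M (OMap F (obj_inv M)) (counit_inv M) (counit M) = Ident D (OMap F (obj_inv M))"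
    "Comp D M (OMap F (obj_inv M)) M (counit M) (counit_inv M) = Ident D M"
    unfolding counit_inv_def by blast+
qed

declare counit_inv [simp]

text \<open>The simp rule \<open>assoc\<close> brackets to the right, so the two mutually inverse
  morphisms are met with a tail \<open>f\<close> attached, where the equations of
  \<open>counit_inv\<close> no longer match.\<close>

lemma counit_cancel [simp]:
  assumes "M \<in> Obj D" "W \<in> Obj D" "f \<in> Hom D W M"
  shows "Comp D W (OMap F (obj_inv M)) M (counit M) (Comp D W M (OMap F (obj_inv M)) (counit_inv M) f) = f"
proof -
  have "Comp D W (OMap F (obj_inv M)) M (counit M) (Comp D W M (OMap F (obj_inv M)) (counit_inv M) f)
     = Comp D W M M (Comp D M (OMap F (obj_inv M)) M (counit M) (counit_inv M)) f"
    using assms by (simp del: counit_inv(2,3) add: counit_inv(1))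
  then show ?thesis using assms by simp
qed

definition preimg where
  "preimg X Y g = (SOME f. f \<in> Hom C X Y \<and> AMap F X Y f = g)"

lemma preimg [simp]:
  assumes "X \<in> Obj C" "Y \<in> Obj C" "g \<in> Hom D (OMap F X) (OMap F Y)"
  shows "preimg X Y g \<in> Hom C X Y" "AMap F X Y (preimg X Y g) = g"
proof -
  have "\<exists>f. f \<in> Hom C X Y \<and> AMap F X Y f = g" using full[OF assms] by blast
  from someI_ex[OF this] show "preimg X Y g \<in> Hom C X Y" "AMap F X Y (preimg X Y g) = g"
    unfolding preimg_def by blast+
qed

definition quasi_inv where
  "quasi_inv = \<lparr>OMap = obj_inv, AMap = (\<lambda>M N g. preimg (obj_inv M) (obj_inv N)
     (Comp D (OMap F (obj_inv M)) N (OMap F (obj_inv N)) (counit_inv N)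
        (Comp D (OMap F (obj_inv M)) M N g (counit M))))\<rparr>"

text \<open>By faithfulness both functor laws may be checked after applying \<open>F\<close>; there
  the new morphism map is conjugation by the counit, and adjacent counits cancel.\<close>

lemma quasi_inv_functor: "is_functor D C quasi_inv"
  unfolding is_functor_def quasi_inv_def
proof (intro conjI ballI; clarsimp)
  fix X assume "X \<in> Obj D"
  then show "preimg (obj_inv X) (obj_inv X) (Ident D (OMap F (obj_inv X))) = Ident C (obj_inv X)"
    by (intro faithful[of "obj_inv X" "obj_inv X"]) simp_all
next
  fix X Y Z f g assume "X \<in> Obj D" "Y \<in> Obj D" "Z \<in> Obj D" "f \<in> Hom D X Y" "g \<in> Hom D Y Z"
  then show "preimg (obj_inv X) (obj_inv Z)
        (Comp D (OMap F (obj_inv X)) Z (OMap F (obj_inv Z)) (counit_inv Z)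
          (Comp D (OMap F (obj_inv X)) Y Z g (Comp D (OMap F (obj_inv X)) X Y f (counit X)))) =
      Comp C (obj_inv X) (obj_inv Y) (obj_inv Z)
        (preimg (obj_inv Y) (obj_inv Z)
          (Comp D (OMap F (obj_inv Y)) Z (OMap F (obj_inv Z)) (counit_inv Z)
            (Comp D (OMap F (obj_inv Y)) Y Z g (counit Y))))
        (preimg (obj_inv X) (obj_inv Y)
          (Comp D (OMap F (obj_inv X)) Y (OMap F (obj_inv Y)) (counit_inv Y)
            (Comp D (OMap F (obj_inv X)) X Y f (counit X))))"
    by (intro faithful[of "obj_inv X" "obj_inv Z"]) (simp_all add: map_comp)
qed

theorem equivalence: "equivalence C D F"
proof -
  have 1: "nat_isomorphic D D (functor_comp F quasi_inv) id_functor"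
    unfolding nat_isomorphic_def
    by (rule exI[of _ counit]) (auto simp: functor_comp_def quasi_inv_def id_functor_def counit)
  \<comment> \<open>The unit has to become the inverse counit under \<open>F\<close>; its own
    inverse \<open>\<theta>\<close> is then the preimage of the counit.\<close>
  define \<eta> where "\<eta> X = preimg X (obj_inv (OMap F X)) (counit_inv (OMap F X))" for X
  have \<eta>: "\<eta> X \<in> Hom C X (obj_inv (OMap F X))" "AMap F X (obj_inv (OMap F X)) (\<eta> X) = counit_inv (OMap F X)"
    if "X \<in> Obj C" for X unfolding \<eta>_def using that by simp_all
  define \<theta> where "\<theta> X = preimg (obj_inv (OMap F X)) X (counit (OMap F X))" for X
  have \<theta>: "\<theta> X \<in> Hom C (obj_inv (OMap F X)) X" "AMap F (obj_inv (OMap F X)) X (\<theta> X) = counit (OMap F X)"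
    if "X \<in> Obj C" for X unfolding \<theta>_def using that by simp_all
  have 2: "is_iso C X (obj_inv (OMap F X)) (\<eta> X)" if X: "X \<in> Obj C" for X
  proof -
    have "Comp C X (obj_inv (OMap F X)) X (\<theta> X) (\<eta> X) = Ident C X"
      by (rule faithful[of X X]) (simp_all add: X \<eta> \<theta> map_comp)
    moreover have "Comp C (obj_inv (OMap F X)) X (obj_inv (OMap F X)) (\<eta> X) (\<theta> X) = Ident C (obj_inv (OMap F X))"
      by (rule faithful[of "obj_inv (OMap F X)" "obj_inv (OMap F X)"]) (simp_all add: X \<eta> \<theta> map_comp)
    ultimately show ?thesis unfolding is_iso_def using X \<eta> \<theta> by blast
  qed
  have "nat_isomorphic C C id_functor (functor_comp quasi_inv F)"
    unfolding nat_isomorphic_def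
  proof (intro exI[of _ \<eta>] conjI ballI; simp add: functor_comp_def quasi_inv_def id_functor_def 2)
    fix X Y f assume X: "X \<in> Obj C" "Y \<in> Obj C" "f \<in> Hom C X Y"
    show "Comp C X Y (obj_inv (OMap F Y)) (\<eta> Y) f =
       Comp C X (obj_inv (OMap F X)) (obj_inv (OMap F Y))
        (preimg (obj_inv (OMap F X)) (obj_inv (OMap F Y))
          (Comp D (OMap F (obj_inv (OMap F X))) (OMap F Y) (OMap F (obj_inv (OMap F Y))) (counit_inv (OMap F Y))
            (Comp D (OMap F (obj_inv (OMap F X))) (OMap F X) (OMap F Y) (AMap F X Y f) (counit (OMap F X)))))
        (\<eta> X)"
      by (rule faithful[of X "obj_inv (OMap F Y)"]) (simp_all add: X \<eta> map_comp)
  qed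
  with 1 show ?thesis
    unfolding equivalence_def using C.category D.category is_fun quasi_inv_functor by blast
qed

end

text \<open>If the congruence defining the quotient is the kernel of \<open>F\<close>, every property of the quotient
  category is inherited from \<open>F\<close>; in particular the class of objects need not be closed under sums.\<close>

locale kernel_quotient = fun_between C D F
  for C :: "('o, 'm, 'y) add_cat_scheme" and D :: "('p, 'n, 'z) cat_scheme"
    and F :: "('o, 'm, 'p, 'n) cat_functor" +
  fixes U :: "'o set"
  assumes kernel: "\<lbrakk>X \<in> Obj C; Y \<in> Obj C; f \<in> Hom C X Y; g \<in> Hom C X Y\<rbrakk> \<Longrightarrow>
      (f, g) \<in> quot_rel C U X Y \<longleftrightarrow> AMap F X Y f = AMap F X Y g"
begin

abbreviation qcls where "qcls X Y f \<equiv> quot_rel C U X Y `` {f}"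

lemma quot_rel_iff:
  assumes "X \<in> Obj C" "Y \<in> Obj C"
  shows "(f, g) \<in> quot_rel C U X Y \<longleftrightarrow> f \<in> Hom C X Y \<and> g \<in> Hom C X Y \<and> AMap F X Y f = AMap F X Y g"
  using kernel[OF assms] by (auto simp: quot_rel_def)

lemma qcls_eq:
  assumes "X \<in> Obj C" "Y \<in> Obj C" "f \<in> Hom C X Y"
  shows "qcls X Y f = {g \<in> Hom C X Y. AMap F X Y g = AMap F X Y f}"
  using assms by (auto simp: quot_rel_iff)

lemma qcls_eq_iff:
  assumes "X \<in> Obj C" "Y \<in> Obj C" "f \<in> Hom C X Y" "g \<in> Hom C X Y"
  shows "qcls X Y f = qcls X Y g \<longleftrightarrow> AMap F X Y f = AMap F X Y g"
  using assms by (auto simp: qcls_eq)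

lemma quot_Hom: "a \<in> Hom (quot_cat C U) X Y \<longleftrightarrow> (\<exists>f \<in> Hom C X Y. a = qcls X Y f)"
  by (auto simp: quot_cat_def quotient_def)

text \<open>The image of a composite under \<open>F\<close> depends only on the images of the
  factors, so by \<open>kernel\<close> the union over representatives runs over a single
  class.\<close>

lemma quot_Comp:
  assumes "X \<in> Obj C" "Y \<in> Obj C" "Z \<in> Obj C" "f \<in> Hom C X Y" "g \<in> Hom C Y Z"
  shows "Comp (quot_cat C U) X Y Z (qcls Y Z g) (qcls X Y f) = qcls X Z (Comp C X Y Z g f)"
proof -
  have "qcls X Z (Comp C X Y Z g' f') = qcls X Z (Comp C X Y Z g f)"
    if "f' \<in> qcls X Y f" "g' \<in> qcls Y Z g" for f' g'
    using that assms by (auto simp: qcls_eq map_comp)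
  moreover have "f \<in> qcls X Y f" "g \<in> qcls Y Z g" using assms by (auto simp: qcls_eq)
  ultimately have "(\<Union>f' \<in> qcls X Y f. \<Union>g' \<in> qcls Y Z g. qcls X Z (Comp C X Y Z g' f')) =
      qcls X Z (Comp C X Y Z g f)" by blast
  then show ?thesis by (simp only: quot_cat_def cat.simps)
qed

lemma quot_Ident: "Ident (quot_cat C U) X = qcls X X (Ident C X)"
  by (simp add: quot_cat_def)

lemma quot_Obj [simp]: "Obj (quot_cat C U) = Obj C"
  by (simp add: quot_cat_def)

lemma quot_HomI: "f \<in> Hom C X Y \<Longrightarrow> qcls X Y f \<in> Hom (quot_cat C U) X Y"
  unfolding quot_Hom by blast

lemma quot_HomE:
  assumes "a \<in> Hom (quot_cat C U) X Y"
  obtains f where "f \<in> Hom C X Y" "a = qcls X Y f"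
  using assms unfolding quot_Hom by blast

lemma category_quot: "category (quot_cat C U)"
  unfolding category_def quot_Obj
proof (intro conjI ballI)
  fix X Y a assume X: "X \<in> Obj C" "Y \<in> Obj C" and a: "a \<in> Hom (quot_cat C U) X Y"
  obtain f where f: "f \<in> Hom C X Y" "a = qcls X Y f" using a by (rule quot_HomE)
  show "Comp (quot_cat C U) X X Y a (Ident (quot_cat C U) X) = a"
    unfolding f(2) quot_Ident using quot_Comp[OF X(1) X(1) X(2) C.id_hom[OF X(1)] f(1)] X f(1) by (simp only: C.id_right)
  show "Comp (quot_cat C U) X Y Y (Ident (quot_cat C U) Y) a = a"
    unfolding f(2) quot_Ident using quot_Comp[OF X(1) X(2) X(2) f(1) C.id_hom[OF X(2)]] X f(1) by (simp only: C.id_left)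
next
  fix X Y Z a b assume X: "X \<in> Obj C" "Y \<in> Obj C" "Z \<in> Obj C"
    and a: "a \<in> Hom (quot_cat C U) X Y" and b: "b \<in> Hom (quot_cat C U) Y Z"
  obtain f where f: "f \<in> Hom C X Y" "a = qcls X Y f" using a by (rule quot_HomE)
  obtain g where g: "g \<in> Hom C Y Z" "b = qcls Y Z g" using b by (rule quot_HomE)
  show "Comp (quot_cat C U) X Y Z b a \<in> Hom (quot_cat C U) X Z"
    unfolding f(2) g(2) quot_Comp[OF X f(1) g(1)] by (rule quot_HomI[OF C.comp_hom[OF X f(1) g(1)]])
next
  fix W X Y Z a b c assume X: "W \<in> Obj C" "X \<in> Obj C" "Y \<in> Obj C" "Z \<in> Obj C"
    and a: "a \<in> Hom (quot_cat C U) W X" and b: "b \<in> Hom (quot_cat C U) X Y" and c: "c \<in> Hom (quot_cat C U) Y Z"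
  obtain f where f: "f \<in> Hom C W X" "a = qcls W X f" using a by (rule quot_HomE)
  obtain g where g: "g \<in> Hom C X Y" "b = qcls X Y g" using b by (rule quot_HomE)
  obtain h where h: "h \<in> Hom C Y Z" "c = qcls Y Z h" using c by (rule quot_HomE)
  have gf: "Comp C W X Y g f \<in> Hom C W Y" and hg: "Comp C X Y Z h g \<in> Hom C X Z"
    using X f(1) g(1) h(1) by simp_all
  show "Comp (quot_cat C U) W Y Z c (Comp (quot_cat C U) W X Y b a) =
      Comp (quot_cat C U) W X Z (Comp (quot_cat C U) X Y Z c b) a"
    unfolding f(2) g(2) h(2) quot_Comp[OF X(1,2,3) f(1) g(1)] quot_Comp[OF X(2,3,4) g(1) h(1)]
      quot_Comp[OF X(1,3,4) gf h(1)] quot_Comp[OF X(1,2,4) f(1) hg] C.assoc[OF X f(1) g(1) h(1)] ..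
next
  fix X assume "X \<in> Obj C"
  then show "Ident (quot_cat C U) X \<in> Hom (quot_cat C U) X X"
    unfolding quot_Ident by (intro quot_HomI C.id_hom)
qed

text \<open>An arbitrary representative will do, because a class is a fibre of the morphism map of
  \<open>F\<close>.\<close>

definition induced where
  "induced = \<lparr>OMap = OMap F, AMap = (\<lambda>X Y a. AMap F X Y (SOME f. f \<in> a))\<rparr>"

lemma AMap_induced:
  assumes "X \<in> Obj C" "Y \<in> Obj C" "f \<in> Hom C X Y"
  shows "AMap induced X Y (qcls X Y f) = AMap F X Y f"
proof -
  have "(SOME g. g \<in> qcls X Y f) \<in> qcls X Y f"
    by (rule someI[of _ f]) (use assms in \<open>simp add: qcls_eq\<close>)
  then show ?thesis using assms by (simp add: induced_def qcls_eq)
qed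

lemma OMap_induced [simp]: "OMap induced = OMap F"
  by (simp add: induced_def)

text \<open>Faithfulness comes for free: distinct classes are distinct fibres of the morphism map.
  Fullness and essential surjectivity are what remains to be supplied.\<close>

theorem induces_equivalence:
  assumes surj_hom: "\<And>X Y g. \<lbrakk>X \<in> Obj C; Y \<in> Obj C; g \<in> Hom D (OMap F X) (OMap F Y)\<rbrakk> \<Longrightarrow>
      \<exists>f \<in> Hom C X Y. AMap F X Y f = g"
    and surj_obj: "\<And>M. M \<in> Obj D \<Longrightarrow> \<exists>X \<in> Obj C. \<exists>e. is_iso D (OMap F X) M e"
  shows "induces_equivalence C U D F"
proof -
  have ind: "is_functor (quot_cat C U) D induced"
    unfolding is_functor_def
  proof (intro conjI ballI)
    fix X Y Z f g assume X: "X \<in> Obj (quot_cat C U)" "Y \<in> Obj (quot_cat C U)" "Z \<in> Obj (quot_cat C U)"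
      and "f \<in> Hom (quot_cat C U) X Y" "g \<in> Hom (quot_cat C U) Y Z"
    then obtain f' g' where "f' \<in> Hom C X Y" "f = qcls X Y f'" "g' \<in> Hom C Y Z" "g = qcls Y Z g'"
      unfolding quot_Hom by blast
    with X show "AMap induced X Z (Comp (quot_cat C U) X Y Z g f) =
      Comp D (OMap induced X) (OMap induced Y) (OMap induced Z) (AMap induced Y Z g) (AMap induced X Y f)"
      by (simp only: quot_Comp quot_Obj AMap_induced map_comp OMap_induced C.comp_hom)
  next
    fix X Y f assume X: "X \<in> Obj (quot_cat C U)" "Y \<in> Obj (quot_cat C U)"
      and "f \<in> Hom (quot_cat C U) X Y"
    then obtain f' where "f' \<in> Hom C X Y" "f = qcls X Y f'"
      unfolding quot_Hom by blast
    with X show "AMap induced X Y f \<in> Hom D (OMap induced X) (OMap induced Y)"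
      by (simp only: quot_Obj AMap_induced OMap_induced map_hom)
  qed (simp_all only: quot_Ident quot_Obj AMap_induced C.id_hom map_id OMap_induced map_obj)
  interpret ff_es "quot_cat C U" D induced
  proof unfold_locales
    show "category (quot_cat C U)" by (rule category_quot)
    show "is_functor (quot_cat C U) D induced" by (rule ind)
    fix X Y g assume "X \<in> Obj (quot_cat C U)" "Y \<in> Obj (quot_cat C U)"
      "g \<in> Hom D (OMap induced X) (OMap induced Y)"
    then obtain f where "f \<in> Hom C X Y" "AMap F X Y f = g" "X \<in> Obj C" "Y \<in> Obj C" using surj_hom by force
    then show "\<exists>f \<in> Hom (quot_cat C U) X Y. AMap induced X Y f = g"
      by (intro bexI[of _ "qcls X Y f"]) (auto simp: AMap_induced quot_Hom)
  next
    fix X Y f g assume "X \<in> Obj (quot_cat C U)" "Y \<in> Obj (quot_cat C U)"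
      "f \<in> Hom (quot_cat C U) X Y" "g \<in> Hom (quot_cat C U) X Y"
      "AMap induced X Y f = AMap induced X Y g"
    then show "f = g" unfolding quot_Hom by (metis AMap_induced qcls_eq_iff quot_Obj)
  next
    fix M assume "M \<in> Obj D"
    then show "\<exists>X \<in> Obj (quot_cat C U). \<exists>e. is_iso D (OMap induced X) M e" using surj_obj by simp
  qed
  show ?thesis
    unfolding induces_equivalence_def
    by (rule exI[of _ induced])
      (use equivalence in \<open>auto simp: functor_comp_def quot_functor_def AMap_induced\<close>)
qed

end

section \<open>Localization at a class admitting a calculus of right fractions\<close>

text \<open>The calculus of right fractions, for roofs whose denominator points back to the source.
  Closure of \<open>S\<close> under two out of three is not among the axioms;
  \<open>weak_ore\<close> stands in for it.\<close>

locale ore = cat C for C :: "('o, 'm, 'z) cat_scheme" +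
  fixes S :: "'o \<Rightarrow> 'o \<Rightarrow> 'm set"
  assumes S_id [simp]: "X \<in> Obj C \<Longrightarrow> Ident C X \<in> S X X"
    and S_comp: "\<And>X Y Z s t. \<lbrakk>X \<in> Obj C; Y \<in> Obj C; Z \<in> Obj C; s \<in> Hom C X Y; s \<in> S X Y;
      t \<in> Hom C Y Z; t \<in> S Y Z\<rbrakk> \<Longrightarrow> Comp C X Y Z t s \<in> S X Z"
    and ore: "\<And>X Y Z f t. \<lbrakk>X \<in> Obj C; Y \<in> Obj C; Z \<in> Obj C; f \<in> Hom C X Y; t \<in> Hom C Z Y; t \<in> S Z Y\<rbrakk> \<Longrightarrow>
      \<exists>V \<in> Obj C. \<exists>u \<in> Hom C V X \<inter> S V X. \<exists>v \<in> Hom C V Z. Comp C V X Y f u = Comp C V Z Y t v"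
    and cancel: "\<And>X Y Z f g t. \<lbrakk>X \<in> Obj C; Y \<in> Obj C; Z \<in> Obj C; f \<in> Hom C X Y; g \<in> Hom C X Y;
      t \<in> Hom C Y Z; t \<in> S Y Z; Comp C X Y Z t f = Comp C X Y Z t g\<rbrakk> \<Longrightarrow>
      \<exists>V \<in> Obj C. \<exists>u \<in> Hom C V X \<inter> S V X. Comp C V X Y f u = Comp C V X Y g u"
begin

text \<open>Since \<open>assoc\<close> brackets to the right, a commuting square cannot be
  substituted in front of a further arrow; this form can be applied by \<open>rule\<close>
  instead.\<close>

lemma whisker:
  assumes "Comp C X Y Z g f = Comp C X Y' Z g' f'"
    and "W \<in> Obj C" "X \<in> Obj C" "Y \<in> Obj C" "Y' \<in> Obj C" "Z \<in> Obj C"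
      "f \<in> Hom C X Y" "g \<in> Hom C Y Z" "f' \<in> Hom C X Y'" "g' \<in> Hom C Y' Z" "a \<in> Hom C W X"
  shows "Comp C W Y Z g (Comp C W X Y f a) = Comp C W Y' Z g' (Comp C W X Y' f' a)"
  using assms assoc[of W X Y Z a f g] assoc[of W X Y' Z a f' g'] by simp

text \<open>A witness in \<open>roof_rel\<close> puts only the composite \<open>s m\<close> in
  \<open>S\<close>, not \<open>m\<close>. The Ore condition is therefore applied after composing
  with \<open>s\<close>, and \<open>cancel\<close> removes \<open>s\<close> at the price of a
  further morphism of \<open>S\<close>.\<close>

lemma weak_ore:
  assumes obj: "V \<in> Obj C" "M \<in> Obj C" "Z \<in> Obj C" "X \<in> Obj C"
    and hom: "u \<in> Hom C V Z" "m \<in> Hom C M Z" "s \<in> Hom C Z X"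
    and s: "s \<in> S Z X" and sm: "Comp C M Z X s m \<in> S M X"
  obtains W a b where "W \<in> Obj C" "a \<in> Hom C W V" "a \<in> S W V" "b \<in> Hom C W M"
    "Comp C W V Z u a = Comp C W M Z m b"
proof -
  obtain W a b where 1: "W \<in> Obj C" "a \<in> Hom C W V" "a \<in> S W V" "b \<in> Hom C W M"
      "Comp C W V X (Comp C V Z X s u) a = Comp C W M X (Comp C M Z X s m) b"
    using ore[of V X M "Comp C V Z X s u" "Comp C M Z X s m"] obj hom sm by force
  then have "Comp C W Z X s (Comp C W V Z u a) = Comp C W Z X s (Comp C W M Z m b)"
    using obj hom by simp
  then obtain W' c where 2: "W' \<in> Obj C" "c \<in> Hom C W' W" "c \<in> S W' W"
      "Comp C W' W Z (Comp C W V Z u a) c = Comp C W' W Z (Comp C W M Z m b) c"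
    using cancel[of W Z X "Comp C W V Z u a" "Comp C W M Z m b" s] obj hom 1(1,2,4) s by force
  show ?thesis
  proof (rule that[of W' "Comp C W' W V a c" "Comp C W' W M b c"])
    show "Comp C W' V Z u (Comp C W' W V a c) = Comp C W' M Z m (Comp C W' W M b c)"
      using 2 obj hom 1(1,2,4) by simp
  qed (use 1(1-4) 2(1-3) obj hom in \<open>auto intro: S_comp\<close>)
qed

lemma roofs_iff:
  "(Z, s, f) \<in> roofs C S X Y \<longleftrightarrow> Z \<in> Obj C \<and> s \<in> Hom C Z X \<and> s \<in> S Z X \<and> f \<in> Hom C Z Y"
  by (simp add: roofs_def)

lemma roof_relI:
  assumes "(Z, s, f) \<in> roofs C S X Y" "(Z', s', f') \<in> roofs C S X Y"
    "V \<in> Obj C" "u \<in> Hom C V Z" "v \<in> Hom C V Z'" "Comp C V Z X s u \<in> S V X"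
    "Comp C V Z X s u = Comp C V Z' X s' v" "Comp C V Z Y f u = Comp C V Z' Y f' v"
  shows "((Z, s, f), (Z', s', f')) \<in> roof_rel C S X Y"
  using assms unfolding roof_rel_def by blast

lemma roof_relE:
  assumes "((Z, s, f), (Z', s', f')) \<in> roof_rel C S X Y"
  obtains V u v where "Z \<in> Obj C" "s \<in> Hom C Z X" "s \<in> S Z X" "f \<in> Hom C Z Y"
    "Z' \<in> Obj C" "s' \<in> Hom C Z' X" "s' \<in> S Z' X" "f' \<in> Hom C Z' Y"
    "V \<in> Obj C" "u \<in> Hom C V Z" "v \<in> Hom C V Z'" "Comp C V Z X s u \<in> S V X"
    "Comp C V Z X s u = Comp C V Z' X s' v" "Comp C V Z Y f u = Comp C V Z' Y f' v"
  using assms unfolding roof_rel_def roofs_def by blast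

lemma roof_rel_refl:
  assumes "X \<in> Obj C" "Y \<in> Obj C" "r \<in> roofs C S X Y"
  shows "(r, r) \<in> roof_rel C S X Y"
proof -
  obtain Z s f where r: "r = (Z, s, f)" by (cases r)
  show ?thesis unfolding r
    by (rule roof_relI[of _ _ _ _ _ _ _ _ Z "Ident C Z" "Ident C Z"])
      (use assms r in \<open>auto simp: roofs_iff\<close>)
qed

lemma roof_rel_sym: "(r, r') \<in> roof_rel C S X Y \<Longrightarrow> (r', r) \<in> roof_rel C S X Y"
  unfolding roof_rel_def by (clarsimp, metis)

lemma roof_rel_trans:
  assumes X: "X \<in> Obj C" "Y \<in> Obj C" and 12: "(r1, r2) \<in> roof_rel C S X Y" and 23: "(r2, r3) \<in> roof_rel C S X Y"
  shows "(r1, r3) \<in> roof_rel C S X Y"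
proof -
  obtain Z1 s1 f1 Z2 s2 f2 Z3 s3 f3 where r: "r1 = (Z1, s1, f1)" "r2 = (Z2, s2, f2)" "r3 = (Z3, s3, f3)"
    by (cases r1, cases r2, cases r3)
  obtain V u v where 1: "Z1 \<in> Obj C" "s1 \<in> Hom C Z1 X" "s1 \<in> S Z1 X" "f1 \<in> Hom C Z1 Y"
    "Z2 \<in> Obj C" "s2 \<in> Hom C Z2 X" "s2 \<in> S Z2 X" "f2 \<in> Hom C Z2 Y"
    "V \<in> Obj C" "u \<in> Hom C V Z1" "v \<in> Hom C V Z2" "Comp C V Z1 X s1 u \<in> S V X"
    "Comp C V Z1 X s1 u = Comp C V Z2 X s2 v" "Comp C V Z1 Y f1 u = Comp C V Z2 Y f2 v"
    by (rule roof_relE[OF 12[unfolded r]])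
  obtain V' u' v' where 2:
    "Z3 \<in> Obj C" "s3 \<in> Hom C Z3 X" "s3 \<in> S Z3 X" "f3 \<in> Hom C Z3 Y"
    "V' \<in> Obj C" "u' \<in> Hom C V' Z2" "v' \<in> Hom C V' Z3" "Comp C V' Z2 X s2 u' \<in> S V' X"
    "Comp C V' Z2 X s2 u' = Comp C V' Z3 X s3 v'" "Comp C V' Z2 Y f2 u' = Comp C V' Z3 Y f3 v'"
    by (rule roof_relE[OF 23[unfolded r]])
  \<comment> \<open>The two witnesses meet over \<open>Z2\<close>, where the composite of
    \<open>s2\<close> and \<open>u'\<close> is known to be in \<open>S\<close>; a common refinement
    of them is the new witness.\<close>
  obtain W a b where w: "W \<in> Obj C" "a \<in> Hom C W V" "a \<in> S W V" "b \<in> Hom C W V'"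
    "Comp C W V Z2 v a = Comp C W V' Z2 u' b"
    by (rule weak_ore[of V V' Z2 X v u' s2]) (use X 1 2 in auto)
  note obj = X 1(1,5,9) 2(1,5) w(1)
  note hom = 1(2,4,6,8,10,11) 2(2,4,6,7) w(2,4)
  have es: "Comp C W Z1 X s1 (Comp C W V Z1 u a) = Comp C W Z2 X s2 (Comp C W V Z2 v a)"
    and ef: "Comp C W Z1 Y f1 (Comp C W V Z1 u a) = Comp C W Z2 Y f2 (Comp C W V Z2 v a)"
    by (rule whisker[OF 1(13)], use obj hom in simp_all) (rule whisker[OF 1(14)], use obj hom in simp_all)
  have es': "Comp C W Z2 X s2 (Comp C W V' Z2 u' b) = Comp C W Z3 X s3 (Comp C W V' Z3 v' b)"
    and ef': "Comp C W Z2 Y f2 (Comp C W V' Z2 u' b) = Comp C W Z3 Y f3 (Comp C W V' Z3 v' b)"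
    by (rule whisker[OF 2(9)], use obj hom in simp_all) (rule whisker[OF 2(10)], use obj hom in simp_all)
  have "Comp C W V X (Comp C V Z1 X s1 u) a \<in> S W X"
    by (rule S_comp) (use obj hom w(3) 1(12) in simp_all)
  then have "Comp C W Z1 X s1 (Comp C W V Z1 u a) \<in> S W X" using obj hom by simp
  then show ?thesis unfolding r
    by (intro roof_relI[where V = W and u = "Comp C W V Z1 u a" and v = "Comp C W V' Z3 v' b"])
      (use obj hom 1(3) 2(3) es es' ef ef' w(5) in \<open>auto simp: roofs_iff\<close>)
qed

lemma equiv_roof_rel: "\<lbrakk>X \<in> Obj C; Y \<in> Obj C\<rbrakk> \<Longrightarrow> equiv (roofs C S X Y) (roof_rel C S X Y)"
proof (rule equivI)
  show "roof_rel C S X Y \<subseteq> roofs C S X Y \<times> roofs C S X Y" by (auto simp: roof_rel_def)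
qed (auto intro!: refl_onI symI transI intro: roof_rel_refl roof_rel_sym roof_rel_trans)

text \<open>Both factors and both Ore squares vary at once. The refinement has two stages: first an
  object over the witness \<open>M\<close>, which identifies the first factors, then one over the
  witness \<open>N\<close>, which identifies the second.\<close>

lemma roof_comp_wd:
  assumes X: "X \<in> Obj C" "Y \<in> Obj C" "W \<in> Obj C"
    and r: "((Z, s, f), (Z2, s2, f2)) \<in> roof_rel C S X Y"
    and r': "((N1, t, g), (N2, t2, g2)) \<in> roof_rel C S Y W"
    and V: "V \<in> Obj C" "u \<in> Hom C V Z" "u \<in> S V Z" "v \<in> Hom C V N1" "Comp C V Z Y f u = Comp C V N1 Y t v"
    and V2: "V2 \<in> Obj C" "u2 \<in> Hom C V2 Z2" "u2 \<in> S V2 Z2" "v2 \<in> Hom C V2 N2"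
      "Comp C V2 Z2 Y f2 u2 = Comp C V2 N2 Y t2 v2"
  shows "((V, Comp C V Z X s u, Comp C V N1 W g v), (V2, Comp C V2 Z2 X s2 u2, Comp C V2 N2 W g2 v2)) \<in> roof_rel C S X W"
proof -
  obtain M m m2 where 1: "Z \<in> Obj C" "s \<in> Hom C Z X" "s \<in> S Z X" "f \<in> Hom C Z Y"
    "Z2 \<in> Obj C" "s2 \<in> Hom C Z2 X" "s2 \<in> S Z2 X" "f2 \<in> Hom C Z2 Y"
    "M \<in> Obj C" "m \<in> Hom C M Z" "m2 \<in> Hom C M Z2" "Comp C M Z X s m \<in> S M X"
    "Comp C M Z X s m = Comp C M Z2 X s2 m2" "Comp C M Z Y f m = Comp C M Z2 Y f2 m2"
    by (rule roof_relE[OF r])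
  obtain N k k2 where 2: "N1 \<in> Obj C" "t \<in> Hom C N1 Y" "t \<in> S N1 Y" "g \<in> Hom C N1 W"
    "N2 \<in> Obj C" "t2 \<in> Hom C N2 Y" "t2 \<in> S N2 Y" "g2 \<in> Hom C N2 W"
    "N \<in> Obj C" "k \<in> Hom C N N1" "k2 \<in> Hom C N N2" "Comp C N N1 Y t k \<in> S N Y"
    "Comp C N N1 Y t k = Comp C N N2 Y t2 k2" "Comp C N N1 W g k = Comp C N N2 W g2 k2"
    by (rule roof_relE[OF r'])
  note base = X V(1) V2(1) 1(1,5,9) 2(1,5,9) V(2,4) V2(2,4) 1(2,4,6,8,10,11) 2(2,4,6,8,10,11)
  \<comment> \<open>\<open>A\<close> and \<open>A'\<close> bring \<open>V\<close> and
    \<open>V2\<close> over \<open>M\<close>, by morphisms \<open>a\<close> and \<open>a'\<close> of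
    \<open>S\<close>.\<close>
  obtain A a b where A: "A \<in> Obj C" "a \<in> Hom C A V" "a \<in> S A V" "b \<in> Hom C A M"
    "Comp C A V Z u a = Comp C A M Z m b"
    by (rule weak_ore[of V M Z X u m s]) (use base 1(3,12) in auto)
  obtain A' a' b' where A': "A' \<in> Obj C" "a' \<in> Hom C A' V2" "a' \<in> S A' V2" "b' \<in> Hom C A' M"
    "Comp C A' V2 Z2 u2 a' = Comp C A' M Z2 m2 b'"
    by (rule weak_ore[of V2 M Z2 X u2 m2 s2]) (use base 1(7,12,13) in auto)
  \<comment> \<open>\<open>b'\<close> itself need not be in \<open>S\<close>. Its composite to
    \<open>X\<close> is, by comparison with the path through \<open>V2\<close>, and that is what
    \<open>weak_ore\<close> asks for.\<close>
  have "Comp C A' M X (Comp C M Z X s m) b' = Comp C A' V2 X (Comp C V2 Z2 X s2 u2) a'"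
    unfolding 1(13) using base A' by simp
  moreover have "Comp C A' V2 X (Comp C V2 Z2 X s2 u2) a' \<in> S A' X"
    by (intro S_comp) (use base A' V2(3) 1(7) in simp_all)
  ultimately have sb: "Comp C A' M X (Comp C M Z X s m) b' \<in> S A' X" by simp
  \<comment> \<open>Over \<open>P\<close> the two maps to \<open>M\<close> agree; from here on
    \<open>\<alpha>\<close> and \<open>\<beta>\<close> exhibit a common refinement of
    \<open>V\<close> and \<open>V2\<close>.\<close>
  obtain P p q where P: "P \<in> Obj C" "p \<in> Hom C P A" "p \<in> S P A" "q \<in> Hom C P A'"
    "Comp C P A M b p = Comp C P A' M b' q"
    by (rule weak_ore[of A A' M X b b' "Comp C M Z X s m"]) (use base A A' 1(12) sb in auto)
  define \<alpha> \<beta> \<gamma> where defs: "\<alpha> = Comp C P A V a p" "\<beta> = Comp C P A' V2 a' q" "\<gamma> = Comp C P A M b p"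
  have hom: "\<alpha> \<in> Hom C P V" "\<beta> \<in> Hom C P V2" "\<gamma> \<in> Hom C P M"
    unfolding defs using base A A' P by simp_all
  have \<alpha>S: "\<alpha> \<in> S P V" unfolding defs by (rule S_comp) (use base A P in simp_all)
  have u\<alpha>: "Comp C P V Z u \<alpha> = Comp C P M Z m \<gamma>"
    unfolding defs by (rule whisker[OF A(5)]) (use base A P in simp_all)
  have u\<beta>: "Comp C P V2 Z2 u2 \<beta> = Comp C P M Z2 m2 \<gamma>"
    unfolding defs P(5) by (rule whisker[OF A'(5)]) (use base A' P in simp_all)
  have "Comp C P N1 Y t (Comp C P V N1 v \<alpha>) = Comp C P Z Y f (Comp C P V Z u \<alpha>)"
    by (rule whisker[OF V(5)[symmetric]]) (use base P(1) hom in simp_all)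
  also have "\<dots> = Comp C P Z2 Y f2 (Comp C P M Z2 m2 \<gamma>)"
    unfolding u\<alpha> by (rule whisker[OF 1(14)]) (use base P(1) hom in simp_all)
  also have "\<dots> = Comp C P N2 Y t2 (Comp C P V2 N2 v2 \<beta>)"
    unfolding u\<beta>[symmetric] by (rule whisker[OF V2(5)]) (use base P(1) hom in simp_all)
  finally have tv: "Comp C P N1 Y t (Comp C P V N1 v \<alpha>) = Comp C P N2 Y t2 (Comp C P V2 N2 v2 \<beta>)" .
  \<comment> \<open>\<open>Q\<close> brings the leg to \<open>N1\<close> over \<open>N\<close>. The
    leg to \<open>N2\<close> then agrees with the one through \<open>k2\<close> only after composing
    with \<open>t2\<close>, so a further refinement \<open>Q'\<close> has to cancel
    \<open>t2\<close>.\<close>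
  obtain Q \<delta> \<epsilon> where Q: "Q \<in> Obj C" "\<delta> \<in> Hom C Q P" "\<delta> \<in> S Q P" "\<epsilon> \<in> Hom C Q N"
    "Comp C Q P N1 (Comp C P V N1 v \<alpha>) \<delta> = Comp C Q N N1 k \<epsilon>"
    by (rule weak_ore[of P N N1 Y "Comp C P V N1 v \<alpha>" k t]) (use base P(1) hom 2(3,12) in auto)
  have "Comp C Q N2 Y t2 (Comp C Q P N2 (Comp C P V2 N2 v2 \<beta>) \<delta>) = Comp C Q N1 Y t (Comp C Q P N1 (Comp C P V N1 v \<alpha>) \<delta>)"
    by (rule whisker[OF tv[symmetric]]) (use base P(1) hom Q(1,2) in simp_all)
  also have "\<dots> = Comp C Q N2 Y t2 (Comp C Q N N2 k2 \<epsilon>)"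
    unfolding Q(5) by (rule whisker[OF 2(13)]) (use base Q in simp_all)
  finally obtain Q' \<zeta> where Q': "Q' \<in> Obj C" "\<zeta> \<in> Hom C Q' Q" "\<zeta> \<in> S Q' Q"
    "Comp C Q' Q N2 (Comp C Q P N2 (Comp C P V2 N2 v2 \<beta>) \<delta>) \<zeta> = Comp C Q' Q N2 (Comp C Q N N2 k2 \<epsilon>) \<zeta>"
    using cancel[of Q N2 Y "Comp C Q P N2 (Comp C P V2 N2 v2 \<beta>) \<delta>" "Comp C Q N N2 k2 \<epsilon>" t2]
      base P(1) hom Q(1,2,4) 2(7) by auto
  note base = base P(1) hom Q(1,2,4) Q'(1,2)
  define \<xi> where \<xi>: "\<xi> = Comp C Q' Q P \<delta> \<zeta>"
  have \<xi>h: "\<xi> \<in> Hom C Q' P" unfolding \<xi> using base by simp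
  have \<xi>S: "\<xi> \<in> S Q' P" unfolding \<xi> by (rule S_comp) (use base Q(3) Q'(3) in simp_all)
  note base = base \<xi>h
  have e1: "Comp C Q' P N1 (Comp C P V N1 v \<alpha>) \<xi> = Comp C Q' N N1 k (Comp C Q' Q N \<epsilon> \<zeta>)"
    unfolding \<xi> by (rule whisker[OF Q(5)]) (use base in simp_all)
  have e2: "Comp C Q' P N2 (Comp C P V2 N2 v2 \<beta>) \<xi> = Comp C Q' N N2 k2 (Comp C Q' Q N \<epsilon> \<zeta>)"
    using Q'(4) base unfolding \<xi> by simp
  have e3: "Comp C Q' N N1 k (Comp C Q' Q N \<epsilon> \<zeta>) = Comp C Q' V N1 v (Comp C Q' P V \<alpha> \<xi>)"
    unfolding e1[symmetric] using base by simp
  have e4: "Comp C Q' N N2 k2 (Comp C Q' Q N \<epsilon> \<zeta>) = Comp C Q' V2 N2 v2 (Comp C Q' P V2 \<beta> \<xi>)"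
    unfolding e2[symmetric] using base by simp
  have gv: "Comp C Q' V W (Comp C V N1 W g v) (Comp C Q' P V \<alpha> \<xi>) = Comp C Q' V2 W (Comp C V2 N2 W g2 v2) (Comp C Q' P V2 \<beta> \<xi>)"
  proof -
    have "Comp C Q' N1 W g (Comp C Q' N N1 k (Comp C Q' Q N \<epsilon> \<zeta>)) = Comp C Q' N2 W g2 (Comp C Q' N N2 k2 (Comp C Q' Q N \<epsilon> \<zeta>))"
      by (rule whisker[OF 2(14)]) (use base in simp_all)
    then show ?thesis unfolding e3 e4 using base by simp
  qed
  have sm: "Comp C P Z X s (Comp C P V Z u \<alpha>) = Comp C P Z2 X s2 (Comp C P V2 Z2 u2 \<beta>)"
    unfolding u\<alpha> u\<beta> by (rule whisker[OF 1(13)]) (use base in simp_all)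
  have su: "Comp C Q' V X (Comp C V Z X s u) (Comp C Q' P V \<alpha> \<xi>) = Comp C Q' V2 X (Comp C V2 Z2 X s2 u2) (Comp C Q' P V2 \<beta> \<xi>)"
    using whisker[OF sm, of Q' \<xi>] base by simp
  show ?thesis
  proof (rule roof_relI[OF _ _ _ _ _ _ su gv])
    show "Comp C Q' V X (Comp C V Z X s u) (Comp C Q' P V \<alpha> \<xi>) \<in> S Q' X"
      by (intro S_comp) (use base 1(3) V(3) \<alpha>S \<xi>S in simp_all)
  qed (use base V(3) V2(3) 1(3,7) in \<open>auto simp: roofs_iff intro: S_comp\<close>)
qed

abbreviation rcls where "rcls X Y r \<equiv> roof_rel C S X Y `` {r}"

lemma loc_Obj [simp]: "Obj (localization C S) = Obj C"
  by (simp add: localization_def)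

lemma loc_Ident: "Ident (localization C S) X = rcls X X (X, Ident C X, Ident C X)"
  by (simp add: localization_def)

lemma loc_Hom: "Hom (localization C S) X Y = (\<lambda>r. rcls X Y r) ` roofs C S X Y"
  by (auto simp: localization_def quotient_def)

lemma loc_HomE:
  assumes "a \<in> Hom (localization C S) X Y"
  obtains Z s f where "Z \<in> Obj C" "s \<in> Hom C Z X" "s \<in> S Z X" "f \<in> Hom C Z Y" "a = rcls X Y (Z, s, f)"
  using assms unfolding loc_Hom roofs_def by blast

lemma rcls_eqI: "\<lbrakk>X \<in> Obj C; Y \<in> Obj C; (r, r') \<in> roof_rel C S X Y\<rbrakk> \<Longrightarrow> rcls X Y r = rcls X Y r'"
  using equiv_roof_rel equiv_class_eq by metis

lemma rcls_eq_iff: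
  "\<lbrakk>X \<in> Obj C; Y \<in> Obj C; r' \<in> roofs C S X Y\<rbrakk> \<Longrightarrow> rcls X Y r = rcls X Y r' \<longleftrightarrow> (r, r') \<in> roof_rel C S X Y"
  using equiv_roof_rel eq_equiv_class equiv_class_eq by metis

text \<open>By \<open>roof_comp_wd\<close> the set comprehension in \<open>localization\<close>
  collects a single class, so any one completion computes it.\<close>

lemma loc_Comp:
  assumes X: "X \<in> Obj C" "Y \<in> Obj C" "W \<in> Obj C"
    and f: "(Z, s, f) \<in> roofs C S X Y" and g: "(N, t, g) \<in> roofs C S Y W"
    and V: "V \<in> Obj C" "u \<in> Hom C V Z" "u \<in> S V Z" "v \<in> Hom C V N" "Comp C V Z Y f u = Comp C V N Y t v"
  shows "Comp (localization C S) X Y W (rcls Y W (N, t, g)) (rcls X Y (Z, s, f)) =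
    rcls X W (V, Comp C V Z X s u, Comp C V N W g v)" (is "?L = ?R")
proof (intro Set.set_eqI iffI)
  fix r assume "r \<in> ?R"
  then have "\<exists>V' \<in> Obj C. \<exists>u' \<in> Hom C V' Z \<inter> S V' Z. \<exists>v' \<in> Hom C V' N.
      Comp C V' Z Y f u' = Comp C V' N Y t v' \<and>
      ((V', Comp C V' Z X s u', Comp C V' N W g v'), r) \<in> roof_rel C S X W"
    using V by auto
  moreover have "(Z, s, f) \<in> rcls X Y (Z, s, f)" "(N, t, g) \<in> rcls Y W (N, t, g)"
    using roof_rel_refl[OF X(1,2) f] roof_rel_refl[OF X(2,3) g] by simp_all
  ultimately have "\<exists>(Z, s, f) \<in> rcls X Y (Z, s, f). \<exists>(Z', t, g) \<in> rcls Y W (N, t, g).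
      \<exists>V' \<in> Obj C. \<exists>u' \<in> Hom C V' Z \<inter> S V' Z. \<exists>v' \<in> Hom C V' Z'.
      Comp C V' Z Y f u' = Comp C V' Z' Y t v' \<and>
      ((V', Comp C V' Z X s u', Comp C V' Z' W g v'), r) \<in> roof_rel C S X W"
    by (metis (mono_tags, lifting) case_prod_conv)
  then show "r \<in> ?L" unfolding localization_def by simp
next
  fix r assume "r \<in> ?L"
  then obtain Z' s' f' N' t' g' V' u' v' where
    1: "((Z, s, f), (Z', s', f')) \<in> roof_rel C S X Y" "((N, t, g), (N', t', g')) \<in> roof_rel C S Y W"
     "V' \<in> Obj C" "u' \<in> Hom C V' Z'" "u' \<in> S V' Z'" "v' \<in> Hom C V' N'" "Comp C V' Z' Y f' u' = Comp C V' N' Y t' v'"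
     "((V', Comp C V' Z' X s' u', Comp C V' N' W g' v'), r) \<in> roof_rel C S X W"
    unfolding localization_def by auto
  show "r \<in> ?R"
    using roof_rel_trans[OF X(1,3) roof_comp_wd[OF X 1(1,2) V 1(3-7)] 1(8)] by simp
qed

lemma rcls_Hom: "(Z, s, f) \<in> roofs C S X Y \<Longrightarrow> rcls X Y (Z, s, f) \<in> Hom (localization C S) X Y"
  unfolding loc_Hom by blast

lemma loc_comp_exists:
  assumes X: "X \<in> Obj C" "Y \<in> Obj C" "W \<in> Obj C"
    and f: "(Z, s, f) \<in> roofs C S X Y" and g: "(N, t, g) \<in> roofs C S Y W"
  obtains V u v where "V \<in> Obj C" "u \<in> Hom C V Z" "u \<in> S V Z" "v \<in> Hom C V N" "Comp C V Z Y f u = Comp C V N Y t v"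
    "(V, Comp C V Z X s u, Comp C V N W g v) \<in> roofs C S X W"
    "Comp (localization C S) X Y W (rcls Y W (N, t, g)) (rcls X Y (Z, s, f)) =
      rcls X W (V, Comp C V Z X s u, Comp C V N W g v)"
proof -
  obtain V u v where V: "V \<in> Obj C" "u \<in> Hom C V Z" "u \<in> S V Z" "v \<in> Hom C V N" "Comp C V Z Y f u = Comp C V N Y t v"
    using ore[of Z Y N f t] X f g unfolding roofs_iff by blast
  moreover have "(V, Comp C V Z X s u, Comp C V N W g v) \<in> roofs C S X W"
    using V X f g unfolding roofs_iff by (auto intro: S_comp)
  ultimately show ?thesis using that loc_Comp[OF X f g V] by blast
qed

theorem category_localization: "category (localization C S)"
  unfolding category_def loc_Obj
proof (intro conjI ballI)
  fix X assume "X \<in> Obj C"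
  then show "Ident (localization C S) X \<in> Hom (localization C S) X X"
    unfolding loc_Ident by (intro rcls_Hom) (simp add: roofs_iff)
next
  fix X Y Z a b assume X: "X \<in> Obj C" "Y \<in> Obj C" "Z \<in> Obj C"
    and "a \<in> Hom (localization C S) X Y" "b \<in> Hom (localization C S) Y Z"
  then show "Comp (localization C S) X Y Z b a \<in> Hom (localization C S) X Z"
    by (elim loc_HomE) (metis loc_comp_exists roofs_iff rcls_Hom)
next
  fix X Y a assume X: "X \<in> Obj C" "Y \<in> Obj C" and "a \<in> Hom (localization C S) X Y"
  then obtain Z s f where a: "Z \<in> Obj C" "s \<in> Hom C Z X" "s \<in> S Z X" "f \<in> Hom C Z Y" "a = rcls X Y (Z, s, f)"
    by (elim loc_HomE)
  show "Comp (localization C S) X X Y a (Ident (localization C S) X) = a"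
    unfolding a(5) loc_Ident
    by (subst loc_Comp[where V = Z and u = s and v = "Ident C Z"]) (use X a in \<open>simp_all add: roofs_iff\<close>)
  show "Comp (localization C S) X Y Y (Ident (localization C S) Y) a = a"
    unfolding a(5) loc_Ident
    by (subst loc_Comp[where V = Z and u = "Ident C Z" and v = f]) (use X a in \<open>simp_all add: roofs_iff\<close>)
next
  fix W X Y Z a b c assume X: "W \<in> Obj C" "X \<in> Obj C" "Y \<in> Obj C" "Z \<in> Obj C"
    and "a \<in> Hom (localization C S) W X" "b \<in> Hom (localization C S) X Y" "c \<in> Hom (localization C S) Y Z"
  then obtain A s f B t g D r h where
    a: "A \<in> Obj C" "s \<in> Hom C A W" "s \<in> S A W" "f \<in> Hom C A X" "a = rcls W X (A, s, f)" and
    b: "B \<in> Obj C" "t \<in> Hom C B X" "t \<in> S B X" "g \<in> Hom C B Y" "b = rcls X Y (B, t, g)" and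
    c: "D \<in> Obj C" "r \<in> Hom C D Y" "r \<in> S D Y" "h \<in> Hom C D Z" "c = rcls Y Z (D, r, h)"
    by (elim loc_HomE)
  have R: "(A, s, f) \<in> roofs C S W X" "(B, t, g) \<in> roofs C S X Y" "(D, r, h) \<in> roofs C S Y Z"
    using a b c by (simp_all add: roofs_iff)
  obtain N k l where N: "N \<in> Obj C" "k \<in> Hom C N B" "k \<in> S N B" "l \<in> Hom C N D" "Comp C N B Y g k = Comp C N D Y r l"
    "(N, Comp C N B X t k, Comp C N D Z h l) \<in> roofs C S X Z"
    "Comp (localization C S) X Y Z c b = rcls X Z (N, Comp C N B X t k, Comp C N D Z h l)"
    unfolding b(5) c(5) using loc_comp_exists[OF X(2-4) R(2,3)] by metis
  obtain J j p where J: "J \<in> Obj C" "j \<in> Hom C J A" "j \<in> S J A" "p \<in> Hom C J N"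
    "Comp C J A X f j = Comp C J N X (Comp C N B X t k) p"
    "Comp (localization C S) W X Z (Comp (localization C S) X Y Z c b) a =
      rcls W Z (J, Comp C J A W s j, Comp C J N Z (Comp C N D Z h l) p)"
    unfolding N(7) a(5) using loc_comp_exists[OF X(1,2,4) R(1) N(6)] by metis
  \<comment> \<open>The completion \<open>J\<close>, chosen for \<open>a\<close> followed by the
    composite of \<open>b\<close> and \<open>c\<close>, also completes \<open>a\<close> followed by
    \<open>b\<close>. The square still missing for \<open>c\<close> has the identity of
    \<open>J\<close> as one side, so both bracketings give a roof on \<open>J\<close>.\<close>
  have e: "Comp C J A X f j = Comp C J B X t (Comp C J N B k p)"
    using J N(1,2) b(1,2) X by simp
  have "Comp (localization C S) W X Y b a = rcls W Y (J, Comp C J A W s j, Comp C J B Y g (Comp C J N B k p))"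
    unfolding a(5) b(5) by (rule loc_Comp[OF X(1-3) R(1,2) J(1-3) _ e]) (use J N(1,2) b(1) in simp)
  moreover have g': "(J, Comp C J A W s j, Comp C J B Y g (Comp C J N B k p)) \<in> roofs C S W Y"
    unfolding roofs_iff using J(1-4) N(1,2) a b X by (auto intro: S_comp)
  have "Comp C J N Y (Comp C N B Y g k) p = Comp C J N Y (Comp C N D Y r l) p" by (simp only: N(5))
  then have e': "Comp C J J Y (Comp C J B Y g (Comp C J N B k p)) (Ident C J) = Comp C J D Y r (Comp C J N D l p)"
    using J(1-4) N(1,2,4) b(1-4) c(1-4) X by simp
  ultimately have "Comp (localization C S) W Y Z c (Comp (localization C S) W X Y b a) =
      rcls W Z (J, Comp C J J W (Comp C J A W s j) (Ident C J), Comp C J D Z h (Comp C J N D l p))"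
    unfolding c(5) using loc_Comp[OF X(1,3,4) g' R(3) J(1) _ _ _ e'] J N c X by simp
  also have "\<dots> = rcls W Z (J, Comp C J A W s j, Comp C J N Z (Comp C N D Z h l) p)"
    using J(1-4) N(1,4) a c X by simp
  finally show "Comp (localization C S) W Y Z c (Comp (localization C S) W X Y b a) =
      Comp (localization C S) W X Z (Comp (localization C S) X Y Z c b) a"
    unfolding J(6) .
qed

abbreviation lcls where "lcls X Y f \<equiv> rcls X Y (X, Ident C X, f)"

lemma lcls_roof: "\<lbrakk>X \<in> Obj C; f \<in> Hom C X Y\<rbrakk> \<Longrightarrow> (X, Ident C X, f) \<in> roofs C S X Y"
  by (simp add: roofs_iff)

lemma lcls_Hom: "\<lbrakk>X \<in> Obj C; f \<in> Hom C X Y\<rbrakk> \<Longrightarrow> lcls X Y f \<in> Hom (localization C S) X Y"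
  by (intro rcls_Hom lcls_roof)

lemma lcls_comp:
  assumes "X \<in> Obj C" "Y \<in> Obj C" "Z \<in> Obj C" "f \<in> Hom C X Y" "g \<in> Hom C Y Z"
  shows "Comp (localization C S) X Y Z (lcls Y Z g) (lcls X Y f) = lcls X Z (Comp C X Y Z g f)"
  by (subst loc_Comp[where V = X and u = "Ident C X" and v = f]) (use assms in \<open>simp_all add: roofs_iff\<close>)

text \<open>The inverse is the backward roof with denominator \<open>s\<close> and identity
  numerator. The roof \<open>(X, s, s)\<close> is equivalent to the identity of \<open>Y\<close>
  because \<open>s\<close> itself is a comparison map.\<close>

lemma lcls_iso:
  assumes X: "X \<in> Obj C" "Y \<in> Obj C" and s: "s \<in> Hom C X Y" "s \<in> S X Y"
  shows "is_iso (localization C S) X Y (lcls X Y s)"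
proof -
  let ?i = "rcls Y X (X, s, Ident C X)"
  have i: "(X, s, Ident C X) \<in> roofs C S Y X" using X s by (simp add: roofs_iff)
  have "Comp (localization C S) X Y X ?i (lcls X Y s) = Ident (localization C S) X"
    unfolding loc_Ident
    by (subst loc_Comp[where V = X and u = "Ident C X" and v = "Ident C X"]) (use X s in \<open>simp_all add: roofs_iff\<close>)
  moreover have "Comp (localization C S) Y X Y (lcls X Y s) ?i = rcls Y Y (X, s, s)"
    by (subst loc_Comp[where V = X and u = "Ident C X" and v = "Ident C X"]) (use X s in \<open>simp_all add: roofs_iff\<close>)
  moreover have "rcls Y Y (X, s, s) = Ident (localization C S) Y"
    unfolding loc_Ident
    by (intro rcls_eqI roof_relI[where V = X and u = "Ident C X" and v = s]) (use X s in \<open>simp_all add: roofs_iff\<close>)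
  ultimately show ?thesis
    unfolding is_iso_def using rcls_Hom[OF i] lcls_Hom[OF X(1) s(1)] by auto
qed

text \<open>Only classes of the form \<open>lcls X Y f\<close> reach \<open>loc_extend\<close> here,
  so it is enough that the union is constant on these: \<open>F\<close> preserves \<open>S\<close>
  and composition, hence carries a witness of equivalence to a witness.\<close>

lemma AMap_loc_extend:
  assumes F: "is_functor C C F"
    and FS: "\<And>X Y s. \<lbrakk>X \<in> Obj C; Y \<in> Obj C; s \<in> Hom C X Y; s \<in> S X Y\<rbrakk> \<Longrightarrow> AMap F X Y s \<in> S (OMap F X) (OMap F Y)"
    and X: "X \<in> Obj C" "Y \<in> Obj C" and f: "f \<in> Hom C X Y"
  shows "AMap (functor_comp (loc_extend C S F) (loc_functor C S)) X Y f =
    lcls (OMap F X) (OMap F Y) (AMap F X Y f)"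
proof -
  interpret F: fun_between C C F by unfold_locales (rule F)
  have 1: "rcls (OMap F X) (OMap F Y) (OMap F Z, AMap F Z X s, AMap F Z Y g) =
      rcls (OMap F X) (OMap F Y) (OMap F X, AMap F X X (Ident C X), AMap F X Y f)"
    if "((X, Ident C X, f), (Z, s, g)) \<in> roof_rel C S X Y" for Z s g
    using that
  proof (rule roof_relE)
    fix V u v
    assume 1: "X \<in> Obj C" "Ident C X \<in> Hom C X X" "Ident C X \<in> S X X" "f \<in> Hom C X Y"
      "Z \<in> Obj C" "s \<in> Hom C Z X" "s \<in> S Z X" "g \<in> Hom C Z Y"
      "V \<in> Obj C" "u \<in> Hom C V X" "v \<in> Hom C V Z" "Comp C V X X (Ident C X) u \<in> S V X"
      "Comp C V X X (Ident C X) u = Comp C V Z X s v" "Comp C V X Y f u = Comp C V Z Y g v"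
    have "AMap F V X (Comp C V Z X s v) \<in> S (OMap F V) (OMap F X)"
      by (rule FS) (use 1 X in simp_all)
    moreover have "AMap F V X (Comp C V X X (Ident C X) u) = AMap F V X (Comp C V Z X s v)"
      "AMap F V Y (Comp C V X Y f u) = AMap F V Y (Comp C V Z Y g v)" using 1 by simp_all
    ultimately show ?thesis
      by (intro rcls_eqI roof_relI[where V = "OMap F V" and u = "AMap F V Z v" and v = "AMap F V X u"])
        (use 1(1,2,4-11) X FS in \<open>simp_all add: roofs_iff F.map_comp del: id_left F.map_id\<close>)
  qed
  have "AMap (functor_comp (loc_extend C S F) (loc_functor C S)) X Y f =
      (\<Union>(Z, s, g) \<in> lcls X Y f. rcls (OMap F X) (OMap F Y) (OMap F Z, AMap F Z X s, AMap F Z Y g))"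
    by (simp add: functor_comp_def loc_extend_def loc_functor_def)
  also have "\<dots> = (\<Union>(Z, s, g) \<in> lcls X Y f. rcls (OMap F X) (OMap F Y) (OMap F X, AMap F X X (Ident C X), AMap F X Y f))"
    by (rule SUP_cong[OF refl]) (use 1 in auto)
  also have "\<dots> = rcls (OMap F X) (OMap F Y) (OMap F X, AMap F X X (Ident C X), AMap F X Y f)"
    using roof_rel_refl[OF X lcls_roof[OF X(1) f]] by auto
  finally show ?thesis using X by simp
qed

end

section \<open>Modules, generators and projectives\<close>

definition submod :: "('a, 'r) ring_scheme \<Rightarrow> ('a, 'u) module \<Rightarrow> 'u set \<Rightarrow> bool" where
  "submod R M N \<longleftrightarrow> N \<subseteq> carrier M \<and> \<zero>\<^bsub>M\<^esub> \<in> N \<and> (\<forall>x \<in> N. \<forall>y \<in> N. x \<oplus>\<^bsub>M\<^esub> y \<in> N) \<and>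
     (\<forall>a \<in> carrier R. \<forall>x \<in> N. a \<odot>\<^bsub>M\<^esub> x \<in> N)"

text \<open>Unlike a sum over a finite set of generators, the indexed form tolerates repetitions, so
  images of generators and concatenations of two families need no care.\<close>

primrec lincomb :: "('a, 'u) module \<Rightarrow> (nat \<Rightarrow> 'a) \<Rightarrow> (nat \<Rightarrow> 'u) \<Rightarrow> nat \<Rightarrow> 'u" where
  "lincomb M c b 0 = \<zero>\<^bsub>M\<^esub>"
| "lincomb M c b (Suc k) = lincomb M c b k \<oplus>\<^bsub>M\<^esub> c k \<odot>\<^bsub>M\<^esub> b k"

definition gens :: "('a, 'r) ring_scheme \<Rightarrow> ('a, 'u) module \<Rightarrow> 'u set \<Rightarrow> (nat \<Rightarrow> 'u) \<Rightarrow> nat \<Rightarrow> bool" where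
  "gens R M N b k \<longleftrightarrow> (\<forall>j<k. b j \<in> N) \<and>
     (\<forall>x \<in> N. \<exists>c. (\<forall>j<k. c j \<in> carrier R) \<and> x = lincomb M c b k)"

lemma lincomb_cong:
  "(\<And>j. j < k \<Longrightarrow> c j = c' j) \<Longrightarrow> (\<And>j. j < k \<Longrightarrow> b j = b' j) \<Longrightarrow> lincomb M c b k = lincomb M c' b' k"
  by (induction k) auto

text \<open>A submodule of the product of \<open>A\<close> and \<open>B\<close>, kept as a relation
  so that the product needs no carrier; \<open>rel3\<close> is the same for three factors.\<close>

definition rel2 where
  "rel2 R A B E \<longleftrightarrow> (\<forall>x y. E x y \<longrightarrow> x \<in> carrier A \<and> y \<in> carrier B) \<and> E \<zero>\<^bsub>A\<^esub> \<zero>\<^bsub>B\<^esub> \<and>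
     (\<forall>x y x' y'. E x y \<longrightarrow> E x' y' \<longrightarrow> E (x \<oplus>\<^bsub>A\<^esub> x') (y \<oplus>\<^bsub>B\<^esub> y')) \<and>
     (\<forall>a \<in> carrier R. \<forall>x y. E x y \<longrightarrow> E (a \<odot>\<^bsub>A\<^esub> x) (a \<odot>\<^bsub>B\<^esub> y))"

definition rel3 where
  "rel3 R A B C E \<longleftrightarrow> (\<forall>x y z. E x y z \<longrightarrow> x \<in> carrier A \<and> y \<in> carrier B \<and> z \<in> carrier C) \<and>
     E \<zero>\<^bsub>A\<^esub> \<zero>\<^bsub>B\<^esub> \<zero>\<^bsub>C\<^esub> \<and>
     (\<forall>x y z x' y' z'. E x y z \<longrightarrow> E x' y' z' \<longrightarrow> E (x \<oplus>\<^bsub>A\<^esub> x') (y \<oplus>\<^bsub>B\<^esub> y') (z \<oplus>\<^bsub>C\<^esub> z')) \<and>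
     (\<forall>a \<in> carrier R. \<forall>x y z. E x y z \<longrightarrow> E (a \<odot>\<^bsub>A\<^esub> x) (a \<odot>\<^bsub>B\<^esub> y) (a \<odot>\<^bsub>C\<^esub> z))"

lemma rel2D:
  assumes "rel2 R A B E"
  shows "E x y \<Longrightarrow> x \<in> carrier A" "E x y \<Longrightarrow> y \<in> carrier B" "E \<zero>\<^bsub>A\<^esub> \<zero>\<^bsub>B\<^esub>"
    "E x y \<Longrightarrow> E x' y' \<Longrightarrow> E (x \<oplus>\<^bsub>A\<^esub> x') (y \<oplus>\<^bsub>B\<^esub> y')"
    "a \<in> carrier R \<Longrightarrow> E x y \<Longrightarrow> E (a \<odot>\<^bsub>A\<^esub> x) (a \<odot>\<^bsub>B\<^esub> y)"
  using assms unfolding rel2_def by simp_all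

lemma rel3D:
  assumes "rel3 R A B C E"
  shows "E x y z \<Longrightarrow> x \<in> carrier A" "E x y z \<Longrightarrow> y \<in> carrier B" "E x y z \<Longrightarrow> z \<in> carrier C"
    "E \<zero>\<^bsub>A\<^esub> \<zero>\<^bsub>B\<^esub> \<zero>\<^bsub>C\<^esub>"
    "E x y z \<Longrightarrow> E x' y' z' \<Longrightarrow> E (x \<oplus>\<^bsub>A\<^esub> x') (y \<oplus>\<^bsub>B\<^esub> y') (z \<oplus>\<^bsub>C\<^esub> z')"
    "a \<in> carrier R \<Longrightarrow> E x y z \<Longrightarrow> E (a \<odot>\<^bsub>A\<^esub> x) (a \<odot>\<^bsub>B\<^esub> y) (a \<odot>\<^bsub>C\<^esub> z)"
  using assms unfolding rel3_def by simp_all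

context left_module
begin

lemma zero_smult [simp]: "x \<in> carrier M \<Longrightarrow> \<zero> \<odot>\<^bsub>M\<^esub> x = \<zero>\<^bsub>M\<^esub>"
  using smult_l_distr[of \<zero> \<zero> x] smult_closed[of \<zero> x] M.add.l_cancel_one'[of "\<zero> \<odot>\<^bsub>M\<^esub> x" "\<zero> \<odot>\<^bsub>M\<^esub> x"] by simp

lemma smult_zero [simp]: "a \<in> carrier R \<Longrightarrow> a \<odot>\<^bsub>M\<^esub> \<zero>\<^bsub>M\<^esub> = \<zero>\<^bsub>M\<^esub>"
  using smult_r_distr[of a "\<zero>\<^bsub>M\<^esub>" "\<zero>\<^bsub>M\<^esub>"] smult_closed[of a "\<zero>\<^bsub>M\<^esub>"] M.add.l_cancel_one'[of "a \<odot>\<^bsub>M\<^esub> \<zero>\<^bsub>M\<^esub>" "a \<odot>\<^bsub>M\<^esub> \<zero>\<^bsub>M\<^esub>"] by simp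

lemma neg_eqI: "\<lbrakk>x \<in> carrier M; y \<in> carrier M; x \<oplus>\<^bsub>M\<^esub> y = \<zero>\<^bsub>M\<^esub>\<rbrakk> \<Longrightarrow> y = \<ominus>\<^bsub>M\<^esub> x"
  using M.minus_equality[of y x] M.a_comm by simp

lemma neg_smult_one: "x \<in> carrier M \<Longrightarrow> (\<ominus> \<one>) \<odot>\<^bsub>M\<^esub> x = \<ominus>\<^bsub>M\<^esub> x"
  using smult_l_distr[of \<one> "\<ominus> \<one>" x] smult_one[of x] smult_closed[of "\<ominus> \<one>" x]
  by (intro neg_eqI) (auto simp: R.r_neg)

lemma smult_neg: "\<lbrakk>a \<in> carrier R; x \<in> carrier M\<rbrakk> \<Longrightarrow> a \<odot>\<^bsub>M\<^esub> (\<ominus>\<^bsub>M\<^esub> x) = \<ominus>\<^bsub>M\<^esub> (a \<odot>\<^bsub>M\<^esub> x)"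
  using smult_r_distr[of a x "\<ominus>\<^bsub>M\<^esub> x"]
  by (intro neg_eqI) (auto simp: M.r_neg smult_closed)

end

section \<open>Left modules over a fixed ring: arithmetic, generation, homomorphisms\<close>

locale ring_ctx = ring R for R :: "('a, 'r) ring_scheme" (structure)
begin

context
  fixes M :: "('a, 'u) module"
  assumes M: "left_module R M"
begin

interpretation M: left_module R M by (rule M)

text \<open>Every term of every complex is a module of its own. The facts of the locale are restated
  with \<open>left_module R M\<close> as a premise, which the simplifier can discharge for each of
  them.\<close>

lemma lm_add [simp]: "\<lbrakk>x \<in> carrier M; y \<in> carrier M\<rbrakk> \<Longrightarrow> x \<oplus>\<^bsub>M\<^esub> y \<in> carrier M" by simp
lemma lm_zero [simp]: "\<zero>\<^bsub>M\<^esub> \<in> carrier M" by simp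
lemma lm_neg [simp]: "x \<in> carrier M \<Longrightarrow> \<ominus>\<^bsub>M\<^esub> x \<in> carrier M" by simp
lemma lm_smult [simp]: "\<lbrakk>a \<in> carrier R; x \<in> carrier M\<rbrakk> \<Longrightarrow> a \<odot>\<^bsub>M\<^esub> x \<in> carrier M" by (rule M.smult_closed)
lemma lm_l_zero [simp]: "x \<in> carrier M \<Longrightarrow> \<zero>\<^bsub>M\<^esub> \<oplus>\<^bsub>M\<^esub> x = x" by simp
lemma lm_r_zero [simp]: "x \<in> carrier M \<Longrightarrow> x \<oplus>\<^bsub>M\<^esub> \<zero>\<^bsub>M\<^esub> = x" by simp
lemma lm_assoc: "\<lbrakk>x \<in> carrier M; y \<in> carrier M; z \<in> carrier M\<rbrakk> \<Longrightarrow> (x \<oplus>\<^bsub>M\<^esub> y) \<oplus>\<^bsub>M\<^esub> z = x \<oplus>\<^bsub>M\<^esub> (y \<oplus>\<^bsub>M\<^esub> z)"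
  by (rule M.a_assoc)
lemma lm_comm: "\<lbrakk>x \<in> carrier M; y \<in> carrier M\<rbrakk> \<Longrightarrow> x \<oplus>\<^bsub>M\<^esub> y = y \<oplus>\<^bsub>M\<^esub> x" by (rule M.a_comm)
lemma lm_lcomm: "\<lbrakk>x \<in> carrier M; y \<in> carrier M; z \<in> carrier M\<rbrakk> \<Longrightarrow> x \<oplus>\<^bsub>M\<^esub> (y \<oplus>\<^bsub>M\<^esub> z) = y \<oplus>\<^bsub>M\<^esub> (x \<oplus>\<^bsub>M\<^esub> z)"
  by (rule M.a_lcomm)
lemma lm_l_neg [simp]: "x \<in> carrier M \<Longrightarrow> \<ominus>\<^bsub>M\<^esub> x \<oplus>\<^bsub>M\<^esub> x = \<zero>\<^bsub>M\<^esub>" by (rule M.l_neg)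
lemma lm_r_neg [simp]: "x \<in> carrier M \<Longrightarrow> x \<oplus>\<^bsub>M\<^esub> \<ominus>\<^bsub>M\<^esub> x = \<zero>\<^bsub>M\<^esub>" by (rule M.r_neg)
lemma lm_l_neg2 [simp]: "\<lbrakk>x \<in> carrier M; y \<in> carrier M\<rbrakk> \<Longrightarrow> \<ominus>\<^bsub>M\<^esub> x \<oplus>\<^bsub>M\<^esub> (x \<oplus>\<^bsub>M\<^esub> y) = y" by (rule M.r_neg1)
lemma lm_neg_add: "\<lbrakk>x \<in> carrier M; y \<in> carrier M\<rbrakk> \<Longrightarrow> \<ominus>\<^bsub>M\<^esub> (x \<oplus>\<^bsub>M\<^esub> y) = \<ominus>\<^bsub>M\<^esub> x \<oplus>\<^bsub>M\<^esub> \<ominus>\<^bsub>M\<^esub> y" by (rule M.minus_add)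
lemma lm_smult_zero [simp]: "a \<in> carrier R \<Longrightarrow> a \<odot>\<^bsub>M\<^esub> \<zero>\<^bsub>M\<^esub> = \<zero>\<^bsub>M\<^esub>" by simp
lemma lm_zero_smult [simp]: "x \<in> carrier M \<Longrightarrow> \<zero> \<odot>\<^bsub>M\<^esub> x = \<zero>\<^bsub>M\<^esub>" by simp
lemma lm_smult_one [simp]: "x \<in> carrier M \<Longrightarrow> \<one> \<odot>\<^bsub>M\<^esub> x = x" by (rule M.smult_one)
lemma lm_smult_add: "\<lbrakk>a \<in> carrier R; x \<in> carrier M; y \<in> carrier M\<rbrakk> \<Longrightarrow> a \<odot>\<^bsub>M\<^esub> (x \<oplus>\<^bsub>M\<^esub> y) = a \<odot>\<^bsub>M\<^esub> x \<oplus>\<^bsub>M\<^esub> a \<odot>\<^bsub>M\<^esub> y"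
  by (rule M.smult_r_distr)
lemma lm_add_smult: "\<lbrakk>a \<in> carrier R; b \<in> carrier R; x \<in> carrier M\<rbrakk> \<Longrightarrow> (a \<oplus> b) \<odot>\<^bsub>M\<^esub> x = a \<odot>\<^bsub>M\<^esub> x \<oplus>\<^bsub>M\<^esub> b \<odot>\<^bsub>M\<^esub> x"
  by (rule M.smult_l_distr)
lemma lm_mult_smult: "\<lbrakk>a \<in> carrier R; b \<in> carrier R; x \<in> carrier M\<rbrakk> \<Longrightarrow> (a \<otimes> b) \<odot>\<^bsub>M\<^esub> x = a \<odot>\<^bsub>M\<^esub> (b \<odot>\<^bsub>M\<^esub> x)"
  by (rule M.smult_assoc)
lemma lm_smult_neg: "\<lbrakk>a \<in> carrier R; x \<in> carrier M\<rbrakk> \<Longrightarrow> a \<odot>\<^bsub>M\<^esub> (\<ominus>\<^bsub>M\<^esub> x) = \<ominus>\<^bsub>M\<^esub> (a \<odot>\<^bsub>M\<^esub> x)"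
  by (rule M.smult_neg)
lemma lm_neg_one_smult: "x \<in> carrier M \<Longrightarrow> (\<ominus> \<one>) \<odot>\<^bsub>M\<^esub> x = \<ominus>\<^bsub>M\<^esub> x" by (rule M.neg_smult_one)

lemma submod_closed:
  assumes "submod R M N"
  shows "x \<in> N \<Longrightarrow> x \<in> carrier M" "\<zero>\<^bsub>M\<^esub> \<in> N" "\<lbrakk>x \<in> N; y \<in> N\<rbrakk> \<Longrightarrow> x \<oplus>\<^bsub>M\<^esub> y \<in> N"
    "\<lbrakk>a \<in> carrier R; x \<in> N\<rbrakk> \<Longrightarrow> a \<odot>\<^bsub>M\<^esub> x \<in> N" "x \<in> N \<Longrightarrow> \<ominus>\<^bsub>M\<^esub> x \<in> N"
proof -
  show c: "x \<in> N \<Longrightarrow> x \<in> carrier M" "\<zero>\<^bsub>M\<^esub> \<in> N" "\<lbrakk>x \<in> N; y \<in> N\<rbrakk> \<Longrightarrow> x \<oplus>\<^bsub>M\<^esub> y \<in> N"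
    "\<And>a. \<lbrakk>a \<in> carrier R; x \<in> N\<rbrakk> \<Longrightarrow> a \<odot>\<^bsub>M\<^esub> x \<in> N" using assms by (auto simp: submod_def)
  show "x \<in> N \<Longrightarrow> \<ominus>\<^bsub>M\<^esub> x \<in> N" using c(1) c(4)[of "\<ominus> \<one>"] by (simp add: lm_neg_one_smult)
qed

lemma lincomb_closed [simp]:
  "\<lbrakk>\<And>j. j < k \<Longrightarrow> c j \<in> carrier R; \<And>j. j < k \<Longrightarrow> b j \<in> carrier M\<rbrakk> \<Longrightarrow> lincomb M c b k \<in> carrier M"
  by (induction k) auto

lemma submod_lincomb:
  "\<lbrakk>submod R M N; \<And>j. j < k \<Longrightarrow> c j \<in> carrier R; \<And>j. j < k \<Longrightarrow> b j \<in> N\<rbrakk> \<Longrightarrow> lincomb M c b k \<in> N"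
  by (induction k) (auto intro: submod_closed)

lemma lincomb_add:
  assumes "\<And>j. j < k \<Longrightarrow> c j \<in> carrier R" "\<And>j. j < k \<Longrightarrow> c' j \<in> carrier R" "\<And>j. j < k \<Longrightarrow> b j \<in> carrier M"
  shows "lincomb M (\<lambda>j. c j \<oplus> c' j) b k = lincomb M c b k \<oplus>\<^bsub>M\<^esub> lincomb M c' b k"
  using assms by (induction k) (auto simp: lm_add_smult lm_assoc lm_lcomm)

lemma lincomb_smult:
  assumes "a \<in> carrier R" "\<And>j. j < k \<Longrightarrow> c j \<in> carrier R" "\<And>j. j < k \<Longrightarrow> b j \<in> carrier M"
  shows "lincomb M (\<lambda>j. a \<otimes> c j) b k = a \<odot>\<^bsub>M\<^esub> lincomb M c b k"
  using assms by (induction k) (auto simp: lm_smult_add lm_mult_smult)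

lemma lincomb_append:
  assumes "\<And>j. j < k + l \<Longrightarrow> c j \<in> carrier R" "\<And>j. j < k + l \<Longrightarrow> b j \<in> carrier M"
  shows "lincomb M c b (k + l) = lincomb M c b k \<oplus>\<^bsub>M\<^esub> lincomb M (\<lambda>j. c (k + j)) (\<lambda>j. b (k + j)) l"
  using assms by (induction l) (auto simp: lm_assoc)

lemma lincomb_zero:
  assumes "\<And>j. j < k \<Longrightarrow> c j \<in> carrier R" "\<And>j. j < k \<Longrightarrow> b j = \<zero>\<^bsub>M\<^esub>"
  shows "lincomb M c b k = \<zero>\<^bsub>M\<^esub>"
  using assms by (induction k) auto

lemma submod_span: "\<forall>j<k. b j \<in> carrier M \<Longrightarrow> submod R M {lincomb M c b k |c. \<forall>j<k. c j \<in> carrier R}"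
  unfolding submod_def
proof (intro conjI ballI subsetI)
  assume b: "\<forall>j<k. b j \<in> carrier M"
  let ?S = "{lincomb M c b k |c. \<forall>j<k. c j \<in> carrier R}"
  have bj: "j < k \<Longrightarrow> b j \<in> carrier M" for j using b by blast
  have "\<zero>\<^bsub>M\<^esub> = lincomb M (\<lambda>_. \<zero>) b k" using b by (induction k) auto
  then show "\<zero>\<^bsub>M\<^esub> \<in> ?S" by blast
  fix x assume x: "x \<in> ?S"
  then obtain c where c: "x = lincomb M c b k" "\<And>j. j < k \<Longrightarrow> c j \<in> carrier R" by blast
  show "x \<in> carrier M" unfolding c(1) by (rule lincomb_closed[OF c(2) bj])
  show "x \<oplus>\<^bsub>M\<^esub> y \<in> ?S" if y: "y \<in> ?S" for y
  proof -
    from y obtain c' where c': "y = lincomb M c' b k" "\<And>j. j < k \<Longrightarrow> c' j \<in> carrier R" by blast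
    have "x \<oplus>\<^bsub>M\<^esub> y = lincomb M (\<lambda>j. c j \<oplus> c' j) b k"
      unfolding c(1) c'(1) by (rule lincomb_add[symmetric]) (simp_all add: c(2) c'(2) bj)
    then show ?thesis using c(2) c'(2) a_closed by blast
  qed
  show "a \<odot>\<^bsub>M\<^esub> x \<in> ?S" if a: "a \<in> carrier R" for a
  proof -
    have "a \<odot>\<^bsub>M\<^esub> x = lincomb M (\<lambda>j. a \<otimes> c j) b k"
      unfolding c(1) by (rule lincomb_smult[symmetric]) (simp_all add: c(2) bj a)
    then show ?thesis using c(2) a m_closed by blast
  qed
qed

lemma lincomb_indicator:
  assumes "\<forall>j<k. b j \<in> carrier M" "i < k"
  shows "lincomb M (\<lambda>j. if j = i then \<one> else \<zero>) b k = b i"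
proof -
  have "lincomb M (\<lambda>j. if j = i then \<one> else \<zero>) b k = (if i < k then b i else \<zero>\<^bsub>M\<^esub>)"
    using assms(1) by (induction k) (auto simp: less_Suc_eq)
  then show ?thesis using assms by simp
qed

lemma finsum_image_lincomb:
  assumes "inj_on b {..<k}" "\<forall>j<k. b j \<in> carrier M" "\<forall>j<k. c (b j) \<in> carrier R"
  shows "(\<Oplus>\<^bsub>M\<^esub>g \<in> b ` {..<k}. c g \<odot>\<^bsub>M\<^esub> g) = lincomb M (c \<circ> b) b k"
  using assms
proof (induction k)
  case (Suc k)
  then have "b k \<notin> b ` {..<k}" by (auto dest!: inj_onD[of b "{..<Suc k}" k])
  moreover have "(\<lambda>g. c g \<odot>\<^bsub>M\<^esub> g) \<in> b ` {..<k} \<rightarrow> carrier M" using Suc.prems by auto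
  ultimately show ?case
    using Suc by (auto simp: lessThan_Suc inj_on_insert M.finsum_insert lm_comm)
qed simp

lemma submod_finsum_span:
  assumes "finite G" "G \<subseteq> carrier M"
  shows "submod R M {\<Oplus>\<^bsub>M\<^esub>g \<in> G. c g \<odot>\<^bsub>M\<^esub> g |c. c \<in> G \<rightarrow> carrier R}" "G \<subseteq> {\<Oplus>\<^bsub>M\<^esub>g \<in> G. c g \<odot>\<^bsub>M\<^esub> g |c. c \<in> G \<rightarrow> carrier R}"
proof -
  obtain b where b: "bij_betw b {..<card G} G"
    using ex_bij_betw_nat_finite[OF assms(1)] by (auto simp: atLeast0LessThan)
  define k where "k = card G"
  have bG: "b ` {..<k} = G" "inj_on b {..<k}" using b by (auto simp: bij_betw_def k_def)
  have bM: "\<forall>j<k. b j \<in> carrier M" using bG assms by auto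
  have "{\<Oplus>\<^bsub>M\<^esub>g \<in> G. c g \<odot>\<^bsub>M\<^esub> g |c. c \<in> G \<rightarrow> carrier R} = {lincomb M c b k |c. \<forall>j<k. c j \<in> carrier R}"
  proof (intro equalityI subsetI; clarify)
    fix c assume "c \<in> G \<rightarrow> carrier R"
    then have "\<forall>j<k. c (b j) \<in> carrier R" using bG by auto
    then show "\<exists>c'. (\<Oplus>\<^bsub>M\<^esub>g \<in> G. c g \<odot>\<^bsub>M\<^esub> g) = lincomb M c' b k \<and> (\<forall>j<k. c' j \<in> carrier R)"
      using finsum_image_lincomb[OF bG(2) bM] bG(1) by (intro exI[of _ "c \<circ> b"]) auto
  next
    fix c assume c: "\<forall>j<k. c j \<in> carrier R"
    define c' where "c' g = c (inv_into {..<k} b g)" for g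
    have c'b: "c' (b j) = c j" if "j < k" for j unfolding c'_def using bG(2) that by simp
    then have "c' \<in> G \<rightarrow> carrier R" using c bG(1) by auto
    moreover have "(\<Oplus>\<^bsub>M\<^esub>g \<in> G. c' g \<odot>\<^bsub>M\<^esub> g) = lincomb M (c' \<circ> b) b k"
      using finsum_image_lincomb[OF bG(2) bM, of c'] c c'b bG(1) by simp
    moreover have "\<dots> = lincomb M c b k" by (rule lincomb_cong) (simp_all add: c'b)
    ultimately show "\<exists>c'. lincomb M c b k = (\<Oplus>\<^bsub>M\<^esub>g \<in> G. c' g \<odot>\<^bsub>M\<^esub> g) \<and> c' \<in> G \<rightarrow> carrier R" by metis
  qed
  moreover have "g \<in> {lincomb M c b k |c. \<forall>j<k. c j \<in> carrier R}" if g: "g \<in> G" for g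
  proof -
    obtain i where "i < k" "g = b i" using g unfolding bG(1)[symmetric] by auto
    then have "g = lincomb M (\<lambda>j. if j = i then \<one> else \<zero>) b k"
      using lincomb_indicator[OF bM, of i] by simp
    then show ?thesis by auto
  qed
  ultimately show "submod R M {\<Oplus>\<^bsub>M\<^esub>g \<in> G. c g \<odot>\<^bsub>M\<^esub> g |c. c \<in> G \<rightarrow> carrier R}" "G \<subseteq> {\<Oplus>\<^bsub>M\<^esub>g \<in> G. c g \<odot>\<^bsub>M\<^esub> g |c. c \<in> G \<rightarrow> carrier R}"
    using submod_span[OF bM] by auto
qed

lemma fg_module_iff: "fg_module R M \<longleftrightarrow> (\<exists>b k. gens R M (carrier M) b k)"
proof
  assume "fg_module R M"
  then obtain G where G: "finite G" "G \<subseteq> carrier M"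
    "\<And>x. x \<in> carrier M \<Longrightarrow> \<exists>c \<in> G \<rightarrow> carrier R. x = (\<Oplus>\<^bsub>M\<^esub>g \<in> G. c g \<odot>\<^bsub>M\<^esub> g)" unfolding fg_module_def by auto
  obtain b where b: "bij_betw b {..<card G} G"
    using ex_bij_betw_nat_finite[OF G(1)] by (auto simp: atLeast0LessThan)
  define k where "k = card G"
  have bG: "b ` {..<k} = G" "inj_on b {..<k}" using b by (auto simp: bij_betw_def k_def)
  have bM: "\<forall>j<k. b j \<in> carrier M" using bG G by auto
  have "\<exists>c. (\<forall>j<k. c j \<in> carrier R) \<and> x = lincomb M c b k" if x: "x \<in> carrier M" for x
  proof -
    obtain c where c: "c \<in> G \<rightarrow> carrier R" "x = (\<Oplus>\<^bsub>M\<^esub>g \<in> G. c g \<odot>\<^bsub>M\<^esub> g)" using G(3)[OF x] by auto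
    then have "\<forall>j<k. c (b j) \<in> carrier R" using bG(1) by auto
    then show ?thesis using c(2) finsum_image_lincomb[OF bG(2) bM] bG(1) by (intro exI[of _ "c \<circ> b"]) auto
  qed
  then show "\<exists>b k. gens R M (carrier M) b k" unfolding gens_def using bM by blast
next
  assume "\<exists>b k. gens R M (carrier M) b k"
  then obtain b k where b: "\<forall>j<k. b j \<in> carrier M"
    "\<And>x. x \<in> carrier M \<Longrightarrow> \<exists>c. (\<forall>j<k. c j \<in> carrier R) \<and> x = lincomb M c b k" unfolding gens_def by auto
  \<comment> \<open>\<open>b\<close> may repeat values, so a combination indexed by \<open>j\<close>
    is not termwise a sum over the image. It lies in the span because the span is a
    submodule.\<close>
  let ?G = "b ` {..<k}"
  have G: "finite ?G" "?G \<subseteq> carrier M" using b by auto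
  have "x \<in> {\<Oplus>\<^bsub>M\<^esub>g \<in> ?G. c g \<odot>\<^bsub>M\<^esub> g |c. c \<in> ?G \<rightarrow> carrier R}" if x: "x \<in> carrier M" for x
  proof -
    obtain c where c: "\<forall>j<k. c j \<in> carrier R" "x = lincomb M c b k" using b(2)[OF x] by auto
    show ?thesis unfolding c(2)
      by (rule submod_lincomb[OF submod_finsum_span(1)[OF G]]) (use c(1) submod_finsum_span(2)[OF G] in auto)
  qed
  then show "fg_module R M" unfolding fg_module_def using M G by blast
qed

end

lemma fg_lm [simp]: "fg_module R M \<Longrightarrow> left_module R M"
  by (simp add: fg_module_def)

lemma proj_fg [simp]: "fg_projective R M \<Longrightarrow> fg_module R M"
  by (simp add: fg_projective_def)

lemma rel2_lincomb:
  assumes "rel2 R A B E" "\<And>j. j < k \<Longrightarrow> c j \<in> carrier R" "\<And>j. j < k \<Longrightarrow> E (a j) (b j)"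
  shows "E (lincomb A c a k) (lincomb B c b k)"
  using assms(2,3) by (induction k) (use assms(1) in \<open>auto simp: rel2_def\<close>)

lemma rel3_lincomb:
  assumes "rel3 R A B C E" "\<And>j. j < k \<Longrightarrow> r j \<in> carrier R" "\<And>j. j < k \<Longrightarrow> E (a j) (b j) (c j)"
  shows "E (lincomb A r a k) (lincomb B r b k) (lincomb C r c k)"
  using assms(2,3) by (induction k) (use assms(1) in \<open>auto simp: rel3_def\<close>)

lemma hom_closed: "\<lbrakk>f \<in> mod_hom R M N; x \<in> carrier M\<rbrakk> \<Longrightarrow> f x \<in> carrier N"
  by (auto simp: mod_hom_def)

lemma hom_add: "\<lbrakk>f \<in> mod_hom R M N; x \<in> carrier M; y \<in> carrier M\<rbrakk> \<Longrightarrow> f (x \<oplus>\<^bsub>M\<^esub> y) = f x \<oplus>\<^bsub>N\<^esub> f y"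
  by (auto simp: mod_hom_def)

lemma hom_smult: "\<lbrakk>f \<in> mod_hom R M N; a \<in> carrier R; x \<in> carrier M\<rbrakk> \<Longrightarrow> f (a \<odot>\<^bsub>M\<^esub> x) = a \<odot>\<^bsub>N\<^esub> f x"
  by (auto simp: mod_hom_def)

lemma hom_zero:
  assumes "left_module R M" "left_module R N" "f \<in> mod_hom R M N"
  shows "f \<zero>\<^bsub>M\<^esub> = \<zero>\<^bsub>N\<^esub>"
  using hom_smult[OF assms(3), of \<zero> "\<zero>\<^bsub>M\<^esub>"] hom_closed[OF assms(3), of "\<zero>\<^bsub>M\<^esub>"] assms(1,2) by simp

lemma hom_neg:
  assumes "left_module R M" "left_module R N" "f \<in> mod_hom R M N" "x \<in> carrier M"
  shows "f (\<ominus>\<^bsub>M\<^esub> x) = \<ominus>\<^bsub>N\<^esub> f x"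
  using hom_smult[OF assms(3), of "\<ominus> \<one>" x] hom_closed[OF assms(3,4)] assms(1,2,4) by (simp add: lm_neg_one_smult)

lemma mod_homI:
  assumes "\<And>x. x \<in> carrier M \<Longrightarrow> f x \<in> carrier N"
    "\<And>x y. x \<in> carrier M \<Longrightarrow> y \<in> carrier M \<Longrightarrow> f (x \<oplus>\<^bsub>M\<^esub> y) = f x \<oplus>\<^bsub>N\<^esub> f y"
    "\<And>a x. a \<in> carrier R \<Longrightarrow> x \<in> carrier M \<Longrightarrow> f (a \<odot>\<^bsub>M\<^esub> x) = a \<odot>\<^bsub>N\<^esub> f x"
  shows "f \<in> mod_hom R M N"
  using assms by (auto simp: mod_hom_def)

lemma hom_comp: "\<lbrakk>f \<in> mod_hom R A B; g \<in> mod_hom R B C\<rbrakk> \<Longrightarrow> (\<lambda>x. g (f x)) \<in> mod_hom R A C"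
  by (rule mod_homI) (simp_all add: hom_closed[of f A B] hom_closed[of g B C] hom_add[of f A B] hom_add[of g B C]
    hom_smult[of f A B] hom_smult[of g B C])

lemma hom_id: "(\<lambda>x. x) \<in> mod_hom R M M"
  by (rule mod_homI) auto

lemma hom_const_zero: "left_module R N \<Longrightarrow> (\<lambda>x. \<zero>\<^bsub>N\<^esub>) \<in> mod_hom R M N"
  by (rule mod_homI) auto

lemma hom_sum:
  "\<lbrakk>left_module R N; f \<in> mod_hom R M N; g \<in> mod_hom R M N\<rbrakk> \<Longrightarrow> (\<lambda>x. f x \<oplus>\<^bsub>N\<^esub> g x) \<in> mod_hom R M N"
  by (rule mod_homI) (simp_all add: hom_closed[of f M N] hom_closed[of g M N] hom_add[of f M N] hom_add[of g M N]
    hom_smult[of f M N] hom_smult[of g M N] lm_smult_add lm_assoc lm_lcomm)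

lemma hom_uminus:
  "\<lbrakk>left_module R N; f \<in> mod_hom R M N\<rbrakk> \<Longrightarrow> (\<lambda>x. \<ominus>\<^bsub>N\<^esub> f x) \<in> mod_hom R M N"
  by (rule mod_homI) (simp_all add: hom_closed[of f M N] hom_add[of f M N] hom_smult[of f M N] lm_smult_neg lm_neg_add)

lemma submod_left_module:
  assumes M: "left_module R M" and N: "submod R M N"
  shows "left_module R (M\<lparr>carrier := N\<rparr>)"
proof -
  note c = submod_closed[OF M N] and nm = submod_closed(1)[OF M N]
  have "abelian_group (M\<lparr>carrier := N\<rparr>)"
  proof (rule abelian_groupI)
    fix x assume "x \<in> carrier (M\<lparr>carrier := N\<rparr>)"
    then show "\<exists>y \<in> carrier (M\<lparr>carrier := N\<rparr>). y \<oplus>\<^bsub>M\<lparr>carrier := N\<rparr>\<^esub> x = \<zero>\<^bsub>M\<lparr>carrier := N\<rparr>\<^esub>"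
      using M c by (intro bexI[of _ "\<ominus>\<^bsub>M\<^esub> x"]) auto
  qed (use M c in \<open>auto intro: lm_assoc[OF M] lm_comm[OF M]\<close>)
  then show ?thesis
    unfolding left_module_def left_module_axioms_def
    using ring_axioms M c by (auto intro: lm_smult_add lm_add_smult lm_mult_smult lm_smult_one)
qed

lemma submod_image:
  assumes "left_module R M" "left_module R N" "f \<in> mod_hom R M N"
  shows "submod R N (f ` carrier M)"
  unfolding submod_def
proof (intro conjI ballI subsetI)
  show "\<zero>\<^bsub>N\<^esub> \<in> f ` carrier M"
    using hom_zero[OF assms] assms(1) by (intro image_eqI[of _ f "\<zero>\<^bsub>M\<^esub>"]) simp_all
  fix x assume "x \<in> f ` carrier M"
  then obtain x' where x: "x' \<in> carrier M" "x = f x'" by blast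
  show "x \<in> carrier N" using x hom_closed[OF assms(3)] by simp
  show "x \<oplus>\<^bsub>N\<^esub> y \<in> f ` carrier M" if "y \<in> f ` carrier M" for y
    using that x hom_add[OF assms(3) x(1), symmetric] assms(1) by auto
  show "a \<odot>\<^bsub>N\<^esub> x \<in> f ` carrier M" if "a \<in> carrier R" for a
    using that x hom_smult[OF assms(3) that x(1), symmetric] assms(1) by auto
qed

text \<open>The dual basis criterion for projectivity: the coordinate functionals are packed into
  one map from elements to coordinate vectors, of which the first \<open>k\<close> entries count. It
  replaces a condition on all modules by data on \<open>P\<close> alone.\<close>

definition dual_basis :: "('a, 'u) module \<Rightarrow> nat \<Rightarrow> (nat \<Rightarrow> 'u) \<Rightarrow> ('u \<Rightarrow> nat \<Rightarrow> 'a) \<Rightarrow> bool" where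
  "dual_basis P k b \<phi> \<longleftrightarrow> (\<forall>j<k. b j \<in> carrier P) \<and>
     (\<forall>x \<in> carrier P. (\<forall>j<k. \<phi> x j \<in> carrier R) \<and> x = lincomb P (\<phi> x) b k \<and>
        (\<forall>y \<in> carrier P. \<forall>j<k. \<phi> (x \<oplus>\<^bsub>P\<^esub> y) j = \<phi> x j \<oplus> \<phi> y j) \<and>
        (\<forall>a \<in> carrier R. \<forall>j<k. \<phi> (a \<odot>\<^bsub>P\<^esub> x) j = a \<otimes> \<phi> x j))"

lemma dual_basis_hom:
  assumes "left_module R N" "dual_basis P k b \<phi>" "\<And>j. j < k \<Longrightarrow> y j \<in> carrier N"
  shows "(\<lambda>x. lincomb N (\<phi> x) y k) \<in> mod_hom R P N"
proof (rule mod_homI)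
  note d = assms(2)[unfolded dual_basis_def]
  fix x assume x: "x \<in> carrier P"
  show "lincomb N (\<phi> x) y k \<in> carrier N" using assms x d by simp
  show "lincomb N (\<phi> (x \<oplus>\<^bsub>P\<^esub> x')) y k = lincomb N (\<phi> x) y k \<oplus>\<^bsub>N\<^esub> lincomb N (\<phi> x') y k" if "x' \<in> carrier P" for x'
    by (subst lincomb_add[symmetric]) (use assms(1,3) x that d in \<open>auto intro!: lincomb_cong\<close>)
  show "lincomb N (\<phi> (a \<odot>\<^bsub>P\<^esub> x)) y k = a \<odot>\<^bsub>N\<^esub> lincomb N (\<phi> x) y k" if "a \<in> carrier R" for a
    by (subst lincomb_smult[symmetric]) (use assms(1,3) x that d in \<open>auto intro!: lincomb_cong\<close>)
qed

text \<open>Related elements are chosen for the finitely many \<open>b j\<close> and extended by the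
  coordinates; the extension stays inside \<open>E\<close> because \<open>E\<close> is a submodule
  of the product.\<close>

lemma dual_basis_lift:
  assumes B: "left_module R B" and C: "left_module R C" and d: "dual_basis P k b \<phi>"
    and E: "rel3 R P B C E" and total: "\<And>x. x \<in> carrier P \<Longrightarrow> \<exists>y z. E x y z"
  shows "\<exists>h \<in> mod_hom R P B. \<exists>l \<in> mod_hom R P C. \<forall>x \<in> carrier P. E x (h x) (l x)"
proof -
  have "\<forall>j<k. \<exists>y z. E (b j) y z" using total d by (auto simp: dual_basis_def)
  then obtain y z where yz: "\<And>j. j < k \<Longrightarrow> E (b j) (y j) (z j)" by metis
  have 1: "E x (lincomb B (\<phi> x) y k) (lincomb C (\<phi> x) z k)" if "x \<in> carrier P" for x
  proof -
    have "E (lincomb P (\<phi> x) b k) (lincomb B (\<phi> x) y k) (lincomb C (\<phi> x) z k)"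
      by (rule rel3_lincomb[OF E]) (use d that yz in \<open>auto simp: dual_basis_def\<close>)
    moreover have "lincomb P (\<phi> x) b k = x" using d that by (auto simp: dual_basis_def)
    ultimately show ?thesis by simp
  qed
  have 2: "y j \<in> carrier B" "z j \<in> carrier C" if "j < k" for j
    using yz[OF that] E unfolding rel3_def by blast+
  show ?thesis
    by (rule bexI[OF _ dual_basis_hom[OF B d 2(1)]], rule bexI[OF _ dual_basis_hom[OF C d 2(2)]])
      (simp_all add: 1)
qed

lemma fg_projective_dual_basis:
  assumes "fg_module R P" "dual_basis P k b \<phi>"
  shows "fg_projective R P"
  unfolding fg_projective_def
proof (intro conjI allI impI)
  fix M N :: "('a, 'b) module" and g f
  assume "fg_module R M \<and> fg_module R N \<and> g \<in> mod_hom R M N \<and> g ` carrier M = carrier N \<and> f \<in> mod_hom R P N"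
  then have M: "left_module R M" "left_module R N" and g: "g \<in> mod_hom R M N" "g ` carrier M = carrier N"
    and f: "f \<in> mod_hom R P N" by auto
  have P: "left_module R P" using assms(1) by simp
  \<comment> \<open>Lifting \<open>f\<close> through \<open>g\<close> is a binary condition, so the
    third component is filled with zero.\<close>
  let ?E = "\<lambda>x y z. x \<in> carrier P \<and> y \<in> carrier M \<and> z = \<zero>\<^bsub>M\<^esub> \<and> g y = f x"
  have "rel3 R P M M ?E"
    unfolding rel3_def using M P by (simp add: hom_add[OF g(1)] hom_smult[OF g(1)] hom_zero[OF _ _ g(1)]
      hom_add[OF f] hom_smult[OF f] hom_zero[OF _ _ f])
  moreover have "\<exists>y z. ?E x y z" if "x \<in> carrier P" for x
  proof -
    have "f x \<in> g ` carrier M" using g(2) hom_closed[OF f] that by simp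
    then obtain y where "y \<in> carrier M" "g y = f x" by (auto simp: image_iff)
    then show ?thesis using that by blast
  qed
  ultimately show "\<exists>h \<in> mod_hom R P M. \<forall>x \<in> carrier P. g (h x) = f x"
    using dual_basis_lift[OF M(1) M(1) assms(2), of ?E] by meson
qed (rule assms(1))

text \<open>The empty family is a dual basis of a zero module.\<close>

lemma zero_fg_projective:
  assumes "left_module R M" "carrier M = {\<zero>\<^bsub>M\<^esub>}"
  shows "fg_projective R M"
proof (rule fg_projective_dual_basis)
  show "fg_module R M" unfolding fg_module_iff[OF assms(1)] gens_def using assms by (auto intro!: exI[of _ 0])
  show "dual_basis M 0 (\<lambda>_. \<zero>\<^bsub>M\<^esub>) (\<lambda>_ _. \<zero>)" unfolding dual_basis_def using assms by auto
qed

end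

section \<open>Free modules and covers\<close>

locale universe_ctx = ring_ctx R for R :: "('a, 'r) ring_scheme" (structure) +
  fixes e :: "'a list \<Rightarrow> 'u"
  assumes inj_e: "inj_on e (lists (carrier R))"
begin

definition coord :: "'u \<Rightarrow> nat \<Rightarrow> 'a" where
  "coord x j = inv_into (lists (carrier R)) e x ! j"

definition tup :: "nat \<Rightarrow> (nat \<Rightarrow> 'a) \<Rightarrow> 'u" where
  "tup k f = e (map f [0..<k])"

text \<open>An element is the code under \<open>e\<close> of a list of length \<open>k\<close>,
  which \<open>coord\<close> reads back. \<open>undefined\<close> supplies the fields
  \<open>mult\<close> and \<open>one\<close>, which have no meaning for modules.\<close>

definition free :: "nat \<Rightarrow> ('a, 'u) module" where
  "free k = undefined\<lparr>carrier := {tup k f |f. \<forall>j<k. f j \<in> carrier R},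
     zero := tup k (\<lambda>_. \<zero>), add := (\<lambda>x y. tup k (\<lambda>j. coord x j \<oplus> coord y j)),
     smult := (\<lambda>a x. tup k (\<lambda>j. a \<otimes> coord x j))\<rparr>"

lemma coord_tup [simp]:
  assumes "\<forall>j<k. f j \<in> carrier R" "j < k"
  shows "coord (tup k f) j = f j"
proof -
  have "map f [0..<k] \<in> lists (carrier R)" using assms by auto
  then show ?thesis unfolding coord_def tup_def using inv_into_f_f[OF inj_e] assms by simp
qed

lemma tup_cong: "(\<And>j. j < k \<Longrightarrow> f j = g j) \<Longrightarrow> tup k f = tup k g"
  unfolding tup_def by (rule arg_cong[of _ _ e]) auto

lemma free_carrierE:
  assumes "x \<in> carrier (free k)"
  obtains f where "\<forall>j<k. f j \<in> carrier R" "x = tup k f"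
  using assms by (auto simp: free_def)

lemma tup_carrier: "\<forall>j<k. f j \<in> carrier R \<Longrightarrow> tup k f \<in> carrier (free k)"
  by (auto simp: free_def)

lemma coord_closed [simp]: "\<lbrakk>x \<in> carrier (free k); j < k\<rbrakk> \<Longrightarrow> coord x j \<in> carrier R"
  by (elim free_carrierE) simp

lemma tup_coord: "x \<in> carrier (free k) \<Longrightarrow> tup k (coord x) = x"
  by (elim free_carrierE) (auto intro: tup_cong)

lemma free_simps:
  "\<zero>\<^bsub>free k\<^esub> = tup k (\<lambda>_. \<zero>)" "x \<oplus>\<^bsub>free k\<^esub> y = tup k (\<lambda>j. coord x j \<oplus> coord y j)"
  "a \<odot>\<^bsub>free k\<^esub> x = tup k (\<lambda>j. a \<otimes> coord x j)"
  by (simp_all add: free_def)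

lemma free_eqI: "\<lbrakk>x \<in> carrier (free k); y \<in> carrier (free k); \<And>j. j < k \<Longrightarrow> coord x j = coord y j\<rbrakk> \<Longrightarrow> x = y"
  by (metis tup_cong tup_coord)

lemma coord_free [simp]:
  "j < k \<Longrightarrow> coord \<zero>\<^bsub>free k\<^esub> j = \<zero>"
  "\<lbrakk>x \<in> carrier (free k); y \<in> carrier (free k); j < k\<rbrakk> \<Longrightarrow> coord (x \<oplus>\<^bsub>free k\<^esub> y) j = coord x j \<oplus> coord y j"
  "\<lbrakk>a \<in> carrier R; x \<in> carrier (free k); j < k\<rbrakk> \<Longrightarrow> coord (a \<odot>\<^bsub>free k\<^esub> x) j = a \<otimes> coord x j"
  unfolding free_simps by (rule coord_tup; simp)+

lemma free_closed [simp]: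
  "\<zero>\<^bsub>free k\<^esub> \<in> carrier (free k)"
  "\<lbrakk>x \<in> carrier (free k); y \<in> carrier (free k)\<rbrakk> \<Longrightarrow> x \<oplus>\<^bsub>free k\<^esub> y \<in> carrier (free k)"
  "\<lbrakk>a \<in> carrier R; x \<in> carrier (free k)\<rbrakk> \<Longrightarrow> a \<odot>\<^bsub>free k\<^esub> x \<in> carrier (free k)"
  unfolding free_simps by (rule tup_carrier; simp)+

lemma free_left_module: "left_module R (free k)"
proof -
  have "abelian_group (free k)"
  proof (rule abelian_groupI)
    fix x assume x: "x \<in> carrier (free k)"
    have t: "tup k (\<lambda>j. \<ominus> coord x j) \<in> carrier (free k)" by (rule tup_carrier) (use x in simp)
    have "tup k (\<lambda>j. \<ominus> coord x j) \<oplus>\<^bsub>free k\<^esub> x = \<zero>\<^bsub>free k\<^esub>"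
      by (rule free_eqI[of _ k]) (use x t in \<open>simp_all add: l_neg\<close>)
    then show "\<exists>y \<in> carrier (free k). y \<oplus>\<^bsub>free k\<^esub> x = \<zero>\<^bsub>free k\<^esub>" using t by blast
  next
    fix x y z assume "x \<in> carrier (free k)" "y \<in> carrier (free k)" "z \<in> carrier (free k)"
    then show "x \<oplus>\<^bsub>free k\<^esub> y \<oplus>\<^bsub>free k\<^esub> z = x \<oplus>\<^bsub>free k\<^esub> (y \<oplus>\<^bsub>free k\<^esub> z)"
      by (intro free_eqI[of _ k]) (simp_all add: a_assoc)
  next
    fix x y assume "x \<in> carrier (free k)" "y \<in> carrier (free k)"
    then show "x \<oplus>\<^bsub>free k\<^esub> y = y \<oplus>\<^bsub>free k\<^esub> x"
      by (intro free_eqI[of _ k]) (simp_all add: a_comm)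
  next
    fix x assume "x \<in> carrier (free k)"
    then show "\<zero>\<^bsub>free k\<^esub> \<oplus>\<^bsub>free k\<^esub> x = x"
      by (intro free_eqI[of _ k]) simp_all
  qed simp_all
  moreover have "left_module_axioms R (free k)"
  proof
    fix a b x assume "a \<in> carrier R" "b \<in> carrier R" "x \<in> carrier (free k)"
    then show "(a \<oplus> b) \<odot>\<^bsub>free k\<^esub> x = a \<odot>\<^bsub>free k\<^esub> x \<oplus>\<^bsub>free k\<^esub> b \<odot>\<^bsub>free k\<^esub> x"
      "(a \<otimes> b) \<odot>\<^bsub>free k\<^esub> x = a \<odot>\<^bsub>free k\<^esub> (b \<odot>\<^bsub>free k\<^esub> x)"
      by (intro free_eqI[of _ k]; simp add: l_distr m_assoc)+
  next
    fix a x y assume "a \<in> carrier R" "x \<in> carrier (free k)" "y \<in> carrier (free k)"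
    then show "a \<odot>\<^bsub>free k\<^esub> (x \<oplus>\<^bsub>free k\<^esub> y) = a \<odot>\<^bsub>free k\<^esub> x \<oplus>\<^bsub>free k\<^esub> a \<odot>\<^bsub>free k\<^esub> y"
      by (intro free_eqI[of _ k]) (simp_all add: r_distr)
  next
    fix x assume "x \<in> carrier (free k)"
    then show "\<one> \<odot>\<^bsub>free k\<^esub> x = x" by (intro free_eqI[of _ k]) simp_all
  qed simp
  ultimately show ?thesis using ring_axioms by (simp add: left_module_def)
qed

definition unit_vec :: "nat \<Rightarrow> nat \<Rightarrow> 'u" where
  "unit_vec k i = tup k (\<lambda>j. if i = j then \<one> else \<zero>)"

lemma unit_vec_closed [simp]: "unit_vec k i \<in> carrier (free k)"
  unfolding unit_vec_def by (rule tup_carrier) simp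

lemma coord_unit_vec [simp]: "j < k \<Longrightarrow> coord (unit_vec k i) j = (if i = j then \<one> else \<zero>)"
  unfolding unit_vec_def by (rule coord_tup) simp_all

lemma lincomb_unit_vec:
  assumes c: "\<And>j. j < k \<Longrightarrow> c j \<in> carrier R"
  shows "lincomb (free k) c (unit_vec k) k = tup k c"
proof -
  \<comment> \<open>The partial sum of the first \<open>m\<close> unit vectors is the tuple cut off
    at \<open>m\<close>.\<close>
  have "m \<le> k \<Longrightarrow> lincomb (free k) c (unit_vec k) m = tup k (\<lambda>j. if j < m then c j else \<zero>)" for m
  proof (induction m)
    case (Suc m)
    have t: "tup k (\<lambda>j. if j < m' then c j else \<zero>) \<in> carrier (free k)" for m'
      by (rule tup_carrier) (simp add: c)
    have "coord (tup k (\<lambda>j. if j < m' then c j else \<zero>)) j = (if j < m' then c j else \<zero>)" if "j < k" for m' j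
      by (rule coord_tup) (use c that in simp_all)
    then show ?case
      using Suc c t by (intro free_eqI[of _ k]) (simp_all, metis not_less_less_Suc_eq)
  qed (simp add: free_simps)
  from this[of k] show ?thesis by (auto intro: tup_cong)
qed

lemma free_dual_basis: "dual_basis (free k) k (unit_vec k) coord"
  unfolding dual_basis_def by (auto simp: lincomb_unit_vec tup_coord)

lemma free_fg: "fg_module R (free k)"
  unfolding fg_module_iff[OF free_left_module] gens_def
proof (intro exI conjI ballI allI impI)
  fix x assume "x \<in> carrier (free k)"
  then show "x = lincomb (free k) (coord x) (unit_vec k) k" by (simp add: lincomb_unit_vec tup_coord)
qed simp_all

lemma free_projective: "fg_projective R (free k)"
  by (rule fg_projective_dual_basis[OF free_fg free_dual_basis])

text \<open>\<open>fg_projective\<close> tests against modules on the same carrier type only. The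
  cover of \<open>P\<close> by a free module can be used there because lists over the ring are coded
  in that type; the coordinates of a splitting are the functionals.\<close>

lemma fg_projective_imp_dual_basis:
  fixes P :: "('a, 'u) module"
  assumes P: "fg_projective R P"
  obtains k b \<phi> where "dual_basis P k b \<phi>"
proof -
  have lm: "left_module R P" using P by simp
  obtain b k where b: "\<forall>j<k. b j \<in> carrier P"
    "\<And>x. x \<in> carrier P \<Longrightarrow> \<exists>c. (\<forall>j<k. c j \<in> carrier R) \<and> x = lincomb P c b k"
    using P fg_module_iff[OF lm] unfolding gens_def by auto
  define g where "g x = lincomb P (coord x) b k" for x
  have g: "g \<in> mod_hom R (free k) P"
    unfolding g_def using dual_basis_hom[OF lm free_dual_basis] b(1) by simp
  have "g ` carrier (free k) = carrier P"
  proof (intro equalityI subsetI)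
    fix x assume "x \<in> carrier P"
    then obtain c where c: "\<forall>j<k. c j \<in> carrier R" "x = lincomb P c b k" using b(2) by auto
    then have "x = g (tup k c)" unfolding g_def by (auto intro!: lincomb_cong)
    then show "x \<in> g ` carrier (free k)" using tup_carrier[OF c(1)] by blast
  qed (use hom_closed[OF g] in auto)
  then obtain s where s: "s \<in> mod_hom R P (free k)" "\<And>x. x \<in> carrier P \<Longrightarrow> g (s x) = x"
    using P free_fg g hom_id[of P] unfolding fg_projective_def by metis
  have "dual_basis P k b (\<lambda>x. coord (s x))"
    unfolding dual_basis_def using b(1) s(2)
    by (auto simp: coord_closed[OF hom_closed[OF s(1)]] hom_closed[OF s(1)] hom_add[OF s(1)] hom_smult[OF s(1)] g_def)
  then show ?thesis by (rule that)
qed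

lemma projective_lift:
  fixes P :: "('a, 'u) module"
  assumes "fg_projective R P" "left_module R B" "left_module R C"
    and "rel3 R P B C E" "\<And>x. x \<in> carrier P \<Longrightarrow> \<exists>y z. E x y z"
  shows "\<exists>h \<in> mod_hom R P B. \<exists>l \<in> mod_hom R P C. \<forall>x \<in> carrier P. E x (h x) (l x)"
  using fg_projective_imp_dual_basis[OF assms(1)] dual_basis_lift[OF assms(2,3) _ assms(4,5)] by metis

text \<open>Linearity is forced: sums and multiples of related triples are related, so by uniqueness
  they are the chosen ones. This serves the degrees in which no projectivity is available.\<close>

lemma rel3_functional_lift:
  assumes "rel3 R P B C E" "\<And>x. x \<in> carrier P \<Longrightarrow> \<exists>y z. E x y z"
    and "\<And>x y z y' z'. E x y z \<Longrightarrow> E x y' z' \<Longrightarrow> y = y' \<and> z = z'"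
  shows "\<exists>h \<in> mod_hom R P B. \<exists>l \<in> mod_hom R P C. \<forall>x \<in> carrier P. E x (h x) (l x)"
proof -
  obtain h l where hl: "\<And>x. x \<in> carrier P \<Longrightarrow> E x (h x) (l x)" using assms(2) by metis
  note r = rel3D[OF assms(1)]
  have add: "h (x \<oplus>\<^bsub>P\<^esub> y) = h x \<oplus>\<^bsub>B\<^esub> h y \<and> l (x \<oplus>\<^bsub>P\<^esub> y) = l x \<oplus>\<^bsub>C\<^esub> l y"
    if "x \<in> carrier P" "y \<in> carrier P" for x y
  proof (rule assms(3))
    show E: "E (x \<oplus>\<^bsub>P\<^esub> y) (h x \<oplus>\<^bsub>B\<^esub> h y) (l x \<oplus>\<^bsub>C\<^esub> l y)"
      by (rule r(5)[OF hl hl]) (use that in simp_all)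
    then have "x \<oplus>\<^bsub>P\<^esub> y \<in> carrier P" by (rule r(1))
    then show "E (x \<oplus>\<^bsub>P\<^esub> y) (h (x \<oplus>\<^bsub>P\<^esub> y)) (l (x \<oplus>\<^bsub>P\<^esub> y))" by (rule hl)
  qed
  have sm: "h (a \<odot>\<^bsub>P\<^esub> x) = a \<odot>\<^bsub>B\<^esub> h x \<and> l (a \<odot>\<^bsub>P\<^esub> x) = a \<odot>\<^bsub>C\<^esub> l x"
    if "x \<in> carrier P" "a \<in> carrier R" for x a
  proof (rule assms(3))
    show E: "E (a \<odot>\<^bsub>P\<^esub> x) (a \<odot>\<^bsub>B\<^esub> h x) (a \<odot>\<^bsub>C\<^esub> l x)"
      by (rule r(6)[OF that(2) hl]) (use that in simp_all)
    then have "a \<odot>\<^bsub>P\<^esub> x \<in> carrier P" by (rule r(1))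
    then show "E (a \<odot>\<^bsub>P\<^esub> x) (h (a \<odot>\<^bsub>P\<^esub> x)) (l (a \<odot>\<^bsub>P\<^esub> x))" by (rule hl)
  qed
  have "h \<in> mod_hom R P B" by (rule mod_homI) (use add sm r(2)[OF hl] in simp_all)
  moreover have "l \<in> mod_hom R P C" by (rule mod_homI) (use add sm r(3)[OF hl] in simp_all)
  ultimately show ?thesis using hl by blast
qed

end

text \<open>Finite dimension enters the homological part through \<open>noeth\<close> alone, which
  \<open>findim_algebra_noetherian\<close> provides.\<close>

locale noeth_ctx = universe_ctx R e for R :: "('a, 'r) ring_scheme" (structure) and e :: "'a list \<Rightarrow> 'u" +
  assumes noeth: "\<And>(M :: ('a, 'u) module) N. fg_module R M \<Longrightarrow> submod R M N \<Longrightarrow> \<exists>b k. gens R M N b k"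
begin

text \<open>Applying \<open>noeth\<close> to the product of \<open>A\<close> and \<open>B\<close>
  would need a carrier for it. Instead generators are found for the projection of \<open>E\<close>
  to \<open>A\<close> and for the fibre of \<open>E\<close> over zero, a submodule of
  \<open>B\<close>; together they generate \<open>E\<close>.\<close>

lemma projective_cover_rel:
  fixes A B :: "('a, 'u) module"
  assumes A: "fg_module R A" and B: "fg_module R B" and E: "rel2 R A B E"
  obtains P \<alpha> \<beta> where "fg_projective R P" "\<alpha> \<in> mod_hom R P A" "\<beta> \<in> mod_hom R P B"
    "\<And>x. x \<in> carrier P \<Longrightarrow> E (\<alpha> x) (\<beta> x)"
    "\<And>y z. E y z \<Longrightarrow> \<exists>x \<in> carrier P. \<alpha> x = y \<and> \<beta> x = z"
proof -
  have A': "left_module R A" and B': "left_module R B" using A B by auto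
  note r = rel2D[OF E]
  have S1: "submod R A {y. \<exists>z. E y z}"
    unfolding submod_def mem_Collect_eq
  proof (intro conjI ballI subsetI)
    fix x assume "x \<in> {y. \<exists>z. E y z}"
    then show "x \<in> carrier A" by (auto dest: r(1))
  next
    show "\<exists>z. E \<zero>\<^bsub>A\<^esub> z" using r(3) by blast
  next
    fix x y assume "x \<in> {y. \<exists>z. E y z}" "y \<in> {y. \<exists>z. E y z}"
    then obtain x' y' where "E x x'" "E y y'" by blast
    then show "\<exists>z. E (x \<oplus>\<^bsub>A\<^esub> y) z" using r(4) by metis
  next
    fix a x assume a: "a \<in> carrier R" and "x \<in> {y. \<exists>z. E y z}"
    then obtain x' where "E x x'" by blast
    then show "\<exists>z. E (a \<odot>\<^bsub>A\<^esub> x) z" using r(5)[OF a] by metis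
  qed
  have S2: "submod R B {z. E \<zero>\<^bsub>A\<^esub> z}"
    unfolding submod_def
  proof (intro conjI ballI)
    show "x \<oplus>\<^bsub>B\<^esub> y \<in> {z. E \<zero>\<^bsub>A\<^esub> z}" if "x \<in> {z. E \<zero>\<^bsub>A\<^esub> z}" "y \<in> {z. E \<zero>\<^bsub>A\<^esub> z}" for x y
    proof -
      have "E (\<zero>\<^bsub>A\<^esub> \<oplus>\<^bsub>A\<^esub> \<zero>\<^bsub>A\<^esub>) (x \<oplus>\<^bsub>B\<^esub> y)" by (rule r(4)) (use that in simp_all)
      then show ?thesis using A' by simp
    qed
    show "a \<odot>\<^bsub>B\<^esub> x \<in> {z. E \<zero>\<^bsub>A\<^esub> z}" if "a \<in> carrier R" "x \<in> {z. E \<zero>\<^bsub>A\<^esub> z}" for a x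
    proof -
      have "E (a \<odot>\<^bsub>A\<^esub> \<zero>\<^bsub>A\<^esub>) (a \<odot>\<^bsub>B\<^esub> x)" by (rule r(5)) (use that in simp_all)
      then show ?thesis using A' that by simp
    qed
  qed (use r(2,3) in auto)
  obtain p k where p: "\<And>j. j < k \<Longrightarrow> \<exists>z. E (p j) z"
    "\<And>y z. E y z \<Longrightarrow> \<exists>c. (\<forall>j<k. c j \<in> carrier R) \<and> y = lincomb A c p k"
    using noeth[OF A S1] unfolding gens_def by blast
  then obtain m where m: "\<And>j. j < k \<Longrightarrow> E (p j) (m j)" by metis
  obtain q l where q: "\<And>j. j < l \<Longrightarrow> E \<zero>\<^bsub>A\<^esub> (q j)"
    "\<And>z. E \<zero>\<^bsub>A\<^esub> z \<Longrightarrow> \<exists>c. (\<forall>j<l. c j \<in> carrier R) \<and> z = lincomb B c q l"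
    using noeth[OF B S2] unfolding gens_def by blast
  \<comment> \<open>The first \<open>k\<close> generators are pairs that lift generators of the
    projection; the remaining \<open>l\<close> have first component zero.\<close>
  define y where "y j = (if j < k then p j else \<zero>\<^bsub>A\<^esub>)" for j
  define z where "z j = (if j < k then m j else q (j - k))" for j
  have Eyz: "E (y j) (z j)" if "j < k + l" for j
    using m[of j] q(1)[of "j - k"] that unfolding y_def z_def by auto
  have yA: "y j \<in> carrier A" and zB: "z j \<in> carrier B" if "j < k + l" for j
    using r(1,2)[OF Eyz[OF that]] .
  define \<alpha> where "\<alpha> x = lincomb A (coord x) y (k + l)" for x
  define \<beta> where "\<beta> x = lincomb B (coord x) z (k + l)" for x
  show ?thesis
  proof (rule that)
    show "fg_projective R (free (k + l))" by (rule free_projective)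
    show "\<alpha> \<in> mod_hom R (free (k + l)) A"
      unfolding \<alpha>_def by (rule dual_basis_hom[OF A' free_dual_basis yA])
    show "\<beta> \<in> mod_hom R (free (k + l)) B"
      unfolding \<beta>_def by (rule dual_basis_hom[OF B' free_dual_basis zB])
    show "E (\<alpha> x) (\<beta> x)" if x: "x \<in> carrier (free (k + l))" for x
      unfolding \<alpha>_def \<beta>_def by (rule rel2_lincomb[OF E]) (use x Eyz in simp_all)
    fix y' z' assume yz: "E y' z'"
    obtain c where c: "\<And>j. j < k \<Longrightarrow> c j \<in> carrier R" "y' = lincomb A c p k" using p(2)[OF yz] by auto
    \<comment> \<open>\<open>z1\<close> is the second component that the lifted generators produce
      for the same \<open>y'\<close>. Hence the difference of \<open>z'\<close> and
      \<open>z1\<close> lies in the fibre over zero and is covered by the remaining \<open>l\<close>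
      generators.\<close>
    define z1 where "z1 = lincomb B c m k"
    have z1: "E y' z1" unfolding c(2) z1_def by (rule rel2_lincomb[OF E c(1) m])
    have mem: "y' \<in> carrier A" "z' \<in> carrier B" "z1 \<in> carrier B" using r(1,2)[OF yz] r(2)[OF z1] .
    have "E (y' \<oplus>\<^bsub>A\<^esub> (\<ominus> \<one>) \<odot>\<^bsub>A\<^esub> y') (z' \<oplus>\<^bsub>B\<^esub> (\<ominus> \<one>) \<odot>\<^bsub>B\<^esub> z1)"
      by (intro r(4)[OF yz] r(5)[OF _ z1]) simp
    then have "E \<zero>\<^bsub>A\<^esub> (z' \<oplus>\<^bsub>B\<^esub> \<ominus>\<^bsub>B\<^esub> z1)"
      using A' B' mem by (simp add: lm_neg_one_smult)
    then obtain c' where c': "\<And>j. j < l \<Longrightarrow> c' j \<in> carrier R" "z' \<oplus>\<^bsub>B\<^esub> \<ominus>\<^bsub>B\<^esub> z1 = lincomb B c' q l" using q(2) by blast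
    define f where "f j = (if j < k then c j else c' (j - k))" for j
    have f: "\<forall>j<k + l. f j \<in> carrier R" unfolding f_def using c(1) c'(1) by auto
    have 1: "\<alpha> (tup (k + l) f) = lincomb A f y (k + l)"
      unfolding \<alpha>_def by (rule lincomb_cong) (use f in simp_all)
    have "lincomb A f y (k + l) = lincomb A f y k \<oplus>\<^bsub>A\<^esub> lincomb A (\<lambda>j. f (k + j)) (\<lambda>j. y (k + j)) l"
      by (rule lincomb_append[OF A']) (use f yA in simp_all)
    moreover have "lincomb A f y k = y'"
      unfolding c(2) by (rule lincomb_cong) (simp_all add: f_def y_def)
    moreover have "lincomb A (\<lambda>j. f (k + j)) (\<lambda>j. y (k + j)) l = \<zero>\<^bsub>A\<^esub>"
      by (rule lincomb_zero[OF A']) (use f in \<open>simp_all add: y_def\<close>)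
    ultimately have \<alpha>: "\<alpha> (tup (k + l) f) = y'" using 1 A' mem by simp
    have 2: "\<beta> (tup (k + l) f) = lincomb B f z (k + l)"
      unfolding \<beta>_def by (rule lincomb_cong) (use f in simp_all)
    have "lincomb B f z (k + l) = lincomb B f z k \<oplus>\<^bsub>B\<^esub> lincomb B (\<lambda>j. f (k + j)) (\<lambda>j. z (k + j)) l"
      by (rule lincomb_append[OF B']) (use f zB in simp_all)
    moreover have "lincomb B f z k = z1"
      unfolding z1_def by (rule lincomb_cong) (simp_all add: f_def z_def)
    moreover have "lincomb B (\<lambda>j. f (k + j)) (\<lambda>j. z (k + j)) l = z' \<oplus>\<^bsub>B\<^esub> \<ominus>\<^bsub>B\<^esub> z1"
      unfolding c'(2) by (rule lincomb_cong) (simp_all add: f_def z_def)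
    ultimately have "\<beta> (tup (k + l) f) = z'" using 2 B' mem by (simp add: lm_lcomm)
    with \<alpha> show "\<exists>x \<in> carrier (free (k + l)). \<alpha> x = y' \<and> \<beta> x = z'"
      using tup_carrier[OF f] by blast
  qed
qed

end

section \<open>The homotopy category\<close>

lemma homotopy_rel_iff:
  "(f, g) \<in> homotopy_rel R X Y \<longleftrightarrow> f \<in> chain_maps R X Y \<and> g \<in> chain_maps R X Y \<and>
     (\<exists>h. \<forall>i. h i \<in> mod_hom R (Term X i) (Term Y (i - 1)) \<and>
        (\<forall>x \<in> carrier (Term X i).
           f i x = g i x \<oplus>\<^bsub>Term Y i\<^esub>
             (Diff Y (i - 1) (h i x) \<oplus>\<^bsub>Term Y i\<^esub> h (i + 1) (Diff X i x))))"
  by (simp add: homotopy_rel_def)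

abbreviation hcls where "hcls R X Y f \<equiv> homotopy_rel R X Y `` {f}"

context ring_ctx
begin

lemmas lm_ac = lm_assoc lm_comm lm_lcomm

lemma lm_move:
  fixes M :: "('a, 'u) module"
  shows "\<lbrakk>left_module R M; y \<in> carrier M; s \<in> carrier M; x = y \<oplus>\<^bsub>M\<^esub> s\<rbrakk> \<Longrightarrow> y = x \<oplus>\<^bsub>M\<^esub> \<ominus>\<^bsub>M\<^esub> s"
  by (simp add: lm_assoc)

abbreviation cx :: "('a, 'u) cplx \<Rightarrow> bool" where "cx \<equiv> bounded_complex R"

lemma cx_fg [simp]: "cx X \<Longrightarrow> fg_module R (Term X i)"
  by (simp add: bounded_complex_def)

lemma cx_lm: "cx X \<Longrightarrow> left_module R (Term X i)"
  by simp

lemma diff_hom: "cx X \<Longrightarrow> j = i + 1 \<Longrightarrow> Diff X i \<in> mod_hom R (Term X i) (Term X j)"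
  by (simp add: bounded_complex_def)

lemma diff_closed [simp]: "\<lbrakk>cx X; x \<in> carrier (Term X i); j = i + 1\<rbrakk> \<Longrightarrow> Diff X i x \<in> carrier (Term X j)"
  by (rule hom_closed[OF diff_hom])

lemma diff_diff: "\<lbrakk>cx X; x \<in> carrier (Term X i); j = i + 1\<rbrakk> \<Longrightarrow> Diff X j (Diff X i x) = \<zero>\<^bsub>Term X (i + 2)\<^esub>"
  by (simp add: bounded_complex_def)

lemma diff_diff' [simp]:
  "\<lbrakk>cx X; x \<in> carrier (Term X i)\<rbrakk> \<Longrightarrow> Diff X (i + 1) (Diff X i x) = \<zero>\<^bsub>Term X (i + 2)\<^esub>"
  "\<lbrakk>cx X; x \<in> carrier (Term X (i - 1))\<rbrakk> \<Longrightarrow> Diff X i (Diff X (i - 1) x) = \<zero>\<^bsub>Term X (i + 1)\<^esub>"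
  "\<lbrakk>cx X; x \<in> carrier (Term X (i - 2))\<rbrakk> \<Longrightarrow> Diff X (i - 1) (Diff X (i - 2) x) = \<zero>\<^bsub>Term X i\<^esub>"
  using diff_diff[of X x "i - 1" i] diff_diff[of X x i "i + 1"] diff_diff[of X x "i - 2" "i - 1"] by (simp_all add: add.commute)

lemma diff_add [simp]:
  "\<lbrakk>cx X; x \<in> carrier (Term X i); y \<in> carrier (Term X i)\<rbrakk> \<Longrightarrow>
   Diff X i (x \<oplus>\<^bsub>Term X i\<^esub> y) = Diff X i x \<oplus>\<^bsub>Term X (i + 1)\<^esub> Diff X i y"
  by (rule hom_add[OF diff_hom[OF _ refl]])

lemma diff_smult:
  "\<lbrakk>cx X; a \<in> carrier R; x \<in> carrier (Term X i)\<rbrakk> \<Longrightarrow>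
   Diff X i (a \<odot>\<^bsub>Term X i\<^esub> x) = a \<odot>\<^bsub>Term X (i + 1)\<^esub> Diff X i x"
  by (rule hom_smult[OF diff_hom[OF _ refl]])

lemma diff_zero [simp]: "cx X \<Longrightarrow> Diff X i \<zero>\<^bsub>Term X i\<^esub> = \<zero>\<^bsub>Term X (i + 1)\<^esub>"
  by (rule hom_zero[OF cx_lm cx_lm diff_hom[OF _ refl]])

lemma diff_neg [simp]:
  "\<lbrakk>cx X; x \<in> carrier (Term X i)\<rbrakk> \<Longrightarrow> Diff X i (\<ominus>\<^bsub>Term X i\<^esub> x) = \<ominus>\<^bsub>Term X (i + 1)\<^esub> Diff X i x"
  by (rule hom_neg[OF cx_lm cx_lm diff_hom[OF _ refl]])

context
  fixes f :: "int \<Rightarrow> 'u \<Rightarrow> 'u" and X Y :: "('a, 'u) cplx"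
  assumes f: "f \<in> chain_maps R X Y"
begin

lemma cm_hom: "f i \<in> mod_hom R (Term X i) (Term Y i)"
  using f by (simp add: chain_maps_def)

lemma cm_closed: "x \<in> carrier (Term X i) \<Longrightarrow> f i x \<in> carrier (Term Y i)"
  by (rule hom_closed[OF cm_hom])

lemma cm_add: "\<lbrakk>x \<in> carrier (Term X i); y \<in> carrier (Term X i)\<rbrakk> \<Longrightarrow> f i (x \<oplus>\<^bsub>Term X i\<^esub> y) = f i x \<oplus>\<^bsub>Term Y i\<^esub> f i y"
  by (rule hom_add[OF cm_hom])

lemma cm_smult: "\<lbrakk>a \<in> carrier R; x \<in> carrier (Term X i)\<rbrakk> \<Longrightarrow> f i (a \<odot>\<^bsub>Term X i\<^esub> x) = a \<odot>\<^bsub>Term Y i\<^esub> f i x"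
  by (rule hom_smult[OF cm_hom])

lemma cm_zero: "\<lbrakk>cx X; cx Y\<rbrakk> \<Longrightarrow> f i \<zero>\<^bsub>Term X i\<^esub> = \<zero>\<^bsub>Term Y i\<^esub>"
  by (rule hom_zero[OF cx_lm cx_lm cm_hom])

lemma cm_neg: "\<lbrakk>cx X; cx Y; x \<in> carrier (Term X i)\<rbrakk> \<Longrightarrow> f i (\<ominus>\<^bsub>Term X i\<^esub> x) = \<ominus>\<^bsub>Term Y i\<^esub> f i x"
  by (rule hom_neg[OF cx_lm cx_lm cm_hom])

lemma cm_diff: "\<lbrakk>x \<in> carrier (Term X i); j = i + 1\<rbrakk> \<Longrightarrow> f j (Diff X i x) = Diff Y i (f i x)"
  using f by (simp add: chain_maps_def)

lemmas cmD = cm_closed cm_add cm_zero cm_neg cm_diff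

end

lemma chain_mapsI:
  assumes "\<And>i. f i \<in> mod_hom R (Term X i) (Term Y i)"
    "\<And>i x. x \<in> carrier (Term X i) \<Longrightarrow> f (i + 1) (Diff X i x) = Diff Y i (f i x)"
  shows "f \<in> chain_maps R X Y"
  using assms by (simp add: chain_maps_def)

lemma chain_maps_id: "(\<lambda>i x. x) \<in> chain_maps R X X"
  by (rule chain_mapsI) (simp_all add: hom_id)

lemma chain_maps_comp:
  assumes "f \<in> chain_maps R X Y" "g \<in> chain_maps R Y Z"
  shows "(\<lambda>i x. g i (f i x)) \<in> chain_maps R X Z"
  by (rule chain_mapsI) (simp_all add: hom_comp[OF cm_hom[OF assms(1)] cm_hom[OF assms(2)]]
    cm_diff[OF assms(1)] cm_diff[OF assms(2)] cm_closed[OF assms(1)])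

lemma chain_maps_add:
  assumes "cx X" "cx Y" and f: "f \<in> chain_maps R X Y" and g: "g \<in> chain_maps R X Y"
  shows "(\<lambda>i x. f i x \<oplus>\<^bsub>Term Y i\<^esub> g i x) \<in> chain_maps R X Y"
  by (rule chain_mapsI)
    (use assms(1,2) in \<open>simp_all add: hom_sum[OF _ cm_hom[OF f] cm_hom[OF g]] cmD[OF f] cmD[OF g]\<close>)

lemma chain_maps_cong:
  assumes "cx X" "f \<in> chain_maps R X Y" "\<And>i x. x \<in> carrier (Term X i) \<Longrightarrow> g i x = f i x"
  shows "g \<in> chain_maps R X Y"
  by (rule chain_mapsI, rule mod_homI)
    (use assms(1) in \<open>simp_all add: assms(3) cmD[OF assms(2)] cm_smult[OF assms(2)]\<close>)

lemma homotopyI: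
  assumes "f \<in> chain_maps R X Y" "g \<in> chain_maps R X Y"
    "\<And>i. h i \<in> mod_hom R (Term X i) (Term Y (i - 1))"
    "\<And>i x. x \<in> carrier (Term X i) \<Longrightarrow> f i x = g i x \<oplus>\<^bsub>Term Y i\<^esub>
             (Diff Y (i - 1) (h i x) \<oplus>\<^bsub>Term Y i\<^esub> h (i + 1) (Diff X i x))"
  shows "(f, g) \<in> homotopy_rel R X Y"
  unfolding homotopy_rel_iff using assms by blast

lemma homotopyE:
  assumes "(f, g) \<in> homotopy_rel R X Y"
  obtains h where "f \<in> chain_maps R X Y" "g \<in> chain_maps R X Y"
    "\<And>i. h i \<in> mod_hom R (Term X i) (Term Y (i - 1))"
    "\<And>i x. x \<in> carrier (Term X i) \<Longrightarrow> f i x = g i x \<oplus>\<^bsub>Term Y i\<^esub>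
             (Diff Y (i - 1) (h i x) \<oplus>\<^bsub>Term Y i\<^esub> h (i + 1) (Diff X i x))"
proof -
  obtain h where "f \<in> chain_maps R X Y" "g \<in> chain_maps R X Y"
    "\<forall>i. h i \<in> mod_hom R (Term X i) (Term Y (i - 1)) \<and>
        (\<forall>x \<in> carrier (Term X i).
           f i x = g i x \<oplus>\<^bsub>Term Y i\<^esub>
             (Diff Y (i - 1) (h i x) \<oplus>\<^bsub>Term Y i\<^esub> h (i + 1) (Diff X i x)))"
    using assms unfolding homotopy_rel_iff by (elim conjE exE)
  then show ?thesis by (intro that[of h]) simp_all
qed

context
  fixes h :: "int \<Rightarrow> 'u \<Rightarrow> 'u" and X Y :: "('a, 'u) cplx"
  assumes h: "\<And>i. h i \<in> mod_hom R (Term X i) (Term Y (i - 1))"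
begin

lemma hty_closed: "\<lbrakk>x \<in> carrier (Term X i); j = i - 1\<rbrakk> \<Longrightarrow> h i x \<in> carrier (Term Y j)"
  using hom_closed[OF h] by simp

lemma hty_add: "\<lbrakk>x \<in> carrier (Term X i); y \<in> carrier (Term X i)\<rbrakk> \<Longrightarrow> h i (x \<oplus>\<^bsub>Term X i\<^esub> y) = h i x \<oplus>\<^bsub>Term Y (i - 1)\<^esub> h i y"
  by (rule hom_add[OF h])

lemma hty_zero: "\<lbrakk>cx X; cx Y\<rbrakk> \<Longrightarrow> h i \<zero>\<^bsub>Term X i\<^esub> = \<zero>\<^bsub>Term Y (i - 1)\<^esub>"
  by (rule hom_zero[OF cx_lm cx_lm h])

lemmas htyD = hty_closed hty_add hty_zero

end

text \<open>Chain maps are functions with arbitrary values off the carriers, so agreement on the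
  carriers is the equality that can be proved; the zero homotopy turns it into equality of
  classes.\<close>

lemma homotopy_cong:
  assumes X: "cx X" "cx Y" and f: "f \<in> chain_maps R X Y"
    and eq: "\<And>i x. x \<in> carrier (Term X i) \<Longrightarrow> g i x = f i x"
  shows "(f, g) \<in> homotopy_rel R X Y"
proof (rule homotopyI[OF f])
  show "g \<in> chain_maps R X Y" by (rule chain_maps_cong[OF X(1) f eq])
  show "(\<lambda>x. \<zero>\<^bsub>Term Y (i - 1)\<^esub>) \<in> mod_hom R (Term X i) (Term Y (i - 1))" for i
    using X by (intro hom_const_zero) simp
  fix i x assume x: "x \<in> carrier (Term X i)"
  show "f i x = g i x \<oplus>\<^bsub>Term Y i\<^esub> (Diff Y (i - 1) \<zero>\<^bsub>Term Y (i - 1)\<^esub> \<oplus>\<^bsub>Term Y i\<^esub> \<zero>\<^bsub>Term Y (i + 1 - 1)\<^esub>)"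
    using X x cm_closed[OF f x] diff_zero[OF X(2), of "i - 1"] by (simp add: eq)
qed

lemma homotopy_refl: "\<lbrakk>cx X; cx Y; f \<in> chain_maps R X Y\<rbrakk> \<Longrightarrow> (f, f) \<in> homotopy_rel R X Y"
  by (rule homotopy_cong) simp_all

lemma homotopy_sym:
  assumes X: "cx X" "cx Y" and fg: "(f, g) \<in> homotopy_rel R X Y"
  shows "(g, f) \<in> homotopy_rel R X Y"
proof -
  obtain h where f: "f \<in> chain_maps R X Y" and g: "g \<in> chain_maps R X Y"
    and h: "\<And>i. h i \<in> mod_hom R (Term X i) (Term Y (i - 1))"
    and eq: "\<And>i x. x \<in> carrier (Term X i) \<Longrightarrow> f i x = g i x \<oplus>\<^bsub>Term Y i\<^esub>
             (Diff Y (i - 1) (h i x) \<oplus>\<^bsub>Term Y i\<^esub> h (i + 1) (Diff X i x))"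
    using fg by (rule homotopyE) blast
  show ?thesis
  proof (rule homotopyI[OF g f, of "\<lambda>i x. \<ominus>\<^bsub>Term Y (i - 1)\<^esub> h i x"])
    fix i show "(\<lambda>x. \<ominus>\<^bsub>Term Y (i - 1)\<^esub> h i x) \<in> mod_hom R (Term X i) (Term Y (i - 1))"
      using X by (intro hom_uminus h) simp
  next
    fix i x assume x: "x \<in> carrier (Term X i)"
    have c: "h i x \<in> carrier (Term Y (i - 1))" "h (i + 1) (Diff X i x) \<in> carrier (Term Y i)"
      using X x by (simp_all add: htyD[OF h])
    have "g i x = f i x \<oplus>\<^bsub>Term Y i\<^esub> \<ominus>\<^bsub>Term Y i\<^esub> (Diff Y (i - 1) (h i x) \<oplus>\<^bsub>Term Y i\<^esub> h (i + 1) (Diff X i x))"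
      by (rule lm_move[OF _ _ _ eq]) (use X x c cm_closed[OF g] in simp_all)
    moreover have "Diff Y (i - 1) (\<ominus>\<^bsub>Term Y (i - 1)\<^esub> h i x) = \<ominus>\<^bsub>Term Y i\<^esub> Diff Y (i - 1) (h i x)"
      using diff_neg[OF X(2) c(1)] by simp
    ultimately show "g i x = f i x \<oplus>\<^bsub>Term Y i\<^esub> (Diff Y (i - 1) (\<ominus>\<^bsub>Term Y (i - 1)\<^esub> h i x) \<oplus>\<^bsub>Term Y i\<^esub>
        \<ominus>\<^bsub>Term Y (i + 1 - 1)\<^esub> h (i + 1) (Diff X i x))"
      using X c by (simp add: lm_neg_add)
  qed
qed

lemma homotopy_add:
  assumes X: "cx X" "cx Y" and fg: "(f, g) \<in> homotopy_rel R X Y" and fg': "(f', g') \<in> homotopy_rel R X Y"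
  shows "(\<lambda>i x. f i x \<oplus>\<^bsub>Term Y i\<^esub> f' i x, \<lambda>i x. g i x \<oplus>\<^bsub>Term Y i\<^esub> g' i x) \<in> homotopy_rel R X Y"
proof -
  obtain h where f: "f \<in> chain_maps R X Y" and g: "g \<in> chain_maps R X Y"
    and h: "\<And>i. h i \<in> mod_hom R (Term X i) (Term Y (i - 1))"
    and eq: "\<And>i x. x \<in> carrier (Term X i) \<Longrightarrow> f i x = g i x \<oplus>\<^bsub>Term Y i\<^esub>
             (Diff Y (i - 1) (h i x) \<oplus>\<^bsub>Term Y i\<^esub> h (i + 1) (Diff X i x))"
    using fg by (rule homotopyE) blast
  obtain h' where f': "f' \<in> chain_maps R X Y" and g': "g' \<in> chain_maps R X Y"
    and h': "\<And>i. h' i \<in> mod_hom R (Term X i) (Term Y (i - 1))"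
    and eq': "\<And>i x. x \<in> carrier (Term X i) \<Longrightarrow> f' i x = g' i x \<oplus>\<^bsub>Term Y i\<^esub>
             (Diff Y (i - 1) (h' i x) \<oplus>\<^bsub>Term Y i\<^esub> h' (i + 1) (Diff X i x))"
    using fg' by (rule homotopyE) blast
  show ?thesis
  proof (rule homotopyI[OF chain_maps_add[OF X f f'] chain_maps_add[OF X g g'], of "\<lambda>i x. h i x \<oplus>\<^bsub>Term Y (i - 1)\<^esub> h' i x"])
    fix i show "(\<lambda>x. h i x \<oplus>\<^bsub>Term Y (i - 1)\<^esub> h' i x) \<in> mod_hom R (Term X i) (Term Y (i - 1))"
      using X by (intro hom_sum h h') simp
  next
    fix i x assume x: "x \<in> carrier (Term X i)"
    have c: "h i x \<in> carrier (Term Y (i - 1))" "h (i + 1) (Diff X i x) \<in> carrier (Term Y i)"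
      "h' i x \<in> carrier (Term Y (i - 1))" "h' (i + 1) (Diff X i x) \<in> carrier (Term Y i)"
      using X x by (simp_all add: htyD[OF h] htyD[OF h'])
    have "Diff Y (i - 1) (h i x \<oplus>\<^bsub>Term Y (i - 1)\<^esub> h' i x) = Diff Y (i - 1) (h i x) \<oplus>\<^bsub>Term Y i\<^esub> Diff Y (i - 1) (h' i x)"
      using diff_add[OF X(2) c(1,3)] by simp
    then show "f i x \<oplus>\<^bsub>Term Y i\<^esub> f' i x = g i x \<oplus>\<^bsub>Term Y i\<^esub> g' i x \<oplus>\<^bsub>Term Y i\<^esub> (Diff Y (i - 1) (h i x \<oplus>\<^bsub>Term Y (i - 1)\<^esub> h' i x) \<oplus>\<^bsub>Term Y i\<^esub>
        (h (i + 1) (Diff X i x) \<oplus>\<^bsub>Term Y (i + 1 - 1)\<^esub> h' (i + 1) (Diff X i x)))"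
      using X x c by (simp add: eq eq' cm_closed[OF g] cm_closed[OF g'] lm_ac)
  qed
qed

lemma homotopy_trans:
  assumes X: "cx X" "cx Y" and fg: "(f, g) \<in> homotopy_rel R X Y" and gk: "(g, k) \<in> homotopy_rel R X Y"
  shows "(f, k) \<in> homotopy_rel R X Y"
proof -
  obtain h where f: "f \<in> chain_maps R X Y" and g: "g \<in> chain_maps R X Y"
    and h: "\<And>i. h i \<in> mod_hom R (Term X i) (Term Y (i - 1))"
    and eq: "\<And>i x. x \<in> carrier (Term X i) \<Longrightarrow> f i x = g i x \<oplus>\<^bsub>Term Y i\<^esub>
             (Diff Y (i - 1) (h i x) \<oplus>\<^bsub>Term Y i\<^esub> h (i + 1) (Diff X i x))"
    using fg by (rule homotopyE) blast
  obtain h' where k: "k \<in> chain_maps R X Y"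
    and h': "\<And>i. h' i \<in> mod_hom R (Term X i) (Term Y (i - 1))"
    and eq': "\<And>i x. x \<in> carrier (Term X i) \<Longrightarrow> g i x = k i x \<oplus>\<^bsub>Term Y i\<^esub>
             (Diff Y (i - 1) (h' i x) \<oplus>\<^bsub>Term Y i\<^esub> h' (i + 1) (Diff X i x))"
    using gk by (rule homotopyE) blast
  show ?thesis
  proof (rule homotopyI[OF f k, of "\<lambda>i x. h i x \<oplus>\<^bsub>Term Y (i - 1)\<^esub> h' i x"])
    fix i show "(\<lambda>x. h i x \<oplus>\<^bsub>Term Y (i - 1)\<^esub> h' i x) \<in> mod_hom R (Term X i) (Term Y (i - 1))"
      using X by (intro hom_sum h h') simp
  next
    fix i x assume x: "x \<in> carrier (Term X i)"
    have c: "h i x \<in> carrier (Term Y (i - 1))" "h (i + 1) (Diff X i x) \<in> carrier (Term Y i)"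
      "h' i x \<in> carrier (Term Y (i - 1))" "h' (i + 1) (Diff X i x) \<in> carrier (Term Y i)"
      using X x by (simp_all add: htyD[OF h] htyD[OF h'])
    have "Diff Y (i - 1) (h i x \<oplus>\<^bsub>Term Y (i - 1)\<^esub> h' i x) = Diff Y (i - 1) (h i x) \<oplus>\<^bsub>Term Y i\<^esub> Diff Y (i - 1) (h' i x)"
      using diff_add[OF X(2) c(1,3)] by simp
    then show "f i x = k i x \<oplus>\<^bsub>Term Y i\<^esub> (Diff Y (i - 1) (h i x \<oplus>\<^bsub>Term Y (i - 1)\<^esub> h' i x) \<oplus>\<^bsub>Term Y i\<^esub>
        (h (i + 1) (Diff X i x) \<oplus>\<^bsub>Term Y (i + 1 - 1)\<^esub> h' (i + 1) (Diff X i x)))"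
      using X x c by (simp add: eq[OF x] eq'[OF x] cm_closed[OF k] lm_ac)
  qed
qed

lemma homotopy_comp_left:
  assumes X: "cx X" "cx Y" "cx Z" and fg: "(f, g) \<in> homotopy_rel R X Y" and k: "k \<in> chain_maps R Y Z"
  shows "(\<lambda>i x. k i (f i x), \<lambda>i x. k i (g i x)) \<in> homotopy_rel R X Z"
proof -
  obtain h where f: "f \<in> chain_maps R X Y" and g: "g \<in> chain_maps R X Y"
    and h: "\<And>i. h i \<in> mod_hom R (Term X i) (Term Y (i - 1))"
    and eq: "\<And>i x. x \<in> carrier (Term X i) \<Longrightarrow> f i x = g i x \<oplus>\<^bsub>Term Y i\<^esub>
             (Diff Y (i - 1) (h i x) \<oplus>\<^bsub>Term Y i\<^esub> h (i + 1) (Diff X i x))"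
    using fg by (rule homotopyE) blast
  show ?thesis
  proof (rule homotopyI[OF chain_maps_comp[OF f k] chain_maps_comp[OF g k], of "\<lambda>i x. k (i - 1) (h i x)"])
    fix i show "(\<lambda>x. k (i - 1) (h i x)) \<in> mod_hom R (Term X i) (Term Z (i - 1))"
      by (rule hom_comp[OF h cm_hom[OF k]])
  next
    fix i x assume x: "x \<in> carrier (Term X i)"
    have c: "h i x \<in> carrier (Term Y (i - 1))" "h (i + 1) (Diff X i x) \<in> carrier (Term Y i)"
      using X x by (simp_all add: htyD[OF h])
    have "k i (Diff Y (i - 1) (h i x)) = Diff Z (i - 1) (k (i - 1) (h i x))"
      by (rule cm_diff[OF k]) (use c in simp_all)
    then show "k i (f i x) = k i (g i x) \<oplus>\<^bsub>Term Z i\<^esub> (Diff Z (i - 1) (k (i - 1) (h i x)) \<oplus>\<^bsub>Term Z i\<^esub>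
        k (i + 1 - 1) (h (i + 1) (Diff X i x)))"
      using X x c by (simp add: eq[OF x] cm_closed[OF g] cm_add[OF k])
  qed
qed

lemma homotopy_comp_right:
  assumes X: "cx W" "cx X" "cx Y" and fg: "(f, g) \<in> homotopy_rel R X Y" and k: "k \<in> chain_maps R W X"
  shows "(\<lambda>i x. f i (k i x), \<lambda>i x. g i (k i x)) \<in> homotopy_rel R W Y"
proof -
  obtain h where f: "f \<in> chain_maps R X Y" and g: "g \<in> chain_maps R X Y"
    and h: "\<And>i. h i \<in> mod_hom R (Term X i) (Term Y (i - 1))"
    and eq: "\<And>i x. x \<in> carrier (Term X i) \<Longrightarrow> f i x = g i x \<oplus>\<^bsub>Term Y i\<^esub>
             (Diff Y (i - 1) (h i x) \<oplus>\<^bsub>Term Y i\<^esub> h (i + 1) (Diff X i x))"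
    using fg by (rule homotopyE) blast
  show ?thesis
  proof (rule homotopyI[OF chain_maps_comp[OF k f] chain_maps_comp[OF k g], of "\<lambda>i x. h i (k i x)"])
    fix i show "(\<lambda>x. h i (k i x)) \<in> mod_hom R (Term W i) (Term Y (i - 1))"
      by (rule hom_comp[OF cm_hom[OF k] h])
  next
    fix i x assume x: "x \<in> carrier (Term W i)"
    show "f i (k i x) = g i (k i x) \<oplus>\<^bsub>Term Y i\<^esub> (Diff Y (i - 1) (h i (k i x)) \<oplus>\<^bsub>Term Y i\<^esub>
        h (i + 1) (k (i + 1) (Diff W i x)))"
      using eq[OF cm_closed[OF k x]] cm_diff[OF k x] by simp
  qed
qed

lemma homotopy_comp:
  assumes X: "cx X" "cx Y" "cx Z" and "(f, f') \<in> homotopy_rel R X Y" "(g, g') \<in> homotopy_rel R Y Z"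
  shows "(\<lambda>i x. g i (f i x), \<lambda>i x. g' i (f' i x)) \<in> homotopy_rel R X Z"
proof -
  have g: "g \<in> chain_maps R Y Z" and f': "f' \<in> chain_maps R X Y" using assms(4,5) by (simp_all add: homotopy_rel_iff)
  show ?thesis
    by (rule homotopy_trans[OF X(1,3) homotopy_comp_left[OF X assms(4) g] homotopy_comp_right[OF X assms(5) f']])
qed

lemma hcls_eq_iff:
  assumes X: "cx X" "cx Y" and f: "f \<in> chain_maps R X Y" "g \<in> chain_maps R X Y"
  shows "hcls R X Y f = hcls R X Y g \<longleftrightarrow> (f, g) \<in> homotopy_rel R X Y"
proof
  assume "hcls R X Y f = hcls R X Y g"
  then show "(f, g) \<in> homotopy_rel R X Y" using homotopy_refl[OF X f(2)] by blast
next
  assume 1: "(f, g) \<in> homotopy_rel R X Y"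
  show "hcls R X Y f = hcls R X Y g"
    using homotopy_trans[OF X 1] homotopy_trans[OF X homotopy_sym[OF X 1]] by blast
qed

lemma hcls_self: "\<lbrakk>cx X; cx Y; f \<in> chain_maps R X Y\<rbrakk> \<Longrightarrow> f \<in> hcls R X Y f"
  using homotopy_refl by blast

lemma hcls_eqI: "\<lbrakk>cx X; cx Y; (f, g) \<in> homotopy_rel R X Y\<rbrakk> \<Longrightarrow> hcls R X Y f = hcls R X Y g"
  by (subst hcls_eq_iff) (simp_all add: homotopy_rel_iff)

abbreviation K :: "(('a, 'u) cplx, (int \<Rightarrow> 'u \<Rightarrow> 'u) set) add_cat" where "K \<equiv> Kb_mod R"

lemma K_Obj [simp]: "X \<in> Obj K \<longleftrightarrow> cx X"
  by (simp add: Kb_mod_def)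

lemma K_HomI: "f \<in> chain_maps R X Y \<Longrightarrow> hcls R X Y f \<in> Hom K X Y"
  unfolding Kb_mod_def by (simp add: quotientI)

lemma K_HomE:
  assumes "a \<in> Hom K X Y"
  obtains f where "f \<in> chain_maps R X Y" "a = hcls R X Y f"
  using assms unfolding Kb_mod_def by (auto elim: quotientE)

lemma K_Ident: "Ident K X = hcls R X X (\<lambda>i x. x)"
  by (simp add: Kb_mod_def)

text \<open>Composition and addition in \<open>Kb_mod\<close> are unions over all representatives;
  this reduces them to one pair.\<close>

lemma UN_const_eq:
  assumes "a \<in> A" "b \<in> B" "\<And>x y. x \<in> A \<Longrightarrow> y \<in> B \<Longrightarrow> F x y = c"
  shows "(\<Union>x \<in> A. \<Union>y \<in> B. F x y) = c"
  using assms by blast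

lemma K_Comp:
  assumes X: "cx X" "cx Y" "cx Z" and f: "f \<in> chain_maps R X Y" and g: "g \<in> chain_maps R Y Z"
  shows "Comp K X Y Z (hcls R Y Z g) (hcls R X Y f) = hcls R X Z (\<lambda>i x. g i (f i x))"
proof -
  have "(\<Union>f' \<in> hcls R X Y f. \<Union>g' \<in> hcls R Y Z g. hcls R X Z (\<lambda>i x. g' i (f' i x))) = hcls R X Z (\<lambda>i x. g i (f i x))"
  proof (rule UN_const_eq[OF hcls_self[OF X(1,2) f] hcls_self[OF X(2,3) g]])
    fix f' g' assume "f' \<in> hcls R X Y f" "g' \<in> hcls R Y Z g"
    then have "(f', f) \<in> homotopy_rel R X Y" "(g', g) \<in> homotopy_rel R Y Z"
      using homotopy_sym[OF X(1,2)] homotopy_sym[OF X(2,3)] by simp_all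
    then show "hcls R X Z (\<lambda>i x. g' i (f' i x)) = hcls R X Z (\<lambda>i x. g i (f i x))"
      by (rule hcls_eqI[OF X(1,3) homotopy_comp[OF X]])
  qed
  then show ?thesis by (simp add: Kb_mod_def)
qed

lemma K_HAdd:
  assumes X: "cx X" "cx Y" and f: "f \<in> chain_maps R X Y" and g: "g \<in> chain_maps R X Y"
  shows "HAdd K X Y (hcls R X Y f) (hcls R X Y g) = hcls R X Y (\<lambda>i x. f i x \<oplus>\<^bsub>Term Y i\<^esub> g i x)"
proof -
  have "(\<Union>f' \<in> hcls R X Y f. \<Union>g' \<in> hcls R X Y g. hcls R X Y (\<lambda>i x. f' i x \<oplus>\<^bsub>Term Y i\<^esub> g' i x)) = hcls R X Y (\<lambda>i x. f i x \<oplus>\<^bsub>Term Y i\<^esub> g i x)"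
  proof (rule UN_const_eq[OF hcls_self[OF X f] hcls_self[OF X g]])
    fix f' g' assume "f' \<in> hcls R X Y f" "g' \<in> hcls R X Y g"
    then have "(f', f) \<in> homotopy_rel R X Y" "(g', g) \<in> homotopy_rel R X Y"
      using homotopy_sym[OF X] by simp_all
    then show "hcls R X Y (\<lambda>i x. f' i x \<oplus>\<^bsub>Term Y i\<^esub> g' i x) = hcls R X Y (\<lambda>i x. f i x \<oplus>\<^bsub>Term Y i\<^esub> g i x)"
      by (rule hcls_eqI[OF X homotopy_add[OF X]])
  qed
  then show ?thesis by (simp add: Kb_mod_def)
qed

lemma category_K: "category K"
  unfolding category_def K_Obj
proof (intro conjI ballI)
  fix X :: "('a, 'u) cplx" assume "X \<in> Obj K"
  show "Ident K X \<in> Hom K X X" unfolding K_Ident by (rule K_HomI[OF chain_maps_id])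
next
  fix X Y :: "('a, 'u) cplx" and a assume "X \<in> Obj K" "Y \<in> Obj K" and a: "a \<in> Hom K X Y"
  then have X: "cx X" "cx Y" by simp_all
  obtain f where f: "f \<in> chain_maps R X Y" "a = hcls R X Y f" using a by (rule K_HomE)
  show "Comp K X X Y a (Ident K X) = a" "Comp K X Y Y (Ident K Y) a = a"
    unfolding f(2) K_Ident by (simp_all add: K_Comp X f(1) chain_maps_id)
next
  fix X Y Z :: "('a, 'u) cplx" and a b assume "X \<in> Obj K" "Y \<in> Obj K" "Z \<in> Obj K" and a: "a \<in> Hom K X Y" and b: "b \<in> Hom K Y Z"
  then have X: "cx X" "cx Y" "cx Z" by simp_all
  obtain f where f: "f \<in> chain_maps R X Y" "a = hcls R X Y f" using a by (rule K_HomE)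
  obtain g where g: "g \<in> chain_maps R Y Z" "b = hcls R Y Z g" using b by (rule K_HomE)
  show "Comp K X Y Z b a \<in> Hom K X Z"
    unfolding f(2) g(2) K_Comp[OF X f(1) g(1)] by (rule K_HomI[OF chain_maps_comp[OF f(1) g(1)]])
next
  fix W X Y Z :: "('a, 'u) cplx" and a b c
  assume "W \<in> Obj K" "X \<in> Obj K" "Y \<in> Obj K" "Z \<in> Obj K"
    and a: "a \<in> Hom K W X" and b: "b \<in> Hom K X Y" and c: "c \<in> Hom K Y Z"
  then have X: "cx W" "cx X" "cx Y" "cx Z" by simp_all
  obtain f where f: "f \<in> chain_maps R W X" "a = hcls R W X f" using a by (rule K_HomE)
  obtain g where g: "g \<in> chain_maps R X Y" "b = hcls R X Y g" using b by (rule K_HomE)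
  obtain h where h: "h \<in> chain_maps R Y Z" "c = hcls R Y Z h" using c by (rule K_HomE)
  show "Comp K W Y Z c (Comp K W X Y b a) = Comp K W X Z (Comp K X Y Z c b) a"
    unfolding f(2) g(2) h(2) K_Comp[OF X(1,2,3) f(1) g(1)] K_Comp[OF X(2,3,4) g(1) h(1)]
      K_Comp[OF X(1,3,4) chain_maps_comp[OF f(1) g(1)] h(1)] K_Comp[OF X(1,2,4) f(1) chain_maps_comp[OF g(1) h(1)]] ..
qed

end

section \<open>Cosets, quasi-isomorphisms and truncation\<close>

context ring_ctx
begin

context
  fixes M :: "('a, 'u) module" and N :: "'u set"
  assumes M: "left_module R M" and N: "submod R M N"
begin

lemma mem_coset: "z \<in> N +>\<^bsub>M\<^esub> x \<longleftrightarrow> (\<exists>b \<in> N. z = b \<oplus>\<^bsub>M\<^esub> x)"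
  by (auto simp: a_r_coset_def')

lemma coset_eq_iff:
  assumes x: "x \<in> carrier M" and y: "y \<in> carrier M"
  shows "N +>\<^bsub>M\<^esub> x = N +>\<^bsub>M\<^esub> y \<longleftrightarrow> (\<exists>b \<in> N. x = b \<oplus>\<^bsub>M\<^esub> y)"
proof
  assume eq: "N +>\<^bsub>M\<^esub> x = N +>\<^bsub>M\<^esub> y"
  have "x \<in> N +>\<^bsub>M\<^esub> x"
    unfolding mem_coset using submod_closed(2)[OF M N] M x by (intro bexI[of _ "\<zero>\<^bsub>M\<^esub>"]) simp_all
  then show "\<exists>b \<in> N. x = b \<oplus>\<^bsub>M\<^esub> y" unfolding eq mem_coset .
next
  assume "\<exists>b \<in> N. x = b \<oplus>\<^bsub>M\<^esub> y"
  then obtain b where b: "b \<in> N" "x = b \<oplus>\<^bsub>M\<^esub> y" by blast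
  have bM: "b \<in> carrier M" using submod_closed(1)[OF M N b(1)] .
  have y': "y = \<ominus>\<^bsub>M\<^esub> b \<oplus>\<^bsub>M\<^esub> x" unfolding b(2) using M bM y by simp
  show "N +>\<^bsub>M\<^esub> x = N +>\<^bsub>M\<^esub> y"
  proof (intro Set.set_eqI iffI)
    fix z assume "z \<in> N +>\<^bsub>M\<^esub> x"
    then obtain c where c: "c \<in> N" "z = c \<oplus>\<^bsub>M\<^esub> x" unfolding mem_coset by blast
    then have "z = (c \<oplus>\<^bsub>M\<^esub> b) \<oplus>\<^bsub>M\<^esub> y" using M submod_closed(1)[OF M N] bM y by (simp add: lm_assoc b(2))
    then show "z \<in> N +>\<^bsub>M\<^esub> y" unfolding mem_coset using submod_closed(3)[OF M N c(1) b(1)] by blast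
  next
    fix z assume "z \<in> N +>\<^bsub>M\<^esub> y"
    then obtain c where c: "c \<in> N" "z = c \<oplus>\<^bsub>M\<^esub> y" unfolding mem_coset by blast
    then have "z = (c \<oplus>\<^bsub>M\<^esub> \<ominus>\<^bsub>M\<^esub> b) \<oplus>\<^bsub>M\<^esub> x"
      using M submod_closed(1)[OF M N] bM x y by (simp add: lm_assoc y')
    then show "z \<in> N +>\<^bsub>M\<^esub> x" unfolding mem_coset
      using submod_closed(3)[OF M N c(1) submod_closed(5)[OF M N b(1)]] by blast
  qed
qed

lemma coset_rep_mem:
  assumes "x \<in> carrier M"
  obtains b where "b \<in> N" "coset_rep M N x = b \<oplus>\<^bsub>M\<^esub> x"
proof -
  have "x \<in> N +>\<^bsub>M\<^esub> x"
    unfolding mem_coset using submod_closed(2)[OF M N] M assms by (intro bexI[of _ "\<zero>\<^bsub>M\<^esub>"]) simp_all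
  then have "coset_rep M N x \<in> N +>\<^bsub>M\<^esub> x" unfolding coset_rep_def by (rule someI)
  then show ?thesis unfolding mem_coset using that by blast
qed

lemma coset_rep_closed:
  assumes "x \<in> carrier M"
  shows "coset_rep M N x \<in> carrier M"
proof -
  obtain b where b: "b \<in> N" "coset_rep M N x = b \<oplus>\<^bsub>M\<^esub> x" using assms by (rule coset_rep_mem)
  show ?thesis unfolding b(2) using M submod_closed(1)[OF M N b(1)] assms by simp
qed

lemma coset_rep_eqI:
  assumes "y \<in> carrier M" "b \<in> N"
  shows "coset_rep M N (b \<oplus>\<^bsub>M\<^esub> y) = coset_rep M N y"
proof -
  have "N +>\<^bsub>M\<^esub> (b \<oplus>\<^bsub>M\<^esub> y) = N +>\<^bsub>M\<^esub> y"
    by (subst coset_eq_iff) (use assms M submod_closed(1)[OF M N assms(2)] in auto)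
  then show ?thesis unfolding coset_rep_def by simp
qed

lemma coset_rep_idem:
  assumes "x \<in> carrier M"
  shows "coset_rep M N (coset_rep M N x) = coset_rep M N x"
proof -
  obtain b where b: "b \<in> N" "coset_rep M N x = b \<oplus>\<^bsub>M\<^esub> x" using assms by (rule coset_rep_mem)
  show ?thesis using coset_rep_eqI[OF assms b(1)] unfolding b(2)[symmetric] .
qed

lemma coset_rep_eqD:
  assumes x: "x \<in> carrier M" "y \<in> carrier M" and "coset_rep M N x = coset_rep M N y"
  shows "\<exists>b \<in> N. x = b \<oplus>\<^bsub>M\<^esub> y"
proof -
  obtain b where b: "b \<in> N" "coset_rep M N x = b \<oplus>\<^bsub>M\<^esub> x" using x(1) by (rule coset_rep_mem)
  obtain c where c: "c \<in> N" "coset_rep M N y = c \<oplus>\<^bsub>M\<^esub> y" using x(2) by (rule coset_rep_mem)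
  have bc: "b \<in> carrier M" "c \<in> carrier M" using submod_closed(1)[OF M N] b c by auto
  have "\<ominus>\<^bsub>M\<^esub> b \<oplus>\<^bsub>M\<^esub> (b \<oplus>\<^bsub>M\<^esub> x) = \<ominus>\<^bsub>M\<^esub> b \<oplus>\<^bsub>M\<^esub> (c \<oplus>\<^bsub>M\<^esub> y)"
    using assms(3) unfolding b(2) c(2) by simp
  then have "x = (\<ominus>\<^bsub>M\<^esub> b \<oplus>\<^bsub>M\<^esub> c) \<oplus>\<^bsub>M\<^esub> y" using M bc x by (simp add: lm_assoc)
  then show ?thesis using submod_closed(3)[OF M N submod_closed(5)[OF M N b(1)] c(1)] by blast
qed

lemma coset_rep_eq_zero_iff:
  assumes x: "x \<in> carrier M"
  shows "coset_rep M N x = coset_rep M N \<zero>\<^bsub>M\<^esub> \<longleftrightarrow> x \<in> N"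
proof
  assume "coset_rep M N x = coset_rep M N \<zero>\<^bsub>M\<^esub>"
  from coset_rep_eqD[OF x lm_zero[OF M] this]
  obtain b where "b \<in> N" "x = b \<oplus>\<^bsub>M\<^esub> \<zero>\<^bsub>M\<^esub>" by blast
  then show "x \<in> N" using M submod_closed(1)[OF M N] by simp
next
  assume "x \<in> N"
  then show "coset_rep M N x = coset_rep M N \<zero>\<^bsub>M\<^esub>"
    using coset_rep_eqI[of "\<zero>\<^bsub>M\<^esub>" x] M x by simp
qed

lemma coset_rep_add:
  assumes x: "x \<in> carrier M" "y \<in> carrier M"
  shows "coset_rep M N (coset_rep M N x \<oplus>\<^bsub>M\<^esub> coset_rep M N y) = coset_rep M N (x \<oplus>\<^bsub>M\<^esub> y)"
proof -
  obtain b where b: "b \<in> N" "coset_rep M N x = b \<oplus>\<^bsub>M\<^esub> x" using x(1) by (rule coset_rep_mem)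
  obtain c where c: "c \<in> N" "coset_rep M N y = c \<oplus>\<^bsub>M\<^esub> y" using x(2) by (rule coset_rep_mem)
  have bc: "b \<in> carrier M" "c \<in> carrier M" using submod_closed(1)[OF M N] b c by auto
  have "b \<oplus>\<^bsub>M\<^esub> x \<oplus>\<^bsub>M\<^esub> (c \<oplus>\<^bsub>M\<^esub> y) = (b \<oplus>\<^bsub>M\<^esub> c) \<oplus>\<^bsub>M\<^esub> (x \<oplus>\<^bsub>M\<^esub> y)" using M bc x by (simp add: lm_ac)
  then show ?thesis
    unfolding b(2) c(2) using coset_rep_eqI[of "x \<oplus>\<^bsub>M\<^esub> y" "b \<oplus>\<^bsub>M\<^esub> c"] submod_closed(3)[OF M N b(1) c(1)] M x by simp
qed

lemma coset_rep_smult: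
  assumes x: "a \<in> carrier R" "x \<in> carrier M"
  shows "coset_rep M N (a \<odot>\<^bsub>M\<^esub> coset_rep M N x) = coset_rep M N (a \<odot>\<^bsub>M\<^esub> x)"
proof -
  obtain b where b: "b \<in> N" "coset_rep M N x = b \<oplus>\<^bsub>M\<^esub> x" using x(2) by (rule coset_rep_mem)
  have bM: "b \<in> carrier M" using submod_closed(1)[OF M N] b by auto
  show ?thesis
    unfolding b(2) using coset_rep_eqI[of "a \<odot>\<^bsub>M\<^esub> x" "a \<odot>\<^bsub>M\<^esub> b"] submod_closed(4)[OF M N x(1) b(1)] M x bM
    by (simp add: lm_smult_add)
qed

lemma quot_module_simps:
  "carrier (quot_module M N) = coset_rep M N ` carrier M"
  "\<zero>\<^bsub>quot_module M N\<^esub> = coset_rep M N \<zero>\<^bsub>M\<^esub>"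
  "x \<oplus>\<^bsub>quot_module M N\<^esub> y = coset_rep M N (x \<oplus>\<^bsub>M\<^esub> y)"
  "a \<odot>\<^bsub>quot_module M N\<^esub> x = coset_rep M N (a \<odot>\<^bsub>M\<^esub> x)"
  by (simp_all add: quot_module_def)

text \<open>The elements are representatives and not cosets, so the axioms are not those of a
  quotient group. Each reduces to the axiom of \<open>M\<close> because an inner
  \<open>coset_rep\<close> is absorbed by an outer one.\<close>

lemma quot_left_module: "left_module R (quot_module M N)"
proof -
  note q = quot_module_simps coset_rep_add coset_rep_smult
  have "abelian_group (quot_module M N)"
  proof (rule abelian_groupI)
    fix x assume "x \<in> carrier (quot_module M N)"
    then obtain x' where x: "x' \<in> carrier M" "x = coset_rep M N x'" by (auto simp: q)
    have "coset_rep M N (\<ominus>\<^bsub>M\<^esub> x') \<oplus>\<^bsub>quot_module M N\<^esub> x = \<zero>\<^bsub>quot_module M N\<^esub>"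
      using x M by (simp add: q)
    then show "\<exists>y \<in> carrier (quot_module M N). y \<oplus>\<^bsub>quot_module M N\<^esub> x = \<zero>\<^bsub>quot_module M N\<^esub>"
      using x(1) M by (intro bexI[of _ "coset_rep M N (\<ominus>\<^bsub>M\<^esub> x')"]) (simp_all add: q)
  next
    fix x y z assume "x \<in> carrier (quot_module M N)" "y \<in> carrier (quot_module M N)" "z \<in> carrier (quot_module M N)"
    then obtain x' y' z' where "x' \<in> carrier M" "x = coset_rep M N x'" "y' \<in> carrier M" "y = coset_rep M N y'"
      "z' \<in> carrier M" "z = coset_rep M N z'" by (auto simp: q)
    then show "x \<oplus>\<^bsub>quot_module M N\<^esub> y \<oplus>\<^bsub>quot_module M N\<^esub> z = x \<oplus>\<^bsub>quot_module M N\<^esub> (y \<oplus>\<^bsub>quot_module M N\<^esub> z)"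
      using M by (simp add: q lm_assoc)
  next
    fix x y assume "x \<in> carrier (quot_module M N)" "y \<in> carrier (quot_module M N)"
    then obtain x' y' where xy: "x' \<in> carrier M" "x = coset_rep M N x'" "y' \<in> carrier M" "y = coset_rep M N y'"
      by (auto simp: q)
    then show "x \<oplus>\<^bsub>quot_module M N\<^esub> y = y \<oplus>\<^bsub>quot_module M N\<^esub> x"
      using M by (simp add: q lm_comm)
    show "x \<oplus>\<^bsub>quot_module M N\<^esub> y \<in> carrier (quot_module M N)" using xy M by (simp add: q)
  next
    fix x assume "x \<in> carrier (quot_module M N)"
    then obtain x' where "x' \<in> carrier M" "x = coset_rep M N x'" by (auto simp: q)
    then show "\<zero>\<^bsub>quot_module M N\<^esub> \<oplus>\<^bsub>quot_module M N\<^esub> x = x" using M by (simp add: q)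
  next
    show "\<zero>\<^bsub>quot_module M N\<^esub> \<in> carrier (quot_module M N)" using M by (simp add: q)
  qed
  moreover have "left_module_axioms R (quot_module M N)"
  proof
    fix a b x assume ab: "a \<in> carrier R" "b \<in> carrier R" and "x \<in> carrier (quot_module M N)"
    then obtain x' where "x' \<in> carrier M" "x = coset_rep M N x'" by (auto simp: q)
    then show "(a \<oplus> b) \<odot>\<^bsub>quot_module M N\<^esub> x = a \<odot>\<^bsub>quot_module M N\<^esub> x \<oplus>\<^bsub>quot_module M N\<^esub> b \<odot>\<^bsub>quot_module M N\<^esub> x"
      "(a \<otimes> b) \<odot>\<^bsub>quot_module M N\<^esub> x = a \<odot>\<^bsub>quot_module M N\<^esub> (b \<odot>\<^bsub>quot_module M N\<^esub> x)"
      using M ab by (simp_all add: q lm_add_smult lm_mult_smult)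
  next
    fix a x y assume a: "a \<in> carrier R" and "x \<in> carrier (quot_module M N)" "y \<in> carrier (quot_module M N)"
    then obtain x' y' where "x' \<in> carrier M" "x = coset_rep M N x'" "y' \<in> carrier M" "y = coset_rep M N y'"
      by (auto simp: q)
    then show "a \<odot>\<^bsub>quot_module M N\<^esub> (x \<oplus>\<^bsub>quot_module M N\<^esub> y) =
        a \<odot>\<^bsub>quot_module M N\<^esub> x \<oplus>\<^bsub>quot_module M N\<^esub> a \<odot>\<^bsub>quot_module M N\<^esub> y"
      using M a by (simp add: q lm_smult_add)
  next
    fix x assume "x \<in> carrier (quot_module M N)"
    then obtain x' where "x' \<in> carrier M" "x = coset_rep M N x'" by (auto simp: q)
    then show "\<one> \<odot>\<^bsub>quot_module M N\<^esub> x = x" using M by (simp add: q)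
  next
    fix a x assume a: "a \<in> carrier R" and "x \<in> carrier (quot_module M N)"
    then obtain x' where "x' \<in> carrier M" "x = coset_rep M N x'" by (auto simp: q)
    then show "a \<odot>\<^bsub>quot_module M N\<^esub> x \<in> carrier (quot_module M N)" using M a by (simp add: q)
  qed
  ultimately show ?thesis using ring_axioms by (simp add: left_module_def)
qed

lemma quot_hom: "coset_rep M N \<in> mod_hom R M (quot_module M N)"
  by (rule mod_homI) (simp_all add: quot_module_simps coset_rep_add coset_rep_smult)

end

lemma hom_lincomb:
  fixes M N :: "('a, 'u) module"
  assumes "left_module R M" "left_module R N" "f \<in> mod_hom R M N"
    "\<And>j. j < k \<Longrightarrow> c j \<in> carrier R" "\<And>j. j < k \<Longrightarrow> b j \<in> carrier M"
  shows "f (lincomb M c b k) = lincomb N c (\<lambda>j. f (b j)) k"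
  using assms(4,5)
  by (induction k) (simp_all add: hom_zero[OF assms(1-3)] hom_add[OF assms(3)] hom_smult[OF assms(3)] assms(1))

lemma fg_image:
  fixes M N :: "('a, 'u) module"
  assumes M: "fg_module R M" and N: "left_module R N" and f: "f \<in> mod_hom R M N" "f ` carrier M = carrier N"
  shows "fg_module R N"
proof -
  have M': "left_module R M" using M by simp
  obtain b k where bk: "\<forall>j<k. b j \<in> carrier M"
    "\<And>x. x \<in> carrier M \<Longrightarrow> \<exists>c. (\<forall>j<k. c j \<in> carrier R) \<and> x = lincomb M c b k"
    using M fg_module_iff[OF M'] unfolding gens_def by auto
  have "\<exists>c. (\<forall>j<k. c j \<in> carrier R) \<and> y = lincomb N c (\<lambda>j. f (b j)) k" if y: "y \<in> carrier N" for y
  proof -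
    obtain x where x: "x \<in> carrier M" "y = f x" using y unfolding f(2)[symmetric] by blast
    obtain c where c: "\<forall>j<k. c j \<in> carrier R" "x = lincomb M c b k" using bk(2)[OF x(1)] by auto
    have "y = lincomb N c (\<lambda>j. f (b j)) k"
      unfolding x(2) c(2) by (rule hom_lincomb[OF M' N f(1)]) (use c(1) bk(1) in simp_all)
    with c(1) show ?thesis by blast
  qed
  then have "gens R N (carrier N) (\<lambda>j. f (b j)) k"
    unfolding gens_def using bk(1) hom_closed[OF f(1)] by simp
  then show ?thesis unfolding fg_module_iff[OF N] by blast
qed

lemma quot_fg:
  assumes "fg_module R M" "submod R M N"
  shows "fg_module R (quot_module M N)"
  using assms by (intro fg_image[of M "quot_module M N" "coset_rep M N"] quot_left_module quot_hom)
    (simp_all add: quot_module_def)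

section \<open>Quasi-isomorphisms in terms of elements\<close>

lemma cocyclesD: "x \<in> cocycles X i \<Longrightarrow> x \<in> carrier (Term X i)" "x \<in> cocycles X i \<Longrightarrow> Diff X i x = \<zero>\<^bsub>Term X (i + 1)\<^esub>"
  by (simp_all add: cocycles_def)

lemma submod_cocycles: "cx X \<Longrightarrow> submod R (Term X i) (cocycles X i)"
  unfolding submod_def cocycles_def by (auto simp: diff_smult)

lemma coboundariesE:
  assumes "x \<in> coboundaries X i"
  obtains w where "w \<in> carrier (Term X (i - 1))" "x = Diff X (i - 1) w"
  using assms by (auto simp: coboundaries_def)

lemma coboundariesI: "w \<in> carrier (Term X (i - 1)) \<Longrightarrow> Diff X (i - 1) w \<in> coboundaries X i"
  by (auto simp: coboundaries_def)

lemma submod_coboundaries: "cx X \<Longrightarrow> submod R (Term X i) (coboundaries X i)"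
  unfolding coboundaries_def by (rule submod_image) (auto intro: diff_hom)

text \<open>Injectivity and surjectivity on cohomology, written without cosets.\<close>

definition qis :: "('a, 'u) cplx \<Rightarrow> ('a, 'u) cplx \<Rightarrow> (int \<Rightarrow> 'u \<Rightarrow> 'u) \<Rightarrow> bool" where
  "qis X Y f \<longleftrightarrow> (\<forall>i. \<forall>x \<in> cocycles X i. f i x \<in> coboundaries Y i \<longrightarrow> x \<in> coboundaries X i) \<and>
     (\<forall>i. \<forall>y \<in> cocycles Y i. \<exists>x \<in> cocycles X i. \<exists>w \<in> coboundaries Y i. y = w \<oplus>\<^bsub>Term Y i\<^esub> f i x)"

lemma cm_cocycles:
  assumes "cx X" "cx Y" "f \<in> chain_maps R X Y" "x \<in> cocycles X i"
  shows "f i x \<in> cocycles Y i"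
  using assms cm_diff[OF assms(3), of x i "i + 1"] by (simp add: cocycles_def cmD[OF assms(3)])

lemma cm_coboundaries:
  assumes "cx X" "cx Y" "f \<in> chain_maps R X Y" "x \<in> coboundaries X i"
  shows "f i x \<in> coboundaries Y i"
  using assms(4)
proof (rule coboundariesE)
  fix w assume w: "w \<in> carrier (Term X (i - 1))" "x = Diff X (i - 1) w"
  have "f i x = Diff Y (i - 1) (f (i - 1) w)"
    unfolding w(2) by (rule cm_diff[OF assms(3)]) (use w in simp_all)
  then show ?thesis using coboundariesI[OF cm_closed[OF assms(3) w(1)]] by simp
qed

lemma bij_cohomology_iff:
  assumes X: "cx X" "cx Y" and f: "f \<in> chain_maps R X Y"
  shows "(\<forall>i. bij_betw (cohomology_map Y f i) (cohomology X i) (cohomology Y i)) \<longleftrightarrow> qis X Y f"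
proof -
  have lm: "left_module R (Term X i)" "left_module R (Term Y i)" for i using X by simp_all
  note BX = submod_coboundaries[OF X(1)] and BY = submod_coboundaries[OF X(2)]
  \<comment> \<open>The union in \<open>cohomology_map\<close> collapses because \<open>f\<close>
    carries coboundaries to coboundaries; after this both halves of bijectivity speak about
    elements.\<close>
  have map: "cohomology_map Y f i (coboundaries X i +>\<^bsub>Term X i\<^esub> x) = coboundaries Y i +>\<^bsub>Term Y i\<^esub> f i x"
    if x: "x \<in> carrier (Term X i)" for i x
  proof -
    have "coboundaries Y i +>\<^bsub>Term Y i\<^esub> f i x' = coboundaries Y i +>\<^bsub>Term Y i\<^esub> f i x"
      if x': "x' \<in> coboundaries X i +>\<^bsub>Term X i\<^esub> x" for x'
    proof -
      obtain b where b: "b \<in> coboundaries X i" "x' = b \<oplus>\<^bsub>Term X i\<^esub> x" using x' mem_coset[OF lm(1) BX] by blast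
      have bX: "b \<in> carrier (Term X i)" using submod_closed(1)[OF lm(1) BX b(1)] .
      show ?thesis
        by (subst coset_eq_iff[OF lm(2) BY])
          (use b bX x lm cm_coboundaries[OF X f b(1)] in \<open>auto simp: cmD[OF f]\<close>)
    qed
    moreover have "x \<in> coboundaries X i +>\<^bsub>Term X i\<^esub> x"
      unfolding mem_coset[OF lm(1) BX] using submod_closed(2)[OF lm(1) BX] lm x
      by (intro bexI[of _ "\<zero>\<^bsub>Term X i\<^esub>"]) simp_all
    ultimately show ?thesis unfolding cohomology_map_def by blast
  qed
  have inj: "inj_on (cohomology_map Y f i) (cohomology X i) \<longleftrightarrow>
      (\<forall>x \<in> cocycles X i. f i x \<in> coboundaries Y i \<longrightarrow> x \<in> coboundaries X i)" for i
  proof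
    assume inj: "inj_on (cohomology_map Y f i) (cohomology X i)"
    show "\<forall>x \<in> cocycles X i. f i x \<in> coboundaries Y i \<longrightarrow> x \<in> coboundaries X i"
    proof (intro ballI impI)
      fix x assume x: "x \<in> cocycles X i" and fx: "f i x \<in> coboundaries Y i"
      have x': "x \<in> carrier (Term X i)" using cocyclesD(1)[OF x] .
      have 0: "\<zero>\<^bsub>Term X i\<^esub> \<in> cocycles X i" using submod_closed(2)[OF lm(1) submod_cocycles[OF X(1)]] .
      have "coboundaries Y i +>\<^bsub>Term Y i\<^esub> f i x = coboundaries Y i +>\<^bsub>Term Y i\<^esub> f i \<zero>\<^bsub>Term X i\<^esub>"
      proof -
        have "f i x = f i x \<oplus>\<^bsub>Term Y i\<^esub> f i \<zero>\<^bsub>Term X i\<^esub>"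
          unfolding cm_zero[OF f X] by (rule lm_r_zero[OF lm(2) cm_closed[OF f x'], symmetric])
        then show ?thesis
          using coset_eq_iff[OF lm(2) BY cm_closed[OF f x'] cm_closed[OF f lm_zero[OF lm(1)]]] fx by blast
      qed
      then have "cohomology_map Y f i (coboundaries X i +>\<^bsub>Term X i\<^esub> x) =
          cohomology_map Y f i (coboundaries X i +>\<^bsub>Term X i\<^esub> \<zero>\<^bsub>Term X i\<^esub>)"
        unfolding map[OF x'] map[OF lm_zero[OF lm(1)]] .
      moreover have "coboundaries X i +>\<^bsub>Term X i\<^esub> x \<in> cohomology X i"
        "coboundaries X i +>\<^bsub>Term X i\<^esub> \<zero>\<^bsub>Term X i\<^esub> \<in> cohomology X i"
        unfolding cohomology_def using x 0 by blast+
      ultimately have "coboundaries X i +>\<^bsub>Term X i\<^esub> x = coboundaries X i +>\<^bsub>Term X i\<^esub> \<zero>\<^bsub>Term X i\<^esub>"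
        by (rule inj_onD[OF inj])
      then obtain b where "b \<in> coboundaries X i" "x = b \<oplus>\<^bsub>Term X i\<^esub> \<zero>\<^bsub>Term X i\<^esub>"
        using coset_eq_iff[OF lm(1) BX x' lm_zero[OF lm(1)]] by blast
      then show "x \<in> coboundaries X i" using lm submod_closed(1)[OF lm(1) BX] by simp
    qed
  next
    assume *: "\<forall>x \<in> cocycles X i. f i x \<in> coboundaries Y i \<longrightarrow> x \<in> coboundaries X i"
    show "inj_on (cohomology_map Y f i) (cohomology X i)"
    proof (rule inj_onI)
      fix a b assume "a \<in> cohomology X i" "b \<in> cohomology X i" and eq: "cohomology_map Y f i a = cohomology_map Y f i b"
      then obtain x y where xy: "x \<in> cocycles X i" "y \<in> cocycles X i"
        and ab: "a = coboundaries X i +>\<^bsub>Term X i\<^esub> x" "b = coboundaries X i +>\<^bsub>Term X i\<^esub> y"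
        unfolding cohomology_def by blast
      have c: "x \<in> carrier (Term X i)" "y \<in> carrier (Term X i)" using cocyclesD(1)[OF xy(1)] cocyclesD(1)[OF xy(2)] .
      from eq obtain w where w: "w \<in> coboundaries Y i" "f i x = w \<oplus>\<^bsub>Term Y i\<^esub> f i y"
        unfolding ab map[OF c(1)] map[OF c(2)] using coset_eq_iff[OF lm(2) BY cm_closed[OF f c(1)] cm_closed[OF f c(2)]] by blast
      have wc: "w \<in> carrier (Term Y i)" using submod_closed(1)[OF lm(2) BY w(1)] .
      let ?u = "x \<oplus>\<^bsub>Term X i\<^esub> \<ominus>\<^bsub>Term X i\<^esub> y"
      have "f i ?u = w" using X c lm wc cm_closed[OF f] w(2) by (simp add: cmD[OF f] lm_assoc)
      moreover have "?u \<in> cocycles X i"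
        using submod_closed[OF lm(1) submod_cocycles[OF X(1)]] xy by simp
      ultimately have "?u \<in> coboundaries X i" using * w(1) by blast
      moreover have "x = ?u \<oplus>\<^bsub>Term X i\<^esub> y" using c lm by (simp add: lm_assoc)
      ultimately show "a = b" unfolding ab using coset_eq_iff[OF lm(1) BX c] by blast
    qed
  qed
  have surj: "cohomology_map Y f i ` cohomology X i = cohomology Y i \<longleftrightarrow>
      (\<forall>y \<in> cocycles Y i. \<exists>x \<in> cocycles X i. \<exists>w \<in> coboundaries Y i. y = w \<oplus>\<^bsub>Term Y i\<^esub> f i x)" for i
  proof -
    have im: "cohomology_map Y f i ` cohomology X i = (\<lambda>x. coboundaries Y i +>\<^bsub>Term Y i\<^esub> f i x) ` cocycles X i"
      unfolding cohomology_def image_image by (rule image_cong[OF refl]) (rule map[OF cocyclesD(1)])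
    have sub: "cohomology_map Y f i ` cohomology X i \<subseteq> cohomology Y i"
      unfolding im unfolding cohomology_def using cm_cocycles[OF X f] by blast
    have "cohomology Y i \<subseteq> cohomology_map Y f i ` cohomology X i \<longleftrightarrow> (\<forall>y \<in> cocycles Y i. \<exists>x \<in> cocycles X i.
        coboundaries Y i +>\<^bsub>Term Y i\<^esub> y = coboundaries Y i +>\<^bsub>Term Y i\<^esub> f i x)"
      unfolding im unfolding cohomology_def by (simp only: image_subset_iff image_iff ball_simps)
    also have "\<dots> \<longleftrightarrow> (\<forall>y \<in> cocycles Y i. \<exists>x \<in> cocycles X i. \<exists>w \<in> coboundaries Y i. y = w \<oplus>\<^bsub>Term Y i\<^esub> f i x)"
      by (intro ball_cong bex_cong refl coset_eq_iff[OF lm(2) BY] cocyclesD(1) cm_closed[OF f])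
    finally show ?thesis using sub by blast
  qed
  show ?thesis unfolding bij_betw_def inj surj qis_def by blast
qed

text \<open>On a cocycle the summand \<open>h (i + 1) (Diff X i x)\<close> vanishes, so homotopic
  maps differ there by a coboundary.\<close>

lemma qis_homotopic:
  assumes X: "cx X" "cx Y" and fg: "(f, g) \<in> homotopy_rel R X Y" and q: "qis X Y g"
  shows "qis X Y f"
proof -
  have lm: "left_module R (Term X i)" "left_module R (Term Y i)" for i using X by simp_all
  note BY = submod_coboundaries[OF X(2)]
  obtain h where f: "f \<in> chain_maps R X Y" and g: "g \<in> chain_maps R X Y"
    and h: "\<And>i. h i \<in> mod_hom R (Term X i) (Term Y (i - 1))"
    and eq: "\<And>i x. x \<in> carrier (Term X i) \<Longrightarrow> f i x = g i x \<oplus>\<^bsub>Term Y i\<^esub>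
             (Diff Y (i - 1) (h i x) \<oplus>\<^bsub>Term Y i\<^esub> h (i + 1) (Diff X i x))"
    using fg by (rule homotopyE) blast
  have e: "\<exists>b \<in> coboundaries Y i. f i x = b \<oplus>\<^bsub>Term Y i\<^esub> g i x \<and> g i x = \<ominus>\<^bsub>Term Y i\<^esub> b \<oplus>\<^bsub>Term Y i\<^esub> f i x" if x: "x \<in> cocycles X i" for i x
  proof -
    have xc: "x \<in> carrier (Term X i)" "Diff X i x = \<zero>\<^bsub>Term X (i + 1)\<^esub>" using cocyclesD[OF x] by auto
    have c: "h i x \<in> carrier (Term Y (i - 1))" using xc by (simp add: htyD[OF h])
    have dc: "Diff Y (i - 1) (h i x) \<in> carrier (Term Y i)" using X c by simp
    have hz: "h (i + 1) \<zero>\<^bsub>Term X (i + 1)\<^esub> = \<zero>\<^bsub>Term Y i\<^esub>" using hty_zero[OF h X, of "i + 1"] by simp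
    have "f i x = Diff Y (i - 1) (h i x) \<oplus>\<^bsub>Term Y i\<^esub> g i x"
      unfolding eq[OF xc(1)] xc(2) hz using lm dc cm_closed[OF g xc(1)] by (simp add: lm_comm)
    then show ?thesis using coboundariesI[OF c] lm dc cm_closed[OF g xc(1)] by auto
  qed
  show ?thesis
    unfolding qis_def
  proof (intro conjI allI ballI impI)
    fix i x assume x: "x \<in> cocycles X i" and fx: "f i x \<in> coboundaries Y i"
    obtain b where b: "b \<in> coboundaries Y i" "g i x = \<ominus>\<^bsub>Term Y i\<^esub> b \<oplus>\<^bsub>Term Y i\<^esub> f i x" using e[OF x] by blast
    have "g i x \<in> coboundaries Y i" unfolding b(2)
      by (rule submod_closed(3)[OF lm(2) BY submod_closed(5)[OF lm(2) BY b(1)] fx])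
    then show "x \<in> coboundaries X i" using q x unfolding qis_def by blast
  next
    fix i y assume "y \<in> cocycles Y i"
    then obtain x w where x: "x \<in> cocycles X i" and w: "w \<in> coboundaries Y i" "y = w \<oplus>\<^bsub>Term Y i\<^esub> g i x"
      using q unfolding qis_def by blast
    obtain b where b: "b \<in> coboundaries Y i" "g i x = \<ominus>\<^bsub>Term Y i\<^esub> b \<oplus>\<^bsub>Term Y i\<^esub> f i x" using e[OF x] by blast
    have "y = (w \<oplus>\<^bsub>Term Y i\<^esub> \<ominus>\<^bsub>Term Y i\<^esub> b) \<oplus>\<^bsub>Term Y i\<^esub> f i x"
      unfolding w(2) b(2) using lm submod_closed(1)[OF lm(2) BY] w(1) b(1) cm_closed[OF f cocyclesD(1)[OF x]]
      by (simp add: lm_assoc)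
    moreover have "w \<oplus>\<^bsub>Term Y i\<^esub> \<ominus>\<^bsub>Term Y i\<^esub> b \<in> coboundaries Y i"
      by (rule submod_closed(3)[OF lm(2) BY w(1) submod_closed(5)[OF lm(2) BY b(1)]])
    ultimately show "\<exists>x \<in> cocycles X i. \<exists>w \<in> coboundaries Y i. y = w \<oplus>\<^bsub>Term Y i\<^esub> f i x" using x by blast
  qed
qed

text \<open>\<open>quasi_isos\<close> asks for the condition on a whole class; by homotopy
  invariance one representative decides.\<close>

lemma quasi_isos_iff:
  assumes X: "cx X" "cx Y" and f: "f \<in> chain_maps R X Y"
  shows "hcls R X Y f \<in> quasi_isos R X Y \<longleftrightarrow> qis X Y f"
proof -
  have "hcls R X Y f \<in> quasi_isos R X Y \<longleftrightarrow> (\<forall>g \<in> hcls R X Y f. qis X Y g)"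
    unfolding quasi_isos_def using K_HomI[OF f] bij_cohomology_iff[OF X] by (auto simp: homotopy_rel_iff)
  also have "\<dots> \<longleftrightarrow> qis X Y f"
    using qis_homotopic[OF X] homotopy_sym[OF X] hcls_self[OF X f] by blast
  finally show ?thesis .
qed

lemma qis_id:
  assumes "cx X"
  shows "qis X X (\<lambda>i x. x)"
  unfolding qis_def
proof (intro conjI allI ballI impI)
  fix i y assume y: "y \<in> cocycles X i"
  have "y = \<zero>\<^bsub>Term X i\<^esub> \<oplus>\<^bsub>Term X i\<^esub> y" using cocyclesD(1)[OF y] assms by simp
  then show "\<exists>x \<in> cocycles X i. \<exists>w \<in> coboundaries X i. y = w \<oplus>\<^bsub>Term X i\<^esub> x"
    using y submod_closed(2)[OF cx_lm[OF assms] submod_coboundaries[OF assms]] by blast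
qed

lemma qis_comp:
  assumes X: "cx X" "cx Y" "cx Z" and f: "f \<in> chain_maps R X Y" "qis X Y f" and g: "g \<in> chain_maps R Y Z" "qis Y Z g"
  shows "qis X Z (\<lambda>i x. g i (f i x))"
  unfolding qis_def
proof (intro conjI allI ballI impI)
  fix i x assume x: "x \<in> cocycles X i" "g i (f i x) \<in> coboundaries Z i"
  have "f i x \<in> coboundaries Y i" using g(2) x(2) cm_cocycles[OF X(1,2) f(1) x(1)] unfolding qis_def by blast
  then show "x \<in> coboundaries X i" using f(2) x(1) unfolding qis_def by blast
next
  fix i z assume "z \<in> cocycles Z i"
  then obtain y w where y: "y \<in> cocycles Y i" and w: "w \<in> coboundaries Z i" "z = w \<oplus>\<^bsub>Term Z i\<^esub> g i y"
    using g(2) unfolding qis_def by blast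
  obtain x v where x: "x \<in> cocycles X i" and v: "v \<in> coboundaries Y i" "y = v \<oplus>\<^bsub>Term Y i\<^esub> f i x"
    using f(2) y unfolding qis_def by blast
  have lm: "left_module R (Term Z i)" using X by simp
  have gv: "g i v \<in> coboundaries Z i" by (rule cm_coboundaries[OF X(2,3) g(1) v(1)])
  have c: "f i x \<in> carrier (Term Y i)" "v \<in> carrier (Term Y i)" "w \<in> carrier (Term Z i)"
    using cm_closed[OF f(1) cocyclesD(1)[OF x]] submod_closed(1)[OF cx_lm[OF X(2)] submod_coboundaries[OF X(2)] v(1)]
      submod_closed(1)[OF lm submod_coboundaries[OF X(3)] w(1)] by auto
  have "z = (w \<oplus>\<^bsub>Term Z i\<^esub> g i v) \<oplus>\<^bsub>Term Z i\<^esub> g i (f i x)"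
    unfolding w(2) v(2) using lm c by (simp add: cmD[OF g(1)] lm_assoc)
  then show "\<exists>x \<in> cocycles X i. \<exists>w \<in> coboundaries Z i. z = w \<oplus>\<^bsub>Term Z i\<^esub> g i (f i x)"
    using x submod_closed(3)[OF lm submod_coboundaries[OF X(3)] w(1) gv] by blast
qed

text \<open>Acyclicity of the mapping cone of a quasi-isomorphism, in terms of elements.\<close>

lemma qis_cone:
  assumes Z: "cx Z" "cx Y" and t: "t \<in> chain_maps R Z Y" "qis Z Y t"
    and z: "z \<in> carrier (Term Z (i + 1))" "Diff Z (i + 1) z = \<zero>\<^bsub>Term Z (i + 2)\<^esub>"
    and y: "y \<in> carrier (Term Y i)" "t (i + 1) z = Diff Y i y"
  obtains z' y' where "z' \<in> carrier (Term Z i)" "y' \<in> carrier (Term Y (i - 1))"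
    "Diff Z i z' = z" "y = t i z' \<oplus>\<^bsub>Term Y i\<^esub> Diff Y (i - 1) y'"
proof -
  have lm: "left_module R (Term Z i)" "left_module R (Term Y i)" for i using Z by simp_all
  have "z \<in> cocycles Z (i + 1)" using z by (simp add: cocycles_def add.commute)
  moreover have "t (i + 1) z \<in> coboundaries Y (i + 1)"
    unfolding y(2) using coboundariesI[of y Y "i + 1"] y(1) by simp
  ultimately have "z \<in> coboundaries Z (i + 1)" using t(2) unfolding qis_def by blast
  then obtain z0 where z0: "z0 \<in> carrier (Term Z i)" "z = Diff Z i z0"
    by (rule coboundariesE) simp
  \<comment> \<open>Injectivity on cohomology has provided a primitive \<open>z0\<close> of
    \<open>z\<close>. The error \<open>?u\<close> is then a cocycle, and surjectivity corrects
    \<open>z0\<close> by a cocycle \<open>z1\<close>, which does not disturb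
    \<open>Diff Z i z0\<close>.\<close>
  let ?u = "y \<oplus>\<^bsub>Term Y i\<^esub> \<ominus>\<^bsub>Term Y i\<^esub> t i z0"
  have tz0: "t i z0 \<in> carrier (Term Y i)" using cm_closed[OF t(1) z0(1)] .
  have "Diff Y i (t i z0) = Diff Y i y" using y(2) cm_diff[OF t(1) z0(1)] z0(2) by simp
  then have "?u \<in> cocycles Y i" using Z y(1) tz0 by (simp add: cocycles_def)
  then obtain z1 w where z1: "z1 \<in> cocycles Z i" and w: "w \<in> coboundaries Y i" "?u = w \<oplus>\<^bsub>Term Y i\<^esub> t i z1"
    using t(2) unfolding qis_def by blast
  obtain y' where y': "y' \<in> carrier (Term Y (i - 1))" "w = Diff Y (i - 1) y'" using w(1) by (rule coboundariesE)
  have z1c: "z1 \<in> carrier (Term Z i)" "Diff Z i z1 = \<zero>\<^bsub>Term Z (i + 1)\<^esub>" using cocyclesD[OF z1] by auto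
  have wc: "w \<in> carrier (Term Y i)" using y' Z by simp
  show ?thesis
  proof (rule that[of "z0 \<oplus>\<^bsub>Term Z i\<^esub> z1" y'])
    show "Diff Z i (z0 \<oplus>\<^bsub>Term Z i\<^esub> z1) = z" using Z z0 z1c by simp
    have "y = ?u \<oplus>\<^bsub>Term Y i\<^esub> t i z0" using lm y(1) tz0 by (simp add: lm_assoc)
    also have "\<dots> = t i (z0 \<oplus>\<^bsub>Term Z i\<^esub> z1) \<oplus>\<^bsub>Term Y i\<^esub> w"
      unfolding w(2) using lm z0(1) z1c(1) wc tz0 by (simp add: cmD[OF t(1)] lm_ac)
    finally show "y = t i (z0 \<oplus>\<^bsub>Term Z i\<^esub> z1) \<oplus>\<^bsub>Term Y i\<^esub> Diff Y (i - 1) y'" unfolding y'(2) .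
  qed (use lm z0 z1c y' in simp_all)
qed

end

section \<open>Truncated complexes and the universal property of truncation\<close>

context ring_ctx
begin

lemma plus_one_one: "i + 1 + 1 = i + (2 :: int)"
  by simp

text \<open>Vanishing of the cocycles below degree \<open>n\<close> says that the terms below degree \<open>n - 1\<close> are zero
  and that the differential in degree \<open>n - 1\<close> is injective, that is, \<open>W \<cong> trunc n W\<close>.\<close>

definition truncated :: "int \<Rightarrow> ('a, 'u) cplx \<Rightarrow> bool" where
  "truncated n W \<longleftrightarrow> (\<forall>i<n. cocycles W i = {\<zero>\<^bsub>Term W i\<^esub>})"

text \<open>The canonical projection of \<open>X\<close> onto its truncation, obtained by truncating
  the identity function; \<open>trunc_map n Y f\<close> is this projection after
  \<open>f\<close>.\<close>

definition tproj :: "int \<Rightarrow> ('a, 'u) cplx \<Rightarrow> int \<Rightarrow> 'u \<Rightarrow> 'u" where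
  "tproj n X = trunc_map n X (\<lambda>i x. x)"

lemma tproj_simps:
  "i < n - 1 \<Longrightarrow> tproj n X i x = \<zero>\<^bsub>Term X i\<^esub>"
  "tproj n X (n - 1) x = coset_rep (Term X (n - 1)) (cocycles X (n - 1)) x"
  "i \<ge> n \<Longrightarrow> tproj n X i x = x"
  by (simp_all add: tproj_def trunc_map_def)

lemma trunc_map_tproj: "trunc_map n Y f = (\<lambda>i x. tproj n Y i (f i x))"
  by (intro ext) (simp add: tproj_def trunc_map_def)

lemma Term_trunc:
  "i < n - 1 \<Longrightarrow> Term (trunc n X) i = (Term X i)\<lparr>carrier := {\<zero>\<^bsub>Term X i\<^esub>}\<rparr>"
  "Term (trunc n X) (n - 1) = quot_module (Term X (n - 1)) (cocycles X (n - 1))"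
  "i \<ge> n \<Longrightarrow> Term (trunc n X) i = Term X i"
  by (simp_all add: trunc_def trunc_term_def)

lemma Diff_trunc:
  "i < n - 1 \<Longrightarrow> Diff (trunc n X) i x = \<zero>\<^bsub>Term (trunc n X) (i + 1)\<^esub>"
  "i \<ge> n - 1 \<Longrightarrow> Diff (trunc n X) i x = Diff X i x"
  by (simp_all add: trunc_def)

lemma degree_cases [case_names below edge above]:
  fixes i n :: int
  assumes "i < n - 1 \<Longrightarrow> P" "i = n - 1 \<Longrightarrow> P" "i \<ge> n \<Longrightarrow> P"
  shows P
  using assms by linarith

lemma truncatedD:
  assumes W: "cx W" "truncated n W" and i: "i < n" and x: "x \<in> carrier (Term W i)" and d: "Diff W i x = \<zero>\<^bsub>Term W (i + 1)\<^esub>"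
  shows "x = \<zero>\<^bsub>Term W i\<^esub>"
proof -
  have "x \<in> cocycles W i" using x d by (simp add: cocycles_def)
  then show ?thesis using W(2) i by (simp add: truncated_def)
qed

text \<open>\<open>Diff W i x\<close> is a cocycle in degree \<open>i + 1 < n\<close>, hence zero;
  so \<open>x\<close> is itself a cocycle below \<open>n\<close>.\<close>

lemma truncated_below:
  assumes W: "cx W" "truncated n W" and i: "i < n - 1" and x: "x \<in> carrier (Term W i)"
  shows "x = \<zero>\<^bsub>Term W i\<^esub>"
proof (rule truncatedD[OF W _ x])
  show "Diff W i x = \<zero>\<^bsub>Term W (i + 1)\<^esub>"
    by (rule truncatedD[OF W]) (use W(1) i x in \<open>simp_all add: plus_one_one\<close>)
qed (use i in simp)

lemma truncatedI:
  assumes "cx W" "\<And>i x. i < n \<Longrightarrow> x \<in> carrier (Term W i) \<Longrightarrow> Diff W i x = \<zero>\<^bsub>Term W (i + 1)\<^esub> \<Longrightarrow> x = \<zero>\<^bsub>Term W i\<^esub>"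
  shows "truncated n W"
  unfolding truncated_def cocycles_def using assms by auto

context
  fixes n :: int and X :: "('a, 'u) cplx"
  assumes X: "cx X"
begin

lemma lmX: "left_module R (Term X i)"
  using X by simp

lemmas edge = lmX[of "n - 1"] submod_cocycles[OF X, of "n - 1"]

text \<open>Exactly the kernel is divided out, so the differential does not see the choice of
  representative. This is why \<open>trunc\<close> may keep \<open>Diff X\<close> as it is in degree
  \<open>n - 1\<close>.\<close>

lemma Diff_coset_rep:
  assumes x: "x \<in> carrier (Term X (n - 1))"
  shows "Diff X (n - 1) (coset_rep (Term X (n - 1)) (cocycles X (n - 1)) x) = Diff X (n - 1) x"
proof -
  obtain b where b: "b \<in> cocycles X (n - 1)" "coset_rep (Term X (n - 1)) (cocycles X (n - 1)) x = b \<oplus>\<^bsub>Term X (n - 1)\<^esub> x"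
    using coset_rep_mem[OF edge x] by blast
  have "b \<in> carrier (Term X (n - 1))" "Diff X (n - 1) b = \<zero>\<^bsub>Term X n\<^esub>" using cocyclesD[OF b(1)] by simp_all
  then show ?thesis unfolding b(2) using X x diff_add[OF X, of b "n - 1" x] by simp
qed

text \<open>This inclusion is the gain from using representatives: functions and equations on
  \<open>X\<close> can be applied directly to elements of the truncation.\<close>

lemma trunc_carrier: "x \<in> carrier (Term (trunc n X) i) \<Longrightarrow> x \<in> carrier (Term X i)"
  by (cases i n rule: degree_cases)
    (auto simp: Term_trunc quot_module_simps[OF edge] coset_rep_closed[OF edge] lmX)

lemma tproj_fix: "x \<in> carrier (Term (trunc n X) i) \<Longrightarrow> tproj n X i x = x"
  by (cases i n rule: degree_cases)
    (auto simp: Term_trunc tproj_simps quot_module_simps[OF edge] coset_rep_idem[OF edge])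

lemma trunc_fg: "fg_module R (Term (trunc n X) i)"
proof (cases i n rule: degree_cases)
  case below
  have "submod R (Term X i) {\<zero>\<^bsub>Term X i\<^esub>}" using lmX by (auto simp: submod_def)
  then have "left_module R ((Term X i)\<lparr>carrier := {\<zero>\<^bsub>Term X i\<^esub>}\<rparr>)" by (rule submod_left_module[OF lmX])
  then show ?thesis unfolding Term_trunc(1)[OF below] by (intro proj_fg zero_fg_projective) simp_all
next
  case edge
  then show ?thesis using quot_fg[OF cx_fg[OF X] submod_cocycles[OF X]] by (simp add: Term_trunc)
next
  case above
  then show ?thesis using X by (simp add: Term_trunc)
qed

lemma tproj_hom: "tproj n X i \<in> mod_hom R (Term X i) (Term (trunc n X) i)"
proof (cases i n rule: degree_cases)
  case below
  then have "tproj n X i = (\<lambda>x. \<zero>\<^bsub>Term X i\<^esub>)" by (intro ext) (simp add: tproj_simps)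
  then show ?thesis using lmX below by (intro mod_homI) (simp_all add: Term_trunc)
next
  case edge
  then have "tproj n X i = coset_rep (Term X (n - 1)) (cocycles X (n - 1))" by (intro ext) (simp add: tproj_simps)
  then show ?thesis using quot_hom[OF lmX submod_cocycles[OF X], of "n - 1"] edge by (simp add: Term_trunc)
next
  case above
  then have "tproj n X i = (\<lambda>x. x)" by (intro ext) (simp add: tproj_simps)
  then show ?thesis using above by (simp add: Term_trunc hom_id)
qed

text \<open>The universal property of the truncation needs no change of functions: a map killing the
  cocycles in degree \<open>n - 1\<close> is insensitive to the choice of representatives.\<close>

lemma hom_trunc:
  assumes f: "f \<in> mod_hom R (Term X i) N" and N: "left_module R N"
    and below: "i < n - 1 \<Longrightarrow> carrier N = {\<zero>\<^bsub>N\<^esub>}"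
    and edge: "\<And>x. i = n - 1 \<Longrightarrow> x \<in> cocycles X i \<Longrightarrow> f x = \<zero>\<^bsub>N\<^esub>"
  shows "f \<in> mod_hom R (Term (trunc n X) i) N" "x \<in> carrier (Term X i) \<Longrightarrow> f (tproj n X i x) = f x"
proof -
  have rep: "f (coset_rep (Term X i) (cocycles X i) x) = f x" if i: "i = n - 1" and x: "x \<in> carrier (Term X i)" for x
  proof -
    obtain b where b: "b \<in> cocycles X i" "coset_rep (Term X i) (cocycles X i) x = b \<oplus>\<^bsub>Term X i\<^esub> x"
      using coset_rep_mem[OF lmX submod_cocycles[OF X] x] by blast
    show ?thesis unfolding b(2) hom_add[OF f cocyclesD(1)[OF b(1)] x] edge[OF i b(1)]
      using N hom_closed[OF f x] by simp
  qed
  show "f \<in> mod_hom R (Term (trunc n X) i) N"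
  proof (cases i n rule: degree_cases)
    case b: below
    have "f \<zero>\<^bsub>Term X i\<^esub> = \<zero>\<^bsub>N\<^esub>" by (rule hom_zero[OF lmX N f])
    then show ?thesis using N lmX by (intro mod_homI) (simp_all add: Term_trunc(1)[OF b])
  next
    case i: edge
    have q: "Term (trunc n X) i = quot_module (Term X i) (cocycles X i)" using i by (simp add: Term_trunc)
    note e = lmX[of i] submod_cocycles[OF X, of i]
    show ?thesis unfolding q
    proof (rule mod_homI)
      fix x assume "x \<in> carrier (quot_module (Term X i) (cocycles X i))"
      then have x: "x \<in> carrier (Term X i)" by (auto simp: quot_module_simps[OF e] coset_rep_closed[OF e])
      show "f x \<in> carrier N" by (rule hom_closed[OF f x])
      show "f (a \<odot>\<^bsub>quot_module (Term X i) (cocycles X i)\<^esub> x) = a \<odot>\<^bsub>N\<^esub> f x" if "a \<in> carrier R" for a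
        using x that lmX by (simp add: quot_module_simps[OF e] rep[OF i] hom_smult[OF f])
      fix y assume "y \<in> carrier (quot_module (Term X i) (cocycles X i))"
      then have y: "y \<in> carrier (Term X i)" by (auto simp: quot_module_simps[OF e] coset_rep_closed[OF e])
      show "f (x \<oplus>\<^bsub>quot_module (Term X i) (cocycles X i)\<^esub> y) = f x \<oplus>\<^bsub>N\<^esub> f y"
        using x y lmX by (simp add: quot_module_simps[OF e] rep[OF i] hom_add[OF f])
    qed
  next
    case above
    then show ?thesis using f by (simp add: Term_trunc)
  qed
  show "f (tproj n X i x) = f x" if x: "x \<in> carrier (Term X i)"
  proof (cases i n rule: degree_cases)
    case b: below
    have "f x = \<zero>\<^bsub>N\<^esub>" using hom_closed[OF f x] below[OF b] by simp
    then show ?thesis using hom_zero[OF lmX N f] by (simp add: tproj_simps(1)[OF b])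
  next
    case edge
    then show ?thesis using rep x by (simp add: tproj_simps)
  next
    case above
    then show ?thesis by (simp add: tproj_simps)
  qed
qed

lemma Diff_trunc_hom: "Diff (trunc n X) i \<in> mod_hom R (Term (trunc n X) i) (Term (trunc n X) (i + 1))"
proof (cases "i < n - 1")
  case True
  then have "Diff (trunc n X) i = (\<lambda>x. \<zero>\<^bsub>Term (trunc n X) (i + 1)\<^esub>)" by (intro ext) (simp add: Diff_trunc)
  then show ?thesis using trunc_fg by (simp add: hom_const_zero)
next
  case False
  then have "Diff (trunc n X) i = Diff X i" "Term (trunc n X) (i + 1) = Term X (i + 1)"
    by (auto simp: Diff_trunc Term_trunc)
  moreover have "Diff X i \<in> mod_hom R (Term (trunc n X) i) (Term X (i + 1))"
    by (rule hom_trunc(1)[OF diff_hom[OF X refl] lmX]) (use False in \<open>auto simp: cocycles_def\<close>)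
  ultimately show ?thesis by simp
qed

lemma trunc_cx: "cx (trunc n X)"
  unfolding bounded_complex_def
proof (intro conjI allI ballI)
  fix i show "fg_module R (Term (trunc n X) i)" by (rule trunc_fg)
  show "Diff (trunc n X) i \<in> mod_hom R (Term (trunc n X) i) (Term (trunc n X) (i + 1))" by (rule Diff_trunc_hom)
  fix x assume x: "x \<in> carrier (Term (trunc n X) i)"
  show "Diff (trunc n X) (i + 1) (Diff (trunc n X) i x) = \<zero>\<^bsub>Term (trunc n X) (i + 2)\<^esub>"
  proof (cases "i < n - 1")
    case True
    then have "Diff (trunc n X) i x = \<zero>\<^bsub>Term (trunc n X) (i + 1)\<^esub>" by (simp add: Diff_trunc)
    then show ?thesis
      using hom_zero[OF fg_lm[OF trunc_fg] fg_lm[OF trunc_fg] Diff_trunc_hom, of "i + 1"] unfolding plus_one_one by simp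
  next
    case False
    then have "Diff (trunc n X) (i + 1) (Diff (trunc n X) i x) = Diff X (i + 1) (Diff X i x)"
      "Term (trunc n X) (i + 2) = Term X (i + 2)"
      by (auto simp: Diff_trunc Term_trunc)
    then show ?thesis using diff_diff'(1)[OF X trunc_carrier[OF x]] by simp
  qed
next
  have "\<exists>a b. concentrated a b X" using X unfolding bounded_complex_def by (rule conjunct2)
  then obtain a b where ab: "concentrated a b X" by blast
  \<comment> \<open>The upper bound is raised to \<open>n\<close> so that the quotient in degree
    \<open>n - 1\<close> always lies inside the interval and need not be computed.\<close>
  have "concentrated (min a (n - 1)) (max b n) (trunc n X)"
    unfolding concentrated_def
  proof (intro allI impI)
    fix i assume i: "i < min a (n - 1) \<or> max b n < i"
    then have "carrier (Term X i) = {\<zero>\<^bsub>Term X i\<^esub>}" using ab unfolding concentrated_def by auto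
    then show "carrier (Term (trunc n X) i) = {\<zero>\<^bsub>Term (trunc n X) i\<^esub>}" using i by (auto simp: Term_trunc)
  qed
  then show "\<exists>a b. concentrated a b (trunc n X)" by blast
qed

lemma trunc_truncated: "truncated n (trunc n X)"
proof (rule truncatedI[OF trunc_cx])
  fix i x assume i: "i < n" and x: "x \<in> carrier (Term (trunc n X) i)"
    and d: "Diff (trunc n X) i x = \<zero>\<^bsub>Term (trunc n X) (i + 1)\<^esub>"
  show "x = \<zero>\<^bsub>Term (trunc n X) i\<^esub>"
  proof (cases i n rule: degree_cases)
    case below
    then show ?thesis using x by (simp add: Term_trunc)
  next
    case e: edge
    have x': "x \<in> carrier (Term X (n - 1))" using trunc_carrier[OF x] e by simp
    moreover have "Diff X (n - 1) x = \<zero>\<^bsub>Term X n\<^esub>" using d e by (simp add: Diff_trunc Term_trunc)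
    ultimately have "x \<in> cocycles X (n - 1)" by (simp add: cocycles_def)
    then have "coset_rep (Term X (n - 1)) (cocycles X (n - 1)) x = \<zero>\<^bsub>Term (trunc n X) (n - 1)\<^esub>"
      using coset_rep_eq_zero_iff[OF edge x'] by (simp add: Term_trunc quot_module_simps[OF edge])
    then show ?thesis using tproj_fix[OF x] e by (simp add: tproj_simps)
  qed (use i in simp)
qed

lemma tproj_chain_map: "tproj n X \<in> chain_maps R X (trunc n X)"
proof (rule chain_mapsI[OF tproj_hom])
  fix i x assume x: "x \<in> carrier (Term X i)"
  show "tproj n X (i + 1) (Diff X i x) = Diff (trunc n X) i (tproj n X i x)"
  proof (cases i n rule: degree_cases)
    case below
    have "Diff X i x \<in> cocycles X (i + 1)" using X x by (simp add: cocycles_def plus_one_one)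
    \<comment> \<open>Only the step from degree \<open>n - 2\<close> to \<open>n - 1\<close> has
      content: a boundary is a cocycle, hence zero in the quotient.\<close>
    have "tproj n X (i + 1) (Diff X i x) = \<zero>\<^bsub>Term (trunc n X) (i + 1)\<^esub>"
    proof (cases "i + 1 = n - 1")
      case True
      have "Diff X i x \<in> carrier (Term X (n - 1))" using X x True by simp
      then show ?thesis using \<open>Diff X i x \<in> cocycles X (i + 1)\<close> coset_rep_eq_zero_iff[OF edge]
        unfolding True by (simp add: tproj_simps Term_trunc quot_module_simps[OF edge])
    next
      case False
      then have "i + 1 < n - 1" using below by simp
      then show ?thesis by (simp add: tproj_simps Term_trunc)
    qed
    then show ?thesis using below by (simp add: Diff_trunc)
  next
    case e: edge
    then show ?thesis using x Diff_coset_rep by (simp add: tproj_simps Diff_trunc)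
  next
    case above
    then show ?thesis by (simp add: tproj_simps Diff_trunc)
  qed
qed

context
  fixes W :: "('a, 'u) cplx"
  assumes W: "cx W" "truncated n W"
begin

text \<open>In degree \<open>n - 1\<close> a cocycle of \<open>X\<close> goes to a cocycle of
  \<open>W\<close>, hence to zero, and further down \<open>W\<close> is zero. So
  \<open>hom_trunc\<close> applies in every degree, with the same function \<open>f\<close>.\<close>

lemma trunc_universal:
  assumes f: "f \<in> chain_maps R X W"
  shows "f \<in> chain_maps R (trunc n X) W" "x \<in> carrier (Term X i) \<Longrightarrow> f i (tproj n X i x) = f i x"
proof -
  have b: "carrier (Term W i) = {\<zero>\<^bsub>Term W i\<^esub>}" if "i < n - 1" for i
    using truncated_below[OF W that] W(1) by auto
  have e: "f i x = \<zero>\<^bsub>Term W i\<^esub>" if "i = n - 1" and x: "x \<in> cocycles X i" for i x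
    using cm_cocycles[OF X W(1) f x] W(2) that(1) by (simp add: truncated_def)
  have lmW: "left_module R (Term W i)" for i using W by simp
  note h = hom_trunc[OF cm_hom[OF f] lmW b e]
  show "x \<in> carrier (Term X i) \<Longrightarrow> f i (tproj n X i x) = f i x" by (rule h(2))
  show "f \<in> chain_maps R (trunc n X) W"
  proof (rule chain_mapsI[OF h(1)])
    fix i x assume x: "x \<in> carrier (Term (trunc n X) i)"
    show "f (i + 1) (Diff (trunc n X) i x) = Diff W i (f i x)"
    proof (cases "i < n - 1")
      case True
      have "f (i + 1) \<zero>\<^bsub>Term (trunc n X) (i + 1)\<^esub> = \<zero>\<^bsub>Term W (i + 1)\<^esub>"
        by (rule hom_zero[OF fg_lm[OF trunc_fg] lmW h(1)])
      moreover have "f i x = \<zero>\<^bsub>Term W i\<^esub>" using cm_closed[OF f trunc_carrier[OF x]] b[OF True] by simp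
      ultimately show ?thesis using True W(1) by (simp add: Diff_trunc)
    next
      case False
      then show ?thesis using cm_diff[OF f trunc_carrier[OF x]] by (simp add: Diff_trunc)
    qed
  qed simp_all
qed

text \<open>The homotopy need not be rebuilt: \<open>h (n - 1)\<close> lands in degree
  \<open>n - 2\<close> of \<open>W\<close>, which is zero, so it kills the cocycles that are divided
  out.\<close>

lemma trunc_universal_homotopy:
  assumes fg: "(f, g) \<in> homotopy_rel R X W"
  shows "(f, g) \<in> homotopy_rel R (trunc n X) W"
proof -
  obtain h where f: "f \<in> chain_maps R X W" and g: "g \<in> chain_maps R X W"
    and h: "\<And>i. h i \<in> mod_hom R (Term X i) (Term W (i - 1))"
    and eq: "\<And>i x. x \<in> carrier (Term X i) \<Longrightarrow> f i x = g i x \<oplus>\<^bsub>Term W i\<^esub>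
             (Diff W (i - 1) (h i x) \<oplus>\<^bsub>Term W i\<^esub> h (i + 1) (Diff X i x))"
    using fg by (rule homotopyE) blast
  have b: "carrier (Term W i) = {\<zero>\<^bsub>Term W i\<^esub>}" if "i < n - 1" for i
    using truncated_below[OF W that] W(1) by auto
  have lmW: "left_module R (Term W i)" for i using W by simp
  have h': "h i \<in> mod_hom R (Term (trunc n X) i) (Term W (i - 1))" for i
  proof (rule hom_trunc(1)[OF h lmW])
    show "carrier (Term W (i - 1)) = {\<zero>\<^bsub>Term W (i - 1)\<^esub>}" if "i < n - 1" using b that by simp
    show "h i x = \<zero>\<^bsub>Term W (i - 1)\<^esub>" if "i = n - 1" "x \<in> cocycles X i" for x
      using b[of "i - 1"] hom_closed[OF h cocyclesD(1)[OF that(2)]] that(1) by simp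
  qed
  show ?thesis
  proof (rule homotopyI[OF trunc_universal(1)[OF f] trunc_universal(1)[OF g] h'])
    fix i x assume x: "x \<in> carrier (Term (trunc n X) i)"
    have x': "x \<in> carrier (Term X i)" by (rule trunc_carrier[OF x])
    show "f i x = g i x \<oplus>\<^bsub>Term W i\<^esub> (Diff W (i - 1) (h i x) \<oplus>\<^bsub>Term W i\<^esub> h (i + 1) (Diff (trunc n X) i x))"
    proof (cases "i < n - 1")
      case True
      have "a = b'" if "a \<in> carrier (Term W i)" "b' \<in> carrier (Term W i)" for a b' using that b[OF True] by simp
      moreover have "h (i + 1) (Diff (trunc n X) i x) \<in> carrier (Term W i)"
        using hom_closed[OF h' hom_closed[OF Diff_trunc_hom x]] by simp
      moreover have "h i x \<in> carrier (Term W (i - 1))" by (rule hom_closed[OF h x'])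
      ultimately show ?thesis using W(1) cm_closed[OF f x'] cm_closed[OF g x'] by simp
    next
      case False
      then show ?thesis using eq[OF x'] by (simp add: Diff_trunc)
    qed
  qed
qed

end

lemma cocycles_trunc: "i \<ge> n \<Longrightarrow> cocycles (trunc n X) i = cocycles X i"
  by (simp add: cocycles_def Term_trunc Diff_trunc)

text \<open>Only degree \<open>n\<close> needs an argument, and there representatives have the same
  differentials as the elements they represent.\<close>

lemma coboundaries_trunc: "i \<ge> n \<Longrightarrow> coboundaries (trunc n X) i = coboundaries X i"
proof (cases "i = n")
  case True
  have "Diff X (n - 1) ` coset_rep (Term X (n - 1)) (cocycles X (n - 1)) ` carrier (Term X (n - 1)) =
      Diff X (n - 1) ` carrier (Term X (n - 1))"
    unfolding image_image by (rule image_cong[OF refl]) (rule Diff_coset_rep)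
  then show ?thesis using True by (simp add: coboundaries_def Term_trunc Diff_trunc quot_module_simps[OF edge])
qed (auto simp: coboundaries_def Term_trunc Diff_trunc)

end

text \<open>Below \<open>n\<close> the cocycles of both complexes are zero, so cohomology imposes no
  condition there.\<close>

lemma qis_truncatedI:
  assumes V: "cx V" "truncated n V" and W: "cx W" "truncated n W" and f: "f \<in> chain_maps R V W"
    and inj: "\<And>i x. i \<ge> n \<Longrightarrow> x \<in> cocycles V i \<Longrightarrow> f i x \<in> coboundaries W i \<Longrightarrow> x \<in> coboundaries V i"
    and surj: "\<And>i y. i \<ge> n \<Longrightarrow> y \<in> cocycles W i \<Longrightarrow> \<exists>x \<in> cocycles V i. \<exists>w \<in> coboundaries W i. y = w \<oplus>\<^bsub>Term W i\<^esub> f i x"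
  shows "qis V W f"
  unfolding qis_def
proof (intro conjI allI ballI impI)
  fix i x assume x: "x \<in> cocycles V i" "f i x \<in> coboundaries W i"
  show "x \<in> coboundaries V i"
  proof (cases "i < n")
    case True
    then have "x = \<zero>\<^bsub>Term V i\<^esub>" using x V(2) by (simp add: truncated_def)
    then show ?thesis using submod_closed(2)[OF cx_lm[OF V(1)] submod_coboundaries[OF V(1)]] by simp
  qed (use inj x in simp)
next
  fix i y assume y: "y \<in> cocycles W i"
  show "\<exists>x \<in> cocycles V i. \<exists>w \<in> coboundaries W i. y = w \<oplus>\<^bsub>Term W i\<^esub> f i x"
  proof (cases "i < n")
    case True
    then have "y = \<zero>\<^bsub>Term W i\<^esub>" using y W(2) by (simp add: truncated_def)
    then have "y = \<zero>\<^bsub>Term W i\<^esub> \<oplus>\<^bsub>Term W i\<^esub> f i \<zero>\<^bsub>Term V i\<^esub>" using W(1) V(1) by (simp add: cm_zero[OF f])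
    then show ?thesis
      using submod_closed(2)[OF cx_lm[OF V(1)] submod_cocycles[OF V(1)]]
        submod_closed(2)[OF cx_lm[OF W(1)] submod_coboundaries[OF W(1)]] by blast
  qed (use surj y in simp)
qed

lemma qis_trunc_source:
  assumes V: "cx V" and W: "cx W" "truncated n W" and f: "f \<in> chain_maps R V W" "qis V W f"
  shows "qis (trunc n V) W f"
proof (rule qis_truncatedI[OF trunc_cx[OF V] trunc_truncated[OF V] W trunc_universal(1)[OF V W f(1)]])
  fix i x assume "i \<ge> n" "x \<in> cocycles (trunc n V) i" "f i x \<in> coboundaries W i"
  then show "x \<in> coboundaries (trunc n V) i"
    using f(2) unfolding qis_def by (simp add: cocycles_trunc[OF V] coboundaries_trunc[OF V])
next
  fix i y assume "i \<ge> n" "y \<in> cocycles W i"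
  then show "\<exists>x \<in> cocycles (trunc n V) i. \<exists>w \<in> coboundaries W i. y = w \<oplus>\<^bsub>Term W i\<^esub> f i x"
    using f(2) unfolding qis_def by (simp add: cocycles_trunc[OF V] coboundaries_trunc[OF V])
qed

lemma trunc_map_chain_map:
  assumes X: "cx X" "cx Y" and f: "f \<in> chain_maps R X Y"
  shows "trunc_map n Y f \<in> chain_maps R (trunc n X) (trunc n Y)"
  unfolding trunc_map_tproj
  by (rule trunc_universal(1)[OF X(1) trunc_cx[OF X(2)] trunc_truncated[OF X(2)] chain_maps_comp[OF f tproj_chain_map[OF X(2)]]])

lemma trunc_map_homotopic:
  assumes X: "cx X" "cx Y" and fg: "(f, g) \<in> homotopy_rel R X Y"
  shows "(trunc_map n Y f, trunc_map n Y g) \<in> homotopy_rel R (trunc n X) (trunc n Y)"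
  unfolding trunc_map_tproj
  by (rule trunc_universal_homotopy[OF X(1) trunc_cx[OF X(2)] trunc_truncated[OF X(2)]
    homotopy_comp_left[OF X trunc_cx[OF X(2)] fg tproj_chain_map[OF X(2)]]])

lemma trunc_map_qis:
  assumes X: "cx X" "cx Y" and f: "f \<in> chain_maps R X Y" "qis X Y f"
  shows "qis (trunc n X) (trunc n Y) (trunc_map n Y f)"
proof (rule qis_truncatedI[OF trunc_cx[OF X(1)] trunc_truncated[OF X(1)] trunc_cx[OF X(2)] trunc_truncated[OF X(2)] trunc_map_chain_map[OF X f(1)]])
  fix i x assume "i \<ge> n" "x \<in> cocycles (trunc n X) i" "trunc_map n Y f i x \<in> coboundaries (trunc n Y) i"
  then show "x \<in> coboundaries (trunc n X) i"
    using f(2) unfolding qis_def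
    by (simp add: cocycles_trunc[OF X(1)] coboundaries_trunc[OF X(1)] coboundaries_trunc[OF X(2)] trunc_map_def)
next
  fix i y assume "i \<ge> n" "y \<in> cocycles (trunc n Y) i"
  then show "\<exists>x \<in> cocycles (trunc n X) i. \<exists>w \<in> coboundaries (trunc n Y) i. y = w \<oplus>\<^bsub>Term (trunc n Y) i\<^esub> trunc_map n Y f i x"
    using f(2) unfolding qis_def
    by (simp add: cocycles_trunc[OF X(1)] cocycles_trunc[OF X(2)] coboundaries_trunc[OF X(2)] trunc_map_def Term_trunc)
qed

text \<open>\<open>H\<close> says that cohomology vanishes below \<open>n\<close>, and this is the
  only cohomology that truncation discards.\<close>

lemma tproj_qis:
  assumes X: "cx X" and H: "\<And>i. i < n \<Longrightarrow> cocycles X i \<subseteq> coboundaries X i"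
  shows "qis X (trunc n X) (tproj n X)"
  unfolding qis_def
proof (intro conjI allI ballI impI)
  fix i x assume "x \<in> cocycles X i" "tproj n X i x \<in> coboundaries (trunc n X) i"
  then show "x \<in> coboundaries X i"
    using H[of i] by (cases "i < n") (auto simp: coboundaries_trunc[OF X] tproj_simps)
next
  fix i y assume y: "y \<in> cocycles (trunc n X) i"
  have lm: "left_module R (Term (trunc n X) i)" using trunc_cx[OF X] by simp
  have z: "\<zero>\<^bsub>Term (trunc n X) i\<^esub> \<in> coboundaries (trunc n X) i"
    by (rule submod_closed(2)[OF lm submod_coboundaries[OF trunc_cx[OF X]]])
  have "\<exists>x \<in> cocycles X i. y = tproj n X i x"
  proof (cases "i < n")
    case True
    then have "y = \<zero>\<^bsub>Term (trunc n X) i\<^esub>" using y trunc_truncated[OF X, of n] by (simp add: truncated_def)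
    then have "y = tproj n X i \<zero>\<^bsub>Term X i\<^esub>" using cm_zero[OF tproj_chain_map[OF X] X trunc_cx[OF X]] by simp
    then show ?thesis using submod_closed(2)[OF cx_lm[OF X] submod_cocycles[OF X]] by blast
  next
    case False
    then show ?thesis using y by (auto simp: cocycles_trunc[OF X] tproj_simps)
  qed
  then obtain x where x: "x \<in> cocycles X i" "y = tproj n X i x" by blast
  have "y = \<zero>\<^bsub>Term (trunc n X) i\<^esub> \<oplus>\<^bsub>Term (trunc n X) i\<^esub> y" using lm cocyclesD(1)[OF y] by simp
  then show "\<exists>x \<in> cocycles X i. \<exists>w \<in> coboundaries (trunc n X) i. y = w \<oplus>\<^bsub>Term (trunc n X) i\<^esub> tproj n X i x"
    using x z by metis
qed

lemma trunc_map_id: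
  assumes X: "cx X" and x: "x \<in> carrier (Term (trunc n X) i)"
  shows "trunc_map n X (\<lambda>i x. x) i x = x"
  unfolding trunc_map_tproj by (rule tproj_fix[OF X x])

text \<open>The inner projection is absorbed by the universal property, applied to the projection of
  \<open>Z\<close> after \<open>g\<close>.\<close>

lemma trunc_map_comp:
  assumes X: "cx X" "cx Y" "cx Z" and f: "f \<in> chain_maps R X Y" and g: "g \<in> chain_maps R Y Z"
    and x: "x \<in> carrier (Term (trunc n X) i)"
  shows "trunc_map n Z g i (trunc_map n Y f i x) = trunc_map n Z (\<lambda>i x. g i (f i x)) i x"
  unfolding trunc_map_tproj
  by (rule trunc_universal(2)[OF X(2) trunc_cx[OF X(3)] trunc_truncated[OF X(3)]
    chain_maps_comp[OF g tproj_chain_map[OF X(3)]] cm_closed[OF f trunc_carrier[OF X(1) x]]])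

lemma AMap_trunc_K:
  assumes X: "cx X" "cx Y" and f: "f \<in> chain_maps R X Y"
  shows "AMap (trunc_K R n) X Y (hcls R X Y f) = hcls R (trunc n X) (trunc n Y) (trunc_map n Y f)"
proof -
  have "hcls R (trunc n X) (trunc n Y) (trunc_map n Y g) = hcls R (trunc n X) (trunc n Y) (trunc_map n Y f)"
    if "g \<in> hcls R X Y f" for g
    by (rule hcls_eqI[OF trunc_cx[OF X(1)] trunc_cx[OF X(2)] trunc_map_homotopic[OF X homotopy_sym[OF X]]])
      (use that in simp)
  moreover have "hcls R X Y f \<noteq> {}" using hcls_self[OF X f] by blast
  ultimately show ?thesis unfolding trunc_K_def cat_functor.simps by (intro SUP_eq_const)
qed

lemma OMap_trunc_K [simp]: "OMap (trunc_K R n) X = trunc n X"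
  by (simp add: trunc_K_def)

lemma trunc_K_functor: "is_functor (K :: (('a, 'u) cplx, _) add_cat) K (trunc_K R n)"
  unfolding is_functor_def K_Obj OMap_trunc_K
proof (intro conjI ballI)
  fix X :: "('a, 'u) cplx" assume "X \<in> Obj K"
  then have X: "cx X" by simp
  show "cx (trunc n X)" by (rule trunc_cx[OF X])
  show "AMap (trunc_K R n) X X (Ident K X) = Ident K (trunc n X)"
    unfolding K_Ident AMap_trunc_K[OF X X chain_maps_id]
    by (rule hcls_eqI[OF trunc_cx[OF X] trunc_cx[OF X]], rule homotopy_cong[OF trunc_cx[OF X] trunc_cx[OF X] trunc_map_chain_map[OF X X chain_maps_id]])
      (simp add: trunc_map_id[OF X])
next
  fix X Y :: "('a, 'u) cplx" and a assume "X \<in> Obj K" "Y \<in> Obj K" and a: "a \<in> Hom K X Y"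
  then have X: "cx X" "cx Y" by simp_all
  obtain f where f: "f \<in> chain_maps R X Y" "a = hcls R X Y f" using a by (rule K_HomE)
  show "AMap (trunc_K R n) X Y a \<in> Hom K (trunc n X) (trunc n Y)"
    unfolding f(2) AMap_trunc_K[OF X f(1)] by (rule K_HomI[OF trunc_map_chain_map[OF X f(1)]])
next
  fix X Y Z :: "('a, 'u) cplx" and a b
  assume "X \<in> Obj K" "Y \<in> Obj K" "Z \<in> Obj K" and a: "a \<in> Hom K X Y" and b: "b \<in> Hom K Y Z"
  then have X: "cx X" "cx Y" "cx Z" by simp_all
  obtain f where f: "f \<in> chain_maps R X Y" "a = hcls R X Y f" using a by (rule K_HomE)
  obtain g where g: "g \<in> chain_maps R Y Z" "b = hcls R Y Z g" using b by (rule K_HomE)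
  note T = trunc_cx[OF X(1)] trunc_cx[OF X(2)] trunc_cx[OF X(3)]
  note tf = trunc_map_chain_map[OF X(1,2) f(1)] and tg = trunc_map_chain_map[OF X(2,3) g(1)]
  show "AMap (trunc_K R n) X Z (Comp K X Y Z b a) =
      Comp K (trunc n X) (trunc n Y) (trunc n Z) (AMap (trunc_K R n) Y Z b) (AMap (trunc_K R n) X Y a)"
    unfolding f(2) g(2) AMap_trunc_K[OF X(1,2) f(1)] AMap_trunc_K[OF X(2,3) g(1)] K_Comp[OF X f(1) g(1)] K_Comp[OF T tf tg]
      AMap_trunc_K[OF X(1,3) chain_maps_comp[OF f(1) g(1)]]
    by (rule hcls_eqI[OF T(1,3) homotopy_sym[OF T(1,3) homotopy_cong[OF T(1,3) chain_maps_comp[OF tf tg]]]])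
      (simp add: trunc_map_comp[OF X f(1) g(1)])
qed

end

section \<open>Lifting along quasi-isomorphisms, and resolutions\<close>

text \<open>Lifts and resolutions are built from the top degree down, each component depending on
  its upper neighbour. This is dependent choice on degrees, with prescribed values above
  \<open>b\<close>.\<close>

lemma int_descending_choice:
  fixes good :: "int \<Rightarrow> 's \<Rightarrow> bool" and rel :: "int \<Rightarrow> 's \<Rightarrow> 's \<Rightarrow> bool" and b :: int
  assumes top: "\<And>i. i > b \<Longrightarrow> good i (s0 i)" "\<And>i. i > b \<Longrightarrow> rel i (s0 i) (s0 (i + 1))"
    and step: "\<And>i s. i \<le> b \<Longrightarrow> good (i + 1) s \<Longrightarrow> \<exists>s'. good i s' \<and> rel i s' s"
  shows "\<exists>S. \<forall>i. good i (S i) \<and> rel i (S i) (S (i + 1))"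
proof -
  \<comment> \<open>\<open>F k\<close> is the state in degree \<open>b + 1 - k\<close>; fixing
    \<open>F 0\<close> makes the sequence fit the values prescribed above \<open>b\<close>.\<close>
  have "\<exists>F. \<forall>k. (good (b + 1 - int k) (F k) \<and> (k = 0 \<longrightarrow> F k = s0 (b + 1))) \<and> rel (b - int k) (F (Suc k)) (F k)"
  proof (rule dependent_nat_choice)
    show "\<exists>x. good (b + 1 - int 0) x \<and> (0 = (0::nat) \<longrightarrow> x = s0 (b + 1))" using top(1)[of "b + 1"] by simp
    fix x k assume "good (b + 1 - int k) x \<and> (k = 0 \<longrightarrow> x = s0 (b + 1))"
    moreover have "b + 1 - int k = (b - int k) + 1" by simp
    ultimately obtain y where "good (b - int k) y" "rel (b - int k) y x"
      using step[of "b - int k" x] by auto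
    then show "\<exists>y. (good (b + 1 - int (Suc k)) y \<and> (Suc k = 0 \<longrightarrow> y = s0 (b + 1))) \<and> rel (b - int k) y x" by auto
  qed
  then obtain F where F: "\<And>k. good (b + 1 - int k) (F k)" "F 0 = s0 (b + 1)" "\<And>k. rel (b - int k) (F (Suc k)) (F k)"
    by blast
  define S where "S i = (if i > b then s0 i else F (nat (b + 1 - i)))" for i
  have "good i (S i) \<and> rel i (S i) (S (i + 1))" for i
  proof (cases "i > b")
    case True
    then show ?thesis using top by (simp add: S_def)
  next
    case False
    define k where "k = nat (b - i)"
    have k: "i = b - int k" "nat (b + 1 - i) = Suc k" using False by (auto simp: k_def)
    have "S (i + 1) = F k" using k F(2) by (cases "k = 0") (auto simp: S_def)
    moreover have "S i = F (Suc k)" using k by (simp add: S_def)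
    moreover have "good i (F (Suc k))" using F(1)[of "Suc k"] unfolding k(1) by simp
    ultimately show ?thesis using F(3)[of k] k(1) by simp
  qed
  then show ?thesis by blast
qed

context ring_ctx
begin

lemma lm_sub:
  fixes M :: "('a, 'u) module"
  shows "\<lbrakk>left_module R M; y \<in> carrier M; s \<in> carrier M; x = y \<oplus>\<^bsub>M\<^esub> s\<rbrakk> \<Longrightarrow> x \<oplus>\<^bsub>M\<^esub> \<ominus>\<^bsub>M\<^esub> y = s"
  by (simp add: lm_ac)

lemma lm_interchange:
  fixes M :: "('a, 'u) module"
  shows "\<lbrakk>left_module R M; a \<in> carrier M; b \<in> carrier M; c \<in> carrier M; d \<in> carrier M\<rbrakk> \<Longrightarrow>
    (a \<oplus>\<^bsub>M\<^esub> b) \<oplus>\<^bsub>M\<^esub> (c \<oplus>\<^bsub>M\<^esub> d) = (a \<oplus>\<^bsub>M\<^esub> c) \<oplus>\<^bsub>M\<^esub> (b \<oplus>\<^bsub>M\<^esub> d)"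
  by (simp add: lm_ac)

lemma lm_add_sub:
  fixes M :: "('a, 'u) module"
  shows "\<lbrakk>left_module R M; s \<in> carrier M; x \<in> carrier M\<rbrakk> \<Longrightarrow> s \<oplus>\<^bsub>M\<^esub> (x \<oplus>\<^bsub>M\<^esub> \<ominus>\<^bsub>M\<^esub> s) = x"
  using lm_lcomm[of M s x "\<ominus>\<^bsub>M\<^esub> s"] by simp

lemma truncated_inj:
  assumes W: "cx W" "truncated n W" and i: "i < n" and x: "x \<in> carrier (Term W i)" "y \<in> carrier (Term W i)"
    and d: "Diff W i x = Diff W i y"
  shows "x = y"
proof -
  have lm: "left_module R (Term W j)" for j using W(1) by simp
  have "x \<oplus>\<^bsub>Term W i\<^esub> \<ominus>\<^bsub>Term W i\<^esub> y = \<zero>\<^bsub>Term W i\<^esub>"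
    by (rule truncatedD[OF W i]) (use W(1) lm x d in simp_all)
  moreover have "x = (x \<oplus>\<^bsub>Term W i\<^esub> \<ominus>\<^bsub>Term W i\<^esub> y) \<oplus>\<^bsub>Term W i\<^esub> y" using lm x by (simp add: lm_assoc)
  ultimately show ?thesis using lm x by simp
qed

lemma cx_below: "cx X \<Longrightarrow> \<exists>a. \<forall>i<a. carrier (Term X i) = {\<zero>\<^bsub>Term X i\<^esub>}"
  and cx_above: "cx X \<Longrightarrow> \<exists>b. \<forall>i>b. carrier (Term X i) = {\<zero>\<^bsub>Term X i\<^esub>}"
  unfolding bounded_complex_def concentrated_def by meson+

lemma truncated_if_zero:
  assumes "cx X" "\<And>i. i < n \<Longrightarrow> carrier (Term X i) = {\<zero>\<^bsub>Term X i\<^esub>}"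
  shows "truncated n X"
  by (rule truncatedI[OF assms(1)]) (use assms(2) in blast)

end

context universe_ctx
begin

text \<open>The two alternatives correspond to the degrees from \<open>n\<close> on, where the
  source is projective, and to those below \<open>n\<close>, where truncatedness leaves no
  choice.\<close>

lemma rel3_lift:
  fixes P B C :: "('a, 'u) module"
  assumes E: "rel3 R P B C E" "\<And>x. x \<in> carrier P \<Longrightarrow> \<exists>y z. E x y z" and lm: "left_module R B" "left_module R C"
    and "fg_projective R P \<or> (\<forall>x y z y' z'. E x y z \<longrightarrow> E x y' z' \<longrightarrow> y = y' \<and> z = z')"
  obtains h l where "h \<in> mod_hom R P B" "l \<in> mod_hom R P C" "\<And>x. x \<in> carrier P \<Longrightarrow> E x (h x) (l x)"
  using assms(5)
proof
  assume "fg_projective R P"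
  from projective_lift[OF this lm E] show thesis using that by blast
next
  assume f: "\<forall>x y z y' z'. E x y z \<longrightarrow> E x y' z' \<longrightarrow> y = y' \<and> z = z'"
  have "\<exists>h \<in> mod_hom R P B. \<exists>l \<in> mod_hom R P C. \<forall>x \<in> carrier P. E x (h x) (l x)"
    by (rule rel3_functional_lift[OF E]) (use f in blast)+
  then show thesis using that by blast
qed

section \<open>Lifting along quasi-isomorphisms of truncated complexes\<close>

context
  fixes Q Z Y :: "('a, 'u) cplx" and n :: int and t :: "int \<Rightarrow> 'u \<Rightarrow> 'u"
  assumes Q: "cx Q" and Z: "cx Z" and Y: "cx Y"
    and proj: "\<And>i. i \<ge> n \<Longrightarrow> fg_projective R (Term Q i)"
    and trZ: "truncated n Z" and trY: "truncated n Y"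
    and t: "t \<in> chain_maps R Z Y" and qt: "qis Z Y t"
begin

lemma lms: "left_module R (Term Q i)" "left_module R (Term Z i)" "left_module R (Term Y i)"
  using Q Z Y by simp_all

text \<open>Composed into the acyclic cone of \<open>t\<close>, the map \<open>f\<close> becomes
  null-homotopic. The two components of a contraction are the lift \<open>v\<close> and the homotopy
  \<open>h\<close>, which is why they are constructed together.\<close>

theorem qis_lift_exists:
  assumes f: "f \<in> chain_maps R Q Y"
  obtains v where "v \<in> chain_maps R Q Z" "(f, \<lambda>i x. t i (v i x)) \<in> homotopy_rel R Q Y"
proof -
  obtain b where b: "\<forall>i>b. carrier (Term Q i) = {\<zero>\<^bsub>Term Q i\<^esub>}" using cx_above[OF Q] by blast
  \<comment> \<open>The invariant is stated on cocycles only: there the term from degree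
    \<open>i + 1\<close> drops out, and the next lower degree applies it just to images of the
    differential.\<close>
  define good where "good = (\<lambda>i (v, h). v \<in> mod_hom R (Term Q i) (Term Z i) \<and> h \<in> mod_hom R (Term Q i) (Term Y (i - 1)) \<and>
    (\<forall>w \<in> cocycles Q i. Diff Z i (v w) = \<zero>\<^bsub>Term Z (i + 1)\<^esub> \<and> f i w = t i (v w) \<oplus>\<^bsub>Term Y i\<^esub> Diff Y (i - 1) (h w)))"
  define rel where "rel = (\<lambda>i (v, h) (v', h'). \<forall>x \<in> carrier (Term Q i). Diff Z i (v x) = v' (Diff Q i x) \<and>
    f i x = t i (v x) \<oplus>\<^bsub>Term Y i\<^esub> (Diff Y (i - 1) (h x) \<oplus>\<^bsub>Term Y i\<^esub> h' (Diff Q i x)))"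
  have dz: "Diff Y (i - 1) \<zero>\<^bsub>Term Y (i - 1)\<^esub> = \<zero>\<^bsub>Term Y i\<^esub>" for i using diff_zero[OF Y, of "i - 1"] by simp
  have "\<exists>S. \<forall>i. good i (S i) \<and> rel i (S i) (S (i + 1))"
  proof (rule int_descending_choice[where b = b and ?s0.0 = "\<lambda>i. (\<lambda>_. \<zero>\<^bsub>Term Z i\<^esub>, \<lambda>_. \<zero>\<^bsub>Term Y (i - 1)\<^esub>)"])
    fix i assume i: "i > b"
    have x0: "x = \<zero>\<^bsub>Term Q i\<^esub>" if "x \<in> carrier (Term Q i)" for x using b[rule_format, OF i] that by simp
    have c0: "x = \<zero>\<^bsub>Term Q i\<^esub>" if "x \<in> cocycles Q i" for x using x0[OF cocyclesD(1)[OF that]] .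
    show "good i (\<lambda>_. \<zero>\<^bsub>Term Z i\<^esub>, \<lambda>_. \<zero>\<^bsub>Term Y (i - 1)\<^esub>)"
      unfolding good_def using Z Y lms cm_zero[OF f Q Y] cm_zero[OF t Z Y]
      by (auto intro!: hom_const_zero dest!: c0 simp: dz)
    show "rel i (\<lambda>_. \<zero>\<^bsub>Term Z i\<^esub>, \<lambda>_. \<zero>\<^bsub>Term Y (i - 1)\<^esub>) (\<lambda>_. \<zero>\<^bsub>Term Z (i + 1)\<^esub>, \<lambda>_. \<zero>\<^bsub>Term Y (i + 1 - 1)\<^esub>)"
      unfolding rel_def using Z Y lms cm_zero[OF f Q Y] cm_zero[OF t Z Y] by (auto dest!: x0 simp: dz)
  next
    fix i s assume "i \<le> b" "good (i + 1) s"
    obtain v' h' where s: "s = (v', h')" by (cases s)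
    from \<open>good (i + 1) s\<close> have v': "v' \<in> mod_hom R (Term Q (i + 1)) (Term Z (i + 1))"
      and h': "h' \<in> mod_hom R (Term Q (i + 1)) (Term Y i)"
      and co: "\<And>w. w \<in> cocycles Q (i + 1) \<Longrightarrow> Diff Z (i + 1) (v' w) = \<zero>\<^bsub>Term Z (i + 2)\<^esub> \<and>
        f (i + 1) w = t (i + 1) (v' w) \<oplus>\<^bsub>Term Y (i + 1)\<^esub> Diff Y i (h' w)"
      unfolding good_def s prod.case plus_one_one by simp_all
    \<comment> \<open>The admissible values for \<open>v\<close> and \<open>h\<close> at
      \<open>x\<close>, given the maps one degree up. The equations are linear, so \<open>E\<close>
      is a submodule of the product; \<open>qis_cone\<close> makes it total.\<close>
    define E where "E x z y \<longleftrightarrow> x \<in> carrier (Term Q i) \<and> z \<in> carrier (Term Z i) \<and> y \<in> carrier (Term Y (i - 1)) \<and>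
      Diff Z i z = v' (Diff Q i x) \<and>
      f i x = t i z \<oplus>\<^bsub>Term Y i\<^esub> (Diff Y (i - 1) y \<oplus>\<^bsub>Term Y i\<^esub> h' (Diff Q i x))" for x z y
    have dc: "Diff Y (i - 1) y \<in> carrier (Term Y i)" if "y \<in> carrier (Term Y (i - 1))" for y using Y that by simp
    have da: "Diff Y (i - 1) (y \<oplus>\<^bsub>Term Y (i - 1)\<^esub> y') = Diff Y (i - 1) y \<oplus>\<^bsub>Term Y i\<^esub> Diff Y (i - 1) y'"
      if "y \<in> carrier (Term Y (i - 1))" "y' \<in> carrier (Term Y (i - 1))" for y y'
      using diff_add[OF Y that] by simp
    have ds: "Diff Y (i - 1) (a \<odot>\<^bsub>Term Y (i - 1)\<^esub> y) = a \<odot>\<^bsub>Term Y i\<^esub> Diff Y (i - 1) y"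
      if "a \<in> carrier R" "y \<in> carrier (Term Y (i - 1))" for a y
      using diff_smult[OF Y that] by simp
    note alg = hom_zero[OF lms(1,2) v'] hom_zero[OF lms(1,3) h'] hom_add[OF v'] hom_add[OF h'] hom_smult[OF v'] hom_smult[OF h']
      hom_closed[OF h'] dc da ds dz cmD[OF t] cmD[OF f] cm_smult[OF t] cm_smult[OF f] diff_smult[OF Q] diff_smult[OF Z] Q Y Z
    have E3: "rel3 R (Term Q i) (Term Z i) (Term Y (i - 1)) E"
      unfolding rel3_def
    proof (intro conjI allI impI ballI)
      show "E \<zero>\<^bsub>Term Q i\<^esub> \<zero>\<^bsub>Term Z i\<^esub> \<zero>\<^bsub>Term Y (i - 1)\<^esub>" unfolding E_def by (simp add: alg lms)
      fix x z y assume 1: "E x z y"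
      then show "x \<in> carrier (Term Q i)" "z \<in> carrier (Term Z i)" "y \<in> carrier (Term Y (i - 1))" unfolding E_def by simp_all
      show "E (a \<odot>\<^bsub>Term Q i\<^esub> x) (a \<odot>\<^bsub>Term Z i\<^esub> z) (a \<odot>\<^bsub>Term Y (i - 1)\<^esub> y)" if "a \<in> carrier R" for a
        using 1 that unfolding E_def by (simp add: alg lms lm_smult_add)
      fix x' z' y' assume 2: "E x' z' y'"
      show "E (x \<oplus>\<^bsub>Term Q i\<^esub> x') (z \<oplus>\<^bsub>Term Z i\<^esub> z') (y \<oplus>\<^bsub>Term Y (i - 1)\<^esub> y')"
        using 1 2 unfolding E_def by (simp add: alg lms lm_ac)
    qed
    have tot: "\<exists>z y. E x z y" if x: "x \<in> carrier (Term Q i)" for x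
    proof -
      have w: "Diff Q i x \<in> carrier (Term Q (i + 1))" "Diff Q i x \<in> cocycles Q (i + 1)"
        using Q x by (simp_all add: cocycles_def plus_one_one)
      \<comment> \<open>The part of \<open>f i x\<close> that \<open>h'\<close> does not account
        for. Its differential is the image under \<open>t\<close> of a cocycle, which is the input
        of \<open>qis_cone\<close>.\<close>
      let ?y = "f i x \<oplus>\<^bsub>Term Y i\<^esub> \<ominus>\<^bsub>Term Y i\<^esub> h' (Diff Q i x)"
      have c: "f i x \<in> carrier (Term Y i)" "h' (Diff Q i x) \<in> carrier (Term Y i)" "v' (Diff Q i x) \<in> carrier (Term Z (i + 1))"
        using cm_closed[OF f x] hom_closed[OF h' w(1)] hom_closed[OF v' w(1)] by auto
      have "f (i + 1) (Diff Q i x) = Diff Y i (f i x)" by (rule cm_diff[OF f x refl])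
      then have e: "Diff Y i (f i x) = Diff Y i (h' (Diff Q i x)) \<oplus>\<^bsub>Term Y (i + 1)\<^esub> t (i + 1) (v' (Diff Q i x))"
        using co[OF w(2)] lm_comm[OF lms(3), of _ "i + 1"] Y c cm_closed[OF t c(3)] by simp
      have "Diff Y i ?y = t (i + 1) (v' (Diff Q i x))"
        using lm_sub[OF lms(3) _ _ e] Y c cm_closed[OF t c(3)] lms by simp
      then obtain z y where zy: "z \<in> carrier (Term Z i)" "y \<in> carrier (Term Y (i - 1))"
        "Diff Z i z = v' (Diff Q i x)" "?y = t i z \<oplus>\<^bsub>Term Y i\<^esub> Diff Y (i - 1) y"
        using qis_cone[OF Z Y t qt c(3) conjunct1[OF co[OF w(2)]], of ?y] c lms by (metis lm_add lm_neg)
      have "f i x = ?y \<oplus>\<^bsub>Term Y i\<^esub> h' (Diff Q i x)" using lms c by (simp add: lm_assoc)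
      then have "f i x = t i z \<oplus>\<^bsub>Term Y i\<^esub> (Diff Y (i - 1) y \<oplus>\<^bsub>Term Y i\<^esub> h' (Diff Q i x))"
        unfolding zy(4) using lm_assoc[OF lms(3) cm_closed[OF t zy(1)] dc[OF zy(2)] c(2)] by simp
      then have "E x z y" unfolding E_def using x zy by simp
      then show ?thesis by blast
    qed
    \<comment> \<open>\<open>y\<close> lives in degree \<open>i - 1 < n - 1\<close>, where
      \<open>Y\<close> is zero, and \<open>z\<close> is determined by its differential because
      \<open>i < n\<close>.\<close>
    have uniq: "z = z' \<and> y = y'" if "i < n" "E x z y" "E x z' y'" for x z y z' y'
    proof -
      have zc: "z \<in> carrier (Term Z i)" "z' \<in> carrier (Term Z i)" "Diff Z i z = Diff Z i z'"
        and yc: "y \<in> carrier (Term Y (i - 1))" "y' \<in> carrier (Term Y (i - 1))"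
        using that(2,3) unfolding E_def by simp_all
      have "i - 1 < n - 1" using that(1) by simp
      from truncated_below[OF Y trY this yc(1)] truncated_below[OF Y trY this yc(2)]
      show ?thesis using truncated_inj[OF Z trZ that(1) zc] by simp
    qed
    have "fg_projective R (Term Q i) \<or> (\<forall>x y z y' z'. E x y z \<longrightarrow> E x y' z' \<longrightarrow> y = y' \<and> z = z')"
    proof (cases "i \<ge> n")
      case True then show ?thesis using proj by blast
    next
      case False then have "i < n" by simp
      from uniq[OF this] show ?thesis by blast
    qed
    then obtain v h where vh: "v \<in> mod_hom R (Term Q i) (Term Z i)" "h \<in> mod_hom R (Term Q i) (Term Y (i - 1))"
      "\<And>x. x \<in> carrier (Term Q i) \<Longrightarrow> E x (v x) (h x)"
      using rel3_lift[OF E3 tot lms(2) lms(3)] by metis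
    have "rel i (v, h) s" unfolding rel_def s prod.case using vh(3) unfolding E_def by blast
    moreover have "good i (v, h)"
      unfolding good_def prod.case
    proof (intro conjI ballI vh)
      fix w assume w: "w \<in> cocycles Q i"
      have Ew: "E w (v w) (h w)" using vh(3) cocyclesD(1)[OF w] .
      show "Diff Z i (v w) = \<zero>\<^bsub>Term Z (i + 1)\<^esub>"
        using Ew cocyclesD(2)[OF w] unfolding E_def by (simp add: alg)
      show "f i w = t i (v w) \<oplus>\<^bsub>Term Y i\<^esub> Diff Y (i - 1) (h w)"
        using Ew cocyclesD(2)[OF w] unfolding E_def by (simp add: alg lms)
    qed
    ultimately show "\<exists>s'. good i s' \<and> rel i s' s" by blast
  qed
  then obtain S where S: "\<And>i. good i (S i)" "\<And>i. rel i (S i) (S (i + 1))" by blast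
  define v where "v i = fst (S i)" for i
  define h where "h i = snd (S i)" for i
  have Sv: "S i = (v i, h i)" for i by (simp add: v_def h_def)
  have vh: "v i \<in> mod_hom R (Term Q i) (Term Z i)" "h i \<in> mod_hom R (Term Q i) (Term Y (i - 1))" for i
    using S(1)[of i] unfolding good_def Sv by simp_all
  have r: "Diff Z i (v i x) = v (i + 1) (Diff Q i x)"
    "f i x = t i (v i x) \<oplus>\<^bsub>Term Y i\<^esub> (Diff Y (i - 1) (h i x) \<oplus>\<^bsub>Term Y i\<^esub> h (i + 1) (Diff Q i x))"
    if "x \<in> carrier (Term Q i)" for i x
    using S(2)[of i] that unfolding rel_def Sv by simp_all
  have vc: "v \<in> chain_maps R Q Z" by (rule chain_mapsI[OF vh(1)]) (simp add: r(1))
  show ?thesis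
    by (rule that[OF vc]) (rule homotopyI[OF f chain_maps_comp[OF vc t] vh(2) r(2)])
qed

text \<open>The difference of \<open>v\<close> and \<open>v'\<close> together with the homotopy
  \<open>k\<close> is a map into the shifted cone of \<open>t\<close>, and acyclicity contracts it.
  Of the contraction, \<open>h\<close> is the homotopy sought, and \<open>l\<close> is a homotopy of
  homotopies that compares \<open>t\<close> after \<open>h\<close> with \<open>k\<close>.\<close>

theorem qis_lift_unique:
  assumes v: "v \<in> chain_maps R Q Z" and v': "v' \<in> chain_maps R Q Z"
    and hom: "(\<lambda>i x. t i (v i x), \<lambda>i x. t i (v' i x)) \<in> homotopy_rel R Q Y"
  shows "(v, v') \<in> homotopy_rel R Q Z"
proof -
  obtain b where b: "\<forall>i>b. carrier (Term Q i) = {\<zero>\<^bsub>Term Q i\<^esub>}" using cx_above[OF Q] by blast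
  obtain k where k: "\<And>i. k i \<in> mod_hom R (Term Q i) (Term Y (i - 1))"
    and keq: "\<And>i x. x \<in> carrier (Term Q i) \<Longrightarrow> t i (v i x) = t i (v' i x) \<oplus>\<^bsub>Term Y i\<^esub>
             (Diff Y (i - 1) (k i x) \<oplus>\<^bsub>Term Y i\<^esub> k (i + 1) (Diff Q i x))"
    using hom by (rule homotopyE) blast
  define good where "good = (\<lambda>i (h, l). h \<in> mod_hom R (Term Q i) (Term Z (i - 1)) \<and> l \<in> mod_hom R (Term Q i) (Term Y (i - 2)) \<and>
    (\<forall>w \<in> cocycles Q i. v i w = v' i w \<oplus>\<^bsub>Term Z i\<^esub> Diff Z (i - 1) (h w) \<and>
      k i w = t (i - 1) (h w) \<oplus>\<^bsub>Term Y (i - 1)\<^esub> Diff Y (i - 2) (l w)))"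
  define rel where "rel = (\<lambda>i (h, l) (h', l'). \<forall>x \<in> carrier (Term Q i).
    v i x = v' i x \<oplus>\<^bsub>Term Z i\<^esub> (Diff Z (i - 1) (h x) \<oplus>\<^bsub>Term Z i\<^esub> h' (Diff Q i x)) \<and>
    k i x \<oplus>\<^bsub>Term Y (i - 1)\<^esub> l' (Diff Q i x) = t (i - 1) (h x) \<oplus>\<^bsub>Term Y (i - 1)\<^esub> Diff Y (i - 2) (l x))"
  have dz: "Diff Z (i - 1) \<zero>\<^bsub>Term Z (i - 1)\<^esub> = \<zero>\<^bsub>Term Z i\<^esub>" for i using diff_zero[OF Z, of "i - 1"] by simp
  have dz2: "Diff Y (i - 2) \<zero>\<^bsub>Term Y (i - 2)\<^esub> = \<zero>\<^bsub>Term Y (i - 1)\<^esub>" for i using diff_zero[OF Y, of "i - 2"] by simp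
  note kz = hty_zero[OF k Q Y]
  have "\<exists>S. \<forall>i. good i (S i) \<and> rel i (S i) (S (i + 1))"
  proof (rule int_descending_choice[where b = b and ?s0.0 = "\<lambda>i. (\<lambda>_. \<zero>\<^bsub>Term Z (i - 1)\<^esub>, \<lambda>_. \<zero>\<^bsub>Term Y (i - 2)\<^esub>)"])
    fix i assume i: "i > b"
    have x0: "x = \<zero>\<^bsub>Term Q i\<^esub>" if "x \<in> carrier (Term Q i)" for x using b[rule_format, OF i] that by simp
    have c0: "x = \<zero>\<^bsub>Term Q i\<^esub>" if "x \<in> cocycles Q i" for x using x0[OF cocyclesD(1)[OF that]] .
    show "good i (\<lambda>_. \<zero>\<^bsub>Term Z (i - 1)\<^esub>, \<lambda>_. \<zero>\<^bsub>Term Y (i - 2)\<^esub>)"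
      unfolding good_def using Z Y lms cm_zero[OF v Q Z] cm_zero[OF v' Q Z] cm_zero[OF t Z Y] kz
      by (auto intro!: hom_const_zero dest!: c0 simp: dz dz2)
    have "i + 1 - 2 = i - 1" by simp
    then show "rel i (\<lambda>_. \<zero>\<^bsub>Term Z (i - 1)\<^esub>, \<lambda>_. \<zero>\<^bsub>Term Y (i - 2)\<^esub>) (\<lambda>_. \<zero>\<^bsub>Term Z (i + 1 - 1)\<^esub>, \<lambda>_. \<zero>\<^bsub>Term Y (i + 1 - 2)\<^esub>)"
      unfolding rel_def using Z Y lms cm_zero[OF v Q Z] cm_zero[OF v' Q Z] cm_zero[OF t Z Y] kz by (auto dest!: x0 simp: dz dz2)
  next
    fix i s assume "i \<le> b" "good (i + 1) s"
    obtain h' l' where s: "s = (h', l')" by (cases s)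
    have ix: "i + 1 - 2 = i - 1" by simp
    from \<open>good (i + 1) s\<close> have h': "h' \<in> mod_hom R (Term Q (i + 1)) (Term Z i)"
      and l': "l' \<in> mod_hom R (Term Q (i + 1)) (Term Y (i - 1))"
      and co: "\<And>w. w \<in> cocycles Q (i + 1) \<Longrightarrow> v (i + 1) w = v' (i + 1) w \<oplus>\<^bsub>Term Z (i + 1)\<^esub> Diff Z i (h' w) \<and>
        k (i + 1) w = t i (h' w) \<oplus>\<^bsub>Term Y i\<^esub> Diff Y (i - 1) (l' w)"
      unfolding good_def s prod.case ix by simp_all
    define E where "E x z y \<longleftrightarrow> x \<in> carrier (Term Q i) \<and> z \<in> carrier (Term Z (i - 1)) \<and> y \<in> carrier (Term Y (i - 2)) \<and>
      v i x = v' i x \<oplus>\<^bsub>Term Z i\<^esub> (Diff Z (i - 1) z \<oplus>\<^bsub>Term Z i\<^esub> h' (Diff Q i x)) \<and>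
      k i x \<oplus>\<^bsub>Term Y (i - 1)\<^esub> l' (Diff Q i x) = t (i - 1) z \<oplus>\<^bsub>Term Y (i - 1)\<^esub> Diff Y (i - 2) y" for x z y
    have dc: "Diff Z (i - 1) y \<in> carrier (Term Z i)" if "y \<in> carrier (Term Z (i - 1))" for y using Z that by simp
    have da: "Diff Z (i - 1) (y \<oplus>\<^bsub>Term Z (i - 1)\<^esub> y') = Diff Z (i - 1) y \<oplus>\<^bsub>Term Z i\<^esub> Diff Z (i - 1) y'"
      if "y \<in> carrier (Term Z (i - 1))" "y' \<in> carrier (Term Z (i - 1))" for y y'
      using diff_add[OF Z that] by simp
    have ds: "Diff Z (i - 1) (a \<odot>\<^bsub>Term Z (i - 1)\<^esub> y) = a \<odot>\<^bsub>Term Z i\<^esub> Diff Z (i - 1) y"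
      if "a \<in> carrier R" "y \<in> carrier (Term Z (i - 1))" for a y
      using diff_smult[OF Z that] by simp
    have dc2: "Diff Y (i - 2) y \<in> carrier (Term Y (i - 1))" if "y \<in> carrier (Term Y (i - 2))" for y using Y that by simp
    have da2: "Diff Y (i - 2) (y \<oplus>\<^bsub>Term Y (i - 2)\<^esub> y') = Diff Y (i - 2) y \<oplus>\<^bsub>Term Y (i - 1)\<^esub> Diff Y (i - 2) y'"
      if "y \<in> carrier (Term Y (i - 2))" "y' \<in> carrier (Term Y (i - 2))" for y y'
      using diff_add[OF Y that] by simp
    have ds2: "Diff Y (i - 2) (a \<odot>\<^bsub>Term Y (i - 2)\<^esub> y) = a \<odot>\<^bsub>Term Y (i - 1)\<^esub> Diff Y (i - 2) y"
      if "a \<in> carrier R" "y \<in> carrier (Term Y (i - 2))" for a y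
      using diff_smult[OF Y that] by simp
    note alg = hom_zero[OF lms(1,2) h'] hom_zero[OF lms(1,3) l'] hom_add[OF h'] hom_add[OF l'] hom_smult[OF h'] hom_smult[OF l']
      hom_closed[OF h'] hom_closed[OF l'] dc da ds dz dc2 da2 ds2 dz2 cmD[OF t] cmD[OF v] cmD[OF v'] cm_smult[OF t] cm_smult[OF v] cm_smult[OF v']
      kz hty_closed[OF k] hty_add[OF k] hom_smult[OF k] diff_smult[OF Q] Q Y Z
    have E3: "rel3 R (Term Q i) (Term Z (i - 1)) (Term Y (i - 2)) E"
      unfolding rel3_def
    proof (intro conjI allI impI ballI)
      show "E \<zero>\<^bsub>Term Q i\<^esub> \<zero>\<^bsub>Term Z (i - 1)\<^esub> \<zero>\<^bsub>Term Y (i - 2)\<^esub>" unfolding E_def by (simp add: alg lms kz)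
      fix x z y assume 1: "E x z y"
      then show "x \<in> carrier (Term Q i)" "z \<in> carrier (Term Z (i - 1))" "y \<in> carrier (Term Y (i - 2))" unfolding E_def by simp_all
      show "E (a \<odot>\<^bsub>Term Q i\<^esub> x) (a \<odot>\<^bsub>Term Z (i - 1)\<^esub> z) (a \<odot>\<^bsub>Term Y (i - 2)\<^esub> y)" if "a \<in> carrier R" for a
        using 1 that unfolding E_def by (simp add: alg lms lm_smult_add[symmetric])
      fix x' z' y' assume 2: "E x' z' y'"
      have m: "x \<in> carrier (Term Q i)" "x' \<in> carrier (Term Q i)" "z \<in> carrier (Term Z (i - 1))" "z' \<in> carrier (Term Z (i - 1))"
        "y \<in> carrier (Term Y (i - 2))" "y' \<in> carrier (Term Y (i - 2))" using 1 2 unfolding E_def by simp_all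
      have "k i x \<oplus>\<^bsub>Term Y (i - 1)\<^esub> k i x' \<oplus>\<^bsub>Term Y (i - 1)\<^esub> (l' (Diff Q i x) \<oplus>\<^bsub>Term Y (i - 1)\<^esub> l' (Diff Q i x')) =
        (k i x \<oplus>\<^bsub>Term Y (i - 1)\<^esub> l' (Diff Q i x)) \<oplus>\<^bsub>Term Y (i - 1)\<^esub> (k i x' \<oplus>\<^bsub>Term Y (i - 1)\<^esub> l' (Diff Q i x'))"
        by (rule lm_interchange[OF lms(3)]) (use m in \<open>simp_all add: alg\<close>)
      also have "\<dots> = t (i - 1) z \<oplus>\<^bsub>Term Y (i - 1)\<^esub> Diff Y (i - 2) y \<oplus>\<^bsub>Term Y (i - 1)\<^esub> (t (i - 1) z' \<oplus>\<^bsub>Term Y (i - 1)\<^esub> Diff Y (i - 2) y')"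
        using 1 2 unfolding E_def by simp
      also have "\<dots> = t (i - 1) z \<oplus>\<^bsub>Term Y (i - 1)\<^esub> t (i - 1) z' \<oplus>\<^bsub>Term Y (i - 1)\<^esub> (Diff Y (i - 2) y \<oplus>\<^bsub>Term Y (i - 1)\<^esub> Diff Y (i - 2) y')"
        by (rule lm_interchange[OF lms(3)]) (use m in \<open>simp_all add: alg\<close>)
      finally have e2: "k i x \<oplus>\<^bsub>Term Y (i - 1)\<^esub> k i x' \<oplus>\<^bsub>Term Y (i - 1)\<^esub> (l' (Diff Q i x) \<oplus>\<^bsub>Term Y (i - 1)\<^esub> l' (Diff Q i x')) =
        t (i - 1) z \<oplus>\<^bsub>Term Y (i - 1)\<^esub> t (i - 1) z' \<oplus>\<^bsub>Term Y (i - 1)\<^esub> (Diff Y (i - 2) y \<oplus>\<^bsub>Term Y (i - 1)\<^esub> Diff Y (i - 2) y')" .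
      have e1: "v i x \<oplus>\<^bsub>Term Z i\<^esub> v i x' = v' i x \<oplus>\<^bsub>Term Z i\<^esub> v' i x' \<oplus>\<^bsub>Term Z i\<^esub>
          (Diff Z (i - 1) z \<oplus>\<^bsub>Term Z i\<^esub> Diff Z (i - 1) z' \<oplus>\<^bsub>Term Z i\<^esub> (h' (Diff Q i x) \<oplus>\<^bsub>Term Z i\<^esub> h' (Diff Q i x')))"
        using 1 2 unfolding E_def by (simp add: alg lms lm_ac)
      show "E (x \<oplus>\<^bsub>Term Q i\<^esub> x') (z \<oplus>\<^bsub>Term Z (i - 1)\<^esub> z') (y \<oplus>\<^bsub>Term Y (i - 2)\<^esub> y')"
        using 1 2 e1 e2 unfolding E_def by (simp add: alg lms)
    qed
    have tot: "\<exists>z y. E x z y" if x: "x \<in> carrier (Term Q i)" for x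
    proof -
      define w where "w = Diff Q i x"
      have w: "w \<in> carrier (Term Q (i + 1))" "w \<in> cocycles Q (i + 1)"
        unfolding w_def using Q x by (simp_all add: cocycles_def plus_one_one)
      \<comment> \<open>The two equations solved for the unknowns: \<open>z0\<close> has to be the
        differential of \<open>z\<close>, and \<open>y0\<close> has to be the image of
        \<open>z\<close> under \<open>t\<close> up to a boundary.\<close>
      define z0 where "z0 = v i x \<oplus>\<^bsub>Term Z i\<^esub> \<ominus>\<^bsub>Term Z i\<^esub> (v' i x \<oplus>\<^bsub>Term Z i\<^esub> h' w)"
      define y0 where "y0 = k i x \<oplus>\<^bsub>Term Y (i - 1)\<^esub> l' w"
      have c: "v i x \<in> carrier (Term Z i)" "v' i x \<in> carrier (Term Z i)" "h' w \<in> carrier (Term Z i)"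
        "k i x \<in> carrier (Term Y (i - 1))" "l' w \<in> carrier (Term Y (i - 1))" "k (i + 1) w \<in> carrier (Term Y i)"
        using x w(1) by (simp_all add: alg)
      have z0c: "z0 \<in> carrier (Term Z i)" and y0c: "y0 \<in> carrier (Term Y (i - 1))"
        unfolding z0_def y0_def using c lms by simp_all
      have dv: "Diff Z i (v i x) = v (i + 1) w" "Diff Z i (v' i x) = v' (i + 1) w"
        unfolding w_def using cm_diff[OF v x refl] cm_diff[OF v' x refl] by simp_all
      have "Diff Z i z0 = \<zero>\<^bsub>Term Z (i + 1)\<^esub>"
        unfolding z0_def using c lms Z dv conjunct1[OF co[OF w(2)]] cm_closed[OF v' w(1)] by simp
      moreover have "t i z0 = Diff Y (i - 1) y0"
      proof -
        have dk: "Diff Y (i - 1) (k i x) \<in> carrier (Term Y i)" "Diff Y (i - 1) (l' w) \<in> carrier (Term Y i)" using c Y by simp_all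
        have "t i (v i x) = (t i (v' i x) \<oplus>\<^bsub>Term Y i\<^esub> t i (h' w)) \<oplus>\<^bsub>Term Y i\<^esub> (Diff Y (i - 1) (k i x) \<oplus>\<^bsub>Term Y i\<^esub> Diff Y (i - 1) (l' w))"
          using keq[OF x] conjunct2[OF co[OF w(2)]] c lms dk unfolding w_def[symmetric] by (simp add: cmD[OF t] lm_ac)
        from lm_sub[OF lms(3) _ _ this]
        have "t i (v i x) \<oplus>\<^bsub>Term Y i\<^esub> \<ominus>\<^bsub>Term Y i\<^esub> (t i (v' i x) \<oplus>\<^bsub>Term Y i\<^esub> t i (h' w)) = Diff Y (i - 1) (k i x) \<oplus>\<^bsub>Term Y i\<^esub> Diff Y (i - 1) (l' w)"
          using c lms dk by (simp add: cmD[OF t])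
        moreover have "Diff Y (i - 1) y0 = Diff Y (i - 1) (k i x) \<oplus>\<^bsub>Term Y i\<^esub> Diff Y (i - 1) (l' w)"
          unfolding y0_def using diff_add[OF Y c(4,5)] by simp
        ultimately show ?thesis unfolding z0_def using c lms Z Y by (simp add: cmD[OF t])
      qed
      ultimately obtain z y where zy: "z \<in> carrier (Term Z (i - 1))" "y \<in> carrier (Term Y (i - 2))"
        "Diff Z (i - 1) z = z0" "y0 = t (i - 1) z \<oplus>\<^bsub>Term Y (i - 1)\<^esub> Diff Y (i - 2) y"
        using qis_cone[OF Z Y t qt, of z0 "i - 1" y0] z0c y0c by (auto simp: add.commute)
      have "v i x = v' i x \<oplus>\<^bsub>Term Z i\<^esub> (z0 \<oplus>\<^bsub>Term Z i\<^esub> h' w)"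
      proof -
        have "v i x = (v' i x \<oplus>\<^bsub>Term Z i\<^esub> h' w) \<oplus>\<^bsub>Term Z i\<^esub> z0"
          unfolding z0_def by (rule lm_add_sub[symmetric, OF lms(2)]) (use c lms in simp_all)
        then show ?thesis using lms c z0c by (simp add: lm_ac)
      qed
      then have "E x z y" unfolding E_def using x zy unfolding y0_def w_def by simp
      then show ?thesis by blast
    qed
    \<comment> \<open>Both unknowns lie in degrees below \<open>n - 1\<close> of truncated
      complexes, so they are zero.\<close>
    have uniq: "z = z' \<and> y = y'" if "i < n" "E x z y" "E x z' y'" for x z y z' y'
    proof -
      have zc: "z \<in> carrier (Term Z (i - 1))" "z' \<in> carrier (Term Z (i - 1))"
        and yc: "y \<in> carrier (Term Y (i - 2))" "y' \<in> carrier (Term Y (i - 2))"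
        using that(2,3) unfolding E_def by simp_all
      have i: "i - 1 < n - 1" "i - 2 < n - 1" using that(1) by simp_all
      show ?thesis
        using truncated_below[OF Y trY i(2) yc(1)] truncated_below[OF Y trY i(2) yc(2)]
          truncated_below[OF Z trZ i(1) zc(1)] truncated_below[OF Z trZ i(1) zc(2)] by simp
    qed
    have "fg_projective R (Term Q i) \<or> (\<forall>x y z y' z'. E x y z \<longrightarrow> E x y' z' \<longrightarrow> y = y' \<and> z = z')"
    proof (cases "i \<ge> n")
      case True then show ?thesis using proj by blast
    next
      case False then have "i < n" by simp
      from uniq[OF this] show ?thesis by blast
    qed
    then obtain h l where hl: "h \<in> mod_hom R (Term Q i) (Term Z (i - 1))" "l \<in> mod_hom R (Term Q i) (Term Y (i - 2))"
      "\<And>x. x \<in> carrier (Term Q i) \<Longrightarrow> E x (h x) (l x)"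
      using rel3_lift[OF E3 tot lms(2) lms(3)] by metis
    have "rel i (h, l) s" unfolding rel_def s prod.case using hl(3) unfolding E_def by blast
    moreover have "good i (h, l)"
      unfolding good_def prod.case
    proof (intro conjI ballI hl)
      fix w assume w: "w \<in> cocycles Q i"
      have Ew: "E w (h w) (l w)" using hl(3) cocyclesD(1)[OF w] .
      show "v i w = v' i w \<oplus>\<^bsub>Term Z i\<^esub> Diff Z (i - 1) (h w)"
        using Ew cocyclesD(2)[OF w] unfolding E_def by (simp add: alg lms)
      show "k i w = t (i - 1) (h w) \<oplus>\<^bsub>Term Y (i - 1)\<^esub> Diff Y (i - 2) (l w)"
        using Ew cocyclesD(2)[OF w] hom_closed[OF k cocyclesD(1)[OF w]] lm_r_zero[OF lms(3)] unfolding E_def by (simp add: alg lms)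
    qed
    ultimately show "\<exists>s'. good i s' \<and> rel i s' s" by blast
  qed
  then obtain S where S: "\<And>i. good i (S i)" "\<And>i. rel i (S i) (S (i + 1))" by blast
  define h where "h i = fst (S i)" for i
  define l where "l i = snd (S i)" for i
  have Sv: "S i = (h i, l i)" for i by (simp add: h_def l_def)
  have h: "h i \<in> mod_hom R (Term Q i) (Term Z (i - 1))" for i
    using S(1)[of i] unfolding good_def Sv by simp
  have r: "v i x = v' i x \<oplus>\<^bsub>Term Z i\<^esub> (Diff Z (i - 1) (h i x) \<oplus>\<^bsub>Term Z i\<^esub> h (i + 1) (Diff Q i x))"
    if "x \<in> carrier (Term Q i)" for i x
    using S(2)[of i] that unfolding rel_def Sv by simp
  show ?thesis by (rule homotopyI[OF v v' h r])
qed

end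

end

context universe_ctx
begin

lemma free_zero: "carrier (free 0) = {\<zero>\<^bsub>free 0\<^esub>}"
  by (auto simp: free_def tup_def)

end

section \<open>Projective resolutions and the Ore conditions\<close>

context noeth_ctx
begin

text \<open>Each term covers the pullback of the cocycles of the next term and
  \<open>Term M i\<close> over \<open>Term M (i + 1)\<close>. Surjectivity onto this pullback
  contains both halves of the quasi-isomorphism condition; going down to \<open>n - 1\<close> is
  what gives injectivity on cohomology in degree \<open>n\<close>.\<close>

theorem resolution:
  fixes M :: "('a, 'u) cplx" and n b :: int
  assumes M: "cx M"
  obtains X \<phi> where "cx X" "\<And>i. fg_projective R (Term X i)" "concentrated (n - 1) b X" "\<phi> \<in> chain_maps R X M"
    "\<And>i p m. \<lbrakk>n - 1 \<le> i; i \<le> b; p \<in> cocycles X (i + 1); m \<in> carrier (Term M i); \<phi> (i + 1) p = Diff M i m\<rbrakk> \<Longrightarrow>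
       \<exists>q \<in> carrier (Term X i). Diff X i q = p \<and> \<phi> i q = m"
proof -
  \<comment> \<open>\<open>C\<close> is the kernel of \<open>\<delta>\<close>. It is part of the
    state because its definition involves the zero of the next term, which the state in degree
    \<open>i\<close> does not contain.\<close>
  define good where "good = (\<lambda>i (P :: ('a, 'u) module, \<delta> :: 'u \<Rightarrow> 'u, \<phi> :: 'u \<Rightarrow> 'u, C).
    fg_projective R P \<and> \<phi> \<in> mod_hom R P (Term M i) \<and> submod R P C \<and>
    (\<forall>p \<in> C. Diff M i (\<phi> p) = \<zero>\<^bsub>Term M (i + 1)\<^esub>) \<and> (i < n - 1 \<or> b < i \<longrightarrow> carrier P = {\<zero>\<^bsub>P\<^esub>}))"
  define rel where "rel = (\<lambda>i (P :: ('a, 'u) module, \<delta>, \<phi> :: 'u \<Rightarrow> 'u, C) (P' :: ('a, 'u) module, \<delta>' :: 'u \<Rightarrow> 'u, \<phi>', C').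
    \<delta> \<in> mod_hom R P P' \<and> C = {x \<in> carrier P. \<delta> x = \<zero>\<^bsub>P'\<^esub>} \<and>
    (\<forall>x \<in> carrier P. \<delta> x \<in> C' \<and> \<phi>' (\<delta> x) = Diff M i (\<phi> x)) \<and>
    (n - 1 \<le> i \<and> i \<le> b \<longrightarrow> (\<forall>p \<in> C'. \<forall>m \<in> carrier (Term M i). \<phi>' p = Diff M i m \<longrightarrow>
       (\<exists>q \<in> carrier P. \<delta> q = p \<and> \<phi> q = m))))"
  have lmM: "left_module R (Term M i)" for i using M by simp
  have f0: "left_module R (free 0)" by (rule free_left_module)
  have sub0: "submod R (free 0) {\<zero>\<^bsub>free 0\<^esub>}" using f0 by (simp add: submod_def)
  have "\<exists>S. \<forall>i. good i (S i) \<and> rel i (S i) (S (i + 1))"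
  proof (rule int_descending_choice[where b = b and
      ?s0.0 = "\<lambda>i. (free 0, \<lambda>_. \<zero>\<^bsub>free 0\<^esub>, \<lambda>_. \<zero>\<^bsub>Term M i\<^esub>, {\<zero>\<^bsub>free 0\<^esub>})"])
    fix i assume i: "i > b"
    show "good i (free 0, \<lambda>_. \<zero>\<^bsub>free 0\<^esub>, \<lambda>_. \<zero>\<^bsub>Term M i\<^esub>, {\<zero>\<^bsub>free 0\<^esub>})"
      unfolding good_def prod.case using free_projective hom_const_zero[OF lmM] sub0 free_zero M by simp
    show "rel i (free 0, \<lambda>_. \<zero>\<^bsub>free 0\<^esub>, \<lambda>_. \<zero>\<^bsub>Term M i\<^esub>, {\<zero>\<^bsub>free 0\<^esub>})
       (free 0, \<lambda>_. \<zero>\<^bsub>free 0\<^esub>, \<lambda>_. \<zero>\<^bsub>Term M (i + 1)\<^esub>, {\<zero>\<^bsub>free 0\<^esub>})"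
      unfolding rel_def prod.case using hom_const_zero[OF f0] free_zero M i by simp
  next
    fix i s assume ib: "i \<le> b" and g: "good (i + 1) s"
    obtain P' \<delta>' \<phi>' C' where s: "s = (P', \<delta>', \<phi>', C')" by (cases s)
    have P': "fg_projective R P'" and \<phi>': "\<phi>' \<in> mod_hom R P' (Term M (i + 1))" and C': "submod R P' C'"
      and dC': "\<And>p. p \<in> C' \<Longrightarrow> Diff M (i + 1) (\<phi>' p) = \<zero>\<^bsub>Term M (i + 2)\<^esub>"
      using g unfolding good_def s prod.case plus_one_one by simp_all
    have lmP': "left_module R P'" using P' by simp
    note c = submod_closed[OF lmP' C']
    show "\<exists>s'. good i s' \<and> rel i s' s"
    proof (cases "n - 1 \<le> i")
      case True
      define E where "E p m \<longleftrightarrow> p \<in> C' \<and> m \<in> carrier (Term M i) \<and> \<phi>' p = Diff M i m" for p m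
      have E: "rel2 R P' (Term M i) E"
        unfolding rel2_def
      proof (intro conjI allI impI ballI)
        show "E \<zero>\<^bsub>P'\<^esub> \<zero>\<^bsub>Term M i\<^esub>" unfolding E_def using c(2) M by (simp add: hom_zero[OF lmP' lmM \<phi>'])
        fix x y assume 1: "E x y"
        then show "x \<in> carrier P'" "y \<in> carrier (Term M i)" unfolding E_def using c(1) by simp_all
        show "E (a \<odot>\<^bsub>P'\<^esub> x) (a \<odot>\<^bsub>Term M i\<^esub> y)" if "a \<in> carrier R" for a
          using 1 that c(1,4) M unfolding E_def by (simp add: hom_smult[OF \<phi>'] diff_smult)
        fix x' y' assume "E x' y'"
        then show "E (x \<oplus>\<^bsub>P'\<^esub> x') (y \<oplus>\<^bsub>Term M i\<^esub> y')"
          using 1 c(1,3) M unfolding E_def by (simp add: hom_add[OF \<phi>'])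
      qed
      obtain P \<alpha> \<beta> where P: "fg_projective R P" and \<alpha>: "\<alpha> \<in> mod_hom R P P'" and \<beta>: "\<beta> \<in> mod_hom R P (Term M i)"
        and sub: "\<And>x. x \<in> carrier P \<Longrightarrow> E (\<alpha> x) (\<beta> x)"
        and sup: "\<And>y z. E y z \<Longrightarrow> \<exists>x \<in> carrier P. \<alpha> x = y \<and> \<beta> x = z"
        using projective_cover_rel[OF proj_fg[OF P'] cx_fg[OF M] E] by metis
      have lmP: "left_module R P" using P by simp
      define C where "C = {x \<in> carrier P. \<alpha> x = \<zero>\<^bsub>P'\<^esub>}"
      have "submod R P C"
        unfolding submod_def C_def
        using lmP lmP' hom_zero[OF lmP lmP' \<alpha>] by (auto simp: hom_add[OF \<alpha>] hom_smult[OF \<alpha>])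
      moreover have "Diff M i (\<beta> p) = \<zero>\<^bsub>Term M (i + 1)\<^esub>" if "p \<in> C" for p
        using sub[of p] that hom_zero[OF lmP' lmM \<phi>'] unfolding C_def E_def by simp
      ultimately have "good i (P, \<alpha>, \<beta>, C)"
        unfolding good_def prod.case using P \<beta> True ib by simp
      moreover have "rel i (P, \<alpha>, \<beta>, C) s"
        unfolding rel_def s prod.case using \<alpha> sub sup unfolding C_def E_def by blast
      ultimately show ?thesis by blast
    next
      case False
      have "good i (free 0, \<lambda>_. \<zero>\<^bsub>P'\<^esub>, \<lambda>_. \<zero>\<^bsub>Term M i\<^esub>, {\<zero>\<^bsub>free 0\<^esub>})"
        unfolding good_def prod.case using free_projective hom_const_zero[OF lmM] sub0 free_zero M by simp
      moreover have "rel i (free 0, \<lambda>_. \<zero>\<^bsub>P'\<^esub>, \<lambda>_. \<zero>\<^bsub>Term M i\<^esub>, {\<zero>\<^bsub>free 0\<^esub>}) s"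
        unfolding rel_def s prod.case
        using hom_const_zero[OF lmP'] free_zero M False c(2) hom_zero[OF lmP' lmM \<phi>'] by simp
      ultimately show ?thesis by blast
    qed
  qed
  then obtain S where S: "\<And>i. good i (S i)" "\<And>i. rel i (S i) (S (i + 1))" by blast
  define P where "P i = fst (S i)" for i
  define \<delta> where "\<delta> i = fst (snd (S i))" for i
  define \<phi> where "\<phi> i = fst (snd (snd (S i)))" for i
  define C where "C i = snd (snd (snd (S i)))" for i
  have Si: "S i = (P i, \<delta> i, \<phi> i, C i)" for i by (simp add: P_def \<delta>_def \<phi>_def C_def)
  define X where "X = \<lparr>Term = P, Diff = \<delta>\<rparr>"
  have X [simp]: "Term X = P" "Diff X = \<delta>" by (simp_all add: X_def)
  have g: "fg_projective R (P i)" "\<phi> i \<in> mod_hom R (P i) (Term M i)" "i < n - 1 \<or> b < i \<Longrightarrow> carrier (P i) = {\<zero>\<^bsub>P i\<^esub>}" for i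
    using S(1)[of i] unfolding good_def Si prod.case by simp_all
  have r: "\<delta> i \<in> mod_hom R (P i) (P (i + 1))" "C i = {x \<in> carrier (P i). \<delta> i x = \<zero>\<^bsub>P (i + 1)\<^esub>}"
    "\<And>x. x \<in> carrier (P i) \<Longrightarrow> \<delta> i x \<in> C (i + 1)" "\<And>x. x \<in> carrier (P i) \<Longrightarrow> \<phi> (i + 1) (\<delta> i x) = Diff M i (\<phi> i x)"
    "\<And>p m. \<lbrakk>n - 1 \<le> i; i \<le> b; p \<in> C (i + 1); m \<in> carrier (Term M i); \<phi> (i + 1) p = Diff M i m\<rbrakk> \<Longrightarrow> \<exists>q \<in> carrier (P i). \<delta> i q = p \<and> \<phi> i q = m"
    for i using S(2)[of i] unfolding rel_def Si prod.case by simp_all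
  have CX: "C i = cocycles X i" for i unfolding r(2) cocycles_def by simp
  have conc: "concentrated (n - 1) b X" unfolding concentrated_def using g(3) by simp
  show ?thesis
  proof (rule that)
    show "cx X"
      unfolding bounded_complex_def
    proof (intro conjI allI ballI)
      show "fg_module R (Term X i)" for i using g(1) by simp
      show "Diff X i \<in> mod_hom R (Term X i) (Term X (i + 1))" for i using r(1) by simp
      show "Diff X (i + 1) (Diff X i x) = \<zero>\<^bsub>Term X (i + 2)\<^esub>" if "x \<in> carrier (Term X i)" for i x
        using r(3)[of x i] that unfolding r(2) plus_one_one by simp
      show "\<exists>a b. concentrated a b X" using conc by blast
    qed
    show "\<phi> \<in> chain_maps R X M" by (rule chain_mapsI) (use g(2) r(4) in simp_all)
    show "fg_projective R (Term X i)" for i using g(1) by simp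
    show "\<exists>q \<in> carrier (Term X i). Diff X i q = p \<and> \<phi> i q = m"
      if "n - 1 \<le> i" "i \<le> b" "p \<in> cocycles X (i + 1)" "m \<in> carrier (Term M i)" "\<phi> (i + 1) p = Diff M i m" for i p m
      using r(5)[OF that(1,2) _ that(4,5)] that(3) unfolding CX by simp
  qed (rule conc)
qed

text \<open>The covering property in degree \<open>i - 1\<close> with \<open>p = x\<close> turns a
  cocycle with trivial image into a coboundary; in degree \<open>i\<close> with \<open>p\<close>
  zero it hits every cocycle of \<open>M\<close>. Above \<open>b\<close> the resolution is zero, and
  \<open>H\<close> makes \<open>M\<close> acyclic there.\<close>

theorem truncated_resolution:
  fixes M :: "('a, 'u) cplx"
  assumes M: "cx M" "truncated n M" and H: "\<And>i. i > b \<Longrightarrow> cocycles M i \<subseteq> coboundaries M i"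
  obtains X \<phi> where "cx X" "\<And>i. fg_projective R (Term X i)" "concentrated (n - 1) b X"
    "\<phi> \<in> chain_maps R (trunc n X) M" "qis (trunc n X) M \<phi>"
proof -
  obtain X \<phi> where X: "cx X" and pX: "\<And>i. fg_projective R (Term X i)" and cX: "concentrated (n - 1) b X"
    and \<phi>: "\<phi> \<in> chain_maps R X M"
    and ce: "\<And>i p m. \<lbrakk>n - 1 \<le> i; i \<le> b; p \<in> cocycles X (i + 1); m \<in> carrier (Term M i); \<phi> (i + 1) p = Diff M i m\<rbrakk> \<Longrightarrow>
       \<exists>q \<in> carrier (Term X i). Diff X i q = p \<and> \<phi> i q = m"
    using resolution[OF M(1), of n b] by blast
  have lmM: "left_module R (Term M i)" for i using M(1) by simp
  have z: "\<zero>\<^bsub>Term X i\<^esub> \<in> cocycles X i" "\<zero>\<^bsub>Term X i\<^esub> \<in> coboundaries X i" "\<zero>\<^bsub>Term M i\<^esub> \<in> coboundaries M i" for i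
    using submod_closed(2)[OF cx_lm submod_cocycles] submod_closed(2)[OF cx_lm submod_coboundaries] X M(1) by blast+
  note \<phi>T = trunc_universal(1)[OF X M \<phi>]
  show ?thesis
  proof (rule that[OF X pX cX \<phi>T], rule qis_truncatedI[OF trunc_cx[OF X] trunc_truncated[OF X] M \<phi>T])
    fix i x assume i: "n \<le> i" and "x \<in> cocycles (trunc n X) i" and \<phi>x: "\<phi> i x \<in> coboundaries M i"
    then have x: "x \<in> cocycles X i" by (simp add: cocycles_trunc[OF X])
    have "x \<in> coboundaries X i"
    proof (cases "i - 1 \<le> b")
      case True
      obtain m where m: "m \<in> carrier (Term M (i - 1))" "\<phi> i x = Diff M (i - 1) m"
        using \<phi>x by (rule coboundariesE)
      have "\<exists>q \<in> carrier (Term X (i - 1)). Diff X (i - 1) q = x \<and> \<phi> (i - 1) q = m"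
        by (rule ce) (use i True x m in simp_all)
      then show ?thesis unfolding coboundaries_def by blast
    next
      case False
      then have "carrier (Term X i) = {\<zero>\<^bsub>Term X i\<^esub>}" using cX unfolding concentrated_def by simp
      then have "x = \<zero>\<^bsub>Term X i\<^esub>" using cocyclesD(1)[OF x] by simp
      then show ?thesis using z(2) by simp
    qed
    then show "x \<in> coboundaries (trunc n X) i" using coboundaries_trunc[OF X i] by simp
  next
    fix i y assume i: "n \<le> i" and y: "y \<in> cocycles M i"
    have yM: "y \<in> carrier (Term M i)" using cocyclesD(1)[OF y] .
    show "\<exists>x \<in> cocycles (trunc n X) i. \<exists>w \<in> coboundaries M i. y = w \<oplus>\<^bsub>Term M i\<^esub> \<phi> i x"
      unfolding cocycles_trunc[OF X i]
    proof (cases "i \<le> b")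
      case True
      have "\<exists>q \<in> carrier (Term X i). Diff X i q = \<zero>\<^bsub>Term X (i + 1)\<^esub> \<and> \<phi> i q = y"
        by (rule ce) (use i True z(1) yM cocyclesD(2)[OF y] cm_zero[OF \<phi> X M(1)] in simp_all)
      then obtain q where "q \<in> cocycles X i" "\<phi> i q = y" unfolding cocycles_def by blast
      moreover have "y = \<zero>\<^bsub>Term M i\<^esub> \<oplus>\<^bsub>Term M i\<^esub> y" using lmM yM by simp
      ultimately show "\<exists>x \<in> cocycles X i. \<exists>w \<in> coboundaries M i. y = w \<oplus>\<^bsub>Term M i\<^esub> \<phi> i x" using z(3) by metis
    next
      case False
      then have "y \<in> coboundaries M i" using H[of i] y by auto
      moreover have "y = y \<oplus>\<^bsub>Term M i\<^esub> \<phi> i \<zero>\<^bsub>Term X i\<^esub>" using lmM yM cm_zero[OF \<phi> X M(1)] by simp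
      ultimately show "\<exists>x \<in> cocycles X i. \<exists>w \<in> coboundaries M i. y = w \<oplus>\<^bsub>Term M i\<^esub> \<phi> i x" using z(1) by blast
    qed
  qed
qed

text \<open>In \<open>trunc n P\<close> the term that may fail to be projective is the quotient in
  degree \<open>n - 1\<close>, and the lifting theorems ask for projectivity from degree
  \<open>n\<close> on.\<close>

lemma projective_replacement:
  fixes X :: "('a, 'u) cplx"
  assumes X: "cx X" "truncated n X"
  obtains Q q where "cx Q" "truncated n Q" "\<And>i. i \<ge> n \<Longrightarrow> fg_projective R (Term Q i)" "q \<in> chain_maps R Q X" "qis Q X q"
proof -
  obtain b where b: "\<forall>i>b. carrier (Term X i) = {\<zero>\<^bsub>Term X i\<^esub>}" using cx_above[OF X(1)] by blast
  have "cocycles X i \<subseteq> coboundaries X i" if i: "i > b" for i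
    using cocyclesD(1)[of _ X i] b[rule_format, OF i] submod_closed(2)[OF cx_lm[OF X(1)] submod_coboundaries[OF X(1)], of i] by auto
  then obtain P \<phi> where P: "cx P" "\<And>i. fg_projective R (Term P i)" "\<phi> \<in> chain_maps R (trunc n P) X" "qis (trunc n P) X \<phi>"
    using truncated_resolution[OF X] by metis
  show ?thesis
    by (rule that[OF trunc_cx[OF P(1)] trunc_truncated[OF P(1)] _ P(3,4)]) (simp add: Term_trunc P(2))
qed

lemma truncated_mono: "truncated n X \<Longrightarrow> m \<le> n \<Longrightarrow> truncated m X"
  by (simp add: truncated_def)

lemma truncated_exists:
  fixes X :: "('a, 'u) cplx"
  assumes "cx X"
  shows "\<exists>n. truncated n X"
proof -
  obtain a where a: "\<forall>i<a. carrier (Term X i) = {\<zero>\<^bsub>Term X i\<^esub>}" using cx_below[OF assms] by blast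
  show ?thesis by (rule exI[of _ a]) (rule truncated_if_zero[OF assms a[rule_format]])
qed

text \<open>For the Ore conditions \<open>n\<close> is free and unrelated to the truncation degree
  of the theorem; it is taken small enough for all three complexes.\<close>

lemma truncated_common:
  fixes X Y Z :: "('a, 'u) cplx"
  assumes "cx X" "cx Y" "cx Z"
  obtains n where "truncated n X" "truncated n Y" "truncated n Z"
proof -
  obtain i j k where "truncated i X" "truncated j Y" "truncated k Z" using assms truncated_exists by metis
  then show ?thesis by (intro that[of "min i (min j k)"]) (auto elim: truncated_mono)
qed

abbreviation QI where "QI \<equiv> quasi_isos R"

lemma QI_E:
  fixes X Y :: "('a, 'u) cplx"
  assumes "cx X" "cx Y" "a \<in> Hom K X Y" "a \<in> QI X Y"
  obtains f where "f \<in> chain_maps R X Y" "a = hcls R X Y f" "qis X Y f"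
  using assms quasi_isos_iff K_HomE by metis

lemma QI_I:
  fixes X Y :: "('a, 'u) cplx"
  assumes "cx X" "cx Y" "f \<in> chain_maps R X Y" "qis X Y f"
  shows "hcls R X Y f \<in> QI X Y"
  using assms quasi_isos_iff by metis

text \<open>In both conditions the new quasi-isomorphism is a replacement \<open>q\<close> of the
  source \<open>X\<close>. The Ore square comes from lifting \<open>f\<close> after \<open>q\<close>
  along \<open>t\<close>, and cancellation from the uniqueness of such lifts.\<close>

theorem ore_K: "ore (K :: (('a, 'u) cplx, _) add_cat) QI"
proof
  show "category (K :: (('a, 'u) cplx, _) add_cat)" by (rule category_K)
next
  fix X :: "('a, 'u) cplx" assume "X \<in> Obj K"
  then have X: "cx X" by simp
  show "Ident K X \<in> QI X X" unfolding K_Ident by (rule QI_I[OF X X chain_maps_id qis_id[OF X]])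
next
  fix X Y Z :: "('a, 'u) cplx" and s t assume "X \<in> Obj K" "Y \<in> Obj K" "Z \<in> Obj K"
    and s: "s \<in> Hom K X Y" "s \<in> QI X Y" and t: "t \<in> Hom K Y Z" "t \<in> QI Y Z"
  then have X: "cx X" "cx Y" "cx Z" by simp_all
  obtain f where f: "f \<in> chain_maps R X Y" "s = hcls R X Y f" "qis X Y f" by (rule QI_E[OF X(1,2) s])
  obtain g where g: "g \<in> chain_maps R Y Z" "t = hcls R Y Z g" "qis Y Z g" by (rule QI_E[OF X(2,3) t])
  show "Comp K X Y Z t s \<in> QI X Z"
    unfolding f(2) g(2) K_Comp[OF X f(1) g(1)]
    by (rule QI_I[OF X(1,3) chain_maps_comp[OF f(1) g(1)] qis_comp[OF X f(1,3) g(1,3)]])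
next
  fix X Y Z :: "('a, 'u) cplx" and a s assume "X \<in> Obj K" "Y \<in> Obj K" "Z \<in> Obj K"
    and a: "a \<in> Hom K X Y" and s: "s \<in> Hom K Z Y" "s \<in> QI Z Y"
  then have X: "cx X" "cx Y" "cx Z" by simp_all
  obtain f where f: "f \<in> chain_maps R X Y" "a = hcls R X Y f" using a by (rule K_HomE)
  obtain t where t: "t \<in> chain_maps R Z Y" "s = hcls R Z Y t" "qis Z Y t" by (rule QI_E[OF X(3,2) s])
  obtain n where n: "truncated n X" "truncated n Y" "truncated n Z" by (rule truncated_common[OF X])
  obtain Q q where Q: "cx Q" and pQ: "\<And>i. i \<ge> n \<Longrightarrow> fg_projective R (Term Q i)"
    and q: "q \<in> chain_maps R Q X" "qis Q X q"
    using projective_replacement[OF X(1) n(1)] by metis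
  obtain v where v: "v \<in> chain_maps R Q Z" "(\<lambda>i x. f i (q i x), \<lambda>i x. t i (v i x)) \<in> homotopy_rel R Q Y"
    by (rule qis_lift_exists[OF Q X(3,2) pQ n(3,2) t(1,3) chain_maps_comp[OF q(1) f(1)]])
  show "\<exists>V \<in> Obj K. \<exists>u \<in> Hom K V X \<inter> QI V X. \<exists>v \<in> Hom K V Z. Comp K V X Y a u = Comp K V Z Y s v"
  proof (intro bexI)
    show "Comp K Q X Y a (hcls R Q X q) = Comp K Q Z Y s (hcls R Q Z v)"
      unfolding f(2) t(2) K_Comp[OF Q X(1,2) q(1) f(1)] K_Comp[OF Q X(3,2) v(1) t(1)] by (rule hcls_eqI[OF Q X(2) v(2)])
    show "hcls R Q X q \<in> Hom K Q X \<inter> QI Q X" using K_HomI[OF q(1)] QI_I[OF Q X(1) q] by blast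
    show "hcls R Q Z v \<in> Hom K Q Z" by (rule K_HomI[OF v(1)])
  qed (simp add: Q)
next
  fix X Y Z :: "('a, 'u) cplx" and a b s assume "X \<in> Obj K" "Y \<in> Obj K" "Z \<in> Obj K"
    and a: "a \<in> Hom K X Y" and b: "b \<in> Hom K X Y" and s: "s \<in> Hom K Y Z" "s \<in> QI Y Z"
    and eq: "Comp K X Y Z s a = Comp K X Y Z s b"
  then have X: "cx X" "cx Y" "cx Z" by simp_all
  obtain f where f: "f \<in> chain_maps R X Y" "a = hcls R X Y f" using a by (rule K_HomE)
  obtain g where g: "g \<in> chain_maps R X Y" "b = hcls R X Y g" using b by (rule K_HomE)
  obtain t where t: "t \<in> chain_maps R Y Z" "s = hcls R Y Z t" "qis Y Z t" by (rule QI_E[OF X(2,3) s])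
  obtain n where n: "truncated n X" "truncated n Y" "truncated n Z" by (rule truncated_common[OF X])
  obtain Q q where Q: "cx Q" and pQ: "\<And>i. i \<ge> n \<Longrightarrow> fg_projective R (Term Q i)"
    and q: "q \<in> chain_maps R Q X" "qis Q X q"
    using projective_replacement[OF X(1) n(1)] by metis
  have "(\<lambda>i x. t i (f i x), \<lambda>i x. t i (g i x)) \<in> homotopy_rel R X Z"
    using eq unfolding f(2) g(2) t(2) K_Comp[OF X f(1) t(1)] K_Comp[OF X g(1) t(1)]
    by (subst (asm) hcls_eq_iff[OF X(1,3) chain_maps_comp[OF f(1) t(1)] chain_maps_comp[OF g(1) t(1)]])
  note hq = homotopy_comp_right[OF Q X(1,3) this q(1)]
  have "(\<lambda>i x. f i (q i x), \<lambda>i x. g i (q i x)) \<in> homotopy_rel R Q Y"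
    by (rule qis_lift_unique[OF Q X(2,3) pQ n(2,3) t(1,3) chain_maps_comp[OF q(1) f(1)] chain_maps_comp[OF q(1) g(1)] hq])
  then have "Comp K Q X Y a (hcls R Q X q) = Comp K Q X Y b (hcls R Q X q)"
    unfolding f(2) g(2) K_Comp[OF Q X(1,2) q(1) f(1)] K_Comp[OF Q X(1,2) q(1) g(1)] by (rule hcls_eqI[OF Q X(2)])
  moreover have "hcls R Q X q \<in> Hom K Q X \<inter> QI Q X" using K_HomI[OF q(1)] QI_I[OF Q X(1) q] by blast
  ultimately show "\<exists>V \<in> Obj K. \<exists>u \<in> Hom K V X \<inter> QI V X. Comp K V X Y a u = Comp K V X Y b u" using K_Obj[of Q] Q by blast
qed

end

section \<open>Finite-dimensional algebras are Noetherian\<close>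

lemma (in ring_ctx) gens_insert:
  fixes M :: "('a, 'u) module"
  assumes M: "left_module R M" and N: "submod R M N" and g: "gens R M N' b k" and sub: "N' \<subseteq> N" and w: "w \<in> N"
    and dec: "\<And>x. x \<in> N \<Longrightarrow> \<exists>a \<in> carrier R. \<exists>y \<in> N'. x = y \<oplus>\<^bsub>M\<^esub> a \<odot>\<^bsub>M\<^esub> w"
  shows "gens R M N (b(k := w)) (Suc k)"
  unfolding gens_def
proof (intro conjI allI impI ballI)
  fix j assume "j < Suc k"
  then show "(b(k := w)) j \<in> N" using g sub w by (auto simp: gens_def less_Suc_eq)
next
  fix x assume "x \<in> N"
  then obtain a y where a: "a \<in> carrier R" "y \<in> N'" "x = y \<oplus>\<^bsub>M\<^esub> a \<odot>\<^bsub>M\<^esub> w" using dec by blast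
  then obtain c where c: "\<forall>j<k. c j \<in> carrier R" "y = lincomb M c b k" using g by (auto simp: gens_def)
  have "lincomb M (c(k := a)) (b(k := w)) k = lincomb M c b k" by (rule lincomb_cong) simp_all
  then have "x = lincomb M (c(k := a)) (b(k := w)) (Suc k)" using a c by simp
  moreover have "\<forall>j<Suc k. (c(k := a)) j \<in> carrier R" using a c by (auto simp: less_Suc_eq)
  ultimately show "\<exists>c. (\<forall>j<Suc k. c j \<in> carrier R) \<and> x = lincomb M c (b(k := w)) (Suc k)" by blast
qed

text \<open>Induction on the number of spanning vectors. If \<open>N\<close> is not inside the span
  \<open>S\<close> of the first \<open>k\<close>, one vector \<open>w\<close> of \<open>N\<close>
  with nonzero last coefficient is added to generators of the intersection of \<open>N\<close> and
  \<open>S\<close>.\<close>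

lemma field_subspace_gens:
  fixes K :: "'k ring" (structure) and M :: "('k, 'u) module"
  assumes K: "field K" and M: "left_module K M" and N: "submod K M N"
    and b: "\<forall>j<k. b j \<in> carrier M"
    and sp: "\<And>x. x \<in> N \<Longrightarrow> \<exists>c. (\<forall>j<k. c j \<in> carrier K) \<and> x = lincomb M c b k"
  shows "\<exists>b k. gens K M N b k"
proof -
  interpret K: field K by (rule K)
  interpret ring_ctx K by unfold_locales
  show ?thesis using N b sp
  proof (induction k arbitrary: N)
    case 0
    then have "gens K M N b 0" by (auto simp: gens_def)
    then show ?case by blast
  next
    case (Suc k)
    note N = submod_closed[OF M Suc.prems(1)]
    have bM: "\<forall>j<k. b j \<in> carrier M" "b k \<in> carrier M" using Suc.prems(2) by auto
    define S where "S = {lincomb M c b k |c. \<forall>j<k. c j \<in> carrier K}"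
    have S: "submod K M S" unfolding S_def by (rule submod_span[OF M bM(1)])
    have NS: "submod K M (N \<inter> S)" using Suc.prems(1) S unfolding submod_def by blast
    have "\<exists>b k. gens K M (N \<inter> S) b k"
      by (rule Suc.IH[OF NS bM(1)]) (auto simp: S_def)
    then obtain b' k' where g: "gens K M (N \<inter> S) b' k'" by blast
    have dec: "\<exists>y \<in> S. \<exists>a \<in> carrier K. x = y \<oplus>\<^bsub>M\<^esub> a \<odot>\<^bsub>M\<^esub> b k" if x: "x \<in> N" for x
    proof -
      obtain c where "\<forall>j<Suc k. c j \<in> carrier K" "x = lincomb M c b (Suc k)" using Suc.prems(3)[OF x] by blast
      then show ?thesis by (intro bexI[of _ "lincomb M c b k"] bexI[of _ "c k"]) (auto simp: S_def)
    qed
    show ?case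
    proof (cases "N \<subseteq> S")
      case True
      then have "N \<inter> S = N" by blast
      then show ?thesis using g by auto
    next
      case False
      then obtain w where w: "w \<in> N" "w \<notin> S" by blast
      obtain v a where va: "v \<in> S" "a \<in> carrier K" "w = v \<oplus>\<^bsub>M\<^esub> a \<odot>\<^bsub>M\<^esub> b k" using dec[OF w(1)] by blast
      have vM: "v \<in> carrier M" using submod_closed(1)[OF M S va(1)] .
      have "a \<noteq> \<zero>" using va w(2) vM M bM(2) by auto
      then have ai: "inv a \<in> carrier K" "inv a \<otimes> a = \<one>"
        using va(2) K.field_Units by (auto intro: K.Units_l_inv)
      have "gens K M N (b'(k' := w)) (Suc k')"
      proof (rule gens_insert[OF M Suc.prems(1) g _ w(1)])
        fix x assume x: "x \<in> N"
        obtain u r where u: "u \<in> S" "r \<in> carrier K" "x = u \<oplus>\<^bsub>M\<^esub> r \<odot>\<^bsub>M\<^esub> b k" using dec[OF x] by blast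
        have uM: "u \<in> carrier M" using submod_closed(1)[OF M S u(1)] .
        \<comment> \<open>Chosen so that subtracting \<open>s\<close> times \<open>w\<close> from
          \<open>x\<close> cancels the coefficient at \<open>b k\<close>.\<close>
        define s where "s = r \<otimes> inv a"
        have s: "s \<in> carrier K" "s \<otimes> a = r" unfolding s_def using u(2) va(2) ai by (simp_all add: K.m_assoc)
        let ?y = "x \<oplus>\<^bsub>M\<^esub> \<ominus>\<^bsub>M\<^esub> (s \<odot>\<^bsub>M\<^esub> w)"
        have sb: "s \<odot>\<^bsub>M\<^esub> w = s \<odot>\<^bsub>M\<^esub> v \<oplus>\<^bsub>M\<^esub> r \<odot>\<^bsub>M\<^esub> b k"
          unfolding va(3) using s va(2) vM bM(2) M by (simp add: lm_smult_add lm_mult_smult[symmetric])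
        have "?y = u \<oplus>\<^bsub>M\<^esub> \<ominus>\<^bsub>M\<^esub> (s \<odot>\<^bsub>M\<^esub> v)"
          unfolding sb u(3) using M uM vM s(1) u(2) bM(2) by (simp add: lm_neg_add lm_ac)
        moreover have "\<dots> \<in> S"
          by (intro submod_closed(3)[OF M S u(1)] submod_closed(5)[OF M S] submod_closed(4)[OF M S s(1) va(1)])
        ultimately have "?y \<in> N \<inter> S"
          using N(3)[OF x N(5)[OF N(4)[OF s(1) w(1)]]] by simp
        moreover have "x = ?y \<oplus>\<^bsub>M\<^esub> s \<odot>\<^bsub>M\<^esub> w"
          using M N(1)[OF x] N(1)[OF w(1)] s(1) by (simp add: lm_assoc)
        ultimately show "\<exists>a \<in> carrier K. \<exists>y \<in> N \<inter> S. x = y \<oplus>\<^bsub>M\<^esub> a \<odot>\<^bsub>M\<^esub> w" using s(1) by blast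
      qed blast
      then show ?thesis by blast
    qed
  qed
qed

text \<open>Over the field \<open>K\<close> the module \<open>M\<close> is still finitely generated,
  so its subspace \<open>N\<close> is finitely generated over \<open>K\<close>, and the same
  generators serve over \<open>A\<close>.\<close>

lemma findim_algebra_noetherian:
  fixes K :: "'k ring" and A :: "('k, 'a) module" and M :: "('a, 'u) module"
  assumes K: "field K" and alg: "findim_algebra K A" and M: "fg_module A M" and N: "submod A M N"
  shows "\<exists>b k. gens A M N b k"
proof -
  interpret K: field K by (rule K)
  interpret A: findim_algebra K A by (rule alg)
  interpret RA: ring_ctx A by unfold_locales
  interpret RK: ring_ctx K by unfold_locales
  have lm: "left_module A M" using M by (simp add: fg_module_def)
  \<comment> \<open>The structure map from scalars to the algebra; \<open>MK\<close> below is
    \<open>M\<close> with scalars restricted along it.\<close>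
  define \<kappa> where "\<kappa> c = c \<odot>\<^bsub>A\<^esub> \<one>\<^bsub>A\<^esub>" for c
  have \<kappa>c: "\<kappa> c \<in> carrier A" if "c \<in> carrier K" for c using that by (simp add: \<kappa>_def)
  have \<kappa>m: "\<kappa> c \<otimes>\<^bsub>A\<^esub> x = c \<odot>\<^bsub>A\<^esub> x" if "c \<in> carrier K" "x \<in> carrier A" for c x
    using that by (simp add: \<kappa>_def A.smult_mult_left)
  define MK :: "('k, 'u) module" where "MK = undefined\<lparr>carrier := carrier M, zero := \<zero>\<^bsub>M\<^esub>, add := (\<oplus>\<^bsub>M\<^esub>),
    smult := (\<lambda>c x. \<kappa> c \<odot>\<^bsub>M\<^esub> x)\<rparr>"
  have MKs [simp]: "carrier MK = carrier M" "\<zero>\<^bsub>MK\<^esub> = \<zero>\<^bsub>M\<^esub>" "x \<oplus>\<^bsub>MK\<^esub> y = x \<oplus>\<^bsub>M\<^esub> y" "c \<odot>\<^bsub>MK\<^esub> x = \<kappa> c \<odot>\<^bsub>M\<^esub> x" for x y c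
    by (simp_all add: MK_def)
  have lmK: "left_module K MK"
  proof -
    have "abelian_group MK"
    proof (rule abelian_groupI)
      fix x assume "x \<in> carrier MK"
      then show "\<exists>y \<in> carrier MK. y \<oplus>\<^bsub>MK\<^esub> x = \<zero>\<^bsub>MK\<^esub>"
        using lm by (intro bexI[of _ "\<ominus>\<^bsub>M\<^esub> x"]) simp_all
    qed (use lm in \<open>simp_all add: RA.lm_ac\<close>)
    moreover have "left_module_axioms K MK"
    proof
      fix a b x assume abx: "a \<in> carrier K" "b \<in> carrier K" "x \<in> carrier MK"
      have "\<kappa> (a \<oplus>\<^bsub>K\<^esub> b) = \<kappa> a \<oplus>\<^bsub>A\<^esub> \<kappa> b" unfolding \<kappa>_def using abx by (intro A.smult_l_distr) simp_all
      then show "(a \<oplus>\<^bsub>K\<^esub> b) \<odot>\<^bsub>MK\<^esub> x = a \<odot>\<^bsub>MK\<^esub> x \<oplus>\<^bsub>MK\<^esub> b \<odot>\<^bsub>MK\<^esub> x"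
        using abx lm \<kappa>c by (simp add: RA.lm_add_smult)
      have "\<kappa> (a \<otimes>\<^bsub>K\<^esub> b) = \<kappa> a \<otimes>\<^bsub>A\<^esub> \<kappa> b"
        using abx \<kappa>c by (simp add: \<kappa>m) (simp add: \<kappa>_def A.smult_assoc1)
      then show "(a \<otimes>\<^bsub>K\<^esub> b) \<odot>\<^bsub>MK\<^esub> x = a \<odot>\<^bsub>MK\<^esub> (b \<odot>\<^bsub>MK\<^esub> x)"
        using abx lm \<kappa>c by (simp add: RA.lm_mult_smult)
    next
      fix a x y assume "a \<in> carrier K" "x \<in> carrier MK" "y \<in> carrier MK"
      then show "a \<odot>\<^bsub>MK\<^esub> (x \<oplus>\<^bsub>MK\<^esub> y) = a \<odot>\<^bsub>MK\<^esub> x \<oplus>\<^bsub>MK\<^esub> a \<odot>\<^bsub>MK\<^esub> y"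
        using lm \<kappa>c by (simp add: RA.lm_smult_add)
    next
      fix a x assume "a \<in> carrier K" "x \<in> carrier MK"
      then show "a \<odot>\<^bsub>MK\<^esub> x \<in> carrier MK" using lm \<kappa>c by simp
    next
      fix x assume "x \<in> carrier MK"
      moreover have "\<kappa> \<one>\<^bsub>K\<^esub> = \<one>\<^bsub>A\<^esub>" by (simp add: \<kappa>_def)
      ultimately show "\<one>\<^bsub>K\<^esub> \<odot>\<^bsub>MK\<^esub> x = x" using lm by simp
    qed
    ultimately show ?thesis using K.ring_axioms by (simp add: left_module_def)
  qed
  have lcK: "lincomb MK c b k = lincomb M (\<lambda>j. \<kappa> (c j)) b k" for c b k by (induction k) simp_all
  have subK: "submod K MK N'" if "submod A M N'" for N'
    using that \<kappa>c unfolding submod_def by simp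
  obtain B where B: "finite B" "B \<subseteq> carrier A"
    "\<And>x. x \<in> carrier A \<Longrightarrow> \<exists>c \<in> B \<rightarrow> carrier K. x = (\<Oplus>\<^bsub>A\<^esub>b \<in> B. c b \<odot>\<^bsub>A\<^esub> b)"
    using A.finite_dimensional by blast
  obtain g m where g: "\<forall>j<m. g j \<in> carrier M"
    "\<And>x. x \<in> carrier M \<Longrightarrow> \<exists>c. (\<forall>j<m. c j \<in> carrier A) \<and> x = lincomb M c g m"
    using M RA.fg_module_iff[OF lm] unfolding gens_def by auto
  \<comment> \<open>Products of a spanning element of \<open>A\<close> with a generator of
    \<open>M\<close>. Different pairs may give the same product, so the span \<open>S\<close> is
    used as a submodule and no coefficients are matched to pairs.\<close>
  let ?G = "(\<lambda>(b, j). b \<odot>\<^bsub>M\<^esub> g j) ` (B \<times> {..<m})"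
  have G: "finite ?G" "?G \<subseteq> carrier MK" using B(1,2) g(1) lm by auto
  define S where "S = {\<Oplus>\<^bsub>MK\<^esub>g \<in> ?G. c g \<odot>\<^bsub>MK\<^esub> g |c. c \<in> ?G \<rightarrow> carrier K}"
  have subS: "submod K MK S" "?G \<subseteq> S"
    unfolding S_def by (rule RK.submod_finsum_span[OF lmK G])+
  note S = RK.submod_closed[OF lmK subS(1)]
  \<comment> \<open>A scalar of \<open>A\<close>, expanded over \<open>B\<close>, moves
    \<open>g j\<close> into \<open>S\<close>; subsets \<open>B'\<close> of \<open>B\<close> are
    there for the induction.\<close>
  have bg: "(\<Oplus>\<^bsub>A\<^esub>b \<in> B'. c b \<odot>\<^bsub>A\<^esub> b) \<odot>\<^bsub>M\<^esub> g j \<in> S" if "B' \<subseteq> B" "c \<in> B \<rightarrow> carrier K" "j < m" for B' c j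
  proof -
    have "finite B'" using that(1) B(1) finite_subset by blast
    then show ?thesis using that(1)
    proof (induction B')
      case empty
      then show ?case using S(2) lm g(1) that(3) by simp
    next
      case (insert b B')
      have cb: "c b \<in> carrier K" "b \<in> carrier A" using insert.prems that(2) B(2) by auto
      have gj: "g j \<in> carrier M" using g(1) that(3) by blast
      have car: "(\<lambda>b. c b \<odot>\<^bsub>A\<^esub> b) \<in> B' \<rightarrow> carrier A" using insert.prems that(2) B(2) by auto
      then have sumc: "(\<Oplus>\<^bsub>A\<^esub>b \<in> B'. c b \<odot>\<^bsub>A\<^esub> b) \<in> carrier A" by (rule A.finsum_closed)
      have "(\<Oplus>\<^bsub>A\<^esub>b \<in> insert b B'. c b \<odot>\<^bsub>A\<^esub> b) = c b \<odot>\<^bsub>A\<^esub> b \<oplus>\<^bsub>A\<^esub> (\<Oplus>\<^bsub>A\<^esub>b \<in> B'. c b \<odot>\<^bsub>A\<^esub> b)"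
        by (rule A.finsum_insert) (use insert.hyps car cb in simp_all)
      moreover have "(c b \<odot>\<^bsub>A\<^esub> b) \<odot>\<^bsub>M\<^esub> g j = c b \<odot>\<^bsub>MK\<^esub> (b \<odot>\<^bsub>M\<^esub> g j)"
        using \<kappa>m[OF cb, symmetric] RA.lm_mult_smult[OF lm \<kappa>c[OF cb(1)] cb(2) gj] by simp
      ultimately have e: "(\<Oplus>\<^bsub>A\<^esub>b \<in> insert b B'. c b \<odot>\<^bsub>A\<^esub> b) \<odot>\<^bsub>M\<^esub> g j =
          c b \<odot>\<^bsub>MK\<^esub> (b \<odot>\<^bsub>M\<^esub> g j) \<oplus>\<^bsub>MK\<^esub> (\<Oplus>\<^bsub>A\<^esub>b \<in> B'. c b \<odot>\<^bsub>A\<^esub> b) \<odot>\<^bsub>M\<^esub> g j"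
        using RA.lm_add_smult[OF lm _ sumc gj, of "c b \<odot>\<^bsub>A\<^esub> b"] cb by simp
      have "b \<odot>\<^bsub>M\<^esub> g j \<in> ?G" using insert.prems that(3) by auto
      then have "b \<odot>\<^bsub>M\<^esub> g j \<in> S" using subS(2) by blast
      then show ?case unfolding e using insert.IH insert.prems by (intro S(3) S(4)[OF cb(1)]) blast+
    qed
  qed
  have span: "x \<in> S" if x: "x \<in> carrier MK" for x
  proof -
    obtain c where c: "\<forall>j<m. c j \<in> carrier A" "x = lincomb M c g m" using g(2) x by auto
    have "k \<le> m \<Longrightarrow> lincomb M c g k \<in> S" for k
    proof (induction k)
      case 0
      then show ?case using S(2) by simp
    next
      case (Suc k)
      then have k: "k < m" by simp
      obtain r where r: "r \<in> B \<rightarrow> carrier K" "c k = (\<Oplus>\<^bsub>A\<^esub>b \<in> B. r b \<odot>\<^bsub>A\<^esub> b)" using B(3) c(1) k by blast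
      have "c k \<odot>\<^bsub>M\<^esub> g k \<in> S" unfolding r(2) by (rule bg[OF subset_refl r(1) k])
      then show ?case using Suc S(3)[of "lincomb M c g k" "c k \<odot>\<^bsub>M\<^esub> g k"] by simp
    qed
    then show ?thesis using c(2) by simp
  qed
  have "fg_module K MK"
    unfolding fg_module_def
  proof (intro conjI lmK exI[of _ ?G] G ballI)
    fix x assume "x \<in> carrier MK"
    then have "x \<in> S" by (rule span)
    then obtain c where "x = (\<Oplus>\<^bsub>MK\<^esub>g \<in> ?G. c g \<odot>\<^bsub>MK\<^esub> g)" "c \<in> ?G \<rightarrow> carrier K" unfolding S_def by blast
    then show "\<exists>c \<in> ?G \<rightarrow> carrier K. x = (\<Oplus>\<^bsub>MK\<^esub>g \<in> ?G. c g \<odot>\<^bsub>MK\<^esub> g)" by (intro bexI[of _ c])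
  qed
  then obtain b k where bk: "\<forall>j<k. b j \<in> carrier MK"
    "\<And>x. x \<in> carrier MK \<Longrightarrow> \<exists>c. (\<forall>j<k. c j \<in> carrier K) \<and> x = lincomb MK c b k"
    using RK.fg_module_iff[OF lmK] unfolding gens_def by auto
  have "\<exists>b k. gens K MK N b k"
    by (rule field_subspace_gens[OF K lmK subK[OF N] bk(1)]) (use bk(2) RA.submod_closed(1)[OF lm N] in simp)
  then obtain b k where gk: "gens K MK N b k" by blast
  have "gens A M N b k"
    unfolding gens_def
  proof (intro conjI ballI)
    show "\<forall>j<k. b j \<in> N" using gk by (simp add: gens_def)
    fix x assume "x \<in> N"
    then obtain c where "\<forall>j<k. c j \<in> carrier K" "x = lincomb MK c b k" using gk by (auto simp: gens_def)
    then show "\<exists>c. (\<forall>j<k. c j \<in> carrier A) \<and> x = lincomb M c b k"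
      using \<kappa>c by (intro exI[of _ "\<lambda>j. \<kappa> (c j)"]) (simp add: lcK)
  qed
  then show ?thesis by blast
qed

section \<open>The truncation functor on projective complexes\<close>

context noeth_ctx
begin

interpretation L: ore "Kb_mod R :: (('a, 'u) cplx, _) add_cat" "quasi_isos R"
  by (rule ore_K)

abbreviation D where "D \<equiv> localization (K :: (('a, 'u) cplx, _) add_cat) QI"

lemma trunc_K_QI:
  fixes X Y :: "('a, 'u) cplx"
  assumes "cx X" "cx Y" "s \<in> Hom K X Y" "s \<in> QI X Y"
  shows "AMap (trunc_K R n) X Y s \<in> QI (trunc n X) (trunc n Y)"
proof -
  obtain f where f: "f \<in> chain_maps R X Y" "s = hcls R X Y f" "qis X Y f" by (rule QI_E[OF assms])
  show ?thesis
    unfolding f(2) AMap_trunc_K[OF assms(1,2) f(1)]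
    by (rule QI_I[OF trunc_cx[OF assms(1)] trunc_cx[OF assms(2)] trunc_map_chain_map[OF assms(1,2) f(1)] trunc_map_qis[OF assms(1,2) f(1,3)]])
qed

lemma OMap_trunc_KD [simp]: "OMap (trunc_KD R n) X = trunc n X"
  by (simp add: trunc_KD_def trunc_D_def functor_comp_def loc_extend_def loc_functor_def trunc_K_def)

lemma AMap_trunc_KD:
  fixes X Y :: "('a, 'u) cplx"
  assumes "cx X" "cx Y" "a \<in> Hom K X Y"
  shows "AMap (trunc_KD R n) X Y a = L.lcls (trunc n X) (trunc n Y) (AMap (trunc_K R n) X Y a)"
proof -
  have "AMap (functor_comp (loc_extend K QI (trunc_K R n)) (loc_functor K QI)) X Y a =
      L.lcls (OMap (trunc_K R n) X) (OMap (trunc_K R n) Y) (AMap (trunc_K R n) X Y a)"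
    by (rule L.AMap_loc_extend[OF trunc_K_functor]) (use assms trunc_K_QI in simp_all)
  then show ?thesis unfolding trunc_KD_def trunc_D_def by simp
qed

text \<open>A complex \<open>Q\<close> that is projective in degrees at least \<open>n\<close> behaves like a projective resolution
  with respect to \<open>n\<close>-truncated targets: morphisms in the derived category are represented by
  unique homotopy classes, because a quasi-isomorphism \<open>V \<rightarrow> Q\<close> factors through \<open>trunc n V\<close> and
  then splits.\<close>

lemma qis_section:
  fixes V Q :: "('a, 'u) cplx"
  assumes V: "cx V" and Q: "cx Q" "truncated n Q" and proj: "\<And>i. i \<ge> n \<Longrightarrow> fg_projective R (Term Q i)"
    and s: "s \<in> chain_maps R V Q" "qis V Q s"
  obtains u where "u \<in> chain_maps R Q (trunc n V)" "(\<lambda>i x. x, \<lambda>i x. s i (u i x)) \<in> homotopy_rel R Q Q"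
  by (rule qis_lift_exists[OF Q(1) trunc_cx[OF V] Q(1) proj trunc_truncated[OF V] Q(2)
    trunc_universal(1)[OF V Q s(1)] qis_trunc_source[OF V Q s] chain_maps_id])

context
  fixes n :: int and Q W :: "('a, 'u) cplx"
  assumes Q: "cx Q" "truncated n Q" and proj: "\<And>i. i \<ge> n \<Longrightarrow> fg_projective R (Term Q i)"
    and W: "cx W" "truncated n W"
begin

text \<open>In a roof from \<open>Q\<close> to \<open>W\<close> with apex \<open>V\<close> both legs
  factor through \<open>trunc n V\<close>, because \<open>Q\<close> and \<open>W\<close> are
  truncated. There the denominator has a section \<open>u\<close> up to homotopy, and the numerator
  after \<open>u\<close> is the chain map sought.\<close>

lemma derived_hom_representable:
  assumes g: "g \<in> Hom D Q W"
  obtains m where "m \<in> chain_maps R Q W" "g = L.lcls Q W (hcls R Q W m)"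
proof -
  obtain V a b where V: "cx V" and a: "a \<in> Hom K V Q" "a \<in> QI V Q" and b: "b \<in> Hom K V W"
    and g_eq: "g = L.rcls Q W (V, a, b)" using L.loc_HomE[OF g] by (metis K_Obj)
  obtain s where s: "s \<in> chain_maps R V Q" "a = hcls R V Q s" "qis V Q s" by (rule QI_E[OF V Q(1) a])
  obtain f where f: "f \<in> chain_maps R V W" "b = hcls R V W f" using b by (rule K_HomE)
  obtain u where u: "u \<in> chain_maps R Q (trunc n V)" "(\<lambda>i x. x, \<lambda>i x. s i (u i x)) \<in> homotopy_rel R Q Q"
    by (rule qis_section[OF V Q proj s(1,3)])
  let ?V = "trunc n V"
  note TV = trunc_cx[OF V, of n] and p = tproj_chain_map[OF V, of n]
  note sT = trunc_universal[OF V Q s(1)] and fT = trunc_universal[OF V W f(1)]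
  let ?s = "hcls R ?V Q s" and ?f = "hcls R ?V W f"
  have r1: "(V, a, b) \<in> roofs K QI Q W" using V a b by (simp add: L.roofs_iff)
  have r2: "(?V, ?s, ?f) \<in> roofs K QI Q W"
    unfolding L.roofs_iff using TV K_HomI[OF sT(1)] K_HomI[OF fT(1)] QI_I[OF TV Q(1) sT(1) qis_trunc_source[OF V Q s(1,3)]] by simp
  \<comment> \<open>The witness is \<open>V\<close> itself, with the identity and the projection
    \<open>tproj\<close>.\<close>
  have "((V, a, b), (?V, ?s, ?f)) \<in> roof_rel K QI Q W"
  proof (rule L.roof_relI[OF r1 r2])
    show "V \<in> Obj K" using V by simp
    show "Ident K V \<in> Hom K V V" using V L.id_hom by simp
    show "hcls R V ?V (tproj n V) \<in> Hom K V ?V" by (rule K_HomI[OF p])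
    show "Comp K V V Q a (Ident K V) \<in> QI V Q" using V Q a L.id_right by simp
    have "Comp K V V Q a (Ident K V) = hcls R V Q s" using V Q(1) a(1) s(2) L.id_right by simp
    also have "\<dots> = Comp K V ?V Q ?s (hcls R V ?V (tproj n V))"
      unfolding K_Comp[OF V TV Q(1) p sT(1)] by (rule hcls_eqI[OF V Q(1) homotopy_cong[OF V Q(1) s(1)]]) (rule sT(2))
    finally show "Comp K V V Q a (Ident K V) = Comp K V ?V Q ?s (hcls R V ?V (tproj n V))" .
    have "Comp K V V W b (Ident K V) = hcls R V W f" using V W(1) b f(2) L.id_right by simp
    also have "\<dots> = Comp K V ?V W ?f (hcls R V ?V (tproj n V))"
      unfolding K_Comp[OF V TV W(1) p fT(1)] by (rule hcls_eqI[OF V W(1) homotopy_cong[OF V W(1) f(1)]]) (rule fT(2))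
    finally show "Comp K V V W b (Ident K V) = Comp K V ?V W ?f (hcls R V ?V (tproj n V))" .
  qed
  then have e1: "g = L.rcls Q W (?V, ?s, ?f)" unfolding g_eq using Q W by (intro L.rcls_eqI) simp_all
  define m where "m = (\<lambda>i x. f i (u i x))"
  have m: "m \<in> chain_maps R Q W" unfolding m_def by (rule chain_maps_comp[OF u(1) fT(1)])
  have r3: "(Q, Ident K Q, hcls R Q W m) \<in> roofs K QI Q W" using Q by (intro L.lcls_roof K_HomI[OF m]) simp
  have su: "Comp K Q ?V Q ?s (hcls R Q ?V u) = Ident K Q"
    unfolding K_Comp[OF Q(1) TV Q(1) u(1) sT(1)] K_Ident by (rule hcls_eqI[OF Q(1) Q(1) homotopy_sym[OF Q(1) Q(1) u(2)]])
  have idQ: "Ident K Q \<in> Hom K Q Q" "Ident K Q \<in> QI Q Q" using Q L.id_hom L.S_id by simp_all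
  \<comment> \<open>The witness is \<open>Q\<close>, with \<open>u\<close> and the identity:
    \<open>s\<close> after \<open>u\<close> is homotopic to the identity, which clears the
    denominator.\<close>
  have "((?V, ?s, ?f), (Q, Ident K Q, hcls R Q W m)) \<in> roof_rel K QI Q W"
  proof (rule L.roof_relI[OF r2 r3])
    show "Q \<in> Obj K" using Q by simp
    show "hcls R Q ?V u \<in> Hom K Q ?V" by (rule K_HomI[OF u(1)])
    show "Comp K Q ?V Q ?s (hcls R Q ?V u) \<in> QI Q Q" unfolding su by (rule idQ(2))
    show "Comp K Q ?V Q ?s (hcls R Q ?V u) = Comp K Q Q Q (Ident K Q) (Ident K Q)"
      unfolding su using Q idQ L.id_left by simp
    show "Comp K Q ?V W ?f (hcls R Q ?V u) = Comp K Q Q W (hcls R Q W m) (Ident K Q)"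
      unfolding K_Comp[OF Q(1) TV W(1) u(1) fT(1)] using Q W K_HomI[OF m] L.id_right unfolding m_def by simp
  qed (rule idQ(1))
  then have "g = L.lcls Q W (hcls R Q W m)" unfolding e1 using Q W by (intro L.rcls_eqI) simp_all
  with m show ?thesis by (rule that)
qed

text \<open>Equal fractions agree after some quasi-isomorphism \<open>s\<close> into
  \<open>Q\<close>. The homotopy descends to \<open>trunc n V\<close>, and precomposing with the
  section of \<open>s\<close> removes \<open>s\<close>.\<close>

lemma derived_hom_faithful:
  assumes f: "f \<in> chain_maps R Q W" and g: "g \<in> chain_maps R Q W"
    and eq: "L.lcls Q W (hcls R Q W f) = L.lcls Q W (hcls R Q W g)"
  shows "(f, g) \<in> homotopy_rel R Q W"
proof -
  have "((Q, Ident K Q, hcls R Q W f), (Q, Ident K Q, hcls R Q W g)) \<in> roof_rel K QI Q W"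
    using eq Q W L.lcls_roof[OF _ K_HomI[OF g]] by (subst (asm) L.rcls_eq_iff) simp_all
  then obtain V a b where V: "cx V" and a: "a \<in> Hom K V Q" and b: "b \<in> Hom K V Q"
    and aQ: "Comp K V Q Q (Ident K Q) a \<in> QI V Q" "Comp K V Q Q (Ident K Q) a = Comp K V Q Q (Ident K Q) b"
    and fg: "Comp K V Q W (hcls R Q W f) a = Comp K V Q W (hcls R Q W g) b"
    by (rule L.roof_relE) simp
  \<comment> \<open>Both denominators are identities, so the two comparison maps coincide and are a
    quasi-isomorphism.\<close>
  have "b = a" "a \<in> QI V Q" using aQ V Q(1) a b L.id_left by simp_all
  then obtain s where s: "s \<in> chain_maps R V Q" "a = hcls R V Q s" "qis V Q s" using QI_E[OF V Q(1) a] by metis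
  have "(\<lambda>i x. f i (s i x), \<lambda>i x. g i (s i x)) \<in> homotopy_rel R V W"
    using fg unfolding \<open>b = a\<close> s(2) K_Comp[OF V Q(1) W(1) s(1) f] K_Comp[OF V Q(1) W(1) s(1) g]
    by (subst (asm) hcls_eq_iff[OF V W(1) chain_maps_comp[OF s(1) f] chain_maps_comp[OF s(1) g]])
  from trunc_universal_homotopy[OF V W this]
  have h: "(\<lambda>i x. f i (s i x), \<lambda>i x. g i (s i x)) \<in> homotopy_rel R (trunc n V) W" .
  obtain u where u: "u \<in> chain_maps R Q (trunc n V)" "(\<lambda>i x. x, \<lambda>i x. s i (u i x)) \<in> homotopy_rel R Q Q"
    by (rule qis_section[OF V Q proj s(1,3)])
  have 1: "(f, \<lambda>i x. f i (s i (u i x))) \<in> homotopy_rel R Q W" by (rule homotopy_comp_left[OF Q(1) Q(1) W(1) u(2) f])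
  have 2: "(\<lambda>i x. f i (s i (u i x)), \<lambda>i x. g i (s i (u i x))) \<in> homotopy_rel R Q W"
    by (rule homotopy_comp_right[OF Q(1) trunc_cx[OF V] W(1) h u(1)])
  have 3: "(g, \<lambda>i x. g i (s i (u i x))) \<in> homotopy_rel R Q W" by (rule homotopy_comp_left[OF Q(1) Q(1) W(1) u(2) g])
  show ?thesis
    by (rule homotopy_trans[OF Q(1) W(1) 1 homotopy_trans[OF Q(1) W(1) 2 homotopy_sym[OF Q(1) W(1) 3]]])
qed

end

text \<open>From degree \<open>n\<close> on \<open>m\<close> is taken over unchanged, and below
  \<open>n - 1\<close> there is nothing to define on \<open>X\<close>. In degree
  \<open>n - 1\<close> projectivity lifts \<open>m\<close> from quotients to terms; the lift is
  compatible with the differential because that of \<open>Y\<close> is constant on cosets of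
  cocycles.\<close>

lemma trunc_map_surj:
  fixes X Y :: "('a, 'u) cplx"
  assumes X: "cx X" and pX: "fg_projective R (Term X (n - 1))" and zX: "\<And>i. i < n - 1 \<Longrightarrow> carrier (Term X i) = {\<zero>\<^bsub>Term X i\<^esub>}"
    and Y: "cx Y" and m: "m \<in> chain_maps R (trunc n X) (trunc n Y)"
  shows "\<exists>f \<in> chain_maps R X Y. \<forall>i. \<forall>x \<in> carrier (Term (trunc n X) i). trunc_map n Y f i x = m i x"
proof -
  have lm: "left_module R (Term X i)" "left_module R (Term Y i)" "left_module R (Term (trunc n X) i)" "left_module R (Term (trunc n Y) i)" for i
    using X Y trunc_cx[OF X] trunc_cx[OF Y] by simp_all
  note pX' = tproj_chain_map[OF X, of n] and pY' = tproj_chain_map[OF Y, of n]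
  let ?e = "n - 1"
  define E where "E x y z \<longleftrightarrow> x \<in> carrier (Term X ?e) \<and> y \<in> carrier (Term Y ?e) \<and> z = \<zero>\<^bsub>Term Y ?e\<^esub> \<and>
    tproj n Y ?e y = m ?e (tproj n X ?e x)" for x y z
  have E: "rel3 R (Term X ?e) (Term Y ?e) (Term Y ?e) E"
    unfolding rel3_def E_def
    by (auto simp: lm cmD[OF pX'] cmD[OF pY'] cmD[OF m] cm_smult[OF pX'] cm_smult[OF pY'] cm_smult[OF m] X Y trunc_cx[OF X] trunc_cx[OF Y])
  have tot: "\<exists>y z. E x y z" if x: "x \<in> carrier (Term X ?e)" for x
  proof -
    have y: "m ?e (tproj n X ?e x) \<in> carrier (Term (trunc n Y) ?e)" by (rule cm_closed[OF m cm_closed[OF pX' x]])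
    show ?thesis unfolding E_def using x trunc_carrier[OF Y y] tproj_fix[OF Y y] by blast
  qed
  obtain h where h: "h \<in> mod_hom R (Term X ?e) (Term Y ?e)"
    and hE: "\<And>x. x \<in> carrier (Term X ?e) \<Longrightarrow> tproj n Y ?e (h x) = m ?e (tproj n X ?e x)"
    using projective_lift[OF pX lm(2) lm(2) E tot] unfolding E_def by blast
  define f where "f i = (if i < ?e then (\<lambda>_. \<zero>\<^bsub>Term Y i\<^esub>) else if i = ?e then h else m i)" for i
  have f: "f \<in> chain_maps R X Y"
  proof (rule chain_mapsI)
    show "f i \<in> mod_hom R (Term X i) (Term Y i)" for i
      using h cm_hom[OF m, of i] hom_const_zero[OF lm(2)]
      by (cases i n rule: degree_cases) (auto simp: f_def Term_trunc)
    fix i x assume x: "x \<in> carrier (Term X i)"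
    show "f (i + 1) (Diff X i x) = Diff Y i (f i x)"
    proof (cases i n rule: degree_cases)
      case below
      have "f j \<zero>\<^bsub>Term X j\<^esub> = \<zero>\<^bsub>Term Y j\<^esub>" if "j \<le> ?e" for j
        using that hom_zero[OF lm(1,2) h] by (cases "j = ?e") (simp_all add: f_def)
      from this[of "i + 1"] have "f (i + 1) \<zero>\<^bsub>Term X (i + 1)\<^esub> = \<zero>\<^bsub>Term Y (i + 1)\<^esub>" using below by simp
      then show ?thesis using x zX[OF below] X Y below by (simp add: f_def)
    next
      case i: edge
      have "f (i + 1) (Diff X i x) = m n (Diff X ?e x)" using i by (simp add: f_def)
      also have "\<dots> = tproj n Y n (m n (tproj n X n (Diff X ?e x)))" by (simp add: tproj_simps)
      also have "tproj n X n (Diff X ?e x) = Diff (trunc n X) ?e (tproj n X ?e x)"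
        using cm_diff[OF pX', of x ?e n] x i by simp
      also have "m n \<dots> = Diff (trunc n Y) ?e (m ?e (tproj n X ?e x))"
        using cm_diff[OF m, of "tproj n X ?e x" ?e n] cm_closed[OF pX', of x ?e] x i by simp
      also have "\<dots> = Diff (trunc n Y) ?e (tproj n Y ?e (h x))" using hE x i by simp
      also have "\<dots> = tproj n Y n (Diff Y ?e (h x))"
        using cm_diff[OF pY', of "h x" ?e n] hom_closed[OF h, of x] x i by simp
      finally show ?thesis using i by (simp add: f_def tproj_simps)
    next
      case above
      then show ?thesis using cm_diff[OF m, of x i "i + 1"] x by (simp add: f_def Term_trunc Diff_trunc)
    qed
  qed
  moreover have "trunc_map n Y f i x = m i x" if x: "x \<in> carrier (Term (trunc n X) i)" for i x
  proof (cases i n rule: degree_cases)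
    case below
    have "m i x \<in> carrier (Term (trunc n Y) i)" by (rule cm_closed[OF m x])
    then show ?thesis using below by (simp add: trunc_map_tproj tproj_simps Term_trunc)
  next
    case i: edge
    then show ?thesis using hE[of x] trunc_carrier[OF X x] tproj_fix[OF X x] by (simp add: trunc_map_tproj f_def)
  next
    case above
    then show ?thesis by (simp add: trunc_map_tproj f_def tproj_simps)
  qed
  ultimately show ?thesis by blast
qed

text \<open>The other terms are the zero submodules of those of \<open>X\<close>, so all zeros are
  zeros of \<open>X\<close> and no new module has to be coded.\<close>

definition stalk :: "int \<Rightarrow> ('a, 'u) cplx \<Rightarrow> ('a, 'u) cplx" where
  "stalk j X = \<lparr>Term = (\<lambda>i. if i = j then Term X j else (Term X i)\<lparr>carrier := {\<zero>\<^bsub>Term X i\<^esub>}\<rparr>),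
     Diff = (\<lambda>i x. \<zero>\<^bsub>Term X (i + 1)\<^esub>)\<rparr>"

lemma stalk_simps:
  "Term (stalk j X) j = Term X j" "i \<noteq> j \<Longrightarrow> Term (stalk j X) i = (Term X i)\<lparr>carrier := {\<zero>\<^bsub>Term X i\<^esub>}\<rparr>"
  "Diff (stalk j X) i x = \<zero>\<^bsub>Term X (i + 1)\<^esub>" "\<zero>\<^bsub>Term (stalk j X) i\<^esub> = \<zero>\<^bsub>Term X i\<^esub>"
  by (simp_all add: stalk_def)

lemma stalk_proj:
  fixes X :: "('a, 'u) cplx"
  assumes X: "cx X" and p: "fg_projective R (Term X j)"
  shows "fg_projective R (Term (stalk j X) i)"
proof (cases "i = j")
  case False
  have "submod R (Term X i) {\<zero>\<^bsub>Term X i\<^esub>}" using X by (auto simp: submod_def)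
  then have "left_module R ((Term X i)\<lparr>carrier := {\<zero>\<^bsub>Term X i\<^esub>}\<rparr>)" by (rule submod_left_module[OF cx_lm[OF X]])
  then show ?thesis unfolding stalk_simps(2)[OF False] by (intro zero_fg_projective) simp_all
qed (use p in \<open>simp add: stalk_simps\<close>)

lemma stalk_mem:
  fixes X :: "('a, 'u) cplx"
  assumes X: "cx X" and p: "fg_projective R (Term X j)"
  shows "stalk j X \<in> proj_stalks R j" "cx (stalk j X)"
proof -
  have lm: "left_module R (Term (stalk j X) i)" for i using stalk_proj[OF X p] by simp
  have conc: "concentrated j j (stalk j X)" unfolding concentrated_def by (auto simp: stalk_simps(2))
  show "cx (stalk j X)"
    unfolding bounded_complex_def
  proof (intro conjI allI ballI)
    show "fg_module R (Term (stalk j X) i)" for i using stalk_proj[OF X p] by simp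
    have "Diff (stalk j X) i = (\<lambda>x. \<zero>\<^bsub>Term (stalk j X) (i + 1)\<^esub>)" for i by (intro ext) (simp add: stalk_simps)
    then show "Diff (stalk j X) i \<in> mod_hom R (Term (stalk j X) i) (Term (stalk j X) (i + 1))" for i
      using hom_const_zero[OF lm] by simp
    show "Diff (stalk j X) (i + 1) (Diff (stalk j X) i x) = \<zero>\<^bsub>Term (stalk j X) (i + 2)\<^esub>" for i x
      unfolding stalk_simps(3,4) plus_one_one ..
    show "\<exists>a b. concentrated a b (stalk j X)" using conc by blast
  qed
  then show "stalk j X \<in> proj_stalks R j"
    using stalk_proj[OF X p] conc by (simp add: proj_stalks_def Kb_proj_def)
qed

text \<open>A homotopy between the truncations of \<open>f\<close> and \<open>g\<close> lifts, by projectivity in degree \<open>n\<close>, to a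
  homotopy between \<open>f\<close> and \<open>g\<close> up to a map concentrated in degree \<open>n - 1\<close>.\<close>

lemma trunc_map_kernel:
  fixes X Y :: "('a, 'u) cplx"
  assumes X: "cx X" and pX: "\<And>i. fg_projective R (Term X i)" and zX: "\<And>i. i < n - 1 \<Longrightarrow> carrier (Term X i) = {\<zero>\<^bsub>Term X i\<^esub>}"
    and Y: "cx Y" and f: "f \<in> chain_maps R X Y" and g: "g \<in> chain_maps R X Y"
    and fg: "(trunc_map n Y f, trunc_map n Y g) \<in> homotopy_rel R (trunc n X) (trunc n Y)"
  obtains p q where "p \<in> chain_maps R X (stalk (n - 1) X)" "q \<in> chain_maps R (stalk (n - 1) X) Y"
    "(f, \<lambda>i x. g i x \<oplus>\<^bsub>Term Y i\<^esub> q i (p i x)) \<in> homotopy_rel R X Y"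
proof -
  have lm: "left_module R (Term X i)" "left_module R (Term Y i)" "left_module R (Term (trunc n X) i)" "left_module R (Term (trunc n Y) i)" for i
    using X Y trunc_cx[OF X] trunc_cx[OF Y] by simp_all
  note pY' = tproj_chain_map[OF Y, of n]
  let ?e = "n - 1"
  obtain k where k: "\<And>i. k i \<in> mod_hom R (Term (trunc n X) i) (Term (trunc n Y) (i - 1))"
    and keq: "\<And>i x. x \<in> carrier (Term (trunc n X) i) \<Longrightarrow> trunc_map n Y f i x = trunc_map n Y g i x \<oplus>\<^bsub>Term (trunc n Y) i\<^esub>
       (Diff (trunc n Y) (i - 1) (k i x) \<oplus>\<^bsub>Term (trunc n Y) i\<^esub> k (i + 1) (Diff (trunc n X) i x))"
    using fg by (rule homotopyE) blast
  have kn: "k n \<in> mod_hom R (Term X n) (Term (trunc n Y) ?e)" using k[of n] by (simp add: Term_trunc)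
  \<comment> \<open>The component \<open>k n\<close> is the one that ends in the quotient in degree
    \<open>n - 1\<close>; it is lifted to a map into the term of \<open>Y\<close> itself.\<close>
  define E where "E x y z \<longleftrightarrow> x \<in> carrier (Term X n) \<and> y \<in> carrier (Term Y ?e) \<and> z = \<zero>\<^bsub>Term Y ?e\<^esub> \<and>
    tproj n Y ?e y = k n x" for x y z
  have E: "rel3 R (Term X n) (Term Y ?e) (Term Y ?e) E"
    unfolding rel3_def E_def
    by (auto simp: lm cmD[OF pY'] cm_smult[OF pY'] hom_add[OF kn] hom_smult[OF kn] hom_zero[OF lm(1,4) kn] Y trunc_cx[OF Y])
  have tot: "\<exists>y z. E x y z" if x: "x \<in> carrier (Term X n)" for x
  proof -
    have y: "k n x \<in> carrier (Term (trunc n Y) ?e)" by (rule hom_closed[OF kn x])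
    show ?thesis unfolding E_def using x trunc_carrier[OF Y y] tproj_fix[OF Y y] by blast
  qed
  obtain h where h: "h \<in> mod_hom R (Term X n) (Term Y ?e)"
    and hE: "\<And>x. x \<in> carrier (Term X n) \<Longrightarrow> tproj n Y ?e (h x) = k n x"
    using projective_lift[OF pX lm(2) lm(2) E tot] unfolding E_def by blast
  have dh: "Diff Y ?e (h x) = Diff Y ?e (k n x)" if x: "x \<in> carrier (Term X n)" for x
    using Diff_coset_rep[OF Y hom_closed[OF h x]] hE[OF x] by (simp add: tproj_simps)
  \<comment> \<open>\<open>h\<close> replaces \<open>k n\<close>; by \<open>dh\<close> both have the
    same differential, so the homotopy relation survives from degree \<open>n\<close> on. Below
    \<open>n\<close> the homotopy is cut off, which leaves a defect in degree \<open>n - 1\<close>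
    alone, as \<open>X\<close> is zero further down.\<close>
  define l where "l i = (if i < n then (\<lambda>_. \<zero>\<^bsub>Term Y (i - 1)\<^esub>) else if i = n then h else k i)" for i
  have l: "l i \<in> mod_hom R (Term X i) (Term Y (i - 1))" for i
  proof -
    consider "i < n" | "i = n" | "i > n" by linarith
    then show ?thesis
    proof cases
      case 1 then show ?thesis using hom_const_zero[OF lm(2)] by (simp add: l_def)
    next
      case 2 then show ?thesis using h by (simp add: l_def)
    next
      case 3 then show ?thesis using k[of i] by (simp add: l_def Term_trunc)
    qed
  qed
  have above: "f i x = g i x \<oplus>\<^bsub>Term Y i\<^esub> (Diff Y (i - 1) (l i x) \<oplus>\<^bsub>Term Y i\<^esub> l (i + 1) (Diff X i x))"
    if i: "i \<ge> n" and x: "x \<in> carrier (Term X i)" for i x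
  proof -
    have "Diff Y (i - 1) (l i x) = Diff Y (i - 1) (k i x)" using i x dh by (cases "i = n") (auto simp: l_def)
    moreover have "l (i + 1) (Diff X i x) = k (i + 1) (Diff X i x)" using i by (simp add: l_def)
    ultimately show ?thesis using keq[of x i] i x by (simp add: Term_trunc Diff_trunc trunc_map_def)
  qed
  \<comment> \<open>The defect in degree \<open>n - 1\<close>. By \<open>ds\<close> its values are
    cocycles, so it is a chain map from the stalk to \<open>Y\<close>; the map \<open>p\<close> from
    \<open>X\<close> to the stalk is one because \<open>X\<close> vanishes below
    \<open>n - 1\<close>.\<close>
  define s where "s x = f ?e x \<oplus>\<^bsub>Term Y ?e\<^esub> \<ominus>\<^bsub>Term Y ?e\<^esub> (g ?e x \<oplus>\<^bsub>Term Y ?e\<^esub> h (Diff X ?e x))" for x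
  have dX: "Diff X ?e \<in> mod_hom R (Term X ?e) (Term X n)" by (rule diff_hom[OF X]) simp
  have hd: "(\<lambda>x. h (Diff X ?e x)) \<in> mod_hom R (Term X ?e) (Term Y ?e)" by (rule hom_comp[OF dX h])
  have s: "s \<in> mod_hom R (Term X ?e) (Term Y ?e)"
    unfolding s_def by (rule hom_sum[OF lm(2) cm_hom[OF f] hom_uminus[OF lm(2) hom_sum[OF lm(2) cm_hom[OF g] hd]]])
  have sf: "f ?e x = g ?e x \<oplus>\<^bsub>Term Y ?e\<^esub> s x \<oplus>\<^bsub>Term Y ?e\<^esub> h (Diff X ?e x)" if x: "x \<in> carrier (Term X ?e)" for x
  proof -
    have c: "f ?e x \<in> carrier (Term Y ?e)" "g ?e x \<in> carrier (Term Y ?e)" "h (Diff X ?e x) \<in> carrier (Term Y ?e)" "s x \<in> carrier (Term Y ?e)"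
      using cm_closed[OF f x] cm_closed[OF g x] hom_closed[OF hd x] hom_closed[OF s x] by auto
    have "(g ?e x \<oplus>\<^bsub>Term Y ?e\<^esub> h (Diff X ?e x)) \<oplus>\<^bsub>Term Y ?e\<^esub> s x = f ?e x"
      unfolding s_def by (rule lm_add_sub[OF lm(2)]) (use c lm in simp_all)
    then show ?thesis using lm c by (simp add: lm_ac)
  qed
  have ds: "Diff Y ?e (s x) = \<zero>\<^bsub>Term Y n\<^esub>" if x: "x \<in> carrier (Term X ?e)" for x
  proof -
    let ?w = "Diff X ?e x"
    have w: "?w \<in> carrier (Term X n)" using hom_closed[OF dX x] .
    have c: "f ?e x \<in> carrier (Term Y ?e)" "g ?e x \<in> carrier (Term Y ?e)" "h ?w \<in> carrier (Term Y ?e)"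
      using cm_closed[OF f x] cm_closed[OF g x] hom_closed[OF hd x] by auto
    have d: "Diff Y ?e (f ?e x) = f n ?w" "Diff Y ?e (g ?e x) = g n ?w"
      using cm_diff[OF f x, of n] cm_diff[OF g x, of n] by simp_all
    have cn: "f n ?w \<in> carrier (Term Y n)" "g n ?w \<in> carrier (Term Y n)" "Diff Y ?e (h ?w) \<in> carrier (Term Y n)"
      using cm_closed[OF f w] cm_closed[OF g w] c(3) Y by simp_all
    have "Diff X n ?w = \<zero>\<^bsub>Term X (n + 1)\<^esub>" using diff_diff'(2)[OF X, of x n] x by simp
    then have "f n ?w = g n ?w \<oplus>\<^bsub>Term Y n\<^esub> Diff Y ?e (h ?w)"
      using above[OF order_refl w] hom_zero[OF lm(1,2) l, of "n + 1"] lm cn by (simp add: l_def)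
    moreover have "Diff Y ?e (g ?e x \<oplus>\<^bsub>Term Y ?e\<^esub> h ?w) = g n ?w \<oplus>\<^bsub>Term Y n\<^esub> Diff Y ?e (h ?w)"
      using diff_add[OF Y c(2,3)] d(2) by simp
    moreover have "Diff Y ?e (s x) = f n ?w \<oplus>\<^bsub>Term Y n\<^esub> \<ominus>\<^bsub>Term Y n\<^esub> Diff Y ?e (g ?e x \<oplus>\<^bsub>Term Y ?e\<^esub> h ?w)"
      unfolding s_def using diff_add[OF Y c(1), of "\<ominus>\<^bsub>Term Y ?e\<^esub> (g ?e x \<oplus>\<^bsub>Term Y ?e\<^esub> h ?w)"]
        diff_neg[OF Y, of "g ?e x \<oplus>\<^bsub>Term Y ?e\<^esub> h ?w" ?e] c lm d(1) by simp
    ultimately show ?thesis using lm cn by simp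
  qed
  let ?A = "stalk ?e X"
  have A: "cx ?A" by (rule stalk_mem(2)[OF X pX])
  define p where "p i x = (if i = ?e then x else \<zero>\<^bsub>Term X i\<^esub>)" for i x
  define q where "q i x = (if i = ?e then s x else \<zero>\<^bsub>Term Y i\<^esub>)" for i x
  have p: "p \<in> chain_maps R X ?A"
  proof (rule chain_mapsI)
    show "p i \<in> mod_hom R (Term X i) (Term ?A i)" for i
    proof (cases "i = ?e")
      case True
      then have "p i = (\<lambda>x. x)" by (intro ext) (simp add: p_def)
      then show ?thesis using True hom_id by (simp add: stalk_simps)
    next
      case False
      then have "p i = (\<lambda>x. \<zero>\<^bsub>Term ?A i\<^esub>)" by (intro ext) (simp add: p_def stalk_simps)
      then show ?thesis using hom_const_zero[OF cx_lm[OF A]] by simp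
    qed
    show "p (i + 1) (Diff X i x) = Diff ?A i (p i x)" if x: "x \<in> carrier (Term X i)" for i x
      using zX[of i] x X by (cases "i + 1 = ?e") (auto simp: p_def stalk_simps(3))
  qed
  have q: "q \<in> chain_maps R ?A Y"
  proof (rule chain_mapsI)
    show "q i \<in> mod_hom R (Term ?A i) (Term Y i)" for i
    proof (cases "i = ?e")
      case True
      then have "q i = s" by (intro ext) (simp add: q_def)
      then show ?thesis using True s by (simp add: stalk_simps)
    next
      case False
      then have "q i = (\<lambda>x. \<zero>\<^bsub>Term Y i\<^esub>)" by (intro ext) (simp add: q_def)
      then show ?thesis using hom_const_zero[OF lm(2)] by simp
    qed
    show "q (i + 1) (Diff ?A i x) = Diff Y i (q i x)" if x: "x \<in> carrier (Term ?A i)" for i x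
    proof (cases "i = ?e")
      case True
      then show ?thesis using x ds by (simp add: q_def stalk_simps)
    next
      case False
      have "q j \<zero>\<^bsub>Term X j\<^esub> = \<zero>\<^bsub>Term Y j\<^esub>" for j
        using hom_zero[OF lm(1,2) s] by (cases "j = ?e") (simp_all add: q_def)
      from this[of "i + 1"] show ?thesis using False Y by (simp add: q_def[of i] stalk_simps(3))
    qed
  qed
  have "(f, \<lambda>i x. g i x \<oplus>\<^bsub>Term Y i\<^esub> q i (p i x)) \<in> homotopy_rel R X Y"
  proof (rule homotopyI[OF f chain_maps_add[OF X Y g chain_maps_comp[OF p q]] l])
    fix i x assume x: "x \<in> carrier (Term X i)"
    show "f i x = g i x \<oplus>\<^bsub>Term Y i\<^esub> q i (p i x) \<oplus>\<^bsub>Term Y i\<^esub> (Diff Y (i - 1) (l i x) \<oplus>\<^bsub>Term Y i\<^esub> l (i + 1) (Diff X i x))"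
    proof (cases i n rule: degree_cases)
      case below
      have dz: "Diff Y (i - 1) \<zero>\<^bsub>Term Y (i - 1)\<^esub> = \<zero>\<^bsub>Term Y i\<^esub>" using diff_zero[OF Y, of "i - 1"] by simp
      show ?thesis
        using x zX[OF below] below lm by (simp add: q_def l_def dz cm_zero[OF f X Y] cm_zero[OF g X Y])
    next
      case i: edge
      have dz: "Diff Y (?e - 1) \<zero>\<^bsub>Term Y (?e - 1)\<^esub> = \<zero>\<^bsub>Term Y ?e\<^esub>" using diff_zero[OF Y, of "?e - 1"] by simp
      have x': "x \<in> carrier (Term X ?e)" using x i by simp
      have li: "l i x = \<zero>\<^bsub>Term Y (?e - 1)\<^esub>" "l (i + 1) (Diff X i x) = h (Diff X ?e x)" "q i (p i x) = s x"
        using i by (simp_all add: l_def q_def p_def)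
      show ?thesis
        unfolding li unfolding i dz using sf[OF x'] lm hom_closed[OF hd x'] by simp
    next
      case a: above
      then show ?thesis using above[OF a x] lm cm_closed[OF g x] by (simp add: q_def)
    qed
  qed
  with p q show ?thesis by (rule that)
qed

end

section \<open>The truncation functor between the two categories\<close>

context noeth_ctx
begin

interpretation L: ore "Kb_mod R :: (('a, 'u) cplx, _) add_cat" "quasi_isos R"
  by (rule ore_K)

text \<open>\<open>D_interval\<close> expresses vanishing cohomology by a one-element set of cosets;
  the later arguments compare cocycles with coboundaries.\<close>

lemma cohomology_trivial_iff:
  fixes M :: "('a, 'u) cplx"
  assumes M: "cx M"
  shows "cohomology M i = {coboundaries M i} \<longleftrightarrow> cocycles M i \<subseteq> coboundaries M i"
proof -
  have lm: "left_module R (Term M i)" using M by simp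
  note B = submod_coboundaries[OF M, of i] and Z = submod_cocycles[OF M, of i]
  have B0: "coboundaries M i +>\<^bsub>Term M i\<^esub> x = coboundaries M i \<longleftrightarrow> x \<in> coboundaries M i" if x: "x \<in> carrier (Term M i)" for x
  proof -
    have c: "b \<oplus>\<^bsub>Term M i\<^esub> \<zero>\<^bsub>Term M i\<^esub> = b" if "b \<in> coboundaries M i" for b
      using lm submod_closed(1)[OF lm B that] by simp
    have "z \<in> coboundaries M i +>\<^bsub>Term M i\<^esub> \<zero>\<^bsub>Term M i\<^esub> \<longleftrightarrow> z \<in> coboundaries M i" for z
      unfolding mem_coset[OF lm B] using c by metis
    then have z: "coboundaries M i +>\<^bsub>Term M i\<^esub> \<zero>\<^bsub>Term M i\<^esub> = coboundaries M i" by blast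
    have "coboundaries M i +>\<^bsub>Term M i\<^esub> x = coboundaries M i +>\<^bsub>Term M i\<^esub> \<zero>\<^bsub>Term M i\<^esub> \<longleftrightarrow> x \<in> coboundaries M i"
      unfolding coset_eq_iff[OF lm B x lm_zero[OF lm]] using c by metis
    then show ?thesis unfolding z .
  qed
  have 0: "\<zero>\<^bsub>Term M i\<^esub> \<in> cocycles M i" "\<zero>\<^bsub>Term M i\<^esub> \<in> coboundaries M i"
    using submod_closed(2)[OF lm Z] submod_closed(2)[OF lm B] .
  show ?thesis
  proof
    assume h: "cohomology M i = {coboundaries M i}"
    show "cocycles M i \<subseteq> coboundaries M i"
    proof
      fix x assume x: "x \<in> cocycles M i"
      then have "coboundaries M i +>\<^bsub>Term M i\<^esub> x \<in> cohomology M i" unfolding cohomology_def by blast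
      then show "x \<in> coboundaries M i" using B0[OF cocyclesD(1)[OF x]] unfolding h by simp
    qed
  next
    assume h: "cocycles M i \<subseteq> coboundaries M i"
    have "coboundaries M i +>\<^bsub>Term M i\<^esub> x = coboundaries M i" if x: "x \<in> cocycles M i" for x
      using B0[OF cocyclesD(1)[OF x]] h x by blast
    then show "cohomology M i = {coboundaries M i}" unfolding cohomology_def using 0(1) by blast
  qed
qed

context
  fixes n :: int
  assumes n0: "n \<le> 0"
begin

abbreviation KP :: "(('a, 'u) cplx, (int \<Rightarrow> 'u \<Rightarrow> 'u) set) add_cat" where "KP \<equiv> K_proj_interval R (n - 1) 0"
abbreviation DI :: "(('a, 'u) cplx, ('a, 'u) Db_mor) cat" where "DI \<equiv> D_interval R n 0"
abbreviation T where "T \<equiv> AMap (trunc_K R n)"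
abbreviation F where "F \<equiv> trunc_KD R n :: (('a, 'u) cplx, (int \<Rightarrow> 'u \<Rightarrow> 'u) set, ('a, 'u) cplx, ('a, 'u) Db_mor) cat_functor"

lemma KP_simps [simp]: "Hom KP = Hom K" "Comp KP = Comp K" "Ident KP = Ident K" "HAdd KP = HAdd K"
  by (simp_all add: K_proj_interval_def Kb_proj_def)

lemma DI_simps [simp]: "Hom DI = Hom D" "Comp DI = Comp D" "Ident DI = Ident D" "is_iso DI X Y f = is_iso D X Y f"
  by (simp_all add: D_interval_def Db_mod_def)

lemma DI_Obj: "M \<in> Obj DI \<longleftrightarrow> cx M \<and> (\<forall>i. i < n \<or> 0 < i \<longrightarrow> cocycles M i \<subseteq> coboundaries M i)"
proof -
  have "M \<in> Obj DI \<longleftrightarrow> cx M \<and> (\<forall>i. i < n \<or> 0 < i \<longrightarrow> cohomology M i = {coboundaries M i})"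
    by (simp add: D_interval_def Db_mod_def)
  then show ?thesis using cohomology_trivial_iff by metis
qed

lemma KP_Obj: "X \<in> Obj KP \<longleftrightarrow> cx X \<and> (\<forall>i. fg_projective R (Term X i)) \<and>
    (\<exists>Y f. cx Y \<and> (\<forall>i. fg_projective R (Term Y i)) \<and> concentrated (n - 1) 0 Y \<and> is_iso K X Y f)"
  by (auto simp: K_proj_interval_def Kb_proj_def)

lemma category_KP: "category KP"
  unfolding K_proj_interval_def Kb_proj_def by (intro category_full_subcat category_K)

lemma category_DI: "category DI"
  unfolding D_interval_def Db_mod_def by (intro category_full_subcat L.category_localization)

text \<open>The form in which membership is used: \<open>X\<close> is a retract, in the homotopy
  category, of a complex that vanishes outside the degrees from \<open>n - 1\<close> to 0.\<close>

lemma KP_D: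
  assumes "X \<in> Obj KP"
  shows "\<exists>Y a b. cx Y \<and> (\<forall>i. fg_projective R (Term Y i)) \<and> concentrated (n - 1) 0 Y \<and>
    a \<in> Hom K X Y \<and> b \<in> Hom K Y X \<and> Comp K X Y X b a = Ident K X"
  using assms unfolding KP_Obj is_iso_def by blast

lemma KP_cx: "X \<in> Obj KP \<Longrightarrow> cx X"
  unfolding KP_Obj by blast

lemma KP_concentrated:
  assumes "cx X" "\<And>i. fg_projective R (Term X i)" "concentrated (n - 1) 0 X"
  shows "X \<in> Obj KP"
proof -
  have "is_iso K X X (Ident K X)"
    unfolding is_iso_def using assms(1) L.id_hom[of X] L.id_left[of X X "Ident K X"] by auto
  then show ?thesis unfolding KP_Obj using assms by blast
qed

text \<open>The identity of \<open>X\<close> is homotopic to a map through a complex that is zero in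
  positive degrees, so of a positive cocycle only the boundary term of the homotopy is left.\<close>

lemma KP_cohomology:
  assumes X: "X \<in> Obj KP" and i: "i > 0"
  shows "cocycles X i \<subseteq> coboundaries X i"
proof
  fix x assume x: "x \<in> cocycles X i"
  have X': "cx X" by (rule KP_cx[OF X])
  obtain Y a b where Y: "cx Y" "concentrated (n - 1) 0 Y" and a: "a \<in> Hom K X Y" and b: "b \<in> Hom K Y X"
    and ba: "Comp K X Y X b a = Ident K X" using KP_D[OF X] by blast
  obtain f where f: "f \<in> chain_maps R X Y" "a = hcls R X Y f" using a by (rule K_HomE)
  obtain g where g: "g \<in> chain_maps R Y X" "b = hcls R Y X g" using b by (rule K_HomE)
  have lm: "left_module R (Term X i)" using X' by simp
  have "(\<lambda>i x. g i (f i x), \<lambda>i x. x) \<in> homotopy_rel R X X"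
    using ba unfolding f(2) g(2) K_Comp[OF X' Y(1) X' f(1) g(1)] K_Ident
    by (subst (asm) hcls_eq_iff[OF X' X' chain_maps_comp[OF f(1) g(1)] chain_maps_id])
  then have "(\<lambda>i x. x, \<lambda>i x. g i (f i x)) \<in> homotopy_rel R X X" by (rule homotopy_sym[OF X' X'])
  then obtain h where h: "\<And>i. h i \<in> mod_hom R (Term X i) (Term X (i - 1))"
    and eq: "\<And>i x. x \<in> carrier (Term X i) \<Longrightarrow> x = g i (f i x) \<oplus>\<^bsub>Term X i\<^esub>
             (Diff X (i - 1) (h i x) \<oplus>\<^bsub>Term X i\<^esub> h (i + 1) (Diff X i x))" by (rule homotopyE) blast
  have xc: "x \<in> carrier (Term X i)" "Diff X i x = \<zero>\<^bsub>Term X (i + 1)\<^esub>" using cocyclesD[OF x] .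
  have "f i x = \<zero>\<^bsub>Term Y i\<^esub>" using cm_closed[OF f(1) xc(1)] Y(2) i unfolding concentrated_def by simp
  then have "g i (f i x) = \<zero>\<^bsub>Term X i\<^esub>" using cm_zero[OF g(1) Y(1) X'] by simp
  moreover have "h (i + 1) (Diff X i x) = \<zero>\<^bsub>Term X i\<^esub>" unfolding xc(2) using hty_zero[OF h X' X', of "i + 1"] by simp
  moreover have hc: "h i x \<in> carrier (Term X (i - 1))" by (rule hom_closed[OF h xc(1)])
  moreover have "Diff X (i - 1) (h i x) \<in> carrier (Term X i)" using hc X' by simp
  ultimately have "x = Diff X (i - 1) (h i x)" using eq[OF xc(1)] lm by simp
  then show "x \<in> coboundaries X i" using coboundariesI[OF hc] by simp
qed

lemma trunc_DI:
  assumes X: "X \<in> Obj KP"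
  shows "trunc n X \<in> Obj DI"
proof -
  have X': "cx X" using X unfolding KP_Obj by blast
  have "cocycles (trunc n X) i \<subseteq> coboundaries (trunc n X) i" if "i < n" for i
    using trunc_truncated[OF X', of n] that submod_closed(2)[OF cx_lm[OF trunc_cx[OF X']] submod_coboundaries[OF trunc_cx[OF X']]]
    unfolding truncated_def by simp
  \<comment> \<open>By \<open>n0\<close> positive degrees are at least \<open>n\<close>, where
    truncation changes neither cocycles nor coboundaries.\<close>
  moreover have "cocycles (trunc n X) i \<subseteq> coboundaries (trunc n X) i" if "i > 0" for i
    using KP_cohomology[OF X that] cocycles_trunc[OF X', of n i] coboundaries_trunc[OF X', of n i] that n0 by simp
  ultimately show ?thesis unfolding DI_Obj using trunc_cx[OF X'] by blast
qed

interpretation T: fun_between "Kb_mod R :: (('a, 'u) cplx, _) add_cat" "Kb_mod R :: (('a, 'u) cplx, _) add_cat" "trunc_K R n"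
  by unfold_locales (rule trunc_K_functor)

lemma AMap_F:
  fixes X Y :: "('a, 'u) cplx"
  shows "\<lbrakk>cx X; cx Y; a \<in> Hom K X Y\<rbrakk> \<Longrightarrow> AMap F X Y a = L.lcls (trunc n X) (trunc n Y) (T X Y a)"
  by (rule AMap_trunc_KD)

lemma T_Hom:
  fixes X Y :: "('a, 'u) cplx"
  shows "\<lbrakk>cx X; cx Y; a \<in> Hom K X Y\<rbrakk> \<Longrightarrow> T X Y a \<in> Hom K (trunc n X) (trunc n Y)"
  using T.map_hom[of X Y a] by simp

theorem trunc_KD_functor: "is_functor KP DI F"
  unfolding is_functor_def OMap_trunc_KD KP_simps DI_simps
proof (intro conjI ballI)
  fix X assume "X \<in> Obj KP"
  then show "trunc n X \<in> Obj DI" by (rule trunc_DI)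
next
  fix X Y a assume "X \<in> Obj KP" "Y \<in> Obj KP" and a: "a \<in> Hom K X Y"
  then have X: "cx X" "cx Y" using KP_cx by auto
  show "AMap F X Y a \<in> Hom D (trunc n X) (trunc n Y)"
    unfolding AMap_F[OF X a] by (rule L.lcls_Hom[OF _ T_Hom[OF X a]]) (simp add: trunc_cx[OF X(1)])
next
  fix X assume "X \<in> Obj KP"
  then have X: "cx X" by (rule KP_cx)
  have i: "Ident K X \<in> Hom K X X" using L.id_hom X by simp
  show "AMap F X X (Ident K X) = Ident D (trunc n X)"
    unfolding AMap_F[OF X X i] L.loc_Ident using T.map_id[of X] X by simp
next
  fix X Y Z a b assume "X \<in> Obj KP" "Y \<in> Obj KP" "Z \<in> Obj KP" and a: "a \<in> Hom K X Y" and b: "b \<in> Hom K Y Z"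
  then have X: "cx X" "cx Y" "cx Z" using KP_cx by auto
  have ba: "Comp K X Y Z b a \<in> Hom K X Z" using L.comp_hom X a b by simp
  have "Comp D (trunc n X) (trunc n Y) (trunc n Z) (L.lcls (trunc n Y) (trunc n Z) (T Y Z b)) (L.lcls (trunc n X) (trunc n Y) (T X Y a)) =
    L.lcls (trunc n X) (trunc n Z) (Comp K (trunc n X) (trunc n Y) (trunc n Z) (T Y Z b) (T X Y a))"
    by (rule L.lcls_comp) (use X trunc_cx T_Hom[OF X(1,2) a] T_Hom[OF X(2,3) b] in simp_all)
  then show "AMap F X Z (Comp K X Y Z b a) = Comp D (trunc n X) (trunc n Y) (trunc n Z) (AMap F Y Z b) (AMap F X Y a)"
    unfolding AMap_F[OF X(1,2) a] AMap_F[OF X(2,3) b] AMap_F[OF X(1,3) ba] using T.map_comp[of X Y Z a b] X a b by simp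
qed

interpretation F: fun_between KP DI F
  using category_KP category_DI trunc_KD_functor by unfold_locales

lemma trunc_projective:
  assumes "X \<in> Obj KP" "i \<ge> n"
  shows "fg_projective R (Term (trunc n X) i)"
  using assms unfolding KP_Obj by (simp add: Term_trunc)

text \<open>Out of \<open>trunc n X\<close>, which is projective from degree \<open>n\<close> on,
  the passage to the derived category identifies no further maps to a truncated complex.\<close>

lemma AMap_F_eq_iff:
  assumes X: "X \<in> Obj KP" "Y \<in> Obj KP" and a: "a \<in> Hom K X Y" "b \<in> Hom K X Y"
  shows "AMap F X Y a = AMap F X Y b \<longleftrightarrow> T X Y a = T X Y b"
proof -
  have X': "cx X" "cx Y" using X KP_cx by auto
  note TX = trunc_cx[OF X'(1), of n] and TY = trunc_cx[OF X'(2), of n]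
  obtain f where f: "f \<in> chain_maps R (trunc n X) (trunc n Y)" "T X Y a = hcls R (trunc n X) (trunc n Y) f"
    using T_Hom[OF X' a(1)] by (rule K_HomE)
  obtain g where g: "g \<in> chain_maps R (trunc n X) (trunc n Y)" "T X Y b = hcls R (trunc n X) (trunc n Y) g"
    using T_Hom[OF X' a(2)] by (rule K_HomE)
  show ?thesis
    unfolding AMap_F[OF X' a(1)] AMap_F[OF X' a(2)] f(2) g(2) hcls_eq_iff[OF TX TY f(1) g(1)]
    using derived_hom_faithful[OF TX trunc_truncated[OF X'(1)] trunc_projective[OF X(1)] TY trunc_truncated[OF X'(2)] f(1) g(1)]
      hcls_eqI[OF TX TY] by metis
qed

text \<open>A concentrated source \<open>Z\<close> comes first; there the chain map that represents
  a derived morphism lifts. For general \<open>X\<close> with retraction \<open>b a = 1\<close>, the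
  composite \<open>g F(b)\<close> is lifted to \<open>f\<close>, and then
  \<open>F(f a) = g F(b) F(a) = g\<close>.\<close>

lemma F_full:
  assumes X: "X \<in> Obj KP" and Y: "Y \<in> Obj KP" and g: "g \<in> Hom D (trunc n X) (trunc n Y)"
  shows "\<exists>f \<in> Hom K X Y. AMap F X Y f = g"
proof -
  have conc: "\<exists>f \<in> Hom K Z Y. AMap F Z Y f = h"
    if Z: "cx Z" "\<And>i. fg_projective R (Term Z i)" "concentrated (n - 1) 0 Z" and h: "h \<in> Hom D (trunc n Z) (trunc n Y)" for Z h
  proof -
    have ZK: "Z \<in> Obj KP" by (rule KP_concentrated[OF Z])
    have Y': "cx Y" using KP_cx[OF Y] .
    note TZ = trunc_cx[OF Z(1), of n] and TY = trunc_cx[OF Y', of n]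
    obtain m where m: "m \<in> chain_maps R (trunc n Z) (trunc n Y)"
      "h = L.lcls (trunc n Z) (trunc n Y) (hcls R (trunc n Z) (trunc n Y) m)"
      by (rule derived_hom_representable[OF TZ trunc_truncated[OF Z(1)] trunc_projective[OF ZK] TY trunc_truncated[OF Y'] h])
    have zZ: "carrier (Term Z i) = {\<zero>\<^bsub>Term Z i\<^esub>}" if "i < n - 1" for i
      using Z(3) that unfolding concentrated_def by simp
    obtain f where f: "f \<in> chain_maps R Z Y" "\<forall>i. \<forall>x \<in> carrier (Term (trunc n Z) i). trunc_map n Y f i x = m i x"
      using trunc_map_surj[OF Z(1) Z(2) zZ Y' m(1)] by blast
    have "T Z Y (hcls R Z Y f) = hcls R (trunc n Z) (trunc n Y) m"
      unfolding AMap_trunc_K[OF Z(1) Y' f(1)]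
      by (rule hcls_eqI[OF TZ TY homotopy_sym[OF TZ TY homotopy_cong[OF TZ TY m(1)]]]) (rule f(2)[rule_format])
    then show ?thesis
      using AMap_F[OF Z(1) Y' K_HomI[OF f(1)]] m(2) K_HomI[OF f(1)] by (intro bexI[of _ "hcls R Z Y f"]) simp_all
  qed
  have X': "cx X" by (rule KP_cx[OF X])
  obtain Z a b where Z0: "cx Z" "\<forall>i. fg_projective R (Term Z i)" "concentrated (n - 1) 0 Z"
    and a: "a \<in> Hom K X Z" and b: "b \<in> Hom K Z X" and ba: "Comp K X Z X b a = Ident K X" using KP_D[OF X] by blast
  note Z = Z0(1) Z0(2)[rule_format] Z0(3)
  have ZK: "Z \<in> Obj KP" by (rule KP_concentrated[OF Z])
  have o: "X \<in> Obj KP" "Z \<in> Obj KP" "Y \<in> Obj KP" by fact+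
  have Fb: "AMap F Z X b \<in> Hom D (trunc n Z) (trunc n X)" and Fa: "AMap F X Z a \<in> Hom D (trunc n X) (trunc n Z)"
    using F.map_hom[of Z X b] F.map_hom[of X Z a] o a b by simp_all
  have TX: "trunc n X \<in> Obj DI" "trunc n Y \<in> Obj DI" "trunc n Z \<in> Obj DI" using trunc_DI o by simp_all
  have "Comp D (trunc n Z) (trunc n X) (trunc n Y) g (AMap F Z X b) \<in> Hom D (trunc n Z) (trunc n Y)"
    using F.D.comp_hom[of "trunc n Z" "trunc n X" "trunc n Y"] TX Fb g by simp
  from conc[OF Z this] obtain f where f: "f \<in> Hom K Z Y"
    "AMap F Z Y f = Comp D (trunc n Z) (trunc n X) (trunc n Y) g (AMap F Z X b)" by blast
  have fa: "Comp K X Z Y f a \<in> Hom K X Y" using F.C.comp_hom[of X Z Y a f] o a f by simp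
  have "AMap F X Y (Comp K X Z Y f a) = Comp D (trunc n X) (trunc n Z) (trunc n Y) (AMap F Z Y f) (AMap F X Z a)"
    using F.map_comp[of X Z Y a f] o a f(1) by simp
  also have "\<dots> = Comp D (trunc n X) (trunc n X) (trunc n Y) g (Comp D (trunc n X) (trunc n Z) (trunc n X) (AMap F Z X b) (AMap F X Z a))"
    unfolding f(2) using F.D.assoc[of "trunc n X" "trunc n Z" "trunc n X" "trunc n Y" "AMap F X Z a" "AMap F Z X b" g] TX Fa Fb g by simp
  also have "Comp D (trunc n X) (trunc n Z) (trunc n X) (AMap F Z X b) (AMap F X Z a) = Ident D (trunc n X)"
    using F.map_comp[of X Z X a b] F.map_id[of X] o a b ba by simp
  also have "Comp D (trunc n X) (trunc n X) (trunc n Y) g (Ident D (trunc n X)) = g"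
    using F.D.id_right[of "trunc n X" "trunc n Y" g] TX g by simp
  finally show ?thesis using fa by blast
qed

text \<open>Vanishing cohomology below \<open>n\<close> makes \<open>M\<close> isomorphic to
  \<open>trunc n M\<close>, and vanishing above 0 allows a resolution of the latter in degrees from
  \<open>n - 1\<close> to 0.\<close>

lemma F_ess_surj:
  assumes M: "M \<in> Obj DI"
  shows "\<exists>X \<in> Obj KP. \<exists>e. is_iso D (trunc n X) M e"
proof -
  have M': "cx M" and lo: "\<And>i. i < n \<Longrightarrow> cocycles M i \<subseteq> coboundaries M i"
    and hi: "\<And>i. i > 0 \<Longrightarrow> cocycles M i \<subseteq> coboundaries M i" using M unfolding DI_Obj by blast+
  note TM = trunc_cx[OF M', of n] trunc_truncated[OF M', of n] and p = tproj_chain_map[OF M', of n] tproj_qis[OF M' lo]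
  have "cocycles (trunc n M) i \<subseteq> coboundaries (trunc n M) i" if "i > 0" for i
    using hi[OF that] cocycles_trunc[OF M', of n i] coboundaries_trunc[OF M', of n i] that n0 by simp
  then obtain X \<phi> where X: "cx X" "\<And>i. fg_projective R (Term X i)" "concentrated (n - 1) 0 X"
    and \<phi>: "\<phi> \<in> chain_maps R (trunc n X) (trunc n M)" "qis (trunc n X) (trunc n M) \<phi>"
    using truncated_resolution[OF TM, of 0] by metis
  note TX = trunc_cx[OF X(1), of n]
  have 1: "is_iso D (trunc n X) (trunc n M) (L.lcls (trunc n X) (trunc n M) (hcls R (trunc n X) (trunc n M) \<phi>))"
    by (rule L.lcls_iso) (use TX TM K_HomI[OF \<phi>(1)] QI_I[OF TX TM(1) \<phi>] in simp_all)
  have "is_iso D M (trunc n M) (L.lcls M (trunc n M) (hcls R M (trunc n M) (tproj n M)))"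
    by (rule L.lcls_iso) (use M' TM K_HomI[OF p(1)] QI_I[OF M' TM(1) p] in simp_all)
  then obtain e where 2: "is_iso D (trunc n M) M e" unfolding is_iso_def by blast
  interpret D: cat D by unfold_locales (rule L.category_localization)
  have "is_iso D (trunc n X) M (Comp D (trunc n X) (trunc n M) M e
      (L.lcls (trunc n X) (trunc n M) (hcls R (trunc n X) (trunc n M) \<phi>)))"
    by (rule D.iso_comp[OF _ _ _ 1 2]) (use TX TM M' in simp_all)
  then show ?thesis using KP_concentrated[OF X] by blast
qed

lemma K_comp_HAdd:
  fixes X Y Z :: "('a, 'u) cplx"
  assumes X: "cx X" "cx Y" "cx Z" and a: "a \<in> Hom K X Y" and b: "b \<in> Hom K Y Z" "c \<in> Hom K Y Z"
  shows "Comp K X Y Z (HAdd K Y Z b c) a = HAdd K X Z (Comp K X Y Z b a) (Comp K X Y Z c a)"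
proof -
  obtain f where f: "f \<in> chain_maps R X Y" "a = hcls R X Y f" using a by (rule K_HomE)
  obtain g where g: "g \<in> chain_maps R Y Z" "b = hcls R Y Z g" using b(1) by (rule K_HomE)
  obtain h where h: "h \<in> chain_maps R Y Z" "c = hcls R Y Z h" using b(2) by (rule K_HomE)
  show ?thesis
    unfolding f(2) g(2) h(2) K_HAdd[OF X(2,3) g(1) h(1)] K_Comp[OF X f(1) g(1)] K_Comp[OF X f(1) h(1)]
      K_Comp[OF X f(1) chain_maps_add[OF X(2,3) g(1) h(1)]]
      K_HAdd[OF X(1,3) chain_maps_comp[OF f(1) g(1)] chain_maps_comp[OF f(1) h(1)]] ..
qed

lemma stalk_cx:
  assumes "A \<in> proj_stalks R (n - 1)"
  shows "cx A" "\<And>i. i \<noteq> n - 1 \<Longrightarrow> carrier (Term A i) = {\<zero>\<^bsub>Term A i\<^esub>}"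
proof -
  show "cx A" using assms by (simp add: proj_stalks_def Kb_proj_def)
  fix i assume "i \<noteq> n - 1"
  moreover have "concentrated (n - 1) (n - 1) A" using assms by (simp add: proj_stalks_def)
  ultimately show "carrier (Term A i) = {\<zero>\<^bsub>Term A i\<^esub>}" unfolding concentrated_def by (meson linorder_neqE)
qed

text \<open>A map through a stalk in degree \<open>n - 1\<close> is zero from degree
  \<open>n\<close> on, and in degree \<open>n - 1\<close> its values are cocycles, which the
  truncation divides out.\<close>

lemma T_add_stalk:
  fixes X Y A :: "('a, 'u) cplx"
  assumes X: "cx X" "cx Y" and A: "A \<in> proj_stalks R (n - 1)" and b: "b \<in> Hom K X Y"
    and p: "p \<in> Hom K X A" and q: "q \<in> Hom K A Y"
  shows "T X Y (HAdd K X Y b (Comp K X A Y q p)) = T X Y b"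
proof -
  have A': "cx A" by (rule stalk_cx(1)[OF A])
  obtain g where g: "g \<in> chain_maps R X Y" "b = hcls R X Y g" using b by (rule K_HomE)
  obtain p' where p': "p' \<in> chain_maps R X A" "p = hcls R X A p'" using p by (rule K_HomE)
  obtain q' where q': "q' \<in> chain_maps R A Y" "q = hcls R A Y q'" using q by (rule K_HomE)
  note qp = chain_maps_comp[OF p'(1) q'(1)]
  note s = chain_maps_add[OF X g(1) qp]
  have lmY: "left_module R (Term Y i)" for i using X by simp
  have eq: "trunc_map n Y (\<lambda>i x. g i x \<oplus>\<^bsub>Term Y i\<^esub> q' i (p' i x)) i x = trunc_map n Y g i x"
    if x: "x \<in> carrier (Term (trunc n X) i)" for i x
  proof (cases i n rule: degree_cases)
    case below
    then show ?thesis by (simp add: trunc_map_def)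
  next
    case i: edge
    have x': "x \<in> carrier (Term X i)" by (rule trunc_carrier[OF X(1) x])
    have "Diff A i (p' i x) = \<zero>\<^bsub>Term A (i + 1)\<^esub>"
      using stalk_cx(2)[OF A, of "i + 1"] diff_closed[OF A' cm_closed[OF p'(1) x'] refl] i by simp
    then have "q' i (p' i x) \<in> cocycles Y i"
      using cm_closed[OF p'(1) x'] by (intro cm_cocycles[OF A' X(2) q'(1)]) (simp add: cocycles_def)
    from coset_rep_eqI[OF lmY submod_cocycles[OF X(2)] cm_closed[OF g(1) x'] this]
    have "coset_rep (Term Y i) (cocycles Y i) (g i x \<oplus>\<^bsub>Term Y i\<^esub> q' i (p' i x)) = coset_rep (Term Y i) (cocycles Y i) (g i x)"
      using lm_comm[OF lmY cm_closed[OF g(1) x'] cm_closed[OF qp x']] by simp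
    then show ?thesis using i by (simp add: trunc_map_def)
  next
    case above
    have x': "x \<in> carrier (Term X i)" by (rule trunc_carrier[OF X(1) x])
    have "p' i x = \<zero>\<^bsub>Term A i\<^esub>" using cm_closed[OF p'(1) x'] stalk_cx(2)[OF A, of i] above by simp
    then show ?thesis
      using above cm_zero[OF q'(1) A' X(2)] lmY cm_closed[OF g(1) x'] by (simp add: trunc_map_def)
  qed
  note TX = trunc_cx[OF X(1), of n] trunc_cx[OF X(2), of n]
  show ?thesis
    unfolding g(2) p'(2) q'(2) K_Comp[OF X(1) A' X(2) p'(1) q'(1)] K_HAdd[OF X g(1) qp]
      AMap_trunc_K[OF X s] AMap_trunc_K[OF X g(1)]
    by (rule hcls_eqI[OF TX homotopy_sym[OF TX homotopy_cong[OF TX trunc_map_chain_map[OF X g(1)]]]]) (rule eq)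
qed

text \<open>For a concentrated source this is \<open>trunc_map_kernel\<close>. In general one
  precomposes with \<open>v\<close>, splits off the stalk there, and returns along \<open>u\<close>;
  since \<open>v u = 1\<close>, this recovers \<open>a\<close> and \<open>b\<close>, and the
  factorization through the stalk persists.\<close>

lemma T_kernel:
  assumes X: "X \<in> Obj KP" "Y \<in> Obj KP" and a: "a \<in> Hom K X Y" "b \<in> Hom K X Y" and eq: "T X Y a = T X Y b"
  shows "\<exists>h. factors_through K (proj_stalks R (n - 1)) X Y h \<and> a = HAdd K X Y b h"
proof -
  have X': "cx X" by (rule KP_cx[OF X(1)])
  obtain Z u v where Z0: "cx Z" "\<forall>i. fg_projective R (Term Z i)" "concentrated (n - 1) 0 Z"
    and u: "u \<in> Hom K X Z" and v: "v \<in> Hom K Z X" and vu: "Comp K X Z X v u = Ident K X" using KP_D[OF X(1)] by blast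
  note Z = Z0(1) Z0(2)[rule_format] Z0(3)
  have Y': "cx Y" using KP_cx[OF X(2)] .
  have av: "Comp K Z X Y a v \<in> Hom K Z Y" "Comp K Z X Y b v \<in> Hom K Z Y"
    using L.comp_hom[of Z X Y v] X' Y' Z a v by simp_all
  have "T Z Y (Comp K Z X Y a v) = T Z Y (Comp K Z X Y b v)"
    using T.map_comp[of Z X Y v a] T.map_comp[of Z X Y v b] X' Y' Z v a eq by simp
  moreover obtain f where f: "f \<in> chain_maps R Z Y" "Comp K Z X Y a v = hcls R Z Y f" using av(1) by (rule K_HomE)
  moreover obtain g where g: "g \<in> chain_maps R Z Y" "Comp K Z X Y b v = hcls R Z Y g" using av(2) by (rule K_HomE)
  ultimately have fg: "(trunc_map n Y f, trunc_map n Y g) \<in> homotopy_rel R (trunc n Z) (trunc n Y)"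
    using hcls_eq_iff[OF trunc_cx[OF Z(1)] trunc_cx[OF Y'] trunc_map_chain_map[OF Z(1) Y' f(1)] trunc_map_chain_map[OF Z(1) Y' g(1)]]
    by (simp add: AMap_trunc_K[OF Z(1) Y' f(1)] AMap_trunc_K[OF Z(1) Y' g(1)])
  have zZ: "carrier (Term Z i) = {\<zero>\<^bsub>Term Z i\<^esub>}" if "i < n - 1" for i
    using Z(3) that unfolding concentrated_def by simp
  let ?A = "stalk (n - 1) Z"
  obtain p q where p: "p \<in> chain_maps R Z ?A" and q: "q \<in> chain_maps R ?A Y"
    and h: "(f, \<lambda>i x. g i x \<oplus>\<^bsub>Term Y i\<^esub> q i (p i x)) \<in> homotopy_rel R Z Y"
    by (rule trunc_map_kernel[OF Z(1,2) zZ Y' f(1) g(1) fg])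
  note A = stalk_mem[OF Z(1) Z(2)[of "n - 1"]]
  define P where "P = hcls R Z ?A p"
  define Q where "Q = hcls R ?A Y q"
  have P: "P \<in> Hom K Z ?A" and Q: "Q \<in> Hom K ?A Y" unfolding P_def Q_def by (rule K_HomI[OF p], rule K_HomI[OF q])
  have QP: "Comp K Z ?A Y Q P \<in> Hom K Z Y" using L.comp_hom[of Z ?A Y P Q] Z(1) A(2) Y' P Q by simp
  have avq: "Comp K Z X Y a v = HAdd K Z Y (Comp K Z X Y b v) (Comp K Z ?A Y Q P)"
    unfolding f(2) g(2) P_def Q_def K_Comp[OF Z(1) A(2) Y' p q] K_HAdd[OF Z(1) Y' g(1) chain_maps_comp[OF p q]]
    by (rule hcls_eqI[OF Z(1) Y' h])
  have vu': "Comp K X Z Y (Comp K Z X Y c v) u = c" if "c \<in> Hom K X Y" for c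
    using L.assoc[of X Z X Y u v c] L.id_right[of X Y c] X' Y' Z(1) u v that vu by simp
  have Pu: "Comp K X Z ?A P u \<in> Hom K X ?A" using L.comp_hom[of X Z ?A u P] X' Z(1) A(2) u P by simp
  have "a = HAdd K X Y b (Comp K X Z Y (Comp K Z ?A Y Q P) u)"
    using arg_cong[OF avq, of "\<lambda>c. Comp K X Z Y c u"] K_comp_HAdd[OF X' Z(1) Y' u av(2) QP] vu'[OF a(1)] vu'[OF a(2)] by simp
  also have "Comp K X Z Y (Comp K Z ?A Y Q P) u = Comp K X ?A Y Q (Comp K X Z ?A P u)"
    using L.assoc[of X Z ?A Y u P Q] X' Z(1) A(2) Y' u P Q by simp
  finally have "a = HAdd K X Y b (Comp K X ?A Y Q (Comp K X Z ?A P u))" .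
  moreover have "factors_through K (proj_stalks R (n - 1)) X Y (Comp K X ?A Y Q (Comp K X Z ?A P u))"
    unfolding factors_through_def using A(1) Pu Q by blast
  ultimately show ?thesis by blast
qed

text \<open>The condition \<open>kernel\<close> is checked in the homotopy category, where
  \<open>T_add_stalk\<close> and \<open>T_kernel\<close> are its two directions;
  \<open>AMap_F_eq_iff\<close> carries it to the derived category.\<close>

theorem trunc_KD_induces_equivalence: "induces_equivalence KP (proj_stalks R (n - 1)) DI F"
proof -
  interpret kernel_quotient KP DI F "proj_stalks R (n - 1)"
  proof unfold_locales
    fix X Y a b assume X: "X \<in> Obj KP" "Y \<in> Obj KP" and "a \<in> Hom KP X Y" "b \<in> Hom KP X Y"
    then have a: "a \<in> Hom K X Y" "b \<in> Hom K X Y" by simp_all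
    have X': "cx X" "cx Y" using X KP_cx by auto
    have "(a, b) \<in> quot_rel KP (proj_stalks R (n - 1)) X Y \<longleftrightarrow>
        (\<exists>h. factors_through K (proj_stalks R (n - 1)) X Y h \<and> a = HAdd K X Y b h)"
      unfolding quot_rel_def factors_through_def using a by simp
    also have "\<dots> \<longleftrightarrow> T X Y a = T X Y b"
    proof
      assume "\<exists>h. factors_through K (proj_stalks R (n - 1)) X Y h \<and> a = HAdd K X Y b h"
      then obtain A p q where "A \<in> proj_stalks R (n - 1)" "p \<in> Hom K X A" "q \<in> Hom K A Y"
        "a = HAdd K X Y b (Comp K X A Y q p)" unfolding factors_through_def by blast
      then show "T X Y a = T X Y b" using T_add_stalk[OF X' _ a(2)] by simp
    qed (rule T_kernel[OF X a])
    finally show "(a, b) \<in> quot_rel KP (proj_stalks R (n - 1)) X Y \<longleftrightarrow> AMap F X Y a = AMap F X Y b"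
      unfolding AMap_F_eq_iff[OF X a] .
  qed
  show ?thesis
    by (rule induces_equivalence) (use F_full F_ess_surj in simp_all)
qed

end

end

theorem proposition3p1:
  fixes K :: "'k ring" and \<Lambda> :: "('k, 'a) module" and d :: int
  assumes "algebraically_closed K"
    and "findim_algebra K \<Lambda>"
    and "d \<ge> 2"
    and "module_universe \<Lambda> TYPE('u)"
  shows "is_functor (K_proj_interval \<Lambda> (- d + 1) 0) (D_interval \<Lambda> (- d + 2) 0)
           (trunc_KD \<Lambda> (- d + 2)
              :: (('a, 'u) cplx, (int \<Rightarrow> 'u \<Rightarrow> 'u) set, ('a, 'u) cplx, ('a, 'u) Db_mor) cat_functor)
       \<and> induces_equivalence
           (K_proj_interval \<Lambda> (- d + 1) 0) (proj_stalks \<Lambda> (- d + 1))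
           (D_interval \<Lambda> (- d + 2) 0)
           (trunc_KD \<Lambda> (- d + 2)
              :: (('a, 'u) cplx, (int \<Rightarrow> 'u \<Rightarrow> 'u) set, ('a, 'u) cplx, ('a, 'u) Db_mor) cat_functor)"
proof -
  interpret K: algebraically_closed K by (rule assms(1))
  interpret A: findim_algebra K \<Lambda> by (rule assms(2))
  obtain e :: "'a list \<Rightarrow> 'u" where e: "inj_on e (lists (carrier \<Lambda>))"
    using assms(4) unfolding module_universe_def by blast
  interpret noeth_ctx \<Lambda> e
    by unfold_locales (use e findim_algebra_noetherian[OF K.field_axioms assms(2)] in blast)+
  \<comment> \<open>With \<open>n = - d + 2\<close> the interval of projectives starts at
    \<open>n - 1\<close>, and the bound on \<open>d\<close> is the condition
    \<open>n \<le> 0\<close>.\<close>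
  have "- d + 2 \<le> 0" and d: "- d + 1 = (- d + 2) - 1" using assms(3) by simp_all
  then show ?thesis
    unfolding d using trunc_KD_functor trunc_KD_induces_equivalence by blast
qed

end
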